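(* Let $P$ be a right LCM monoid, let $\mathcal{Q}(P)$ denote its boundary quotient C*-algebra with canonical generators $\{s_p: p\in P\}$, and let $\mathcal{Q}_c(P)=C^*(s_p: p\in P_c)$ be the C*-subalgebra generated by the core submonoid $P_c$. Let $S$ be the inverse semigroup associated to $P$. Suppose that $\mathcal{Q}(P)\cong C^*_r(\mathcal{G}_{\mathrm{tight}}(S))$ (canonically, via $s_ps_q^*\leftrightarrow T_{[p,q]}$) and that for every $s\in S$ the set $\{e\in E(S): e\leqslant s\}$ has a finite cover. Then for any C*-algebra $B$, a $*$-homomorphism $\pi:\mathcal{Q}(P)\to B$ is injective if and only if it is injective on $\mathcal{Q}_c(P)$.
   Context: A monoid $P$ is right LCM if it is left cancellative and for all $p,q\in P$ the set $pP\cap qP$ is either empty or equal to $rP$ for some $r\in P$. $U(P)$ is its group of invertible elements. The core submonoid is $P_c=\{p\in P: pP\cap qP\neq\emptyset\text{ for all }q\in P\}$. Let $\mathcal{J}(P)=\{pP: p\in P\}\cup\{\emptyset\}$. A foundation set is a finite $F\subseteq P$ such that for all $p\in P$ there is $f\in F$ with $fP\cap pP\neq\emptyset$. $\mathcal{Q}(P)$ is the universal C*-algebra generated by isometries $\{s_p\}_{p\in P}$ and projections $\{e_X\}_{X\in\mathcal{J}(P)}$ subject to: $s_ps_q=s_{pq}$; $s_pe_Xs_p^*=e_{pX}$; $e_P=1$, $e_\emptyset=0$; $e_Xe_Y=e_{X\cap Y}$; and $\bigvee_{f\in F}e_{fP}=1$ for all foundation sets $F$. The inverse semigroup $S$ of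 $P$: on $P\times P$ let $(p,q)\sim(a,b)$ iff there is $u\in U(P)$ with $pu=a$, $qu=b$; $S=\{[p,q]:p,q\in P\}\cup\{0\}$ with $[p,q][r,t]=[pq',tr']$ if $qP\cap rP=\ell P$ and $qq'=rr'=\ell$, and $[p,q][r,t]=0$ if $qP\cap rP=\emptyset$; $0$ is a zero element. Then $[p,q]^*=[q,p]$ and $E(S)=\{[p,p]:p\in P\}\cup\{0\}$. For an inverse semigroup $S$ with zero: $s\leqslant t$ iff $s=te$ for some $e\in E(S)$. For $C\subseteq D\subseteq E(S)$, $C$ is a cover of $D$ if for each nonzero $d\in D$ there is $c\in C$ with $dc\neq0$. A filter is a nonempty proper subset of $E(S)$ that is upwards closed and closed under products; filters carry the topology from $\{0,1\}^{E(S)}$. $\widehat E_{\mathrm{tight}}(S)$ is the closure of the set of ultrafilters (maximal filters) in the space of filters; $D_e=\{\xi\in\widehat E_{\mathrm{tight}}(S): e\in\xi\}$; $\theta_s:D_{s^*s}\to D_{ss^*}$, $\theta_s(\xi)=\{f\in E(S): f\geqslant ses^*\text{ for some }e\in\xi\}$. The tight groupoid is $\mathcal{G}_{\mathrm{tight}}(S)=\{[s,\xi]: s\in S, \xi\in D_{s^*s}\}$, where $[s,\xi]=[t,\eta]$ iff $\xi=\eta$ and $se=te$ for some $e\in\xi$, with $d[s,\xi]=\xi$, $r[s,\xi]=\theta_s(\xi)$, $[s,\xi]^{-1}=[s^*,\theta_s(\xi)]$, $[s,\theta_t(\xi)][t,\xi]=[st,\xi]$, and topology with basis $\Theta(s,U)=\{[s,\xi]:\xi\in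 U\}$, $U\subseteq D_{s^*s}$ compact open; it is étale, and Hausdorff under the finite cover hypothesis of the claim. $C^*_r(\mathcal{G}_{\mathrm{tight}}(S))$ is its reduced C*-algebra and $T_s=1_{\Theta(s,D_{s^*s})}\in C_c(\mathcal{G}_{\mathrm{tight}}(S))$. It is known that $T_{[p,q]}\mapsto s_ps_q^*$ extends to an isomorphism of the full groupoid C*-algebra $C^*(\mathcal{G}_{\mathrm{tight}}(S))$ onto $\mathcal{Q}(P)$. *)

theory Defs
  imports "HOL-Analysis.Analysis" "HOL-Algebra.Coset" "HOL-Algebra.Ring"
begin

section \<open>C*-algebras\<close>

text \<open>
  Algebras are given by a carrier in an arbitrary type, and they need not be unital: the field
  \<open>one\<close> inherited from the record of rings is not mentioned in the axioms below and only means
  something for those algebras that do have a unit.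
\<close>

record 'a star_alg = "'a ring" +
  scale :: "complex \<Rightarrow> 'a \<Rightarrow> 'a"
  star :: "'a \<Rightarrow> 'a"

record 'a cstar_alg = "'a star_alg" +
  cnorm :: "'a \<Rightarrow> real"

locale star_algebra = abelian_group A for A :: "('a, 'm) star_alg_scheme" (structure) +
  assumes mult_closed: "\<lbrakk>x \<in> carrier A; y \<in> carrier A\<rbrakk> \<Longrightarrow> x \<otimes> y \<in> carrier A"
    and mult_assoc: "\<lbrakk>x \<in> carrier A; y \<in> carrier A; z \<in> carrier A\<rbrakk>
      \<Longrightarrow> (x \<otimes> y) \<otimes> z = x \<otimes> (y \<otimes> z)"
    and mult_distrib_right: "\<lbrakk>x \<in> carrier A; y \<in> carrier A; z \<in> carrier A\<rbrakk>
      \<Longrightarrow> (x \<oplus> y) \<otimes> z = x \<otimes> z \<oplus> y \<otimes> z"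
    and mult_distrib_left: "\<lbrakk>x \<in> carrier A; y \<in> carrier A; z \<in> carrier A\<rbrakk>
      \<Longrightarrow> x \<otimes> (y \<oplus> z) = x \<otimes> y \<oplus> x \<otimes> z"
    and scale_closed: "x \<in> carrier A \<Longrightarrow> scale A c x \<in> carrier A"
    and scale_one: "x \<in> carrier A \<Longrightarrow> scale A 1 x = x"
    and scale_scale: "x \<in> carrier A \<Longrightarrow> scale A c (scale A d x) = scale A (c * d) x"
    and scale_add_left: "x \<in> carrier A \<Longrightarrow> scale A (c + d) x = scale A c x \<oplus> scale A d x"
    and scale_add_right: "\<lbrakk>x \<in> carrier A; y \<in> carrier A\<rbrakk>
      \<Longrightarrow> scale A c (x \<oplus> y) = scale A c x \<oplus> scale A c y"
    and scale_mult_left: "\<lbrakk>x \<in> carrier A; y \<in> carrier A\<rbrakk>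
      \<Longrightarrow> scale A c x \<otimes> y = scale A c (x \<otimes> y)"
    and scale_mult_right: "\<lbrakk>x \<in> carrier A; y \<in> carrier A\<rbrakk>
      \<Longrightarrow> x \<otimes> scale A c y = scale A c (x \<otimes> y)"
    and star_closed: "x \<in> carrier A \<Longrightarrow> star A x \<in> carrier A"
    and star_star: "x \<in> carrier A \<Longrightarrow> star A (star A x) = x"
    and star_add: "\<lbrakk>x \<in> carrier A; y \<in> carrier A\<rbrakk>
      \<Longrightarrow> star A (x \<oplus> y) = star A x \<oplus> star A y"
    and star_scale: "x \<in> carrier A \<Longrightarrow> star A (scale A c x) = scale A (cnj c) (star A x)"
    and star_mult: "\<lbrakk>x \<in> carrier A; y \<in> carrier A\<rbrakk>
      \<Longrightarrow> star A (x \<otimes> y) = star A y \<otimes> star A x"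

definition cstar_seminorm :: "('a, 'm) star_alg_scheme \<Rightarrow> ('a \<Rightarrow> real) \<Rightarrow> bool" where
  "cstar_seminorm A N \<longleftrightarrow>
    (\<forall>x\<in>carrier A. 0 \<le> N x) \<and>
    (\<forall>c. \<forall>x\<in>carrier A. N (scale A c x) = cmod c * N x) \<and>
    (\<forall>x\<in>carrier A. \<forall>y\<in>carrier A. N (x \<oplus>\<^bsub>A\<^esub> y) \<le> N x + N y) \<and>
    (\<forall>x\<in>carrier A. \<forall>y\<in>carrier A. N (x \<otimes>\<^bsub>A\<^esub> y) \<le> N x * N y) \<and>
    (\<forall>x\<in>carrier A. N (star A x \<otimes>\<^bsub>A\<^esub> x) = (N x)\<^sup>2)"

text \<open>
  The value outside the carrier is irrelevant, but \<open>Metric_space\<close> asks for nonnegativity and symmetry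
  on the whole type.
\<close>

definition cdist :: "('a, 'm) cstar_alg_scheme \<Rightarrow> 'a \<Rightarrow> 'a \<Rightarrow> real" where
  "cdist A x y =
    (if x \<in> carrier A \<and> y \<in> carrier A then cnorm A (x \<ominus>\<^bsub>A\<^esub> y) else 0)"

locale cstar_algebra = star_algebra A for A :: "('a, 'm) cstar_alg_scheme" (structure) +
  assumes cnorm_seminorm: "cstar_seminorm A (cnorm A)"
    and cnorm_eq_zero: "\<lbrakk>x \<in> carrier A; cnorm A x = 0\<rbrakk> \<Longrightarrow> x = \<zero>"
    and complete: "Metric_space.mcomplete (carrier A) (cdist A)"

definition star_hom ::
    "('a, 'm) star_alg_scheme \<Rightarrow> ('b, 'n) star_alg_scheme \<Rightarrow> ('a \<Rightarrow> 'b) set" where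
  "star_hom A B = {\<phi>. \<phi> \<in> carrier A \<rightarrow> carrier B \<and>
    (\<forall>x\<in>carrier A. \<forall>y\<in>carrier A. \<phi> (x \<oplus>\<^bsub>A\<^esub> y) = \<phi> x \<oplus>\<^bsub>B\<^esub> \<phi> y) \<and>
    (\<forall>x\<in>carrier A. \<forall>y\<in>carrier A. \<phi> (x \<otimes>\<^bsub>A\<^esub> y) = \<phi> x \<otimes>\<^bsub>B\<^esub> \<phi> y) \<and>
    (\<forall>c. \<forall>x\<in>carrier A. \<phi> (scale A c x) = scale B c (\<phi> x)) \<and>
    (\<forall>x\<in>carrier A. \<phi> (star A x) = star B (\<phi> x))}"

definition star_iso ::
    "('a, 'm) star_alg_scheme \<Rightarrow> ('b, 'n) star_alg_scheme \<Rightarrow> ('a \<Rightarrow> 'b) set" where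
  "star_iso A B = {\<phi> \<in> star_hom A B. bij_betw \<phi> (carrier A) (carrier B)}"

definition cstar_subalgebra :: "'a set \<Rightarrow> ('a, 'm) cstar_alg_scheme \<Rightarrow> bool" where
  "cstar_subalgebra C A \<longleftrightarrow>
    \<zero>\<^bsub>A\<^esub> \<in> C \<and>
    (\<forall>x\<in>C. \<forall>y\<in>C. x \<oplus>\<^bsub>A\<^esub> y \<in> C \<and> x \<otimes>\<^bsub>A\<^esub> y \<in> C) \<and>
    (\<forall>c. \<forall>x\<in>C. scale A c x \<in> C) \<and>
    (\<forall>x\<in>C. star A x \<in> C) \<and>
    closedin (Metric_space.mtopology (carrier A) (cdist A)) C"

definition cstar_generated :: "('a, 'm) cstar_alg_scheme \<Rightarrow> 'a set \<Rightarrow> 'a set" where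
  "cstar_generated A X = \<Inter>{C. cstar_subalgebra C A \<and> X \<subseteq> C}"


subsection \<open>Completion with respect to a C*-seminorm\<close>

text \<open>
  The Hausdorff completion of a *-algebra \<open>A\<close> with respect to a C*-seminorm \<open>N\<close>: Cauchy sequences
  modulo sequences that tend to zero.
\<close>

definition cauchy_seqs :: "('a, 'm) star_alg_scheme \<Rightarrow> ('a \<Rightarrow> real) \<Rightarrow> (nat \<Rightarrow> 'a) set" where
  "cauchy_seqs A N = {f. range f \<subseteq> carrier A \<and>
    (\<forall>\<epsilon>>0. \<exists>M. \<forall>m\<ge>M. \<forall>n\<ge>M. N (f m \<ominus>\<^bsub>A\<^esub> f n) < \<epsilon>)}"

definition seq_class ::
    "('a, 'm) star_alg_scheme \<Rightarrow> ('a \<Rightarrow> real) \<Rightarrow> (nat \<Rightarrow> 'a) \<Rightarrow> (nat \<Rightarrow> 'a) set" where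
  "seq_class A N f = {g \<in> cauchy_seqs A N. (\<lambda>n. N (f n \<ominus>\<^bsub>A\<^esub> g n)) \<longlonglongrightarrow> 0}"

definition seq_rep :: "(nat \<Rightarrow> 'a) set \<Rightarrow> nat \<Rightarrow> 'a" where
  "seq_rep X = (SOME f. f \<in> X)"

definition completion_emb ::
    "('a, 'm) star_alg_scheme \<Rightarrow> ('a \<Rightarrow> real) \<Rightarrow> 'a \<Rightarrow> (nat \<Rightarrow> 'a) set" where
  "completion_emb A N x = seq_class A N (\<lambda>_. x)"

definition completion ::
    "('a, 'm) star_alg_scheme \<Rightarrow> ('a \<Rightarrow> real) \<Rightarrow> (nat \<Rightarrow> 'a) set cstar_alg" where
  "completion A N =
    \<lparr>carrier = seq_class A N ` cauchy_seqs A N,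
     monoid.mult = (\<lambda>X Y. seq_class A N (\<lambda>n. seq_rep X n \<otimes>\<^bsub>A\<^esub> seq_rep Y n)),
     one = completion_emb A N \<one>\<^bsub>A\<^esub>,
     zero = completion_emb A N \<zero>\<^bsub>A\<^esub>,
     add = (\<lambda>X Y. seq_class A N (\<lambda>n. seq_rep X n \<oplus>\<^bsub>A\<^esub> seq_rep Y n)),
     scale = (\<lambda>c X. seq_class A N (\<lambda>n. scale A c (seq_rep X n))),
     star = (\<lambda>X. seq_class A N (\<lambda>n. star A (seq_rep X n))),
     cnorm = (\<lambda>X. lim (\<lambda>n. N (seq_rep X n)))\<rparr>"


subsection \<open>Universal C*-algebras given by generators and relations\<close>

text \<open>
  The free unital *-algebra on a set of generators. Words are lists over the generators and their
  formal adjoints, the letter \<open>(g, True)\<close> being the adjoint of \<open>(g, False)\<close>; elements are finitely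
  supported functions on words, and multiplication is convolution over all splittings of a word.
\<close>

definition word_star :: "('g \<times> bool) list \<Rightarrow> ('g \<times> bool) list" where
  "word_star w = rev (map (\<lambda>(g, b). (g, \<not> b)) w)"

definition free_star_algebra :: "'g set \<Rightarrow> (('g \<times> bool) list \<Rightarrow> complex) star_alg" where
  "free_star_algebra X =
    \<lparr>carrier = {f. finite {w. f w \<noteq> 0} \<and> {w. f w \<noteq> 0} \<subseteq> lists (X \<times> UNIV)},
     monoid.mult = (\<lambda>f g w. \<Sum>i\<le>length w. f (take i w) * g (drop i w)),
     one = (\<lambda>w. if w = [] then 1 else 0),
     zero = (\<lambda>_. 0),
     add = (\<lambda>f g w. f w + g w),
     scale = (\<lambda>c f w. c * f w),
     star = (\<lambda>f w. cnj (f (word_star w)))\<rparr>"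

definition free_gen :: "'g \<Rightarrow> ('g \<times> bool) list \<Rightarrow> complex" where
  "free_gen g = (\<lambda>w. if w = [(g, False)] then 1 else 0)"

text \<open>
  A relation is a pair \<open>(l, r)\<close> standing for the equation \<open>l = r\<close>. A representation of the
  generators in a C*-algebra satisfying the relations induces a C*-seminorm on the free *-algebra
  vanishing on all differences \<open>l - r\<close>, and completing shows that every such seminorm arises in
  this way. The universal C*-algebra is the completion for the largest of these seminorms; the
  supremum is finite as soon as the relations bound the norm of each generator.
\<close>

definition universal_seminorm :: "('a, 'm) star_alg_scheme \<Rightarrow> ('a \<times> 'a) set \<Rightarrow> 'a \<Rightarrow> real" where
  "universal_seminorm A R x =
    (SUP N\<in>{N. cstar_seminorm A N \<and> (\<forall>(l, r)\<in>R. N (l \<ominus>\<^bsub>A\<^esub> r) = 0)}. N x)"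

definition universal_cstar ::
    "'g set \<Rightarrow> ((('g \<times> bool) list \<Rightarrow> complex) \<times> (('g \<times> bool) list \<Rightarrow> complex)) set
      \<Rightarrow> (nat \<Rightarrow> ('g \<times> bool) list \<Rightarrow> complex) set cstar_alg" where
  "universal_cstar X R =
    completion (free_star_algebra X) (universal_seminorm (free_star_algebra X) R)"

definition universal_gen ::
    "'g set \<Rightarrow> ((('g \<times> bool) list \<Rightarrow> complex) \<times> (('g \<times> bool) list \<Rightarrow> complex)) set
      \<Rightarrow> 'g \<Rightarrow> (nat \<Rightarrow> ('g \<times> bool) list \<Rightarrow> complex) set" where
  "universal_gen X R g =
    completion_emb (free_star_algebra X) (universal_seminorm (free_star_algebra X) R) (free_gen g)"


section \<open>Right LCM monoids\<close>

abbreviation principal :: "('p, 'm) monoid_scheme \<Rightarrow> 'p \<Rightarrow> 'p set" where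
  "principal P p \<equiv> p <#\<^bsub>P\<^esub> carrier P"

locale right_lcm_monoid = monoid P for P :: "('p, 'm) monoid_scheme" (structure) +
  assumes left_cancel: "\<lbrakk>p \<in> carrier P; q \<in> carrier P; r \<in> carrier P; p \<otimes> q = p \<otimes> r\<rbrakk> \<Longrightarrow> q = r"
    and right_lcm: "\<lbrakk>p \<in> carrier P; q \<in> carrier P\<rbrakk> \<Longrightarrow>
      principal P p \<inter> principal P q = {} \<or>
      (\<exists>r\<in>carrier P. principal P p \<inter> principal P q = principal P r)"

definition core_submonoid :: "('p, 'm) monoid_scheme \<Rightarrow> 'p set" where
  "core_submonoid P = {p \<in> carrier P. \<forall>q\<in>carrier P. principal P p \<inter> principal P q \<noteq> {}}"

definition ideals :: "('p, 'm) monoid_scheme \<Rightarrow> 'p set set" where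
  "ideals P = principal P ` carrier P \<union> {{}}"

definition foundation_set :: "('p, 'm) monoid_scheme \<Rightarrow> 'p set \<Rightarrow> bool" where
  "foundation_set P F \<longleftrightarrow> finite F \<and> F \<subseteq> carrier P \<and>
    (\<forall>p\<in>carrier P. \<exists>f\<in>F. principal P f \<inter> principal P p \<noteq> {})"


section \<open>The boundary quotient\<close>

datatype 'p bq_gen = Isom 'p | Proj "'p set"

definition bq_gens :: "('p, 'm) monoid_scheme \<Rightarrow> 'p bq_gen set" where
  "bq_gens P = Isom ` carrier P \<union> Proj ` ideals P"

text \<open>The join of commuting projections, by iterating \<open>e \<or> f = e + f - ef\<close>.\<close>

definition proj_join :: "('a, 'm) ring_scheme \<Rightarrow> 'a list \<Rightarrow> 'a" where
  "proj_join A es = foldr (\<lambda>e f. (e \<oplus>\<^bsub>A\<^esub> f) \<ominus>\<^bsub>A\<^esub> (e \<otimes>\<^bsub>A\<^esub> f)) es \<zero>\<^bsub>A\<^esub>"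

definition bq_rels :: "('p, 'm) monoid_scheme \<Rightarrow>
    ((('p bq_gen \<times> bool) list \<Rightarrow> complex) \<times> (('p bq_gen \<times> bool) list \<Rightarrow> complex)) set" where
  "bq_rels P =
    (let A = free_star_algebra (bq_gens P); s = (\<lambda>p. free_gen (Isom p)); e = (\<lambda>X. free_gen (Proj X))
     in {(star A (s p) \<otimes>\<^bsub>A\<^esub> s p, \<one>\<^bsub>A\<^esub>) | p. p \<in> carrier P}
      \<union> {(e X \<otimes>\<^bsub>A\<^esub> e X, e X) | X. X \<in> ideals P}
      \<union> {(star A (e X), e X) | X. X \<in> ideals P}
      \<union> {(s p \<otimes>\<^bsub>A\<^esub> s q, s (p \<otimes>\<^bsub>P\<^esub> q)) | p q. p \<in> carrier P \<and> q \<in> carrier P}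
      \<union> {(s p \<otimes>\<^bsub>A\<^esub> e X \<otimes>\<^bsub>A\<^esub> star A (s p), e (p <#\<^bsub>P\<^esub> X)) | p X. p \<in> carrier P \<and> X \<in> ideals P}
      \<union> {(e (carrier P), \<one>\<^bsub>A\<^esub>), (e {}, \<zero>\<^bsub>A\<^esub>)}
      \<union> {(e X \<otimes>\<^bsub>A\<^esub> e Y, e (X \<inter> Y)) | X Y. X \<in> ideals P \<and> Y \<in> ideals P}
      \<union> {(proj_join A (map (\<lambda>f. e (principal P f)) fs), \<one>\<^bsub>A\<^esub>) | fs. foundation_set P (set fs)})"

definition boundary_quotient :: "('p, 'm) monoid_scheme \<Rightarrow>
    (nat \<Rightarrow> ('p bq_gen \<times> bool) list \<Rightarrow> complex) set cstar_alg" where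
  "boundary_quotient P = universal_cstar (bq_gens P) (bq_rels P)"

definition bq_isom :: "('p, 'm) monoid_scheme \<Rightarrow> 'p \<Rightarrow>
    (nat \<Rightarrow> ('p bq_gen \<times> bool) list \<Rightarrow> complex) set" where
  "bq_isom P p = universal_gen (bq_gens P) (bq_rels P) (Isom p)"

definition bq_core :: "('p, 'm) monoid_scheme \<Rightarrow>
    (nat \<Rightarrow> ('p bq_gen \<times> bool) list \<Rightarrow> complex) set set" where
  "bq_core P = cstar_generated (boundary_quotient P) (bq_isom P ` core_submonoid P)"


section \<open>Inverse semigroups with zero\<close>

record 'a inv_semigroup = "'a partial_object" +
  sprod :: "'a \<Rightarrow> 'a \<Rightarrow> 'a" (infixl "\<cdot>\<index>" 70)
  szero :: 'a
  sinv :: "'a \<Rightarrow> 'a"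

definition idempotents :: "('a, 'm) inv_semigroup_scheme \<Rightarrow> 'a set" where
  "idempotents S = {e \<in> carrier S. e \<cdot>\<^bsub>S\<^esub> e = e}"

definition sle :: "('a, 'm) inv_semigroup_scheme \<Rightarrow> 'a \<Rightarrow> 'a \<Rightarrow> bool" where
  "sle S s t \<longleftrightarrow> (\<exists>e\<in>idempotents S. s = t \<cdot>\<^bsub>S\<^esub> e)"

definition is_cover :: "('a, 'm) inv_semigroup_scheme \<Rightarrow> 'a set \<Rightarrow> 'a set \<Rightarrow> bool" where
  "is_cover S C D \<longleftrightarrow> C \<subseteq> D \<and> D \<subseteq> idempotents S \<and>
    (\<forall>d\<in>D. d \<noteq> szero S \<longrightarrow> (\<exists>c\<in>C. d \<cdot>\<^bsub>S\<^esub> c \<noteq> szero S))"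

definition sfilters :: "('a, 'm) inv_semigroup_scheme \<Rightarrow> 'a set set" where
  "sfilters S = {\<xi>. \<xi> \<noteq> {} \<and> \<xi> \<subset> idempotents S \<and>
    (\<forall>e\<in>\<xi>. \<forall>f\<in>idempotents S. sle S e f \<longrightarrow> f \<in> \<xi>) \<and>
    (\<forall>e\<in>\<xi>. \<forall>f\<in>\<xi>. e \<cdot>\<^bsub>S\<^esub> f \<in> \<xi>)}"

definition sultrafilters :: "('a, 'm) inv_semigroup_scheme \<Rightarrow> 'a set set" where
  "sultrafilters S = {\<xi> \<in> sfilters S. \<forall>\<eta>\<in>sfilters S. \<xi> \<subseteq> \<eta> \<longrightarrow> \<xi> = \<eta>}"

definition sfilter_topology :: "('a, 'm) inv_semigroup_scheme \<Rightarrow> 'a set topology" where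
  "sfilter_topology S =
    pullback_topology (sfilters S) (\<lambda>\<xi>. \<lambda>e\<in>idempotents S. e \<in> \<xi>)
      (product_topology (\<lambda>_. discrete_topology (UNIV :: bool set)) (idempotents S))"

definition tight_spectrum :: "('a, 'm) inv_semigroup_scheme \<Rightarrow> 'a set set" where
  "tight_spectrum S = sfilter_topology S closure_of sultrafilters S"

definition tight_dom :: "('a, 'm) inv_semigroup_scheme \<Rightarrow> 'a \<Rightarrow> 'a set set" where
  "tight_dom S e = {\<xi> \<in> tight_spectrum S. e \<in> \<xi>}"

definition tight_act :: "('a, 'm) inv_semigroup_scheme \<Rightarrow> 'a \<Rightarrow> 'a set \<Rightarrow> 'a set" where
  "tight_act S s \<xi> = {f \<in> idempotents S. \<exists>e\<in>\<xi>. sle S (s \<cdot>\<^bsub>S\<^esub> e \<cdot>\<^bsub>S\<^esub> sinv S s) f}"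


section \<open>Etale groupoids and their reduced C*-algebras\<close>

text \<open>
  Units are kept in a type of their own; the arrows are the points of the topology \<open>gtop\<close>. The
  product \<open>gcomp G \<alpha> \<beta>\<close> is meaningful only if \<open>gsrc G \<alpha> = grng G \<beta>\<close>.
\<close>

record ('g, 'x) top_groupoid =
  gtop :: "'g topology"
  gsrc :: "'g \<Rightarrow> 'x"
  grng :: "'g \<Rightarrow> 'x"
  gcomp :: "'g \<Rightarrow> 'g \<Rightarrow> 'g"
  ginv :: "'g \<Rightarrow> 'g"

abbreviation arrows :: "('g, 'x, 'm) top_groupoid_scheme \<Rightarrow> 'g set" where
  "arrows G \<equiv> topspace (gtop G)"

text \<open>
  The convolution algebra \<open>C\<^sub>c(G)\<close> of a Hausdorff etale groupoid. Functions are set to zero outside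
  the arrows. The sums over arrows in the convolution and in the regular representation below have only
  finitely many nonzero terms.
\<close>

definition cc_algebra ::
    "('g, 'x, 'm) top_groupoid_scheme \<Rightarrow> ('g \<Rightarrow> complex) star_alg" where
  "cc_algebra G =
    \<lparr>carrier = {f. continuous_map (gtop G) euclidean f \<and>
        compactin (gtop G) (gtop G closure_of {\<gamma> \<in> arrows G. f \<gamma> \<noteq> 0}) \<and>
        (\<forall>\<gamma>. \<gamma> \<notin> arrows G \<longrightarrow> f \<gamma> = 0)},
     monoid.mult = (\<lambda>f g \<gamma>. if \<gamma> \<in> arrows G
        then \<Sum>\<^sub>\<infinity>\<alpha>\<in>{\<alpha> \<in> arrows G. grng G \<alpha> = grng G \<gamma>}. f \<alpha> * g (gcomp G (ginv G \<alpha>) \<gamma>)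
        else 0),
     one = indicator {\<gamma> \<in> arrows G. gsrc G \<gamma> = grng G \<gamma> \<and> gcomp G \<gamma> \<gamma> = \<gamma>},
     zero = (\<lambda>_. 0),
     add = (\<lambda>f g \<gamma>. f \<gamma> + g \<gamma>),
     scale = (\<lambda>c f \<gamma>. c * f \<gamma>),
     star = (\<lambda>f \<gamma>. if \<gamma> \<in> arrows G then cnj (f (ginv G \<gamma>)) else 0)\<rparr>"

definition l2_space :: "'g set \<Rightarrow> ('g \<Rightarrow> complex) set" where
  "l2_space X = {v. (\<lambda>\<gamma>. (cmod (v \<gamma>))\<^sup>2) summable_on X}"

definition l2_norm :: "'g set \<Rightarrow> ('g \<Rightarrow> complex) \<Rightarrow> real" where
  "l2_norm X v = sqrt (\<Sum>\<^sub>\<infinity>\<gamma>\<in>X. (cmod (v \<gamma>))\<^sup>2)"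

definition src_fibre :: "('g, 'x, 'm) top_groupoid_scheme \<Rightarrow> 'x \<Rightarrow> 'g set" where
  "src_fibre G x = {\<gamma> \<in> arrows G. gsrc G \<gamma> = x}"

text \<open>The regular representation of \<open>C\<^sub>c(G)\<close> on \<open>\<ell>\<^sup>2\<close> of the source fibre over the unit \<open>x\<close>.\<close>

definition regular_rep ::
    "('g, 'x, 'm) top_groupoid_scheme \<Rightarrow> 'x \<Rightarrow> ('g \<Rightarrow> complex) \<Rightarrow> ('g \<Rightarrow> complex) \<Rightarrow> 'g \<Rightarrow> complex" where
  "regular_rep G x f v \<gamma> = (\<Sum>\<^sub>\<infinity>\<beta>\<in>src_fibre G x. f (gcomp G \<gamma> (ginv G \<beta>)) * v \<beta>)"

definition reduced_norm :: "('g, 'x, 'm) top_groupoid_scheme \<Rightarrow> ('g \<Rightarrow> complex) \<Rightarrow> real" where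
  "reduced_norm G f =
    Sup {l2_norm (src_fibre G x) (regular_rep G x f v) | x v.
      x \<in> gsrc G ` arrows G \<and> v \<in> l2_space (src_fibre G x) \<and> l2_norm (src_fibre G x) v \<le> 1}"

definition reduced_cstar ::
    "('g, 'x, 'm) top_groupoid_scheme \<Rightarrow> (nat \<Rightarrow> 'g \<Rightarrow> complex) set cstar_alg" where
  "reduced_cstar G = completion (cc_algebra G) (reduced_norm G)"

definition reduced_emb ::
    "('g, 'x, 'm) top_groupoid_scheme \<Rightarrow> ('g \<Rightarrow> complex) \<Rightarrow> (nat \<Rightarrow> 'g \<Rightarrow> complex) set" where
  "reduced_emb G = completion_emb (cc_algebra G) (reduced_norm G)"


section \<open>The tight groupoid\<close>

definition germ :: "('a, 'm) inv_semigroup_scheme \<Rightarrow> 'a \<Rightarrow> 'a set \<Rightarrow> ('a \<times> 'a set) set" where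
  "germ S s \<xi> = {(t, \<eta>). t \<in> carrier S \<and> \<eta> \<in> tight_dom S (sinv S t \<cdot>\<^bsub>S\<^esub> t) \<and>
    \<eta> = \<xi> \<and> (\<exists>e\<in>\<xi>. s \<cdot>\<^bsub>S\<^esub> e = t \<cdot>\<^bsub>S\<^esub> e)}"

definition germ_rep :: "('a \<times> 'a set) set \<Rightarrow> 'a \<times> 'a set" where
  "germ_rep \<gamma> = (SOME a. a \<in> \<gamma>)"

definition bisection ::
    "('a, 'm) inv_semigroup_scheme \<Rightarrow> 'a \<Rightarrow> 'a set set \<Rightarrow> ('a \<times> 'a set) set set" where
  "bisection S s U = germ S s ` U"

definition tight_groupoid ::
    "('a, 'm) inv_semigroup_scheme \<Rightarrow> (('a \<times> 'a set) set, 'a set) top_groupoid" where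
  "tight_groupoid S =
    \<lparr>gtop = topology_generated_by {bisection S s U | s U.
        s \<in> carrier S \<and> U \<subseteq> tight_dom S (sinv S s \<cdot>\<^bsub>S\<^esub> s) \<and>
        openin (subtopology (sfilter_topology S) (tight_spectrum S)) U \<and>
        compactin (subtopology (sfilter_topology S) (tight_spectrum S)) U},
     gsrc = (\<lambda>\<gamma>. snd (germ_rep \<gamma>)),
     grng = (\<lambda>\<gamma>. tight_act S (fst (germ_rep \<gamma>)) (snd (germ_rep \<gamma>))),
     gcomp = (\<lambda>\<gamma> \<delta>. germ S (fst (germ_rep \<gamma>) \<cdot>\<^bsub>S\<^esub> fst (germ_rep \<delta>)) (snd (germ_rep \<delta>))),
     ginv = (\<lambda>\<gamma>. germ S (sinv S (fst (germ_rep \<gamma>)))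
        (tight_act S (fst (germ_rep \<gamma>)) (snd (germ_rep \<gamma>))))\<rparr>"

definition tight_T :: "('a, 'm) inv_semigroup_scheme \<Rightarrow> 'a \<Rightarrow> ('a \<times> 'a set) set \<Rightarrow> complex" where
  "tight_T S s = indicator (bisection S s (tight_dom S (sinv S s \<cdot>\<^bsub>S\<^esub> s)))"


section \<open>The inverse semigroup of a right LCM monoid\<close>

definition lcm_class :: "('p, 'm) monoid_scheme \<Rightarrow> 'p \<Rightarrow> 'p \<Rightarrow> ('p \<times> 'p) set" where
  "lcm_class P p q = {(p \<otimes>\<^bsub>P\<^esub> u, q \<otimes>\<^bsub>P\<^esub> u) | u. u \<in> Units P}"

text \<open>
  The element \<open>[p, q]\<close> is the class \<open>lcm_class P p q\<close>, and the zero element is the empty set. The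
  union in the product ranges over all choices of representatives and of a generator of
  \<open>qP \<inter> rP\<close>; all of them yield the same class, and there are none, so that the product is zero, if
  \<open>qP \<inter> rP\<close> is empty or one of the factors is zero.
\<close>

definition lcm_semigroup :: "('p, 'm) monoid_scheme \<Rightarrow> ('p \<times> 'p) set inv_semigroup" where
  "lcm_semigroup P =
    \<lparr>carrier = {lcm_class P p q | p q. p \<in> carrier P \<and> q \<in> carrier P} \<union> {{}},
     sprod = (\<lambda>x y. \<Union>{lcm_class P (p \<otimes>\<^bsub>P\<^esub> q') (t \<otimes>\<^bsub>P\<^esub> r') | p q r t q' r'.
        (p, q) \<in> x \<and> (r, t) \<in> y \<and> q' \<in> carrier P \<and> r' \<in> carrier P \<and>
        q \<otimes>\<^bsub>P\<^esub> q' = r \<otimes>\<^bsub>P\<^esub> r' \<and>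
        principal P q \<inter> principal P r = principal P (q \<otimes>\<^bsub>P\<^esub> q')}),
     szero = {},
     sinv = converse\<rparr>"

end

theory Submission
  imports Defs
begin

text \<open>
  Suppose \<open>\<pi>\<close> is injective, hence isometric, on the core algebra, and let \<open>a \<noteq> 0\<close>. Under the
  isomorphism with the reduced C*-algebra, the conditional expectation onto the functions on the unit space
  is faithful, so \<open>a\<^sup>*a\<close> is approximated by some \<open>b = \<Sum> c\<^sub>X T\<^sub>X\<close> with \<open>\<bar>b(\<xi>)\<bar> \<ge> \<delta>\<close> at a unit
  \<open>\<xi>\<close>, the error being less than \<open>\<delta>\<close>. Finite covers make
  the sets \<open>{\<xi>. T\<^sub>X \<xi> = 1}\<close> clopen, and ultrafilters are dense; so \<open>b\<close> is constant on the units whose filter contains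
  some idempotent \<open>[p, p]\<close>. Among all \<open>r\<close> choose one for which \<open>s\<^sub>p\<^sub>r\<^sup>* T\<^sub>X s\<^sub>p\<^sub>r\<close> vanishes for as many of the
  finitely many \<open>X\<close> as possible. For every remaining \<open>X\<close> this compression is \<open>s\<^sub>c s\<^sub>d\<^sup>*\<close> with
  \<open>c\<close> and \<open>d\<close> in the core submonoid. Hence \<open>g = s\<^sub>p\<^sub>r\<^sup>* b s\<^sub>p\<^sub>r\<close> lies in the core algebra and
  still has norm at least \<open>\<delta>\<close>, whereas \<open>\<pi> a = 0\<close> would give \<open>\<parallel>g\<parallel> = \<parallel>\<pi> g\<parallel> < \<delta>\<close>.
\<close>

section \<open>Completions of C*-seminormed algebras\<close>


text \<open>Two facts used silently, that a *-homomorphism is contractive and that it is isometric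
  where it is injective, are obtained without spectra: the only analytic input is a commuting square
  root of 1 - a for self-adjoint a of norm at most 1. The conditional expectation is never
  constructed either. Values of functions at arrows are matrix entries of the regular
  representations, hence bounded by the reduced norm, and the value of \<open>f* f\<close> at a unit
  dominates |f|^2 at every arrow starting there. Compression loses nothing at the chosen unit for
  the following reason: the value of \<open>s_q* b s_q\<close> at a unit \<eta> is the value of
  \<open>b\<close> at the translate of \<eta> by \<open>q\<close>, and for q = p r this translate
  contains [p, p] whatever \<eta> is. So \<open>r\<close> remains free and can be chosen by counting
  alone. Finite covers enter twice: they make bisections closed, so that each \<open>T_X\<close> is
  continuous and C_c is an algebra, and they make each \<open>T_X\<close> locally constant on the
  units.\<close>

context star_algebra
begin

lemma zero_mult: "x \<in> carrier A \<Longrightarrow> \<zero> \<otimes> x = \<zero>"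
  using mult_distrib_right[of \<zero> \<zero> x] mult_closed[of \<zero> x] by simp

lemma mult_zero: "x \<in> carrier A \<Longrightarrow> x \<otimes> \<zero> = \<zero>"
  using mult_distrib_left[of x \<zero> \<zero>] mult_closed[of x \<zero>] by simp

lemma scale_zero: "x \<in> carrier A \<Longrightarrow> scale A 0 x = \<zero>"
  using scale_add_left[of x 0 0] scale_closed[of x 0] by simp

lemma scale_of_zero: "scale A c \<zero> = \<zero>"
  using scale_add_right[of \<zero> \<zero> c] scale_closed[of \<zero> c] by simp

lemma star_zero: "star A \<zero> = \<zero>"
  using star_add[of \<zero> \<zero>] star_closed[of \<zero>] by simp

lemma a_inv_scale:
  assumes x: "x \<in> carrier A" shows "\<ominus> x = scale A (-1) x"
proof -
  have "x \<oplus> scale A (-1) x = \<zero>"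
    using scale_add_left[of x 1 "-1"] scale_zero[OF x] scale_one[OF x] x by simp
  then show ?thesis by (metis minus_equality a_comm scale_closed x)
qed

lemma minus_scale: "x \<in> carrier A \<Longrightarrow> y \<in> carrier A \<Longrightarrow> x \<ominus> y = x \<oplus> scale A (-1) y"
  by (simp add: a_minus_def a_inv_scale)

lemma minus_mult: "x \<in> carrier A \<Longrightarrow> y \<in> carrier A \<Longrightarrow> (\<ominus> x) \<otimes> y = \<ominus> (x \<otimes> y)"
  by (simp add: a_inv_scale mult_closed scale_mult_left)

lemma mult_minus: "x \<in> carrier A \<Longrightarrow> y \<in> carrier A \<Longrightarrow> x \<otimes> (\<ominus> y) = \<ominus> (x \<otimes> y)"
  by (simp add: a_inv_scale mult_closed scale_mult_right)

lemma star_minus: "x \<in> carrier A \<Longrightarrow> star A (\<ominus> x) = \<ominus> (star A x)"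
  by (simp add: a_inv_scale star_scale star_closed)

lemma diff_add_swap: "\<lbrakk>a \<in> carrier A; b \<in> carrier A; c \<in> carrier A; d \<in> carrier A\<rbrakk>
   \<Longrightarrow> (a \<oplus> b) \<ominus> (c \<oplus> d) = (a \<ominus> c) \<oplus> (b \<ominus> d)"
  by (simp add: a_minus_def minus_add a_ac)

text \<open>Changing one factor at a time: this identity is behind every estimate that makes
  multiplication continuous.\<close>

lemma diff_mult_split: "\<lbrakk>a \<in> carrier A; b \<in> carrier A; c \<in> carrier A; d \<in> carrier A\<rbrakk>
   \<Longrightarrow> (a \<otimes> b) \<ominus> (c \<otimes> d) = (a \<ominus> c) \<otimes> b \<oplus> c \<otimes> (b \<ominus> d)"
  by (simp add: a_minus_def mult_distrib_left mult_distrib_right minus_mult mult_minus mult_closed a_assoc r_neg2 r_neg1)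

lemma diff_scale: "\<lbrakk>a \<in> carrier A; c \<in> carrier A\<rbrakk>
   \<Longrightarrow> scale A z a \<ominus> scale A z c = scale A z (a \<ominus> c)"
  by (simp add: minus_scale scale_add_right scale_closed scale_scale mult.commute)

lemma diff_star: "\<lbrakk>a \<in> carrier A; c \<in> carrier A\<rbrakk>
   \<Longrightarrow> star A a \<ominus> star A c = star A (a \<ominus> c)"
  by (simp add: a_minus_def star_add star_minus)

lemma diff_telescope: "\<lbrakk>a \<in> carrier A; b \<in> carrier A; c \<in> carrier A\<rbrakk>
   \<Longrightarrow> a \<ominus> c = (a \<ominus> b) \<oplus> (b \<ominus> c)"
  by (simp add: a_minus_def a_assoc r_neg1)

lemma diff_self: "a \<in> carrier A \<Longrightarrow> a \<ominus> a = \<zero>"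
  by (simp add: a_minus_def r_neg)

lemma diff_flip: "\<lbrakk>a \<in> carrier A; b \<in> carrier A\<rbrakk> \<Longrightarrow> \<ominus> (a \<ominus> b) = b \<ominus> a"
  by (simp add: a_minus_def minus_add a_ac)

lemma diff_zero: "a \<in> carrier A \<Longrightarrow> a \<ominus> \<zero> = a"
  by (simp add: minus_scale scale_of_zero)

lemma diff_diff: "\<lbrakk>a \<in> carrier A; b \<in> carrier A; c \<in> carrier A\<rbrakk> \<Longrightarrow> (a \<ominus> c) \<ominus> (b \<ominus> c) = a \<ominus> b"
  using diff_telescope[of a c b] diff_flip[of b c] by (simp add: a_minus_def)

lemma diff_eq_zero: "\<lbrakk>a \<in> carrier A; b \<in> carrier A; a \<ominus> b = \<zero>\<rbrakk> \<Longrightarrow> a = b"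
  by (metis a_minus_def minus_equality a_inv_closed minus_minus)

end

text \<open>Seminorms are the right generality, because the universal seminorm on the free algebra
  may have a kernel that only the completion removes. C*-algebras are the instance
  \<open>N = cnorm A\<close>.\<close>

locale cstar_seminormed = star_algebra A for A :: "('a, 'm) star_alg_scheme" (structure) +
  fixes N :: "'a \<Rightarrow> real"
  assumes seminorm: "cstar_seminorm A N"
begin

lemma N_nonneg: "x \<in> carrier A \<Longrightarrow> 0 \<le> N x"
  and N_scale: "x \<in> carrier A \<Longrightarrow> N (scale A c x) = cmod c * N x"
  and N_add: "\<lbrakk>x \<in> carrier A; y \<in> carrier A\<rbrakk> \<Longrightarrow> N (x \<oplus> y) \<le> N x + N y"
  and N_mult: "\<lbrakk>x \<in> carrier A; y \<in> carrier A\<rbrakk> \<Longrightarrow> N (x \<otimes> y) \<le> N x * N y"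
  and N_cstar: "x \<in> carrier A \<Longrightarrow> N (star A x \<otimes> x) = (N x)\<^sup>2"
  using seminorm unfolding cstar_seminorm_def by auto

lemma N_zero: "N \<zero> = 0"
  using N_scale[of \<zero> 0] scale_zero[of \<zero>] by simp

lemma N_a_inv: "x \<in> carrier A \<Longrightarrow> N (\<ominus> x) = N x"
  by (simp add: a_inv_scale N_scale)

lemma N_diff_commute: "\<lbrakk>x \<in> carrier A; y \<in> carrier A\<rbrakk> \<Longrightarrow> N (x \<ominus> y) = N (y \<ominus> x)"
  by (metis N_a_inv diff_flip minus_closed)

lemma N_triangle: "\<lbrakk>x \<in> carrier A; y \<in> carrier A; z \<in> carrier A\<rbrakk> \<Longrightarrow> N (x \<ominus> z) \<le> N (x \<ominus> y) + N (y \<ominus> z)"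
  by (metis N_add diff_telescope minus_closed)

text \<open>The C*-identity and submultiplicativity give (N y)^2 \<le> N (star y) N y, hence N y
  \<le> N (star y); replacing y by its adjoint gives the reverse inequality.\<close>

lemma N_star: assumes "x \<in> carrier A" shows "N (star A x) = N x"
proof -
  have *: "N y \<le> N (star A y)" if y: "y \<in> carrier A" for y
  proof (cases "N y = 0")
    case True then show ?thesis using N_nonneg[OF star_closed[OF y]] by simp
  next
    case False
    then have "0 < N y" using N_nonneg[OF y] by simp
    moreover have "N y * N y \<le> N (star A y) * N y"
      using N_cstar[OF y] N_mult[OF star_closed[OF y] y] by (simp add: power2_eq_square)
    ultimately show ?thesis by simp
  qed
  show ?thesis using *[OF assms] *[OF star_closed[OF assms]] by (simp add: star_star assms)
qed

lemma N_abs_diff: assumes "x \<in> carrier A" "y \<in> carrier A" shows "\<bar>N x - N y\<bar> \<le> N (x \<ominus> y)"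
proof -
  have "N x \<le> N (x \<ominus> y) + N y" "N y \<le> N (y \<ominus> x) + N x"
    using N_triangle[of x y \<zero>] N_triangle[of y x \<zero>] assms by (simp_all add: diff_zero)
  then show ?thesis using N_diff_commute[OF assms] by simp
qed

section \<open>Cauchy sequences and null sequences\<close>

lemma cauchy_seqs_iff: "f \<in> cauchy_seqs A N \<longleftrightarrow> (\<forall>n. f n \<in> carrier A) \<and>
    (\<forall>\<epsilon>>0. \<exists>M. \<forall>m\<ge>M. \<forall>n\<ge>M. N (f m \<ominus> f n) < \<epsilon>)"
  unfolding cauchy_seqs_def by auto

lemma cauchy_closed: "f \<in> cauchy_seqs A N \<Longrightarrow> f n \<in> carrier A"
  by (simp add: cauchy_seqs_iff)

lemma cauchyD: "\<lbrakk>f \<in> cauchy_seqs A N; e > 0\<rbrakk> \<Longrightarrow> \<exists>M. \<forall>m\<ge>M. \<forall>n\<ge>M. N (f m \<ominus> f n) < e"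
  by (simp add: cauchy_seqs_iff)

lemma cauchy_const: "x \<in> carrier A \<Longrightarrow> (\<lambda>_. x) \<in> cauchy_seqs A N"
  by (simp add: cauchy_seqs_iff diff_self N_zero)

lemma cauchy_bounded: assumes f: "f \<in> cauchy_seqs A N" shows "\<exists>K>0. \<forall>n. N (f n) \<le> K"
proof -
  note c = cauchy_closed[OF f]
  obtain M where M: "\<And>m n. m \<ge> M \<Longrightarrow> n \<ge> M \<Longrightarrow> N (f m \<ominus> f n) < 1"
    using cauchyD[OF f, of 1] by auto
  define K where "K = (\<Sum>i\<le>M. N (f i)) + 1"
  have fin: "N (f i) \<le> (\<Sum>i\<le>M. N (f i))" if "i \<le> M" for i
    using that by (intro member_le_sum) (auto simp: N_nonneg c)
  have "N (f n) \<le> K" for n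
  proof (cases "n \<le> M")
    case True then show ?thesis using fin[of n] by (simp add: K_def)
  next
    case False
    then have "N (f n) \<le> N (f M) + N (f n \<ominus> f M)" using N_abs_diff[OF c[of n] c[of M]] by simp
    also have "\<dots> \<le> K" using fin[of M] M[of n M] False by (simp add: K_def)
    finally show ?thesis .
  qed
  moreover have "K > 0" unfolding K_def by (intro add_nonneg_pos sum_nonneg) (auto simp: N_nonneg c)
  ultimately show ?thesis by blast
qed

text \<open>A common criterion for sums, scalar multiples, adjoints and products: in each case the
  increments are dominated linearly by those of the given sequences, and \<open>K\<close> absorbs
  the bounds on the factors.\<close>

lemma cauchy_by_bound:
  assumes "\<And>n. h n \<in> carrier A" "f \<in> cauchy_seqs A N" "g \<in> cauchy_seqs A N" "K > 0"
    and le: "\<And>m n. N (h m \<ominus> h n) \<le> K * N (f m \<ominus> f n) + K * N (g m \<ominus> g n)"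
  shows "h \<in> cauchy_seqs A N"
  unfolding cauchy_seqs_iff
proof (intro conjI allI impI)
  fix e :: real assume e: "e > 0"
  have e2: "e / (2*K) > 0" using e assms by simp
  obtain M1 where M1: "\<And>m n. m \<ge> M1 \<Longrightarrow> n \<ge> M1 \<Longrightarrow> N (f m \<ominus> f n) < e/(2*K)"
    using cauchyD[OF assms(2) e2] by blast
  obtain M2 where M2: "\<And>m n. m \<ge> M2 \<Longrightarrow> n \<ge> M2 \<Longrightarrow> N (g m \<ominus> g n) < e/(2*K)"
    using cauchyD[OF assms(3) e2] by blast
  have "N (h m \<ominus> h n) < e" if "m \<ge> max M1 M2" "n \<ge> max M1 M2" for m n
  proof -
    have "N (f m \<ominus> f n) < e/(2*K)" "N (g m \<ominus> g n) < e/(2*K)"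
      using M1[of m n] M2[of m n] that by auto
    note this[THEN mult_strict_left_mono, OF assms(4)]
    moreover have "K * (e/(2*K)) = e/2" using assms(4) by simp
    ultimately show ?thesis using le[of m n] by linarith
  qed
  then show "\<exists>M. \<forall>m\<ge>M. \<forall>n\<ge>M. N (h m \<ominus> h n) < e" by blast
qed (rule assms(1))

lemma mult_diff_bound:
  assumes "a \<in> carrier A" "b \<in> carrier A" "c \<in> carrier A" "d \<in> carrier A" "N b \<le> K" "N c \<le> L"
  shows "N (a \<otimes> b \<ominus> c \<otimes> d) \<le> K * N (a \<ominus> c) + L * N (b \<ominus> d)"
proof -
  have "N (a \<otimes> b \<ominus> c \<otimes> d) \<le> N ((a \<ominus> c) \<otimes> b) + N (c \<otimes> (b \<ominus> d))"
    unfolding diff_mult_split[OF assms(1-4)] using assms(1-4) by (simp add: N_add mult_closed)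
  also have "\<dots> \<le> N (a \<ominus> c) * N b + N c * N (b \<ominus> d)"
    using assms(1-4) by (simp add: add_mono N_mult)
  also have "\<dots> \<le> N (a \<ominus> c) * K + L * N (b \<ominus> d)"
    using assms by (simp add: add_mono mult_left_mono mult_right_mono N_nonneg)
  finally show ?thesis by (simp add: mult.commute)
qed

lemma cauchy_add: "\<lbrakk>f \<in> cauchy_seqs A N; g \<in> cauchy_seqs A N\<rbrakk> \<Longrightarrow> (\<lambda>n. f n \<oplus> g n) \<in> cauchy_seqs A N"
  by (rule cauchy_by_bound[of _ f g 1]) (simp_all add: cauchy_closed diff_add_swap N_add)

lemma cauchy_scale: "f \<in> cauchy_seqs A N \<Longrightarrow> (\<lambda>n. scale A c (f n)) \<in> cauchy_seqs A N"
\<comment> \<open>The summand 1 keeps the constant positive when c = 0.\<close>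
proof (rule cauchy_by_bound[of _ f f "cmod c + 1"])
  assume f: "f \<in> cauchy_seqs A N"
  fix m n
  have "0 \<le> N (f m \<ominus> f n)" "0 \<le> cmod c * N (f m \<ominus> f n)" by (simp_all add: N_nonneg cauchy_closed[OF f])
  then show "N (scale A c (f m) \<ominus> scale A c (f n)) \<le> (cmod c + 1) * N (f m \<ominus> f n) + (cmod c + 1) * N (f m \<ominus> f n)"
    by (simp add: diff_scale cauchy_closed[OF f] N_scale distrib_right)
qed (simp_all add: cauchy_closed scale_closed add_nonneg_pos)

lemma cauchy_star: "f \<in> cauchy_seqs A N \<Longrightarrow> (\<lambda>n. star A (f n)) \<in> cauchy_seqs A N"
  by (rule cauchy_by_bound[of _ f f 1]) (simp_all add: cauchy_closed star_closed diff_star N_star N_nonneg)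

lemma cauchy_mult: assumes f: "f \<in> cauchy_seqs A N" and g: "g \<in> cauchy_seqs A N"
  shows "(\<lambda>n. f n \<otimes> g n) \<in> cauchy_seqs A N"
proof -
  obtain K where K: "K > 0" "\<And>n. N (f n) \<le> K" using cauchy_bounded[OF f] by blast
  obtain L where L: "L > 0" "\<And>n. N (g n) \<le> L" using cauchy_bounded[OF g] by blast
  have "N (f m \<otimes> g m \<ominus> f n \<otimes> g n) \<le> (K + L) * N (f m \<ominus> f n) + (K + L) * N (g m \<ominus> g n)" for m n
  proof (rule mult_diff_bound)
    show "N (g m) \<le> K + L" using L(2)[of m] K(1) by linarith
    show "N (f n) \<le> K + L" using K(2)[of n] L(1) by linarith
  qed (simp_all add: f g cauchy_closed)
  from cauchy_by_bound[OF _ f g _ this] show ?thesis using K(1) L(1) by (simp add: cauchy_closed[OF f] cauchy_closed[OF g] mult_closed)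
qed

definition eqv :: "(nat \<Rightarrow> 'a) \<Rightarrow> (nat \<Rightarrow> 'a) \<Rightarrow> bool"
  where "eqv f g \<longleftrightarrow> (\<lambda>n. N (f n \<ominus> g n)) \<longlonglongrightarrow> 0"

lemma eqv_refl: "f \<in> cauchy_seqs A N \<Longrightarrow> eqv f f"
  by (simp add: eqv_def diff_self N_zero cauchy_closed)

lemma eqv_sym: "\<lbrakk>f \<in> cauchy_seqs A N; g \<in> cauchy_seqs A N; eqv f g\<rbrakk> \<Longrightarrow> eqv g f"
  unfolding eqv_def by (subst N_diff_commute) (simp_all add: cauchy_closed)

lemma null_by_bound:
  assumes "\<And>n. h n \<in> carrier A" "\<And>n. N (h n) \<le> K * F n + L * G n" "F \<longlonglongrightarrow> 0" "G \<longlonglongrightarrow> 0"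
  shows "(\<lambda>n. N (h n)) \<longlonglongrightarrow> 0"
proof (rule tendsto_sandwich[of "\<lambda>_. 0"])
  show "(\<lambda>n. K * F n + L * G n) \<longlonglongrightarrow> 0"
    using tendsto_add[OF tendsto_mult_right_zero[OF assms(3), of K] tendsto_mult_right_zero[OF assms(4), of L]] by simp
  show "\<forall>\<^sub>F n in sequentially. N (h n) \<le> K * F n + L * G n" using assms(2) by simp
qed (simp_all add: N_nonneg assms(1))

lemma eqv_trans: assumes "f \<in> cauchy_seqs A N" "g \<in> cauchy_seqs A N" "h \<in> cauchy_seqs A N" "eqv f g" "eqv g h"
  shows "eqv f h"
  unfolding eqv_def
  by (rule null_by_bound[OF _ _ assms(4,5)[unfolded eqv_def], of _ 1 1])
     (simp_all add: assms(1-3) cauchy_closed N_triangle)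

lemma seq_class_eq_iff:
  assumes "f \<in> cauchy_seqs A N" "g \<in> cauchy_seqs A N"
  shows "seq_class A N f = seq_class A N g \<longleftrightarrow> eqv f g"
proof
  assume "seq_class A N f = seq_class A N g"
  moreover have "g \<in> seq_class A N g"
    using assms eqv_refl[of g] by (simp add: seq_class_def eqv_def)
  ultimately show "eqv f g" by (auto simp: seq_class_def eqv_def)
next
  assume fg: "eqv f g"
  have "eqv f h \<longleftrightarrow> eqv g h" if "h \<in> cauchy_seqs A N" for h
    using eqv_trans[OF assms that fg] eqv_trans[OF assms(2,1) that eqv_sym[OF assms fg]]
      eqv_trans[OF assms(1,2) that] fg by blast
  then show "seq_class A N f = seq_class A N g"
    unfolding seq_class_def eqv_def by auto
qed

text \<open>The operations of \<open>completion\<close> go through an arbitrary representative. That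
  the chosen one is Cauchy and equivalent to the given sequence is what makes them independent of
  the choice.\<close>

lemma seq_rep_class:
  assumes f: "f \<in> cauchy_seqs A N"
  shows "seq_rep (seq_class A N f) \<in> cauchy_seqs A N" "eqv f (seq_rep (seq_class A N f))"
proof -
  have "f \<in> seq_class A N f" using f eqv_refl[OF f] by (simp add: seq_class_def eqv_def)
  then have "seq_rep (seq_class A N f) \<in> seq_class A N f" unfolding seq_rep_def by (rule someI[of "\<lambda>g. g \<in> seq_class A N f"])
  then show "seq_rep (seq_class A N f) \<in> cauchy_seqs A N" "eqv f (seq_rep (seq_class A N f))"
    by (auto simp: seq_class_def eqv_def)
qed

section \<open>Algebra structure and norm of the completion\<close>

abbreviation "Cpl \<equiv> completion A N"

lemma Cpl_cases: assumes "X \<in> carrier Cpl" obtains f where "f \<in> cauchy_seqs A N" "X = seq_class A N f"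
  using assms by (auto simp: completion_def)

lemma class_closed: "f \<in> cauchy_seqs A N \<Longrightarrow> seq_class A N f \<in> carrier Cpl"
  by (auto simp: completion_def)

lemma class_add: assumes f: "f \<in> cauchy_seqs A N" and g: "g \<in> cauchy_seqs A N"
  shows "seq_class A N f \<oplus>\<^bsub>Cpl\<^esub> seq_class A N g = seq_class A N (\<lambda>n. f n \<oplus> g n)"
proof -
  let ?f = "seq_rep (seq_class A N f)" and ?g = "seq_rep (seq_class A N g)"
  note r = seq_rep_class[OF f] seq_rep_class[OF g]
  have "eqv (\<lambda>n. f n \<oplus> g n) (\<lambda>n. ?f n \<oplus> ?g n)"
    unfolding eqv_def
    by (rule null_by_bound[OF _ _ r(2)[unfolded eqv_def] r(4)[unfolded eqv_def], of _ 1 1])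
       (simp_all add: r(1,3) f g cauchy_closed diff_add_swap N_add)
  then show ?thesis using r f g cauchy_add
    by (simp add: completion_def seq_class_eq_iff eqv_sym)
qed

lemma class_mult: assumes f: "f \<in> cauchy_seqs A N" and g: "g \<in> cauchy_seqs A N"
  shows "seq_class A N f \<otimes>\<^bsub>Cpl\<^esub> seq_class A N g = seq_class A N (\<lambda>n. f n \<otimes> g n)"
proof -
  let ?f = "seq_rep (seq_class A N f)" and ?g = "seq_rep (seq_class A N g)"
  note r = seq_rep_class[OF f] seq_rep_class[OF g]
  obtain K where K: "K > 0" "\<And>n. N (?f n) \<le> K" using cauchy_bounded[OF r(1)] by blast
  obtain L where L: "L > 0" "\<And>n. N (g n) \<le> L" using cauchy_bounded[OF g] by blast
  have "eqv (\<lambda>n. f n \<otimes> g n) (\<lambda>n. ?f n \<otimes> ?g n)"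
    unfolding eqv_def
    by (rule null_by_bound[OF _ _ r(2)[unfolded eqv_def] r(4)[unfolded eqv_def], of _ L K])
       (simp_all add: r(1,3) f g cauchy_closed mult_closed mult_diff_bound K L)
  then show ?thesis using r f g cauchy_mult
    by (simp add: completion_def seq_class_eq_iff eqv_sym)
qed

lemma class_scale: assumes f: "f \<in> cauchy_seqs A N"
  shows "scale Cpl c (seq_class A N f) = seq_class A N (\<lambda>n. scale A c (f n))"
proof -
  let ?f = "seq_rep (seq_class A N f)"
  note r = seq_rep_class[OF f]
  have "eqv (\<lambda>n. scale A c (f n)) (\<lambda>n. scale A c (?f n))"
    unfolding eqv_def
    by (rule null_by_bound[OF _ _ r(2)[unfolded eqv_def] tendsto_const, of _ "cmod c" 0])
       (simp_all add: r(1) f cauchy_closed scale_closed diff_scale N_scale)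
  then show ?thesis using r f cauchy_scale
    by (simp add: completion_def seq_class_eq_iff eqv_sym)
qed

lemma class_star: assumes f: "f \<in> cauchy_seqs A N"
  shows "star Cpl (seq_class A N f) = seq_class A N (\<lambda>n. star A (f n))"
proof -
  let ?f = "seq_rep (seq_class A N f)"
  note r = seq_rep_class[OF f]
  have "eqv (\<lambda>n. star A (f n)) (\<lambda>n. star A (?f n))"
    unfolding eqv_def
    by (rule null_by_bound[OF _ _ r(2)[unfolded eqv_def] tendsto_const, of _ 1 0])
       (simp_all add: r(1) f cauchy_closed star_closed diff_star N_star)
  then show ?thesis using r f cauchy_star
    by (simp add: completion_def seq_class_eq_iff eqv_sym)
qed

lemma class_zero: "\<zero>\<^bsub>Cpl\<^esub> = seq_class A N (\<lambda>_. \<zero>)"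
  by (simp add: completion_def completion_emb_def)

text \<open>By the reverse triangle inequality the seminorms form a real Cauchy sequence, so the
  \<open>lim\<close> in the norm of the completion is a genuine limit.\<close>

lemma norm_convergent: assumes f: "f \<in> cauchy_seqs A N" shows "convergent (\<lambda>n. N (f n))"
proof -
  have "Cauchy (\<lambda>n. N (f n))"
  proof (rule CauchyI)
    fix e :: real assume "0 < e"
    then obtain M where M: "\<forall>m\<ge>M. \<forall>n\<ge>M. N (f m \<ominus> f n) < e" using cauchyD[OF f] by blast
    then have "norm (N (f m) - N (f n)) < e" if "m \<ge> M" "n \<ge> M" for m n
      using N_abs_diff[of "f m" "f n"] cauchy_closed[OF f] that by (smt (verit) real_norm_def)
    then show "\<exists>M. \<forall>m\<ge>M. \<forall>n\<ge>M. norm (N (f m) - N (f n)) < e" by blast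
  qed
  then show ?thesis by (simp add: Cauchy_convergent)
qed

lemma class_norm: assumes f: "f \<in> cauchy_seqs A N"
  shows "(\<lambda>n. N (f n)) \<longlonglongrightarrow> cnorm Cpl (seq_class A N f)"
proof -
  let ?f = "seq_rep (seq_class A N f)"
  note r = seq_rep_class[OF f]
  have 1: "(\<lambda>n. N (?f n)) \<longlonglongrightarrow> cnorm Cpl (seq_class A N f)"
    using norm_convergent[OF r(1)] by (simp add: completion_def convergent_LIMSEQ_iff)
  have 2: "(\<lambda>n. N (f n) - N (?f n)) \<longlonglongrightarrow> 0"
    by (rule Lim_null_comparison[OF _ r(2)[unfolded eqv_def]])
       (use r f in \<open>auto simp: cauchy_closed N_abs_diff\<close>)
  show ?thesis using tendsto_add[OF 1 2] by simp
qed

text \<open>Every operation on classes is computed termwise, so each axiom is inherited from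
  \<open>A\<close>; the additive inverse is the class of the negated sequence.\<close>

lemma Cpl_star_algebra: "star_algebra Cpl"
proof -
  have ag: "abelian_group Cpl"
  proof (rule abelian_groupI)
    fix X assume "X \<in> carrier Cpl"
    then obtain f where f: "f \<in> cauchy_seqs A N" "X = seq_class A N f" by (rule Cpl_cases)
    have "(\<lambda>n. scale A (-1) (f n) \<oplus> f n) = (\<lambda>_. \<zero>)"
      by (rule ext) (simp add: cauchy_closed[OF f(1)] l_neg flip: a_inv_scale)
    then have "seq_class A N (\<lambda>n. scale A (-1) (f n)) \<oplus>\<^bsub>Cpl\<^esub> X = \<zero>\<^bsub>Cpl\<^esub>"
      using f class_add[OF cauchy_scale[OF f(1), of "-1"] f(1)] by (simp add: class_zero)
    then show "\<exists>Y\<in>carrier Cpl. Y \<oplus>\<^bsub>Cpl\<^esub> X = \<zero>\<^bsub>Cpl\<^esub>"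
      using f by (auto intro!: bexI class_closed cauchy_scale)
  qed (auto elim!: Cpl_cases simp: class_add class_zero class_closed cauchy_add cauchy_const cauchy_closed a_ac)
  interpret C: abelian_group Cpl by (rule ag)
  show ?thesis
    by unfold_locales
       (auto elim!: Cpl_cases simp: class_add class_mult class_scale class_star class_closed
          cauchy_add cauchy_mult cauchy_scale cauchy_star cauchy_closed mult_assoc mult_distrib_right
          mult_distrib_left scale_one scale_scale scale_add_left scale_add_right scale_mult_left scale_mult_right
          star_star star_add star_scale star_mult)
qed

lemma Cpl_seminorm: "cstar_seminorm Cpl (cnorm Cpl)"
  unfolding cstar_seminorm_def
proof (intro conjI ballI allI)
  fix X assume "X \<in> carrier Cpl"
  then obtain f where f: "f \<in> cauchy_seqs A N" "X = seq_class A N f" by (rule Cpl_cases)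
  show "0 \<le> cnorm Cpl X"
    using f by (auto intro!: LIMSEQ_le_const[OF class_norm] simp: N_nonneg cauchy_closed)
  show "cnorm Cpl (scale Cpl c X) = cmod c * cnorm Cpl X" for c
  proof (rule LIMSEQ_unique)
    show "(\<lambda>n. N (scale A c (f n))) \<longlonglongrightarrow> cnorm Cpl (scale Cpl c X)"
      using f class_norm[OF cauchy_scale[OF f(1)]] by (simp add: class_scale)
    show "(\<lambda>n. N (scale A c (f n))) \<longlonglongrightarrow> cmod c * cnorm Cpl X"
      using f tendsto_mult_left[OF class_norm[OF f(1)], of "cmod c"] by (simp add: N_scale cauchy_closed)
  qed
  show "cnorm Cpl (star Cpl X \<otimes>\<^bsub>Cpl\<^esub> X) = (cnorm Cpl X)\<^sup>2"
  proof (rule LIMSEQ_unique)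
    show "(\<lambda>n. N (star A (f n) \<otimes> f n)) \<longlonglongrightarrow> cnorm Cpl (star Cpl X \<otimes>\<^bsub>Cpl\<^esub> X)"
      using f class_norm[OF cauchy_mult[OF cauchy_star[OF f(1)] f(1)]] by (simp add: class_star class_mult cauchy_star)
    show "(\<lambda>n. N (star A (f n) \<otimes> f n)) \<longlonglongrightarrow> (cnorm Cpl X)\<^sup>2"
      using f tendsto_power[OF class_norm[OF f(1)], of 2] by (simp add: N_cstar cauchy_closed)
  qed
  fix Y assume "Y \<in> carrier Cpl"
  then obtain g where g: "g \<in> cauchy_seqs A N" "Y = seq_class A N g" by (rule Cpl_cases)
  show "cnorm Cpl (X \<oplus>\<^bsub>Cpl\<^esub> Y) \<le> cnorm Cpl X + cnorm Cpl Y"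
  proof (rule LIMSEQ_le)
    show "(\<lambda>n. N (f n \<oplus> g n)) \<longlonglongrightarrow> cnorm Cpl (X \<oplus>\<^bsub>Cpl\<^esub> Y)"
      using f g class_norm[OF cauchy_add[OF f(1) g(1)]] by (simp add: class_add)
    show "(\<lambda>n. N (f n) + N (g n)) \<longlonglongrightarrow> cnorm Cpl X + cnorm Cpl Y"
      using f g by (auto intro!: tendsto_add class_norm)
  qed (use f g in \<open>auto simp: N_add cauchy_closed\<close>)
  show "cnorm Cpl (X \<otimes>\<^bsub>Cpl\<^esub> Y) \<le> cnorm Cpl X * cnorm Cpl Y"
  proof (rule LIMSEQ_le)
    show "(\<lambda>n. N (f n \<otimes> g n)) \<longlonglongrightarrow> cnorm Cpl (X \<otimes>\<^bsub>Cpl\<^esub> Y)"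
      using f g class_norm[OF cauchy_mult[OF f(1) g(1)]] by (simp add: class_mult)
    show "(\<lambda>n. N (f n) * N (g n)) \<longlonglongrightarrow> cnorm Cpl X * cnorm Cpl Y"
      using f g by (auto intro!: tendsto_mult class_norm)
  qed (use f g in \<open>auto simp: N_mult cauchy_closed\<close>)
qed

lemma Cpl_norm_zero: assumes "X \<in> carrier Cpl" "cnorm Cpl X = 0" shows "X = \<zero>\<^bsub>Cpl\<^esub>"
proof -
  obtain f where f: "f \<in> cauchy_seqs A N" "X = seq_class A N f" using assms(1) by (rule Cpl_cases)
  have "eqv f (\<lambda>_. \<zero>)"
    using class_norm[OF f(1)] assms(2) f by (simp add: eqv_def diff_zero cauchy_closed)
  then show ?thesis using f by (simp add: class_zero seq_class_eq_iff cauchy_const)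
qed

abbreviation "emb \<equiv> completion_emb A N"

lemma emb_closed: "x \<in> carrier A \<Longrightarrow> emb x \<in> carrier Cpl"
  by (simp add: completion_emb_def class_closed cauchy_const)

lemma emb_add: "\<lbrakk>x \<in> carrier A; y \<in> carrier A\<rbrakk> \<Longrightarrow> emb (x \<oplus> y) = emb x \<oplus>\<^bsub>Cpl\<^esub> emb y"
  by (simp add: completion_emb_def class_add cauchy_const)

lemma emb_mult: "\<lbrakk>x \<in> carrier A; y \<in> carrier A\<rbrakk> \<Longrightarrow> emb (x \<otimes> y) = emb x \<otimes>\<^bsub>Cpl\<^esub> emb y"
  by (simp add: completion_emb_def class_mult cauchy_const)

lemma emb_scale: "x \<in> carrier A \<Longrightarrow> emb (scale A c x) = scale Cpl c (emb x)"
  by (simp add: completion_emb_def class_scale cauchy_const)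

lemma emb_star: "x \<in> carrier A \<Longrightarrow> emb (star A x) = star Cpl (emb x)"
  by (simp add: completion_emb_def class_star cauchy_const)

lemma emb_zero: "emb \<zero> = \<zero>\<^bsub>Cpl\<^esub>"
  by (simp add: completion_emb_def class_zero)

lemma emb_norm: "x \<in> carrier A \<Longrightarrow> cnorm Cpl (emb x) = N x"
  using class_norm[OF cauchy_const, of x] by (simp add: completion_emb_def LIMSEQ_const_iff)

lemma emb_diff: "\<lbrakk>x \<in> carrier A; y \<in> carrier A\<rbrakk> \<Longrightarrow> emb (x \<ominus> y) = emb x \<ominus>\<^bsub>Cpl\<^esub> emb y"
  by (simp add: minus_scale star_algebra.minus_scale[OF Cpl_star_algebra] emb_closed emb_add emb_scale scale_closed)

lemma emb_eq_iff: assumes "x \<in> carrier A" "y \<in> carrier A"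
  shows "emb x = emb y \<longleftrightarrow> N (x \<ominus> y) = 0"
  using assms by (simp add: completion_emb_def seq_class_eq_iff cauchy_const eqv_def LIMSEQ_const_iff)

lemma class_diff: assumes f: "f \<in> cauchy_seqs A N" and g: "g \<in> cauchy_seqs A N"
  shows "seq_class A N f \<ominus>\<^bsub>Cpl\<^esub> seq_class A N g = seq_class A N (\<lambda>n. f n \<ominus> g n)"
  using assms by (simp add: star_algebra.minus_scale[OF Cpl_star_algebra] class_closed class_add class_scale
      cauchy_scale minus_scale cauchy_closed)

lemma class_emb_tendsto: assumes f: "f \<in> cauchy_seqs A N" and e: "e > 0"
  shows "\<exists>M. \<forall>n\<ge>M. cnorm Cpl (seq_class A N f \<ominus>\<^bsub>Cpl\<^esub> emb (f n)) < e"
proof -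
  \<comment> \<open>Half of \<open>e\<close>, because the limit over the first index preserves only
    a weak inequality.\<close>
  obtain M where M: "\<And>m n. m \<ge> M \<Longrightarrow> n \<ge> M \<Longrightarrow> N (f m \<ominus> f n) < e/2"
    using cauchyD[OF f, of "e/2"] e by auto
  have "cnorm Cpl (seq_class A N f \<ominus>\<^bsub>Cpl\<^esub> emb (f n)) < e" if "n \<ge> M" for n
  proof -
    have c: "(\<lambda>_. f n) \<in> cauchy_seqs A N" "(\<lambda>m. f m \<ominus> f n) \<in> cauchy_seqs A N"
      using f by (auto simp: cauchy_const cauchy_closed diff_diff N_nonneg
        intro!: cauchy_by_bound[of "\<lambda>m. f m \<ominus> f n" f f 1])
    have "cnorm Cpl (seq_class A N f \<ominus>\<^bsub>Cpl\<^esub> emb (f n)) \<le> e/2"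
      unfolding completion_emb_def class_diff[OF f c(1)]
      by (rule LIMSEQ_le_const2[OF class_norm[OF c(2)]]) (use M that less_imp_le in blast)
    then show ?thesis using e by simp
  qed
  then show ?thesis by blast
qed

lemma emb_dense: assumes "X \<in> carrier Cpl" "e > 0"
  shows "\<exists>x\<in>carrier A. cnorm Cpl (X \<ominus>\<^bsub>Cpl\<^esub> emb x) < e"
proof -
  obtain f where f: "f \<in> cauchy_seqs A N" "X = seq_class A N f" using assms(1) by (rule Cpl_cases)
  obtain M where "\<forall>n\<ge>M. cnorm Cpl (seq_class A N f \<ominus>\<^bsub>Cpl\<^esub> emb (f n)) < e"
    using class_emb_tendsto[OF f(1) assms(2)] by blast
  then show ?thesis using f cauchy_closed[OF f(1)] by blast
qed

end

lemma (in cstar_seminormed) Metric_space_seminorm: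
  assumes d: "\<And>x y. d x y = (if x \<in> carrier A \<and> y \<in> carrier A then N (x \<ominus> y) else 0)"
    and z: "\<And>x. \<lbrakk>x \<in> carrier A; N x = 0\<rbrakk> \<Longrightarrow> x = \<zero>"
  shows "Metric_space (carrier A) d"
proof
  show "d x y = 0 \<longleftrightarrow> x = y" if "x \<in> carrier A" "y \<in> carrier A" for x y
    using that z[of "x \<ominus> y"] diff_eq_zero[of x y] by (auto simp: d diff_self N_zero)
qed (auto simp: d N_nonneg N_triangle intro: N_diff_commute)

sublocale cstar_algebra \<subseteq> cstar_seminormed A "cnorm A"
  by unfold_locales (rule cnorm_seminorm)

context cstar_seminormed begin

lemma Cpl_Metric_space: "Metric_space (carrier Cpl) (cdist Cpl)"
proof -
  interpret C: star_algebra Cpl by (rule Cpl_star_algebra)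
  interpret C: cstar_seminormed Cpl "cnorm Cpl" by unfold_locales (rule Cpl_seminorm)
  show ?thesis by (rule C.Metric_space_seminorm) (auto simp: cdist_def Cpl_norm_zero)
qed

end


context cstar_seminormed begin

text \<open>Completeness by a diagonal sequence: the n-th class is replaced by an element of
  \<open>A\<close> within 1/(n+1) of it, and the class of the resulting sequence is the
  limit.\<close>

theorem completion_cstar_algebra: "cstar_algebra Cpl"
proof -
  interpret C: star_algebra Cpl by (rule Cpl_star_algebra)
  interpret C: cstar_seminormed Cpl "cnorm Cpl" by unfold_locales (rule Cpl_seminorm)
  interpret M: Metric_space "carrier Cpl" "cdist Cpl" by (rule Cpl_Metric_space)
  have "M.mcomplete"
    unfolding M.mcomplete_def
  proof (intro allI impI)
    fix \<sigma> assume s: "M.MCauchy \<sigma>"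
    then have sc: "\<sigma> n \<in> carrier Cpl" for n by (auto simp: M.MCauchy_def)
    have "\<exists>x\<in>carrier A. cnorm Cpl (\<sigma> n \<ominus>\<^bsub>Cpl\<^esub> emb x) < inverse (real (Suc n))" for n
      by (rule emb_dense[OF sc]) simp
    then have "\<exists>x. \<forall>n. x n \<in> carrier A \<and> cnorm Cpl (\<sigma> n \<ominus>\<^bsub>Cpl\<^esub> emb (x n)) < inverse (real (Suc n))"
      by (intro choice allI) blast
    then obtain x where x: "\<And>n. x n \<in> carrier A" "\<And>n. cnorm Cpl (\<sigma> n \<ominus>\<^bsub>Cpl\<^esub> emb (x n)) < inverse (real (Suc n))"
      by blast
    have lim: "\<exists>M. \<forall>n\<ge>M. cnorm Cpl (\<sigma> n \<ominus>\<^bsub>Cpl\<^esub> emb (x n)) < e" if e0: "e > 0" for e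
    proof -
      obtain M where M: "\<forall>n\<ge>M. inverse (real (Suc n)) < e"
        using LIMSEQ_D[OF LIMSEQ_inverse_real_of_nat e0] by auto
      have "cnorm Cpl (\<sigma> n \<ominus>\<^bsub>Cpl\<^esub> emb (x n)) < e" if "n \<ge> M" for n
        using x(2)[of n] M that by (meson less_trans)
      then show ?thesis by blast
    qed
    have xc: "x \<in> cauchy_seqs A N"
      unfolding cauchy_seqs_iff
    proof (intro conjI allI impI x)
      fix e :: real assume "e > 0" then have e: "e/3 > 0" by simp
      obtain M1 where M1: "\<And>n. n \<ge> M1 \<Longrightarrow> cnorm Cpl (\<sigma> n \<ominus>\<^bsub>Cpl\<^esub> emb (x n)) < e/3" using lim[OF e] by blast
      obtain M2 where M2: "\<And>m n. m \<ge> M2 \<Longrightarrow> n \<ge> M2 \<Longrightarrow> cdist Cpl (\<sigma> m) (\<sigma> n) < e/3"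
        using s e unfolding M.MCauchy_def by blast
      have "N (x m \<ominus> x n) < e" if mn: "m \<ge> max M1 M2" "n \<ge> max M1 M2" for m n
      proof -
        have "N (x m \<ominus> x n) = cnorm Cpl (emb (x m) \<ominus>\<^bsub>Cpl\<^esub> emb (x n))"
          using emb_norm[of "x m \<ominus> x n"] emb_diff[of "x m" "x n"] x(1) minus_closed by simp
        also have "\<dots> \<le> cnorm Cpl (emb (x m) \<ominus>\<^bsub>Cpl\<^esub> \<sigma> m) + cnorm Cpl (\<sigma> m \<ominus>\<^bsub>Cpl\<^esub> emb (x n))"
          by (intro C.N_triangle emb_closed x sc)
        also have "\<dots> \<le> cnorm Cpl (emb (x m) \<ominus>\<^bsub>Cpl\<^esub> \<sigma> m) + (cnorm Cpl (\<sigma> m \<ominus>\<^bsub>Cpl\<^esub> \<sigma> n) + cnorm Cpl (\<sigma> n \<ominus>\<^bsub>Cpl\<^esub> emb (x n)))"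
          by (intro add_left_mono C.N_triangle emb_closed x sc)
        also have "cnorm Cpl (emb (x m) \<ominus>\<^bsub>Cpl\<^esub> \<sigma> m) = cnorm Cpl (\<sigma> m \<ominus>\<^bsub>Cpl\<^esub> emb (x m))"
          by (intro C.N_diff_commute emb_closed x sc)
        finally show ?thesis using M1[of m] M1[of n] M2[of m n] mn sc by (simp add: cdist_def)
      qed
      then show "\<exists>M. \<forall>m\<ge>M. \<forall>n\<ge>M. N (x m \<ominus> x n) < e" by blast
    qed
    have "limitin M.mtopology \<sigma> (seq_class A N x) sequentially"
      unfolding M.limit_metric_sequentially
    proof (intro conjI class_closed xc allI impI)
      fix e :: real assume "e > 0" then have e: "e/2 > 0" by simp
      obtain M1 where M1: "\<And>n. n \<ge> M1 \<Longrightarrow> cnorm Cpl (\<sigma> n \<ominus>\<^bsub>Cpl\<^esub> emb (x n)) < e/2" using lim[OF e] by blast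
      obtain M2 where M2: "\<And>n. n \<ge> M2 \<Longrightarrow> cnorm Cpl (seq_class A N x \<ominus>\<^bsub>Cpl\<^esub> emb (x n)) < e/2"
        using class_emb_tendsto[OF xc e] by blast
      have "cdist Cpl (\<sigma> n) (seq_class A N x) < e" if "n \<ge> max M1 M2" for n
      proof -
        have "cdist Cpl (\<sigma> n) (seq_class A N x) = cnorm Cpl (\<sigma> n \<ominus>\<^bsub>Cpl\<^esub> seq_class A N x)"
          by (simp add: cdist_def sc class_closed xc)
        also have "\<dots> \<le> cnorm Cpl (\<sigma> n \<ominus>\<^bsub>Cpl\<^esub> emb (x n)) + cnorm Cpl (emb (x n) \<ominus>\<^bsub>Cpl\<^esub> seq_class A N x)"
          by (intro C.N_triangle emb_closed x sc class_closed xc)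
        also have "cnorm Cpl (emb (x n) \<ominus>\<^bsub>Cpl\<^esub> seq_class A N x) = cnorm Cpl (seq_class A N x \<ominus>\<^bsub>Cpl\<^esub> emb (x n))"
          by (intro C.N_diff_commute emb_closed x class_closed xc)
        finally show ?thesis using M1[of n] M2[of n] that by simp
      qed
      then show "\<exists>M. \<forall>n\<ge>M. \<sigma> n \<in> carrier Cpl \<and> cdist Cpl (\<sigma> n) (seq_class A N x) < e" using sc by blast
    qed
    then show "\<exists>x. limitin M.mtopology \<sigma> x sequentially" by blast
  qed
  then show ?thesis by unfold_locales (auto simp: Cpl_seminorm Cpl_norm_zero)
qed

end


section \<open>Contractivity and uniqueness of C*-norms\<close>

context star_algebra
begin

lemma scale_collect:
  assumes "x \<in> carrier A"
  shows "scale A c x \<oplus> scale A d x = scale A (c + d) x"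
    "x \<oplus> scale A d x = scale A (1 + d) x" "scale A c x \<oplus> x = scale A (c + 1) x" "x \<oplus> x = scale A 2 x"
  using assms scale_add_left[OF assms, of c d] scale_add_left[OF assms, of 1 d] scale_add_left[OF assms, of c 1]
    scale_add_left[OF assms, of 1 1]
  by (simp_all add: scale_one)

lemma scale_collect2:
  assumes "x \<in> carrier A" "z \<in> carrier A"
  shows "scale A c x \<oplus> (scale A d x \<oplus> z) = scale A (c + d) x \<oplus> z"
    "x \<oplus> (scale A d x \<oplus> z) = scale A (1 + d) x \<oplus> z" "scale A c x \<oplus> (x \<oplus> z) = scale A (c + 1) x \<oplus> z"
    "x \<oplus> (x \<oplus> z) = scale A 2 x \<oplus> z"
  using assms by (simp_all add: scale_closed scale_collect flip: a_assoc)

lemma scale_collect3: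
  assumes "x \<in> carrier A" "z \<in> carrier A"
  shows "scale A c x \<oplus> (z \<oplus> scale A d x) = z \<oplus> scale A (c + d) x"
    "x \<oplus> (z \<oplus> scale A d x) = z \<oplus> scale A (1 + d) x" "scale A c x \<oplus> (z \<oplus> x) = z \<oplus> scale A (c + 1) x"
    "x \<oplus> (z \<oplus> x) = z \<oplus> scale A 2 x"
  using assms by (simp_all add: scale_closed scale_collect a_lcomm[of _ z])

lemma scale_collect4:
  assumes "x \<in> carrier A" "z \<in> carrier A" "w \<in> carrier A"
  shows "scale A c x \<oplus> (z \<oplus> (scale A d x \<oplus> w)) = z \<oplus> (scale A (c + d) x \<oplus> w)"
    "x \<oplus> (z \<oplus> (scale A d x \<oplus> w)) = z \<oplus> (scale A (1 + d) x \<oplus> w)"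
    "scale A c x \<oplus> (z \<oplus> (x \<oplus> w)) = z \<oplus> (scale A (c + 1) x \<oplus> w)"
    "x \<oplus> (z \<oplus> (x \<oplus> w)) = z \<oplus> (scale A 2 x \<oplus> w)"
  using assms by (simp_all add: scale_closed scale_collect2 a_lcomm[of _ z])

text \<open>Sorting by \<open>a_ac\<close> need not bring multiples of the same vector together. The
  variants collect multiples that are adjacent or separated by one other summand, at the end of a
  sum or inside it, as happens in the short combinations below.\<close>

lemmas lin_simps = minus_scale scale_add_right scale_scale scale_collect scale_collect2 scale_collect3 scale_collect4
  scale_zero scale_one scale_closed mult_closed a_ac

lemma diff_of_squares:
  assumes "x \<in> carrier A" "y \<in> carrier A" "x \<otimes> y = y \<otimes> x"
  shows "x \<otimes> x \<ominus> y \<otimes> y = (x \<ominus> y) \<otimes> (x \<oplus> y)"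
  using assms diff_mult_split[of x x y y]
  by (simp add: mult_distrib_left mult_distrib_right a_minus_def minus_mult mult_minus mult_closed)

end

text \<open>The subalgebra \<open>C\<close> is carried along so that the results apply both to the
  whole boundary quotient and to its core. The laws of the unit are spelled out because the axioms
  of a C*-algebra say nothing about the field \<open>one\<close>.\<close>

locale unital_cstar = cstar_algebra A for A :: "('a, 'm) cstar_alg_scheme" (structure) +
  fixes C :: "'a set"
  assumes C_subalgebra: "cstar_subalgebra C A" and C_one: "\<one> \<in> C"
    and one_mult: "x \<in> carrier A \<Longrightarrow> \<one> \<otimes> x = x" and mult_one: "x \<in> carrier A \<Longrightarrow> x \<otimes> \<one> = x"
begin

abbreviation nrm ("\<nu>") where "\<nu> \<equiv> cnorm A"

lemma mspace: "Metric_space (carrier A) (cdist A)"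
  by (rule Metric_space_seminorm) (auto simp: cdist_def cnorm_eq_zero)

lemma C_closed: "x \<in> C \<Longrightarrow> y \<in> C \<Longrightarrow> x \<oplus> y \<in> C" "x \<in> C \<Longrightarrow> y \<in> C \<Longrightarrow> x \<otimes> y \<in> C"
  "x \<in> C \<Longrightarrow> scale A c x \<in> C" "x \<in> C \<Longrightarrow> star A x \<in> C"
  and C_zero: "\<zero> \<in> C"
  using C_subalgebra unfolding cstar_subalgebra_def by auto

lemma C_subset: "C \<subseteq> carrier A"
proof -
  interpret M: Metric_space "carrier A" "cdist A" by (rule mspace)
  show ?thesis using C_subalgebra closedin_subset[of M.mtopology C] unfolding cstar_subalgebra_def by simp
qed

lemma C_carrier: "x \<in> C \<Longrightarrow> x \<in> carrier A"
  using C_subset by blast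

lemma C_minus: "x \<in> C \<Longrightarrow> y \<in> C \<Longrightarrow> x \<ominus> y \<in> C"
  by (simp add: minus_scale C_carrier C_closed)

lemma one_carrier: "\<one> \<in> carrier A"
  using C_one C_carrier by blast

lemma star_one: "star A \<one> = \<one>"
  using star_mult[of "star A \<one>" \<one>] one_carrier by (simp add: star_closed star_star one_mult mult_one)

text \<open>Convergence is expressed by real null sequences, so that limit theorems for real
  sequences apply directly.\<close>

definition tends :: "(nat \<Rightarrow> 'a) \<Rightarrow> 'a \<Rightarrow> bool" where
  "tends f x \<longleftrightarrow> (\<lambda>n. \<nu> (f n \<ominus> x)) \<longlonglongrightarrow> 0"

lemma C_complete:
  assumes f: "\<And>n. f n \<in> C" and c: "f \<in> cauchy_seqs A \<nu>"
  shows "\<exists>x\<in>C. tends f x"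
proof -
  interpret M: Metric_space "carrier A" "cdist A" by (rule mspace)
  have fA: "f n \<in> carrier A" for n using f C_carrier by blast
  have "M.MCauchy f"
    unfolding M.MCauchy_def
  proof (intro conjI allI impI)
    show "range f \<subseteq> carrier A" using fA by blast
    show "\<exists>M. \<forall>n n'. M \<le> n \<longrightarrow> M \<le> n' \<longrightarrow> cdist A (f n) (f n') < e" if "0 < e" for e
      using cauchyD[OF c that] by (simp add: cdist_def fA)
  qed
  then obtain x where x: "limitin M.mtopology f x sequentially"
    using complete unfolding M.mcomplete_def by blast
  have "x \<in> C"
    by (rule limitin_closedin[OF x]) (use C_subalgebra f in \<open>simp_all add: cstar_subalgebra_def\<close>)
  moreover have "tends f x"
    unfolding tends_def
  proof (rule LIMSEQ_I)
    fix r :: real assume "0 < r"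
    then obtain M where "\<forall>n\<ge>M. cdist A (f n) x < r" and xA: "x \<in> carrier A"
      using x unfolding M.limit_metric_sequentially by blast
    then show "\<exists>no. \<forall>n\<ge>no. norm (\<nu> (f n \<ominus> x) - 0) < r"
      by (intro exI[of _ M]) (simp add: cdist_def N_nonneg fA)
  qed
  ultimately show ?thesis by blast
qed

lemma tends_unique:
  assumes "tends f x" "tends f y" "\<And>n. f n \<in> carrier A" "x \<in> carrier A" "y \<in> carrier A"
  shows "x = y"
proof -
  have 1: "(\<lambda>n. \<nu> (f n \<ominus> x) + \<nu> (f n \<ominus> y)) \<longlonglongrightarrow> 0"
    using tendsto_add[OF assms(1,2)[unfolded tends_def]] by simp
  have "\<nu> (x \<ominus> y) \<le> \<nu> (f n \<ominus> x) + \<nu> (f n \<ominus> y)" for n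
    using N_triangle[OF assms(4) assms(3)[of n] assms(5)] N_diff_commute[OF assms(4) assms(3)[of n]] by simp
  then have "\<exists>N. \<forall>n\<ge>N. \<nu> (x \<ominus> y) \<le> \<nu> (f n \<ominus> x) + \<nu> (f n \<ominus> y)" by simp
  from LIMSEQ_le_const[OF 1 this] have "\<nu> (x \<ominus> y) = 0" using N_nonneg[OF minus_closed[OF assms(4,5)]] by simp
  then show ?thesis using assms(4,5) cnorm_eq_zero[of "x \<ominus> y"] diff_eq_zero[of x y] by simp
qed

lemma tends_const: "x \<in> carrier A \<Longrightarrow> tends (\<lambda>_. x) x"
  by (simp add: tends_def diff_self N_zero)

lemma tends_add:
  assumes "tends f x" "tends g y" "\<And>n. f n \<in> carrier A" "\<And>n. g n \<in> carrier A" "x \<in> carrier A" "y \<in> carrier A"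
  shows "tends (\<lambda>n. f n \<oplus> g n) (x \<oplus> y)"
  unfolding tends_def
  by (rule null_by_bound[OF _ _ assms(1,2)[unfolded tends_def], of _ 1 1])
     (simp_all add: assms(3-6) diff_add_swap N_add)

lemma tends_scale: "\<lbrakk>tends f x; \<And>n. f n \<in> carrier A; x \<in> carrier A\<rbrakk> \<Longrightarrow> tends (\<lambda>n. scale A c (f n)) (scale A c x)"
  unfolding tends_def using tendsto_mult_right_zero[of "\<lambda>n. \<nu> (f n \<ominus> x)" _ "cmod c"]
  by (simp add: diff_scale N_scale)

lemma tends_star: "\<lbrakk>tends f x; \<And>n. f n \<in> carrier A; x \<in> carrier A\<rbrakk> \<Longrightarrow> tends (\<lambda>n. star A (f n)) (star A x)"
  unfolding tends_def by (simp add: diff_star N_star)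

lemma tends_mult:
  assumes "tends f x" "tends g y" "\<And>n. f n \<in> carrier A" "\<And>n. g n \<in> carrier A" "x \<in> carrier A" "y \<in> carrier A"
    and K: "\<And>n. \<nu> (g n) \<le> K"
  shows "tends (\<lambda>n. f n \<otimes> g n) (x \<otimes> y)"
  unfolding tends_def
  by (rule null_by_bound[OF _ _ assms(1,2)[unfolded tends_def], of _ K "\<nu> x"])
     (simp_all add: assms mult_closed mult_diff_bound)

lemma tends_Suc: "tends f x \<Longrightarrow> tends (\<lambda>n. f (Suc n)) x"
  unfolding tends_def by (rule LIMSEQ_Suc)

lemma tends_norm:
  assumes "tends f x" "\<And>n. f n \<in> carrier A" "x \<in> carrier A"
  shows "(\<lambda>n. \<nu> (f n)) \<longlonglongrightarrow> \<nu> x"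
proof -
  have "(\<lambda>n. \<nu> (f n) - \<nu> x) \<longlonglongrightarrow> 0"
    by (rule Lim_null_comparison[OF _ assms(1)[unfolded tends_def]]) (simp add: N_abs_diff assms(2,3))
  then show ?thesis by (simp add: LIM_zero_iff)
qed

text \<open>The equation says y = (a + y^2)/2 and is solved by 1 minus a square root of 1 - a.
  Iteration from 0 converges even if \<open>a\<close> has norm 1, where the map need not be a strict
  contraction, because the scalar iteration for a = 1 dominates it. The iterates are polynomials in
  \<open>a\<close>, so the limit is self-adjoint and commutes with whatever commutes with
  \<open>a\<close>.\<close>

lemma fixpoint_exists:
  assumes a: "a \<in> C" "star A a = a" "\<nu> a \<le> 1"
  shows "\<exists>y\<in>C. star A y = y \<and> \<nu> y \<le> 1 \<and> y \<oplus> y = a \<oplus> y \<otimes> y \<and>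
    (\<forall>x\<in>carrier A. x \<otimes> a = a \<otimes> x \<longrightarrow> x \<otimes> y = y \<otimes> x)"
proof -
  define y where "y = rec_nat \<zero> (\<lambda>_ z. scale A (1/2) (a \<oplus> z \<otimes> z))"
  have y0: "y 0 = \<zero>" and yS: "\<And>n. y (Suc n) = scale A (1/2) (a \<oplus> y n \<otimes> y n)" by (simp_all add: y_def)
  \<comment> \<open>The same iteration with the scalar 1 in place of \<open>a\<close>; it is
    increasing and stays below 1.\<close>
  define t where "t = rec_nat (0::real) (\<lambda>_ s. (1 + s^2)/2)"
  have t0: "t 0 = 0" and tS: "\<And>n. t (Suc n) = (1 + (t n)^2)/2" by (simp_all add: t_def)
  have aA: "a \<in> carrier A" using a C_carrier by blast
  have yC: "y n \<in> C" for n by (induction n) (simp_all add: y0 yS C_zero C_closed a)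
  then have yA: "y n \<in> carrier A" for n using C_carrier by blast
  have ysa: "star A (y n) = y n" for n
    by (induction n) (simp_all add: y0 yS star_zero star_scale star_add star_mult a aA yA mult_closed)
  have comm: "x \<otimes> y n = y n \<otimes> x" if "x \<in> carrier A" "x \<otimes> a = a \<otimes> x" for x n
  proof (induction n)
    case 0 then show ?case using that by (simp add: y0 zero_mult mult_zero)
  next
    case (Suc n)
    have "x \<otimes> (y n \<otimes> y n) = (x \<otimes> y n) \<otimes> y n" by (simp add: mult_assoc that yA)
    also have "\<dots> = (y n \<otimes> x) \<otimes> y n" using Suc by simp
    also have "\<dots> = y n \<otimes> (x \<otimes> y n)" by (simp add: mult_assoc that yA)
    also have "\<dots> = (y n \<otimes> y n) \<otimes> x" using Suc by (simp add: mult_assoc that yA)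
    finally show ?case using that
      by (simp add: yS scale_mult_right scale_mult_left mult_distrib_left mult_distrib_right aA yA mult_closed)
  qed
  have ya: "y m \<otimes> a = a \<otimes> y m" for m using comm[of a m] aA by simp
  have yy: "y m \<otimes> y n = y n \<otimes> y m" for m n using comm[of "y m" n] ya yA by simp
  have t01: "0 \<le> t n \<and> t n \<le> 1" for n
  proof (induction n)
    case (Suc n)
    then have "(t n)^2 \<le> 1" by (simp add: power_le_one)
    then show ?case by (simp add: tS)
  qed (simp add: t0)
  have ynorm: "\<nu> (y n) \<le> t n" for n
  proof (induction n)
    case (Suc n)
    have "\<nu> (y n \<otimes> y n) \<le> \<nu> (y n) * \<nu> (y n)" by (rule N_mult) (rule yA)+
    also have "\<dots> \<le> (t n)^2" using Suc t01[of n] N_nonneg[OF yA] by (simp add: power2_eq_square mult_mono)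
    finally have "\<nu> (a \<oplus> y n \<otimes> y n) \<le> 1 + (t n)^2" using N_add[of a "y n \<otimes> y n"] a(3) aA yA mult_closed by fastforce
    then show ?case by (simp add: yS N_scale aA yA mult_closed tS)
  qed (simp add: y0 t0 N_zero)
  \<comment> \<open>Increments of the iterates are dominated by those of \<open>t\<close>: since the
    iterates commute, the difference of two squares factorises exactly as for scalars.\<close>
  have step: "\<nu> (y (Suc n) \<ominus> y n) \<le> t (Suc n) - t n" for n
  proof (induction n)
    case 0 show ?case using ynorm[of 1] by (simp add: y0 t0 diff_zero yA)
  next
    case (Suc n)
    have "y (Suc (Suc n)) \<ominus> y (Suc n) = scale A (1/2) (a \<oplus> y (Suc n) \<otimes> y (Suc n) \<ominus> (a \<oplus> y n \<otimes> y n))"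
      by (subst yS, subst (3) yS) (simp add: diff_scale aA yA mult_closed)
    also have "a \<oplus> y (Suc n) \<otimes> y (Suc n) \<ominus> (a \<oplus> y n \<otimes> y n) = y (Suc n) \<otimes> y (Suc n) \<ominus> y n \<otimes> y n"
      by (simp add: diff_add_swap diff_self aA yA mult_closed minus_closed)
    also have "\<dots> = (y (Suc n) \<ominus> y n) \<otimes> (y (Suc n) \<oplus> y n)"
      by (rule diff_of_squares) (simp_all add: yA yy)
    finally have e: "\<nu> (y (Suc (Suc n)) \<ominus> y (Suc n)) = 1/2 * \<nu> ((y (Suc n) \<ominus> y n) \<otimes> (y (Suc n) \<oplus> y n))"
      by (simp add: N_scale yA mult_closed)
    have "\<nu> ((y (Suc n) \<ominus> y n) \<otimes> (y (Suc n) \<oplus> y n)) \<le> \<nu> (y (Suc n) \<ominus> y n) * \<nu> (y (Suc n) \<oplus> y n)"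
      by (rule N_mult) (simp_all add: yA)
    also have "\<dots> \<le> (t (Suc n) - t n) * (t (Suc n) + t n)"
    proof (rule mult_mono[OF Suc])
      show "\<nu> (y (Suc n) \<oplus> y n) \<le> t (Suc n) + t n"
        using N_add[OF yA[of "Suc n"] yA[of n]] ynorm[of n] ynorm[of "Suc n"] by linarith
      show "0 \<le> t (Suc n) - t n" using Suc N_nonneg[of "y (Suc n) \<ominus> y n"] yA by (meson minus_closed order_trans)
    qed (simp add: N_nonneg yA)
    also have "\<dots> = 2 * (t (Suc (Suc n)) - t (Suc n))"
      by (subst (3) tS, subst (4) tS) (simp add: algebra_simps power2_eq_square)
    finally show ?case using e by simp
  qed
  have dist: "\<nu> (y (n + k) \<ominus> y n) \<le> t (n + k) - t n" for n k
  proof (induction k)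
    case (Suc k)
    then show ?case using N_triangle[OF yA[of "Suc (n+k)"] yA[of "n+k"] yA[of n]] step[of "n+k"] by simp
  qed (simp add: diff_self yA N_zero)
  \<comment> \<open>Monotonicity of \<open>t\<close> comes for free, since its increments bound
    norms.\<close>
  have "incseq t" using step N_nonneg[of "y (Suc _) \<ominus> y _"] yA by (intro incseq_SucI) (meson diff_ge_0_iff_ge minus_closed order_trans)
  then have "convergent t" using t01 by (intro Bseq_mono_convergent BseqI'[of _ 1]) (auto simp: incseq_def)
  then have tc: "Cauchy t" by (simp add: Cauchy_convergent_iff)
  have "y \<in> cauchy_seqs A \<nu>"
    unfolding cauchy_seqs_iff
  proof (intro conjI allI impI yA)
    fix e :: real assume "e > 0"
    then obtain M where M: "\<forall>m\<ge>M. \<forall>n\<ge>M. norm (t m - t n) < e" using CauchyD[OF tc] by blast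
    have le: "\<nu> (y m \<ominus> y n) < e" if "n \<le> m" "M \<le> n" for m n
    proof -
      have "\<nu> (y m \<ominus> y n) \<le> t m - t n" using dist[of n "m - n"] that by simp
      moreover have "t m - t n < e" using M that by (smt (verit) le_trans real_norm_def)
      ultimately show ?thesis by linarith
    qed
    have "\<nu> (y m \<ominus> y n) < e" if "m \<ge> M" "n \<ge> M" for m n
      using le[of n m] le[of m n] that N_diff_commute[OF yA yA, of m n] by (cases "n \<le> m") simp_all
    then show "\<exists>M. \<forall>m\<ge>M. \<forall>n\<ge>M. \<nu> (y m \<ominus> y n) < e" by blast
  qed
  from C_complete[OF yC this] obtain z where z: "z \<in> C" "tends y z" by blast
  have zA: "z \<in> carrier A" using z C_carrier by blast
  have y1: "\<nu> (y n) \<le> 1" for n using ynorm[of n] t01[of n] by linarith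
  have zz: "tends (\<lambda>n. y n \<otimes> y n) (z \<otimes> z)" by (rule tends_mult[OF z(2) z(2) yA yA zA zA y1])
  have "tends (\<lambda>n. y (Suc n)) (scale A (1/2) (a \<oplus> z \<otimes> z))"
    unfolding yS by (intro tends_scale tends_add tends_const zz) (simp_all add: aA yA zA mult_closed)
  from tends_unique[OF tends_Suc[OF z(2)] this] have eq: "z = scale A (1/2) (a \<oplus> z \<otimes> z)"
    by (simp add: yA zA aA mult_closed scale_closed)
  have "z \<oplus> z = scale A 2 z" by (simp add: scale_collect zA)
  also have "\<dots> = a \<oplus> z \<otimes> z" by (subst eq) (simp add: scale_scale scale_one zA aA mult_closed)
  finally have e1: "z \<oplus> z = a \<oplus> z \<otimes> z" .
  have e2: "star A z = z"
    using tends_unique[OF tends_star[OF z(2) yA zA] _ _ _ zA] z(2) by (simp add: ysa yA zA star_closed)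
  have e3: "\<nu> z \<le> 1" by (rule LIMSEQ_le_const2[OF tends_norm[OF z(2) yA zA]]) (use y1 in blast)
  have e4: "x \<otimes> z = z \<otimes> x" if x: "x \<in> carrier A" "x \<otimes> a = a \<otimes> x" for x
  proof -
    have "tends (\<lambda>n. x \<otimes> y n) (x \<otimes> z)" by (rule tends_mult[OF tends_const[OF x(1)] z(2) x(1) yA x(1) zA y1])
    moreover have "tends (\<lambda>n. x \<otimes> y n) (z \<otimes> x)"
      unfolding comm[OF x] by (rule tends_mult[OF z(2) tends_const[OF x(1)] yA x(1) zA x(1) order_refl])
    ultimately show ?thesis by (rule tends_unique) (simp_all add: x yA zA mult_closed)
  qed
  show ?thesis using z(1) e1 e2 e3 e4 by blast
qed

text \<open>The root is 1 - y with \<open>y\<close> from the fixed-point equation. The bound on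
  \<one> \<ominus> b stands in for positivity of \<open>b\<close>, so that no order on the algebra
  is required.\<close>

lemma sqrt_exists:
  assumes a: "a \<in> C" "star A a = a" "\<nu> a \<le> 1"
  shows "\<exists>b\<in>C. star A b = b \<and> \<nu> (\<one> \<ominus> b) \<le> 1 \<and> b \<otimes> b = \<one> \<ominus> a \<and>
    (\<forall>x\<in>carrier A. x \<otimes> a = a \<otimes> x \<longrightarrow> x \<otimes> b = b \<otimes> x)"
proof -
  obtain y where y: "y \<in> C" "star A y = y" "\<nu> y \<le> 1" "y \<oplus> y = a \<oplus> y \<otimes> y"
    "\<forall>x\<in>carrier A. x \<otimes> a = a \<otimes> x \<longrightarrow> x \<otimes> y = y \<otimes> x"
    using fixpoint_exists[OF a] by (elim bexE conjE) (rule that)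
  have yA: "y \<in> carrier A" and aA: "a \<in> carrier A" using y(1) a(1) by (simp_all add: C_carrier)
  have yy: "y \<otimes> y = (y \<oplus> y) \<ominus> a" unfolding y(4) using aA yA by (simp add: lin_simps)
  have "(\<one> \<ominus> y) \<otimes> (\<one> \<ominus> y) = (\<one> \<ominus> y) \<ominus> (y \<ominus> y \<otimes> y)"
    using yA one_carrier
    by (simp add: a_minus_def mult_distrib_left mult_distrib_right minus_mult mult_minus one_mult mult_one mult_closed)
  also have "\<dots> = \<one> \<ominus> a" unfolding yy using yA aA one_carrier by (simp add: lin_simps)
  finally have 1: "(\<one> \<ominus> y) \<otimes> (\<one> \<ominus> y) = \<one> \<ominus> a" .
  have 2: "\<one> \<ominus> (\<one> \<ominus> y) = y" using yA one_carrier by (simp add: lin_simps)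
  show ?thesis
  proof (intro bexI[of _ "\<one> \<ominus> y"] conjI ballI impI)
    fix x assume x: "x \<in> carrier A" "x \<otimes> a = a \<otimes> x"
    show "x \<otimes> (\<one> \<ominus> y) = (\<one> \<ominus> y) \<otimes> x"
      using x yA one_carrier bspec[OF y(5) x(1)] 
      by (simp add: a_minus_def mult_distrib_left mult_distrib_right minus_mult mult_minus one_mult mult_one mult_closed)
  qed (use 1 2 y(1-3) yA one_carrier in \<open>simp_all add: C_minus C_one star_one flip: diff_star\<close>)
qed


text \<open>The element u = h + ib satisfies u* u = u u* = r, so its seminorm is at most sqrt r. Now
  \<open>h\<close> is the average of \<open>u\<close> and its adjoint, and h^2 - b^2 is the average
  of their squares.\<close>

lemma norm_le_sqrt_sum_squares:
  assumes N: "cstar_seminorm (A\<lparr>carrier := C\<rparr>) N"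
    and h: "h \<in> C" "star A h = h" and b: "b \<in> C" "star A b = b" and hb: "h \<otimes> b = b \<otimes> h"
    and sq: "h \<otimes> h \<oplus> b \<otimes> b = scale A (complex_of_real r) \<one>" and r: "0 \<le> r"
  shows "N h \<le> sqrt r" "N (h \<otimes> h \<ominus> b \<otimes> b) \<le> r"
proof -
  have Npos: "\<And>x. x \<in> C \<Longrightarrow> 0 \<le> N x"
    and Nscale: "\<And>x c. x \<in> C \<Longrightarrow> N (scale A c x) = cmod c * N x"
    and Nadd: "\<And>x y. \<lbrakk>x \<in> C; y \<in> C\<rbrakk> \<Longrightarrow> N (x \<oplus> y) \<le> N x + N y"
    and Nmult: "\<And>x y. \<lbrakk>x \<in> C; y \<in> C\<rbrakk> \<Longrightarrow> N (x \<otimes> y) \<le> N x * N y"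
    and Ncstar: "\<And>x. x \<in> C \<Longrightarrow> N (star A x \<otimes> x) = (N x)\<^sup>2"
    using N unfolding cstar_seminorm_def by simp_all
  have A: "h \<in> carrier A" "b \<in> carrier A" using h b C_carrier by auto
  define u where "u = h \<oplus> scale A \<i> b"
  define v where "v = h \<oplus> scale A (-\<i>) b"
  have uv: "u \<in> C" "v \<in> C" by (simp_all add: u_def v_def C_closed h b)
  have uvA: "u \<in> carrier A" "v \<in> carrier A" using uv C_carrier by auto
  have su: "star A u = v" "star A v = u"
    by (simp_all add: u_def v_def star_add star_scale star_closed scale_closed h b A)
  have bhb: "scale A \<i> (b \<otimes> h) \<oplus> scale A (-\<i>) (b \<otimes> h) = \<zero>"
    by (simp add: scale_collect scale_zero A mult_closed)
  have mid: "x \<oplus> p \<oplus> (q \<oplus> y) = x \<oplus> y" if "p \<oplus> q = \<zero>" "x \<in> carrier A" "y \<in> carrier A" "p \<in> carrier A" "q \<in> carrier A" for x y p q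
    using that by (metis a_assoc a_closed l_zero)
  have "v \<otimes> u = (h \<otimes> h \<oplus> scale A \<i> (b \<otimes> h)) \<oplus> (scale A (-\<i>) (b \<otimes> h) \<oplus> b \<otimes> b)"
    using A by (simp add: u_def v_def mult_distrib_left mult_distrib_right scale_mult_left scale_mult_right
        scale_closed mult_closed scale_scale scale_one hb scale_add_right a_ac)
  also have "\<dots> = scale A (complex_of_real r) \<one>" by (subst mid) (simp_all add: bhb A mult_closed scale_closed sq)
  finally have vu: "v \<otimes> u = scale A (complex_of_real r) \<one>" .
  have "u \<otimes> v = (h \<otimes> h \<oplus> scale A \<i> (b \<otimes> h)) \<oplus> (scale A (-\<i>) (b \<otimes> h) \<oplus> b \<otimes> b)"
    using A by (simp add: u_def v_def mult_distrib_left mult_distrib_right scale_mult_left scale_mult_right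
        scale_closed mult_closed scale_scale scale_one hb scale_add_right a_ac)
  also have "\<dots> = scale A (complex_of_real r) \<one>" by (subst mid) (simp_all add: bhb A mult_closed scale_closed sq)
  finally have uv': "u \<otimes> v = scale A (complex_of_real r) \<one>" .
  have "(N \<one>)\<^sup>2 = N \<one>" using Ncstar[OF C_one] by (simp add: star_one one_mult one_carrier)
  then have "N \<one> = 0 \<or> N \<one> = 1" by (simp add: power2_eq_square)
  then have n1: "N \<one> \<le> 1" by auto
  have "(N u)\<^sup>2 \<le> r" "(N v)\<^sup>2 \<le> r"
    using Ncstar[OF uv(1)] Ncstar[OF uv(2)] n1 r mult_left_mono[OF n1 r] by (simp_all add: su vu uv' Nscale C_one)
  then have Nu: "N u \<le> sqrt r" and Nv: "N v \<le> sqrt r" by (simp_all add: real_le_rsqrt)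
  have "u \<oplus> v = scale A 2 h \<oplus> scale A 0 b"
    using A by (simp add: u_def v_def lin_simps scale_closed)
  then have "h = scale A (1/2) (u \<oplus> v)" using A by (simp add: scale_zero scale_scale scale_one scale_closed)
  then have "N h = 1/2 * N (u \<oplus> v)" using Nscale[of "u \<oplus> v" "1/2"] uv by (simp add: C_closed)
  then show "N h \<le> sqrt r" using Nadd[OF uv] Nu Nv by simp
  have uu: "u \<otimes> u = (h \<otimes> h \<ominus> b \<otimes> b) \<oplus> scale A (2*\<i>) (b \<otimes> h)"
    using A by (simp add: u_def mult_distrib_left mult_distrib_right scale_mult_left scale_mult_right
        scale_closed mult_closed scale_scale scale_one hb scale_add_right a_ac minus_scale scale_collect scale_collect2)
  have vv: "v \<otimes> v = (h \<otimes> h \<ominus> b \<otimes> b) \<oplus> scale A (-(2*\<i>)) (b \<otimes> h)"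
    using A by (simp add: v_def mult_distrib_left mult_distrib_right scale_mult_left scale_mult_right
        scale_closed mult_closed scale_scale scale_one hb scale_add_right a_ac minus_scale scale_collect scale_collect2)
  define w where "w = h \<otimes> h \<ominus> b \<otimes> b"
  have w: "w \<in> carrier A" "w \<in> C" using A h b by (simp_all add: w_def mult_closed C_minus C_closed)
  have "u \<otimes> u \<oplus> v \<otimes> v = (scale A 2 w) \<oplus> scale A 0 (b \<otimes> h)"
    unfolding uu vv w_def[symmetric] using A w by (simp add: lin_simps)
  then have "w = scale A (1/2) (u \<otimes> u \<oplus> v \<otimes> v)" using A w by (simp add: scale_zero scale_scale scale_one scale_closed mult_closed)
  then have "N w = 1/2 * N (u \<otimes> u \<oplus> v \<otimes> v)" using Nscale[of "u \<otimes> u \<oplus> v \<otimes> v" "1/2"] uv by (simp add: C_closed)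
  moreover have "N (u \<otimes> u) \<le> r" using order_trans[OF Nmult[OF uv(1,1)]] \<open>(N u)\<^sup>2 \<le> r\<close> by (simp add: power2_eq_square)
  moreover have "N (v \<otimes> v) \<le> r" using order_trans[OF Nmult[OF uv(2,2)]] \<open>(N v)\<^sup>2 \<le> r\<close> by (simp add: power2_eq_square)
  ultimately have "N w \<le> r" using Nadd[of "u \<otimes> u" "v \<otimes> v"] uv by (simp add: C_closed)
  then show "N (h \<otimes> h \<ominus> b \<otimes> b) \<le> r" by (simp add: w_def)
qed


lemma mult_star_self: "x \<in> carrier A \<Longrightarrow> star A (star A x \<otimes> x) = star A x \<otimes> x"
  by (simp add: star_mult star_closed star_star)

text \<open>For self-adjoint \<open>h\<close> of norm at most 1, a commuting root \<open>b\<close>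
  of 1 - h^2 makes h + ib unitary, whence N h \<le> 1. Scaling gives all self-adjoint elements and
  the C*-identity the rest.\<close>

theorem seminorm_contractive:
  assumes N: "cstar_seminorm (A\<lparr>carrier := C\<rparr>) N" and x: "x \<in> C"
  shows "N x \<le> \<nu> x"
proof -
  have Npos: "\<And>x. x \<in> C \<Longrightarrow> 0 \<le> N x"
    and Nscale: "\<And>x c. x \<in> C \<Longrightarrow> N (scale A c x) = cmod c * N x"
    and Ncstar: "\<And>x. x \<in> C \<Longrightarrow> N (star A x \<otimes> x) = (N x)\<^sup>2"
    using N unfolding cstar_seminorm_def by simp_all
  have unit: "N h \<le> 1" if h: "h \<in> C" "star A h = h" "\<nu> h \<le> 1" for h
  proof -
    have hA: "h \<in> carrier A" using h C_carrier by blast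
    have "\<nu> (h \<otimes> h) = (\<nu> h)\<^sup>2" using N_cstar[OF hA] h by simp
    also have "\<dots> \<le> 1" using h N_nonneg[OF hA] by (simp add: power_le_one)
    finally have hh: "\<nu> (h \<otimes> h) \<le> 1" .
    have hC2: "h \<otimes> h \<in> C" "star A (h \<otimes> h) = h \<otimes> h" by (simp_all add: h hA C_closed star_mult)
    obtain b where b: "b \<in> C" "star A b = b" "b \<otimes> b = \<one> \<ominus> h \<otimes> h"
       "\<And>x. \<lbrakk>x \<in> carrier A; x \<otimes> (h \<otimes> h) = (h \<otimes> h) \<otimes> x\<rbrakk> \<Longrightarrow> x \<otimes> b = b \<otimes> x"
      using sqrt_exists[of "h \<otimes> h"] hC2 hh by blast
    have "h \<otimes> b = b \<otimes> h" by (rule b(4)) (simp_all add: hA mult_assoc)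
    moreover have "h \<otimes> h \<oplus> b \<otimes> b = scale A (complex_of_real 1) \<one>"
      unfolding b(3) using hA one_carrier by (simp add: lin_simps)
    ultimately show "N h \<le> 1" using norm_le_sqrt_sum_squares(1)[OF N h(1,2) b(1,2), of 1] by simp
  qed
  have sa: "N h \<le> \<nu> h" if h: "h \<in> C" "star A h = h" for h
  proof (cases "\<nu> h = 0")
    case True
    then have "h = \<zero>" using cnorm_eq_zero h C_carrier by blast
    then have "N h = 0" using Nscale[OF h(1), of 0] scale_of_zero by simp
    then show ?thesis using True by simp
  next
    case False
    have hA: "h \<in> carrier A" using h C_carrier by blast
    have p: "0 < \<nu> h" using False N_nonneg[OF hA] by simp
    have "N (scale A (complex_of_real (1 / \<nu> h)) h) \<le> 1"
      by (rule unit) (use p in \<open>simp_all add: C_closed h star_scale hA N_scale norm_divide\<close>)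
    then show ?thesis using p by (simp add: Nscale h norm_divide field_simps)
  qed
  have xA: "x \<in> carrier A" using x C_carrier by blast
  have "(N x)\<^sup>2 \<le> (\<nu> x)\<^sup>2"
    using sa[of "star A x \<otimes> x"] x xA by (simp add: C_closed mult_star_self Ncstar N_cstar)
  then show ?thesis using N_nonneg[OF xA] by (rule power2_le_imp_le)
qed

text \<open>If \<open>N\<close> were smaller than the norm at \<open>x\<close>, the normalised
  positive element \<open>h\<close> constructed below would have norm 1 but N h < 1. For
  \<open>c\<close> in between, the positive part of h - c is annihilated by \<open>N\<close>, hence
  zero by definiteness; then c - h has a square root and the norm drops below 1 after all. Absolute
  values and positivity are expressed through square roots.\<close>

theorem norm_unique:
  assumes N: "cstar_seminorm (A\<lparr>carrier := C\<rparr>) N"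
    and def: "\<And>x. \<lbrakk>x \<in> C; N x = 0\<rbrakk> \<Longrightarrow> x = \<zero>" and x: "x \<in> C"
  shows "N x = \<nu> x"
proof (rule ccontr)
  assume "N x \<noteq> \<nu> x"
  then have less: "N x < \<nu> x" using seminorm_contractive[OF N x] by simp
  have Npos: "\<And>x. x \<in> C \<Longrightarrow> 0 \<le> N x"
    and Nscale: "\<And>x c. x \<in> C \<Longrightarrow> N (scale A c x) = cmod c * N x"
    and Nadd: "\<And>x y. \<lbrakk>x \<in> C; y \<in> C\<rbrakk> \<Longrightarrow> N (x \<oplus> y) \<le> N x + N y"
    and Nmult: "\<And>x y. \<lbrakk>x \<in> C; y \<in> C\<rbrakk> \<Longrightarrow> N (x \<otimes> y) \<le> N x * N y"
    and Ncstar: "\<And>x. x \<in> C \<Longrightarrow> N (star A x \<otimes> x) = (N x)\<^sup>2"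
    using N unfolding cstar_seminorm_def by simp_all
  have nuC: "cstar_seminorm (A\<lparr>carrier := C\<rparr>) \<nu>"
    unfolding cstar_seminorm_def by (simp add: C_carrier N_nonneg N_scale N_add N_mult N_cstar)
  have xA: "x \<in> carrier A" using x C_carrier by blast
  define R where "R = (\<nu> x)\<^sup>2"
  have R: "0 < R" "(N x)\<^sup>2 < R" using less Npos[OF x] by (simp_all add: R_def power_strict_mono)
  define g where "g = scale A (complex_of_real (1 / R)) (star A x \<otimes> x)"
  have gC: "g \<in> C" by (simp add: g_def C_closed x)
  have gA: "g \<in> carrier A" using gC C_carrier by blast
  have gsa: "star A g = g" by (simp add: g_def star_scale mult_star_self xA mult_closed star_closed)
  have g1: "\<nu> g = 1" using R by (simp add: g_def N_scale xA mult_closed star_closed N_cstar norm_divide flip: R_def)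
  have Ng: "N g < 1" using R by (simp add: g_def Nscale C_closed x Ncstar norm_divide)
  \<comment> \<open>A square, so that \<open>h\<close> comes with a self-adjoint root
    \<open>g\<close>, as the estimate for sums of two squares requires.\<close>
  define h where "h = g \<otimes> g"
  have hC: "h \<in> C" by (simp add: h_def C_closed gC)
  have hA: "h \<in> carrier A" using hC C_carrier by blast
  have hsa: "star A h = h" by (simp add: h_def star_mult gA gsa)
  have h1: "\<nu> h = 1" using N_cstar[OF gA] by (simp add: h_def gsa g1)
  have "N h = (N g)\<^sup>2" using Ncstar[OF gC] by (simp add: h_def gsa)
  then have Nh: "N h < 1" using Ng Npos[OF gC] by (simp add: power_less_one_iff abs_less_iff)
  \<comment> \<open>Strictly between N h and 1. Being at least 1/2, it also keeps the norm of k = h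
    - c at most 1.\<close>
  define c where "c = (1 + N h) / 2"
  have c: "N h < c" "c < 1" "1/2 \<le> c" using Nh Npos[OF hC] by (simp_all add: c_def)
  have "\<nu> \<one> = 0 \<or> \<nu> \<one> = 1"
    using N_cstar[OF one_carrier] by (simp add: star_one one_mult one_carrier power2_eq_square)
  then have n1: "\<nu> \<one> \<le> 1" by auto
  have Nc1: "N (scale A (complex_of_real d) \<one>) \<le> d" if "0 \<le> d" for d
    using seminorm_contractive[OF N C_one] n1 mult_left_mono[of "N \<one>" 1 d] that by (simp add: Nscale C_one)
  obtain b where b: "b \<in> C" "star A b = b" "b \<otimes> b = \<one> \<ominus> h"
    "\<And>x. \<lbrakk>x \<in> carrier A; x \<otimes> h = h \<otimes> x\<rbrakk> \<Longrightarrow> x \<otimes> b = b \<otimes> x"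
    using sqrt_exists[OF hC hsa] h1 by auto
  have gb: "g \<otimes> b = b \<otimes> g" by (rule b(4)) (simp_all add: gA h_def mult_assoc)
  have "g \<otimes> g \<oplus> b \<otimes> b = scale A (complex_of_real 1) \<one>"
    unfolding b(3) h_def[symmetric] using hA one_carrier by (simp add: lin_simps)
  \<comment> \<open>With g^2 = h and b^2 = 1 - h this bounds 2h - 1 = g^2 - b^2 by 1.\<close>
  from norm_le_sqrt_sum_squares(2)[OF nuC gC gsa b(1,2) gb this]
  have half: "\<nu> (h \<ominus> (\<one> \<ominus> h)) \<le> 1" by (simp add: b(3) flip: h_def)
  define k where "k = scale A (complex_of_real (-c)) \<one> \<oplus> h"
  have kC: "k \<in> C" by (simp add: k_def C_closed hC C_one)
  have kA: "k \<in> carrier A" using kC C_carrier by blast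
  have ksa: "star A k = k" by (simp add: k_def star_add star_scale star_one one_carrier hA hsa scale_closed)
  have "k = scale A (1/2) (h \<ominus> (\<one> \<ominus> h)) \<oplus> scale A (complex_of_real (1/2 - c)) \<one>"
    using hA one_carrier by (simp add: k_def lin_simps)
  then have "\<nu> k \<le> \<nu> (scale A (1/2) (h \<ominus> (\<one> \<ominus> h))) + \<nu> (scale A (complex_of_real (1/2 - c)) \<one>)"
    using N_add hA one_carrier by (simp add: scale_closed)
  also have "\<dots> = 1/2 * \<nu> (h \<ominus> (\<one> \<ominus> h)) + (c - 1/2) * \<nu> \<one>"
    using c(3) hA one_carrier by (simp add: N_scale del: of_real_diff)
  also have "\<dots> \<le> 1" using half mult_left_mono[OF n1, of "c - 1/2"] c by simp
  finally have k1: "\<nu> k \<le> 1" .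
  define q where "q = k \<otimes> k"
  have q: "q \<in> C" "q \<in> carrier A" "star A q = q" by (simp_all add: q_def C_closed kC kA mult_closed star_mult ksa)
  have "\<nu> q = (\<nu> k)\<^sup>2" using N_cstar[OF kA] by (simp add: q_def ksa)
  then have q1: "\<nu> q \<le> 1" using k1 N_nonneg[OF kA] by (simp add: power_le_one)
  have kq: "k \<otimes> q = q \<otimes> k" by (simp add: q_def mult_assoc kA)
  \<comment> \<open>A root of 1 - k^2 has norm at most 1, hence so has 1 - k^2 itself; that is the
    condition for extracting a root of k^2 = 1 - (1 - k^2).\<close>
  obtain b1 where b1: "b1 \<in> C" "star A b1 = b1" "b1 \<otimes> b1 = \<one> \<ominus> q"
    "\<And>x. \<lbrakk>x \<in> carrier A; x \<otimes> q = q \<otimes> x\<rbrakk> \<Longrightarrow> x \<otimes> b1 = b1 \<otimes> x"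
    using sqrt_exists[OF q(1,3) q1] by blast
  have b1A: "b1 \<in> carrier A" using b1 C_carrier by blast
  have "b1 \<otimes> b1 \<oplus> k \<otimes> k = scale A (complex_of_real 1) \<one>"
    unfolding b1(3) q_def[symmetric] using q one_carrier by (simp add: lin_simps)
  from norm_le_sqrt_sum_squares(1)[OF nuC b1(1,2) kC ksa b1(4)[OF kA kq, symmetric] this]
  have "\<nu> b1 \<le> 1" by simp
  then have q1': "\<nu> (\<one> \<ominus> q) \<le> 1"
    using N_cstar[OF b1A] N_nonneg[OF b1A] by (simp add: b1 power_le_one)
  have q2': "\<one> \<ominus> q \<in> C" "star A (\<one> \<ominus> q) = \<one> \<ominus> q"
    by (simp_all add: C_minus C_one q star_one one_carrier flip: diff_star)
  \<comment> \<open>\<open>w\<close> plays the role of the absolute value of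
    \<open>k\<close>.\<close>
  obtain w where w: "w \<in> C" "star A w = w" "\<nu> (\<one> \<ominus> w) \<le> 1" "w \<otimes> w = \<one> \<ominus> (\<one> \<ominus> q)"
    "\<And>x. \<lbrakk>x \<in> carrier A; x \<otimes> (\<one> \<ominus> q) = (\<one> \<ominus> q) \<otimes> x\<rbrakk> \<Longrightarrow> x \<otimes> w = w \<otimes> x"
    using sqrt_exists[of "\<one> \<ominus> q"] q q1' q2' by blast
  have wA: "w \<in> carrier A" using w C_carrier by blast
  have wk: "k \<otimes> w = w \<otimes> k"
    by (rule w(5)) (simp_all add: a_minus_def mult_distrib_left mult_distrib_right one_mult mult_one mult_minus minus_mult kA q one_carrier kq)
  have ww: "w \<otimes> w = k \<otimes> k"
    unfolding w(4) q_def[symmetric] using q one_carrier by (simp add: lin_simps)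
  define Z where "Z = scale A (complex_of_real (1 - c)) \<one> \<oplus> h"
  have ZC: "Z \<in> C" by (simp add: Z_def C_closed hC C_one)
  have ZA: "Z \<in> carrier A" using ZC C_carrier by blast
  have Zsa: "star A Z = Z" by (simp add: Z_def star_add star_scale star_one one_carrier hA hsa scale_closed)
  have NZ: "N Z < 1"
    using Nadd[of "scale A (complex_of_real (1 - c)) \<one>" h] Nc1[of "1 - c"] c hC C_one by (simp add: Z_def C_closed)
  \<comment> \<open>Twice the positive part of \<open>k\<close>. It annihilates w - k because
    \<open>w\<close> and \<open>k\<close> commute and have equal squares. Moreover w - k is 2 minus
    the sum of \<one> \<ominus> w and \<open>Z\<close>, and that sum has seminorm below 2; this
    forces N d = 0.\<close>
  define d where "d = w \<oplus> k"
  have dC: "d \<in> C" by (simp add: d_def C_closed w kC)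
  have dA: "d \<in> carrier A" using dC C_carrier by blast
  have "d \<otimes> (w \<ominus> k) = \<zero>"
    using wA kA by (simp add: d_def a_minus_def mult_distrib_left mult_distrib_right mult_minus wk ww mult_closed a_ac r_neg r_neg1 r_neg2)
  moreover have "w \<ominus> k = scale A 2 \<one> \<ominus> ((\<one> \<ominus> w) \<oplus> Z)"
    using wA one_carrier hA by (simp add: k_def Z_def lin_simps)
  ultimately have "d \<otimes> (scale A 2 \<one>) \<ominus> d \<otimes> ((\<one> \<ominus> w) \<oplus> Z) = \<zero>"
    using dA wA ZA one_carrier by (simp add: a_minus_def mult_distrib_left mult_minus scale_closed)
  then have "scale A 2 d = d \<otimes> ((\<one> \<ominus> w) \<oplus> Z)"
    using dA wA ZA one_carrier by (simp add: diff_eq_zero scale_closed mult_closed scale_mult_right mult_one)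
  then have "2 * N d = N (d \<otimes> ((\<one> \<ominus> w) \<oplus> Z))" using Nscale[OF dC, of 2] by simp
  also have "\<dots> \<le> N d * N ((\<one> \<ominus> w) \<oplus> Z)" by (rule Nmult) (simp_all add: dC C_closed C_minus C_one w ZC)
  also have "\<dots> \<le> N d * (1 + N Z)"
  proof (rule mult_left_mono[OF _ Npos[OF dC]])
    have "N (\<one> \<ominus> w) \<le> 1" using seminorm_contractive[OF N, of "\<one> \<ominus> w"] w by (simp add: C_minus C_one)
    then show "N ((\<one> \<ominus> w) \<oplus> Z) \<le> 1 + N Z" using Nadd[of "\<one> \<ominus> w" Z] by (simp add: C_minus C_one w ZC)
  qed
  finally have "N d * (1 - N Z) \<le> 0" by (simp add: algebra_simps)
  then have "N d \<le> 0" using NZ by (simp add: mult_le_0_iff)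
  then have "d = \<zero>" using Npos[OF dC] def[OF dC] by simp
  then have "w = \<ominus> k" unfolding d_def using wA kA by (metis minus_equality)
  \<comment> \<open>With w = -k the bound on \<one> \<ominus> w becomes a bound on \<open>Z\<close>,
    so 1 - Z = c - h has a root \<beta>, and g^2 + \<beta>^2 = c.\<close>
  then have "\<one> \<ominus> w = Z" using hA one_carrier by (simp add: k_def Z_def a_inv_scale lin_simps)
  then have "\<nu> Z \<le> 1" using w by simp
  then obtain \<beta> where \<beta>: "\<beta> \<in> C" "star A \<beta> = \<beta>" "\<beta> \<otimes> \<beta> = \<one> \<ominus> Z"
    "\<And>x. \<lbrakk>x \<in> carrier A; x \<otimes> Z = Z \<otimes> x\<rbrakk> \<Longrightarrow> x \<otimes> \<beta> = \<beta> \<otimes> x"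
    using sqrt_exists[OF ZC Zsa] by blast
  have "g \<otimes> \<beta> = \<beta> \<otimes> g"
    by (rule \<beta>(4)) (simp_all add: gA Z_def mult_distrib_left mult_distrib_right scale_mult_left scale_mult_right
       one_mult mult_one one_carrier scale_closed h_def mult_closed mult_assoc)
  moreover have "g \<otimes> g \<oplus> \<beta> \<otimes> \<beta> = scale A (complex_of_real c) \<one>"
    unfolding \<beta>(3) h_def[symmetric] using hA one_carrier by (simp add: Z_def lin_simps)
  ultimately have "\<nu> g \<le> sqrt c" using norm_le_sqrt_sum_squares(1)[OF nuC gC gsa \<beta>(1,2)] c by simp
  then show False using g1 c by simp
qed

end


section \<open>Generators and relations of the boundary quotient\<close>

context star_algebra
begin

text \<open>The C*-identity passes to suprema because squaring is increasing on nonnegative reals.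
  For homogeneity only one inequality passes directly; the other follows by rescaling with
  1/c.\<close>

lemma cstar_seminorm_SUP:
  assumes ne: "\<N> \<noteq> {}" and sn: "\<And>N. N \<in> \<N> \<Longrightarrow> cstar_seminorm A N"
    and bdd: "\<And>x. x \<in> carrier A \<Longrightarrow> bdd_above ((\<lambda>N. N x) ` \<N>)"
  shows "cstar_seminorm A (\<lambda>x. SUP N\<in>\<N>. N x)"
proof -
  define U where "U = (\<lambda>x. SUP N\<in>\<N>. N x)"
  have up: "N x \<le> U x" if "N \<in> \<N>" "x \<in> carrier A" for N x
    unfolding U_def by (rule cSUP_upper[OF that(1) bdd[OF that(2)]])
  have least: "U x \<le> m" if "\<And>N. N \<in> \<N> \<Longrightarrow> N x \<le> m" for x m
    unfolding U_def by (rule cSUP_least[OF ne that])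
  obtain N0 where N0: "N0 \<in> \<N>" using ne by blast
  have pos: "0 \<le> N x" if "N \<in> \<N>" "x \<in> carrier A" for N x
    using sn[OF that(1)] that(2) by (simp add: cstar_seminorm_def)
  have Upos: "0 \<le> U x" if "x \<in> carrier A" for x
    using up[OF N0 that] pos[OF N0 that] by simp
  have Usc: "U (scale A c x) \<le> cmod c * U x" if x: "x \<in> carrier A" for c x
  proof (rule least)
    fix N assume N: "N \<in> \<N>"
    show "N (scale A c x) \<le> cmod c * U x"
      using sn[OF N] x up[OF N x] by (simp add: cstar_seminorm_def mult_left_mono)
  qed
  show ?thesis
    unfolding cstar_seminorm_def U_def[symmetric]
  proof (intro conjI ballI allI)
    fix x assume x: "x \<in> carrier A"
    show "0 \<le> U x" by (rule Upos[OF x])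
    show "U (scale A c x) = cmod c * U x" for c
    proof (cases "c = 0")
      case True
      then show ?thesis using Usc[OF x, of 0] Upos[OF scale_closed[OF x], of 0] by simp
    next
      case False
      have "U x \<le> cmod (1/c) * U (scale A c x)"
        using Usc[OF scale_closed[OF x], of "1/c" c] False by (simp add: scale_scale x scale_one)
      then have "cmod c * U x \<le> U (scale A c x)" using False by (simp add: norm_divide field_simps)
      then show ?thesis using Usc[OF x, of c] by simp
    qed
    show "U (star A x \<otimes> x) = (U x)\<^sup>2"
    proof (rule antisym)
      show "U (star A x \<otimes> x) \<le> (U x)\<^sup>2"
      proof (rule least)
        fix N assume N: "N \<in> \<N>"
        show "N (star A x \<otimes> x) \<le> (U x)\<^sup>2"
          using sn[OF N] x up[OF N x] pos[OF N x] by (simp add: cstar_seminorm_def power_mono)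
      qed
      have "U x \<le> sqrt (U (star A x \<otimes> x))"
      proof (rule least)
        fix N assume N: "N \<in> \<N>"
        have "(N x)\<^sup>2 \<le> U (star A x \<otimes> x)"
          using sn[OF N] x up[OF N mult_closed[OF star_closed[OF x] x]] by (simp add: cstar_seminorm_def)
        then show "N x \<le> sqrt (U (star A x \<otimes> x))" by (rule real_le_rsqrt)
      qed
      then have "(U x)\<^sup>2 \<le> (sqrt (U (star A x \<otimes> x)))\<^sup>2" by (rule power_mono) (rule Upos[OF x])
      also have "\<dots> = U (star A x \<otimes> x)" by (rule real_sqrt_pow2) (rule Upos[OF mult_closed[OF star_closed[OF x] x]])
      finally show "(U x)\<^sup>2 \<le> U (star A x \<otimes> x)" .
    qed
    fix y assume y: "y \<in> carrier A"
    show "U (x \<oplus> y) \<le> U x + U y"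
    proof (rule least)
      fix N assume N: "N \<in> \<N>"
      have "N (x \<oplus> y) \<le> N x + N y" using sn[OF N] x y by (simp add: cstar_seminorm_def)
      then show "N (x \<oplus> y) \<le> U x + U y" using up[OF N x] up[OF N y] by linarith
    qed
    show "U (x \<otimes> y) \<le> U x * U y"
    proof (rule least)
      fix N assume N: "N \<in> \<N>"
      have "N (x \<otimes> y) \<le> N x * N y" using sn[OF N] x y by (simp add: cstar_seminorm_def)
      also have "\<dots> \<le> U x * U y"
        by (rule mult_mono[OF up[OF N x] up[OF N y] Upos[OF x] pos[OF N y]])
      finally show "N (x \<otimes> y) \<le> U x * U y" .
    qed
  qed
qed

end

text \<open>Monomials: elements of the free *-algebra are their finite linear combinations, and on
  them product and adjoint become concatenation and \<open>word_star\<close>.\<close>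

definition word_elt :: "('g \<times> bool) list \<Rightarrow> ('g \<times> bool) list \<Rightarrow> complex" where
  "word_elt w = (\<lambda>v. if v = w then 1 else 0)"

lemma word_star_simps: "length (word_star w) = length w" "word_star (word_star w) = w"
  "i \<le> length w \<Longrightarrow> word_star (take i w) = drop (length w - i) (word_star w)"
  "i \<le> length w \<Longrightarrow> word_star (drop i w) = take (length w - i) (word_star w)"
  by (simp_all add: word_star_def rev_map take_map drop_map rev_take rev_drop o_def case_prod_beta)

lemma word_star_lists: "word_star w \<in> lists (X \<times> UNIV) \<longleftrightarrow> w \<in> lists (X \<times> UNIV)"
  by (auto simp: word_star_def in_lists_conv_set)

section \<open>The free *-algebra on a set of generators\<close>

context
  fixes X :: "'g set"
begin

abbreviation "Fr \<equiv> free_star_algebra X"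

lemma free_carrier: "f \<in> carrier Fr \<longleftrightarrow> finite {w. f w \<noteq> 0} \<and> {w. f w \<noteq> 0} \<subseteq> lists (X \<times> UNIV)"
  by (simp add: free_star_algebra_def)

lemma free_carrier_supset:
  assumes "finite S" "S \<subseteq> lists (X \<times> UNIV)" "\<And>w. f w \<noteq> 0 \<Longrightarrow> w \<in> S"
  shows "f \<in> carrier Fr"
proof -
  have "{w. f w \<noteq> 0} \<subseteq> S" using assms(3) by blast
  then show ?thesis using assms(1,2) finite_subset unfolding free_carrier by blast
qed

lemma free_ops:
  "f \<oplus>\<^bsub>Fr\<^esub> g = (\<lambda>w. f w + g w)" "f \<otimes>\<^bsub>Fr\<^esub> g = (\<lambda>w. \<Sum>i\<le>length w. f (take i w) * g (drop i w))"
  "scale Fr c f = (\<lambda>w. c * f w)" "star Fr f = (\<lambda>w. cnj (f (word_star w)))" "\<zero>\<^bsub>Fr\<^esub> = (\<lambda>_. 0)"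
  "\<one>\<^bsub>Fr\<^esub> = word_elt []"
  by (simp_all add: free_star_algebra_def word_elt_def)

lemma free_add_closed: "f \<in> carrier Fr \<Longrightarrow> g \<in> carrier Fr \<Longrightarrow> f \<oplus>\<^bsub>Fr\<^esub> g \<in> carrier Fr"
  unfolding free_ops
  by (rule free_carrier_supset[of "{w. f w \<noteq> 0} \<union> {w. g w \<noteq> 0}"]) (auto simp: free_carrier)

lemma free_scale_closed: "f \<in> carrier Fr \<Longrightarrow> scale Fr c f \<in> carrier Fr"
  unfolding free_ops
  by (rule free_carrier_supset[of "{w. f w \<noteq> 0}"]) (auto simp: free_carrier)

lemma free_star_closed: assumes "f \<in> carrier Fr" shows "star Fr f \<in> carrier Fr"
  unfolding free_ops
proof (rule free_carrier_supset)
  show "finite (word_star ` {w. f w \<noteq> 0})" using assms by (simp add: free_carrier)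
  show "word_star ` {w. f w \<noteq> 0} \<subseteq> lists (X \<times> UNIV)"
    using assms word_star_lists unfolding free_carrier by blast
  show "w \<in> word_star ` {w. f w \<noteq> 0}" if "cnj (f (word_star w)) \<noteq> 0" for w
    using that by (intro image_eqI[of _ _ "word_star w"]) (simp_all add: word_star_simps)
qed

lemma free_mult_closed: assumes f: "f \<in> carrier Fr" and g: "g \<in> carrier Fr" shows "f \<otimes>\<^bsub>Fr\<^esub> g \<in> carrier Fr"
  unfolding free_ops
proof (rule free_carrier_supset)
  let ?S = "(\<lambda>(u, v). u @ v) ` ({w. f w \<noteq> 0} \<times> {w. g w \<noteq> 0})"
  show "finite ?S" using f g by (simp add: free_carrier)
  show "?S \<subseteq> lists (X \<times> UNIV)"
  proof
    fix w assume "w \<in> ?S"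
    then obtain u v where w: "w = u @ v" "f u \<noteq> 0" "g v \<noteq> 0" by auto
    have "u \<in> lists (X \<times> UNIV)" "v \<in> lists (X \<times> UNIV)" using f g w(2,3) unfolding free_carrier by blast+
    then show "w \<in> lists (X \<times> UNIV)" by (simp add: w(1))
  qed
  fix w assume "(\<Sum>i\<le>length w. f (take i w) * g (drop i w)) \<noteq> 0"
  then obtain i where "f (take i w) * g (drop i w) \<noteq> 0" by (meson sum.neutral)
  then show "w \<in> ?S" by (intro image_eqI[of _ _ "(take i w, drop i w)"]) auto
qed

text \<open>Both sides sum over all ways of cutting \<open>w\<close> into three consecutive pieces;
  in \<open>T\<close> the indices are the lengths of the first two pieces, and the reindexing trades
  cut positions for lengths.\<close>

lemma free_assoc: "(f \<otimes>\<^bsub>Fr\<^esub> g) \<otimes>\<^bsub>Fr\<^esub> h = f \<otimes>\<^bsub>Fr\<^esub> (g \<otimes>\<^bsub>Fr\<^esub> h)"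
proof (rule ext)
  fix w :: "('g \<times> bool) list"
  let ?n = "length w"
  define T where "T = (\<lambda>j k. f (take j w) * g (take k (drop j w)) * h (drop (j + k) w))"
  have "((f \<otimes>\<^bsub>Fr\<^esub> g) \<otimes>\<^bsub>Fr\<^esub> h) w = (\<Sum>i\<le>?n. \<Sum>j\<le>i. T j (i - j))"
    unfolding free_ops sum_distrib_right
    by (intro sum.cong) (auto simp: T_def min_def drop_take)
  also have "\<dots> = (\<Sum>(j,k)\<in>{(j,k). j + k \<le> ?n}. T j k)" by (rule sum.triangle_reindex_eq[symmetric])
  also have "{(j,k). j + k \<le> ?n} = Sigma {..?n} (\<lambda>j. {..?n - j})" by auto
  also have "(\<Sum>(j,k)\<in>Sigma {..?n} (\<lambda>j. {..?n - j}). T j k) = (\<Sum>j\<le>?n. \<Sum>k\<le>?n - j. T j k)"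
    by (rule sum.Sigma[symmetric]) auto
  also have "\<dots> = (f \<otimes>\<^bsub>Fr\<^esub> (g \<otimes>\<^bsub>Fr\<^esub> h)) w"
    unfolding free_ops sum_distrib_left
    by (intro sum.cong) (auto simp: T_def mult.assoc add.commute)
  finally show "((f \<otimes>\<^bsub>Fr\<^esub> g) \<otimes>\<^bsub>Fr\<^esub> h) w = (f \<otimes>\<^bsub>Fr\<^esub> (g \<otimes>\<^bsub>Fr\<^esub> h)) w" .
qed

text \<open>Reversing a word turns the cut after i letters into the cut after
  \<open>length w - i\<close> letters.\<close>

lemma free_star_mult: "star Fr (f \<otimes>\<^bsub>Fr\<^esub> g) = star Fr g \<otimes>\<^bsub>Fr\<^esub> star Fr f"
proof (rule ext)
  fix w :: "('g \<times> bool) list"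
  let ?n = "length w"
  show "star Fr (f \<otimes>\<^bsub>Fr\<^esub> g) w = (star Fr g \<otimes>\<^bsub>Fr\<^esub> star Fr f) w"
    unfolding free_ops cnj_sum word_star_simps
    by (rule sum.reindex_bij_witness[of _ "\<lambda>i. ?n - i" "\<lambda>i. ?n - i"]) (auto simp: word_star_simps mult.commute)
qed

lemma free_star_algebra: "star_algebra Fr"
proof -
  have ag: "abelian_group Fr"
  proof (rule abelian_groupI)
    fix f assume "f \<in> carrier Fr"
    then show "\<exists>g\<in>carrier Fr. g \<oplus>\<^bsub>Fr\<^esub> f = \<zero>\<^bsub>Fr\<^esub>"
      by (intro bexI[of _ "scale Fr (-1) f"] free_scale_closed) (simp_all add: free_ops)
  qed (simp_all add: free_add_closed, simp_all add: free_ops add_ac free_carrier)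
  interpret F: abelian_group Fr by (rule ag)
  show ?thesis
    by unfold_locales
      (simp_all add: free_mult_closed free_scale_closed free_star_closed free_assoc free_star_mult,
       simp_all add: free_ops algebra_simps sum.distrib sum_distrib_left word_star_simps)
qed

lemma word_elt_closed: "w \<in> lists (X \<times> UNIV) \<Longrightarrow> word_elt w \<in> carrier Fr"
  by (rule free_carrier_supset[of "{w}"]) (simp_all add: word_elt_def split: if_splits)

lemma free_one_mult: "\<one>\<^bsub>Fr\<^esub> \<otimes>\<^bsub>Fr\<^esub> f = f"
proof (rule ext)
  fix w :: "('g \<times> bool) list"
  have "(\<one>\<^bsub>Fr\<^esub> \<otimes>\<^bsub>Fr\<^esub> f) w = (\<Sum>i\<le>length w. if i = 0 then f w else 0)"
    unfolding free_ops word_elt_def by (intro sum.cong) (auto simp: take_eq_Nil)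
  then show "(\<one>\<^bsub>Fr\<^esub> \<otimes>\<^bsub>Fr\<^esub> f) w = f w" by simp
qed

lemma free_mult_one: "f \<otimes>\<^bsub>Fr\<^esub> \<one>\<^bsub>Fr\<^esub> = f"
proof (rule ext)
  fix w :: "('g \<times> bool) list"
  have "(f \<otimes>\<^bsub>Fr\<^esub> \<one>\<^bsub>Fr\<^esub>) w = (\<Sum>i\<le>length w. if i = length w then f w else 0)"
    unfolding free_ops word_elt_def by (intro sum.cong) (auto simp: drop_eq_Nil)
  then show "(f \<otimes>\<^bsub>Fr\<^esub> \<one>\<^bsub>Fr\<^esub>) w = f w" by simp
qed

lemma word_elt_append: "word_elt (u @ v) = word_elt u \<otimes>\<^bsub>Fr\<^esub> word_elt v"
proof (rule ext)
  fix w :: "('g \<times> bool) list"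
  have "(word_elt u \<otimes>\<^bsub>Fr\<^esub> word_elt v) w = (\<Sum>i\<le>length w. if i = length u then (if w = u @ v then 1 else 0) else 0)"
    unfolding free_ops word_elt_def
  proof (intro sum.cong refl)
    fix i assume i: "i \<in> {..length w}"
    have ite: "(if A then 1 else 0) * (if B then 1 else 0) = (if A \<and> B then 1 else (0::complex))" for A B by simp
    have iff: "take i w = u \<and> drop i w = v \<longleftrightarrow> i = length u \<and> w = u @ v"
    proof
      assume a: "take i w = u \<and> drop i w = v"
      then have "w = u @ v" using append_take_drop_id[of i w] by simp
      moreover have "length u = i" using a i by (auto simp: min_def)
      ultimately show "i = length u \<and> w = u @ v" by simp
    qed simp
    then show "(if take i w = u then 1 else 0) * (if drop i w = v then 1 else 0) = (if i = length u then if w = u @ v then 1 else 0 else (0::complex))"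
      unfolding ite iff by (cases "i = length u") simp_all
  qed
  then show "word_elt (u @ v) w = (word_elt u \<otimes>\<^bsub>Fr\<^esub> word_elt v) w"
    by (auto simp: word_elt_def)
qed

lemma star_word_elt: "star Fr (word_elt w) = word_elt (word_star w)"
  unfolding free_ops word_elt_def by (auto simp: fun_eq_iff word_star_simps)

lemma free_gen_word: "free_gen g = word_elt [(g, False)]"
  by (simp add: free_gen_def word_elt_def)

lemma free_induct:
  assumes "f \<in> carrier Fr" and z: "Q \<zero>\<^bsub>Fr\<^esub>"
    and w: "\<And>c w. w \<in> lists (X \<times> UNIV) \<Longrightarrow> Q (scale Fr c (word_elt w))"
    and a: "\<And>f g. \<lbrakk>f \<in> carrier Fr; g \<in> carrier Fr; Q f; Q g\<rbrakk> \<Longrightarrow> Q (f \<oplus>\<^bsub>Fr\<^esub> g)"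
  shows "Q f"
proof -
  have "Q f" if "finite S" "S \<subseteq> lists (X \<times> UNIV)" "{w. f w \<noteq> 0} \<subseteq> S" for S f
    using that
  proof (induction S arbitrary: f)
    case empty
    then have "f = \<zero>\<^bsub>Fr\<^esub>" by (auto simp: free_ops)
    then show ?case using z by simp
  next
    case (insert u S)
    define f' where "f' = (\<lambda>w. if w = u then 0 else f w)"
    have f': "{w. f' w \<noteq> 0} \<subseteq> S" using insert.prems by (auto simp: f'_def)
    have "f = scale Fr (f u) (word_elt u) \<oplus>\<^bsub>Fr\<^esub> f'" by (auto simp: free_ops word_elt_def f'_def)
    moreover have "f' \<in> carrier Fr" using insert f' by (intro free_carrier_supset[of S]) auto
    moreover have "Q f'" using insert f' by simp
    ultimately show ?case using insert.prems w[of u "f u"] a[of "scale Fr (f u) (word_elt u)" f']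
      by (simp add: word_elt_closed free_scale_closed)
  qed
  then show ?thesis using assms(1) unfolding free_carrier by blast
qed

text \<open>Letters have seminorm at most 1, hence so do words, and the triangle inequality over the
  support gives an l^1 bound that is the same for every such \<open>N\<close>. This keeps the
  supremum defining the universal seminorm finite.\<close>

lemma free_seminorm_bound:
  assumes N: "cstar_seminorm Fr N" and g: "\<And>g. g \<in> X \<Longrightarrow> N (free_gen g) \<le> 1" and f: "f \<in> carrier Fr"
  shows "N f \<le> (\<Sum>w | f w \<noteq> 0. cmod (f w))"
proof -
  interpret F: star_algebra Fr by (rule free_star_algebra)
  interpret cstar_seminormed Fr N by unfold_locales (rule N)
  have nil: "N (word_elt []) \<le> 1"
  proof -
    have "(N (word_elt []))\<^sup>2 = N (word_elt [])"
      using N_cstar[of "word_elt []"] word_elt_closed[of "[]"] free_one_mult[of "word_elt []", unfolded free_ops(6)]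
      by (simp add: star_word_elt word_star_def)
    then have "N (word_elt []) = 0 \<or> N (word_elt []) = 1" by (simp add: power2_eq_square)
    then show ?thesis by auto
  qed
  have letter: "N (word_elt [(x, b)]) \<le> 1" if x: "x \<in> X" for x b
  proof (cases b)
    case False then show ?thesis using g[OF x] by (simp add: free_gen_word)
  next
    case True
    have "word_elt [(x, b)] = star Fr (free_gen x)" using True by (simp add: free_gen_word star_word_elt word_star_def)
    then show ?thesis using g[OF x] N_star[of "free_gen x"] x by (simp add: free_gen_word word_elt_closed)
  qed
  have word: "N (word_elt w) \<le> 1" if "w \<in> lists (X \<times> UNIV)" for w
    using that
  proof (induction w)
    case Nil show ?case by (rule nil)
  next
    case (Cons a w)
    have "N (word_elt (a # w)) \<le> N (word_elt [a]) * N (word_elt w)"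
      using N_mult[of "word_elt [a]" "word_elt w"] Cons.hyps word_elt_append[of "[a]" w] by (simp add: word_elt_closed)
    also have "\<dots> \<le> 1 * 1"
      using Cons letter[of "fst a" "snd a"] by (intro mult_mono) (auto intro!: N_nonneg word_elt_closed)
    finally show ?case by simp
  qed
  have "N f \<le> (\<Sum>w\<in>S. cmod (f w))" if "finite S" "S \<subseteq> lists (X \<times> UNIV)" "{w. f w \<noteq> 0} \<subseteq> S" for S f
    using that
  proof (induction S arbitrary: f)
    case empty
    then have "f = \<zero>\<^bsub>Fr\<^esub>" by (auto simp: free_ops)
    then show ?case using N_zero by simp
  next
    case (insert u S)
    define f' where "f' = (\<lambda>w. if w = u then 0 else f w)"
    have f': "{w. f' w \<noteq> 0} \<subseteq> S" using insert.prems by (auto simp: f'_def)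
    have e: "f = scale Fr (f u) (word_elt u) \<oplus>\<^bsub>Fr\<^esub> f'" by (auto simp: free_ops word_elt_def f'_def)
    have c: "f' \<in> carrier Fr" using insert f' by (intro free_carrier_supset[of S]) auto
    have u: "word_elt u \<in> carrier Fr" using insert by (simp add: word_elt_closed)
    have "N f \<le> N (scale Fr (f u) (word_elt u)) + N f'"
      by (subst e) (rule N_add[OF F.scale_closed[OF u] c])
    also have "\<dots> \<le> cmod (f u) * 1 + (\<Sum>w\<in>S. cmod (f' w))"
      unfolding N_scale[OF u] using insert f' word[of u] by (intro add_mono mult_left_mono insert.IH) auto
    also have "(\<Sum>w\<in>S. cmod (f' w)) = (\<Sum>w\<in>S. cmod (f w))"
      using insert by (intro sum.cong) (auto simp: f'_def)
    finally show ?case using insert by simp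
  qed
  then show ?thesis using f unfolding free_carrier by blast
qed

lemma universal_seminorm_cstar:
  assumes g: "\<And>N g. \<lbrakk>cstar_seminorm Fr N; \<forall>(l, r)\<in>R. N (l \<ominus>\<^bsub>Fr\<^esub> r) = 0; g \<in> X\<rbrakk> \<Longrightarrow> N (free_gen g) \<le> 1"
  shows "cstar_seminorm Fr (universal_seminorm Fr R)"
    and "\<And>l r. \<lbrakk>(l, r) \<in> R; l \<in> carrier Fr; r \<in> carrier Fr\<rbrakk> \<Longrightarrow> universal_seminorm Fr R (l \<ominus>\<^bsub>Fr\<^esub> r) = 0"
proof -
  let ?N = "{N. cstar_seminorm Fr N \<and> (\<forall>(l, r)\<in>R. N (l \<ominus>\<^bsub>Fr\<^esub> r) = 0)}"
  \<comment> \<open>The zero seminorm respects every relation, so the supremum runs over a nonempty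
    set.\<close>
  have "(\<lambda>_. 0) \<in> ?N" by (simp add: cstar_seminorm_def)
  then have ne: "?N \<noteq> {}" by blast
  have "bdd_above ((\<lambda>N. N f) ` ?N)" if "f \<in> carrier Fr" for f
    using free_seminorm_bound[OF _ _ that] g by (intro bdd_aboveI2[of _ _ "\<Sum>w | f w \<noteq> 0. cmod (f w)"]) blast
  from star_algebra.cstar_seminorm_SUP[OF free_star_algebra ne _ this]
  show "cstar_seminorm Fr (universal_seminorm Fr R)" unfolding universal_seminorm_def by simp
  show "universal_seminorm Fr R (l \<ominus>\<^bsub>Fr\<^esub> r) = 0" if "(l, r) \<in> R" for l r
  proof -
    have "universal_seminorm Fr R (l \<ominus>\<^bsub>Fr\<^esub> r) = (SUP N\<in>?N. 0)"
      unfolding universal_seminorm_def by (rule SUP_cong[OF refl]) (use that in auto)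
    also have "(SUP N\<in>?N. 0) = (0::real)" by (rule cSUP_const[OF ne])
    finally show ?thesis .
  qed
qed

end


section \<open>The boundary quotient and its generators\<close>

context right_lcm_monoid
begin

abbreviation "Fq \<equiv> free_star_algebra (bq_gens P)"
abbreviation "Uq \<equiv> universal_seminorm Fq (bq_rels P)"
abbreviation "Q \<equiv> boundary_quotient P"
abbreviation "sQ \<equiv> bq_isom P"

definition eQ :: "'p set \<Rightarrow> (nat \<Rightarrow> ('p bq_gen \<times> bool) list \<Rightarrow> complex) set" where
  "eQ Y = completion_emb Fq Uq (free_gen (Proj Y))"

lemma Isom_gen: "p \<in> carrier P \<Longrightarrow> Isom p \<in> bq_gens P" and Proj_gen: "Y \<in> ideals P \<Longrightarrow> Proj Y \<in> bq_gens P"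
  by (simp_all add: bq_gens_def)

lemma gen_closed: "g \<in> bq_gens P \<Longrightarrow> free_gen g \<in> carrier Fq"
  by (simp add: free_gen_word word_elt_closed)

lemma bq_relsI:
  "p \<in> carrier P \<Longrightarrow> (star Fq (free_gen (Isom p)) \<otimes>\<^bsub>Fq\<^esub> free_gen (Isom p), \<one>\<^bsub>Fq\<^esub>) \<in> bq_rels P"
  "Y \<in> ideals P \<Longrightarrow> (free_gen (Proj Y) \<otimes>\<^bsub>Fq\<^esub> free_gen (Proj Y), free_gen (Proj Y)) \<in> bq_rels P"
  "Y \<in> ideals P \<Longrightarrow> (star Fq (free_gen (Proj Y)), free_gen (Proj Y)) \<in> bq_rels P"
  "p \<in> carrier P \<Longrightarrow> q \<in> carrier P \<Longrightarrow>
    (free_gen (Isom p) \<otimes>\<^bsub>Fq\<^esub> free_gen (Isom q), free_gen (Isom (p \<otimes> q))) \<in> bq_rels P"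
  "p \<in> carrier P \<Longrightarrow> Y \<in> ideals P \<Longrightarrow>
    (free_gen (Isom p) \<otimes>\<^bsub>Fq\<^esub> free_gen (Proj Y) \<otimes>\<^bsub>Fq\<^esub> star Fq (free_gen (Isom p)), free_gen (Proj (p <# Y))) \<in> bq_rels P"
  "(free_gen (Proj (carrier P)), \<one>\<^bsub>Fq\<^esub>) \<in> bq_rels P" "(free_gen (Proj {}), \<zero>\<^bsub>Fq\<^esub>) \<in> bq_rels P"
  "Y \<in> ideals P \<Longrightarrow> Z \<in> ideals P \<Longrightarrow>
    (free_gen (Proj Y) \<otimes>\<^bsub>Fq\<^esub> free_gen (Proj Z), free_gen (Proj (Y \<inter> Z))) \<in> bq_rels P"
  unfolding bq_rels_def Let_def by blast+

text \<open>The unit and the projections satisfy (N e)^2 = N e, so their seminorm is 0 or 1; for an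
  isometry (N s)^2 is the seminorm of the unit.\<close>

lemma bq_generators_bounded:
  assumes N: "cstar_seminorm Fq N" and R: "\<forall>(l, r)\<in>bq_rels P. N (l \<ominus>\<^bsub>Fq\<^esub> r) = 0" and g: "g \<in> bq_gens P"
  shows "N (free_gen g) \<le> 1"
proof -
  interpret F: star_algebra Fq by (rule free_star_algebra)
  interpret cstar_seminormed Fq N by unfold_locales (rule N)
  have eq: "N l = N r" if "(l, r) \<in> bq_rels P" "l \<in> carrier Fq" "r \<in> carrier Fq" for l r
    using N_abs_diff[OF that(2,3)] R that(1) by fastforce
  have one: "\<one>\<^bsub>Fq\<^esub> \<in> carrier Fq" by (simp add: free_ops word_elt_closed)
  have "star Fq \<one>\<^bsub>Fq\<^esub> = \<one>\<^bsub>Fq\<^esub>" by (simp only: free_ops(6) star_word_elt) (simp add: word_star_def)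
  then have "(N \<one>\<^bsub>Fq\<^esub>)\<^sup>2 = N \<one>\<^bsub>Fq\<^esub>" using N_cstar[OF one] by (simp add: free_one_mult)
  then have "N \<one>\<^bsub>Fq\<^esub> = 0 \<or> N \<one>\<^bsub>Fq\<^esub> = 1" by (simp add: power2_eq_square)
  then have N1: "N \<one>\<^bsub>Fq\<^esub> \<le> 1" by auto
  have gc: "free_gen g \<in> carrier Fq" by (rule gen_closed[OF g])
  show ?thesis
  proof (cases g)
    case (Isom p)
    then have p: "p \<in> carrier P" using g by (auto simp: bq_gens_def)
    have "(N (free_gen g))\<^sup>2 = N \<one>\<^bsub>Fq\<^esub>"
      using N_cstar[OF gc] eq[OF bq_relsI(1)[OF p]] gc one by (simp add: F.mult_closed F.star_closed Isom)
    then have "(N (free_gen g))\<^sup>2 \<le> 1\<^sup>2" using N1 by simp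
    then show ?thesis by (rule power2_le_imp_le) simp
  next
    case (Proj Y)
    then have Y: "Y \<in> ideals P" using g by (auto simp: bq_gens_def)
    let ?e = "free_gen g"
    have sc: "star Fq ?e \<in> carrier Fq" using gc by (rule F.star_closed)
    have "N (star Fq ?e \<ominus>\<^bsub>Fq\<^esub> ?e) = 0" using R bq_relsI(3)[OF Y] Proj by fastforce
    then have "N (star Fq ?e \<otimes>\<^bsub>Fq\<^esub> ?e \<ominus>\<^bsub>Fq\<^esub> ?e \<otimes>\<^bsub>Fq\<^esub> ?e) \<le> 0"
      using mult_diff_bound[OF sc gc gc gc order_refl order_refl] by (simp add: F.diff_self gc N_zero)
    then have "N (star Fq ?e \<otimes>\<^bsub>Fq\<^esub> ?e) = N (?e \<otimes>\<^bsub>Fq\<^esub> ?e)"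
      using N_abs_diff[OF F.mult_closed[OF sc gc] F.mult_closed[OF gc gc]] by simp
    also have "\<dots> = N ?e" using eq[OF bq_relsI(2)[OF Y]] gc by (simp add: F.mult_closed Proj)
    finally have "N ?e * N ?e = N ?e" using N_cstar[OF gc] by (simp add: power2_eq_square)
    then have "N ?e = 0 \<or> N ?e = 1" by simp
    then show ?thesis by auto
  qed
qed

lemma Uq_seminorm: "cstar_seminorm Fq Uq"
  and Uq_rel: "\<lbrakk>(l, r) \<in> bq_rels P; l \<in> carrier Fq; r \<in> carrier Fq\<rbrakk> \<Longrightarrow> Uq (l \<ominus>\<^bsub>Fq\<^esub> r) = 0"
proof -
  show "cstar_seminorm Fq Uq" by (rule universal_seminorm_cstar(1)) (rule bq_generators_bounded)
  show "Uq (l \<ominus>\<^bsub>Fq\<^esub> r) = 0" if "(l, r) \<in> bq_rels P" "l \<in> carrier Fq" "r \<in> carrier Fq"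
    by (rule universal_seminorm_cstar(2)[OF _ that]) (rule bq_generators_bounded)
qed

lemma Uq_seminormed: "cstar_seminormed Fq Uq"
  by (intro cstar_seminormed.intro free_star_algebra cstar_seminormed_axioms.intro Uq_seminorm)

lemma Q_completion: "Q = completion Fq Uq"
  by (simp add: boundary_quotient_def universal_cstar_def)

lemma Q_cstar: "cstar_algebra Q"
  unfolding Q_completion by (rule cstar_seminormed.completion_cstar_algebra[OF Uq_seminormed])

lemma sQ_emb: "sQ p = completion_emb Fq Uq (free_gen (Isom p))"
  by (simp add: bq_isom_def universal_gen_def)

lemma oneQ_emb: "\<one>\<^bsub>Q\<^esub> = completion_emb Fq Uq \<one>\<^bsub>Fq\<^esub>"
  unfolding Q_completion by (simp add: completion_def)

lemma ideals_closed: "carrier P \<in> ideals P" "{} \<in> ideals P" "p \<in> carrier P \<Longrightarrow> principal P p \<in> ideals P"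
proof -
  have "principal P \<one> = carrier P" by (auto simp: l_coset_def)
  then show "carrier P \<in> ideals P" unfolding ideals_def by (metis UnCI image_eqI one_closed)
qed (auto simp: ideals_def)

lemma translate_ideal: assumes p: "p \<in> carrier P" and Y: "Y \<in> ideals P" shows "p <# Y \<in> ideals P"
proof -
  have "p <# principal P q = principal P (p \<otimes> q)" if "q \<in> carrier P" for q
    using p that by (auto simp: l_coset_def m_assoc)
  moreover have "p <# {} = {}" by (simp add: l_coset_def)
  ultimately show ?thesis using Y p unfolding ideals_def by auto
qed

lemma inter_ideal: assumes "Y \<in> ideals P" "Z \<in> ideals P" shows "Y \<inter> Z \<in> ideals P"
  using assms right_lcm unfolding ideals_def by auto

context
begin
interpretation E: cstar_seminormed Fq Uq by (rule Uq_seminormed)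

lemmas gc = gen_closed[OF Isom_gen] gen_closed[OF Proj_gen]

lemma oneF_closed: "\<one>\<^bsub>Fq\<^esub> \<in> carrier Fq" by (simp add: free_ops word_elt_closed)

lemma emb_rel: "\<lbrakk>(l, r) \<in> bq_rels P; l \<in> carrier Fq; r \<in> carrier Fq\<rbrakk> \<Longrightarrow> completion_emb Fq Uq l = completion_emb Fq Uq r"
  by (simp add: E.emb_eq_iff Uq_rel)

lemma sQ_closed: "p \<in> carrier P \<Longrightarrow> sQ p \<in> carrier Q"
  unfolding sQ_emb Q_completion by (intro E.emb_closed gc)

lemma oneQ_closed: "\<one>\<^bsub>Q\<^esub> \<in> carrier Q"
  unfolding oneQ_emb unfolding Q_completion by (intro E.emb_closed oneF_closed)

lemma sQ_isometry: "p \<in> carrier P \<Longrightarrow> star Q (sQ p) \<otimes>\<^bsub>Q\<^esub> sQ p = \<one>\<^bsub>Q\<^esub>"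
  using emb_rel[OF bq_relsI(1), of p]
  by (simp add: oneQ_emb sQ_emb gc oneF_closed E.mult_closed E.star_closed E.emb_mult E.emb_star)
     (simp add: Q_completion)

lemma sQ_mult: "p \<in> carrier P \<Longrightarrow> q \<in> carrier P \<Longrightarrow> sQ p \<otimes>\<^bsub>Q\<^esub> sQ q = sQ (p \<otimes> q)"
  using emb_rel[OF bq_relsI(4), of p q]
  by (simp add: sQ_emb gc E.mult_closed E.emb_mult) (simp add: Q_completion)

lemma eQ_mult: "Y \<in> ideals P \<Longrightarrow> Z \<in> ideals P \<Longrightarrow> eQ Y \<otimes>\<^bsub>Q\<^esub> eQ Z = eQ (Y \<inter> Z)"
  using emb_rel[OF bq_relsI(8), of Y Z]
  by (simp add: eQ_def gc inter_ideal E.mult_closed E.emb_mult) (simp add: Q_completion)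

lemma eQ_full: "eQ (carrier P) = \<one>\<^bsub>Q\<^esub>"
  using emb_rel[OF bq_relsI(6)] by (simp add: eQ_def gc oneF_closed ideals_closed oneQ_emb)

lemma eQ_empty: "eQ {} = \<zero>\<^bsub>Q\<^esub>"
  using emb_rel[OF bq_relsI(7)] by (simp add: eQ_def gc ideals_closed E.emb_zero) (simp add: Q_completion)

lemma eQ_translate: "p \<in> carrier P \<Longrightarrow> Y \<in> ideals P \<Longrightarrow>
    sQ p \<otimes>\<^bsub>Q\<^esub> eQ Y \<otimes>\<^bsub>Q\<^esub> star Q (sQ p) = eQ (p <# Y)"
  using emb_rel[OF bq_relsI(5), of p Y]
  by (simp add: eQ_def sQ_emb gc E.mult_closed E.star_closed E.emb_mult E.emb_star translate_ideal)
     (simp add: Q_completion)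

lemma oneQ_mult: assumes "x \<in> carrier Q" shows "\<one>\<^bsub>Q\<^esub> \<otimes>\<^bsub>Q\<^esub> x = x" "x \<otimes>\<^bsub>Q\<^esub> \<one>\<^bsub>Q\<^esub> = x"
proof -
  obtain f where f: "f \<in> cauchy_seqs Fq Uq" "x = seq_class Fq Uq f"
    using assms unfolding Q_completion by (rule E.Cpl_cases)
  show "\<one>\<^bsub>Q\<^esub> \<otimes>\<^bsub>Q\<^esub> x = x" "x \<otimes>\<^bsub>Q\<^esub> \<one>\<^bsub>Q\<^esub> = x"
    unfolding oneQ_emb f(2) unfolding Q_completion completion_emb_def
    by (simp_all add: E.class_mult f(1) E.cauchy_const oneF_closed free_one_mult free_mult_one)
qed

lemma eQ_principal: assumes p: "p \<in> carrier P" shows "eQ (principal P p) = sQ p \<otimes>\<^bsub>Q\<^esub> star Q (sQ p)"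
  using eQ_translate[OF p ideals_closed(1)] by (simp add: eQ_full oneQ_mult sQ_closed p)

text \<open>A set closed under the operations that contains the generators contains the image of the
  free *-algebra, by induction over words and linear combinations; and that image is dense in the
  completion.\<close>

lemma Q_dense:
  assumes D: "\<And>x y. \<lbrakk>x \<in> D; y \<in> D\<rbrakk> \<Longrightarrow> x \<oplus>\<^bsub>Q\<^esub> y \<in> D" "\<And>x y. \<lbrakk>x \<in> D; y \<in> D\<rbrakk> \<Longrightarrow> x \<otimes>\<^bsub>Q\<^esub> y \<in> D"
      "\<And>x c. x \<in> D \<Longrightarrow> scale Q c x \<in> D" "\<And>x. x \<in> D \<Longrightarrow> star Q x \<in> D"
    and gen: "\<And>p. p \<in> carrier P \<Longrightarrow> sQ p \<in> D" "\<And>Y. Y \<in> ideals P \<Longrightarrow> eQ Y \<in> D" "\<one>\<^bsub>Q\<^esub> \<in> D" "\<zero>\<^bsub>Q\<^esub> \<in> D"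
    and x: "x \<in> carrier Q" and e: "\<epsilon> > 0"
  shows "\<exists>y\<in>D. y \<in> carrier Q \<and> cnorm Q (x \<ominus>\<^bsub>Q\<^esub> y) < \<epsilon>"
proof -
  let ?emb = "completion_emb Fq Uq"
  have letter: "?emb (word_elt [(g, b)]) \<in> D" if g: "g \<in> bq_gens P" for g b
  proof -
    have 1: "?emb (free_gen g) \<in> D"
      using g gen unfolding bq_gens_def sQ_emb eQ_def by auto
    have "?emb (star Fq (free_gen g)) \<in> D"
      using D(4)[OF 1] by (simp add: E.emb_star gen_closed g Q_completion)
    then show ?thesis using 1 by (cases b) (simp_all add: free_gen_word star_word_elt word_star_def)
  qed
  have word: "?emb (word_elt w) \<in> D" if "w \<in> lists (bq_gens P \<times> (UNIV :: bool set))" for w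
    using that
  proof (induction w)
    case Nil show ?case using gen(3) by (simp add: oneQ_emb free_ops)
  next
    case (Cons a w)
    have c: "word_elt [a] \<in> carrier Fq" "word_elt w \<in> carrier Fq" using Cons.hyps by (simp_all add: word_elt_closed)
    have "?emb (word_elt [a]) \<in> D" using letter[of "fst a" "snd a"] Cons.hyps by (simp add: mem_Times_iff)
    then have "?emb (word_elt [a]) \<otimes>\<^bsub>Q\<^esub> ?emb (word_elt w) \<in> D" using Cons D(2) by simp
    then show ?case using c word_elt_append[where X = "bq_gens P" and u = "[a]" and v = w] by (simp add: E.emb_mult Q_completion)
  qed
  have all: "?emb f \<in> D" if "f \<in> carrier Fq" for f
    using that
  proof (rule free_induct)
    show "?emb \<zero>\<^bsub>Fq\<^esub> \<in> D" using gen(4) by (simp add: E.emb_zero Q_completion)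
  next
    fix c w assume "w \<in> lists (bq_gens P \<times> (UNIV :: bool set))"
    then show "?emb (scale Fq c (word_elt w)) \<in> D"
      using D(3)[OF word] by (simp add: E.emb_scale word_elt_closed Q_completion)
  next
    fix f g assume "f \<in> carrier Fq" "g \<in> carrier Fq" "?emb f \<in> D" "?emb g \<in> D"
    then show "?emb (f \<oplus>\<^bsub>Fq\<^esub> g) \<in> D" using D(1)[of "?emb f" "?emb g"] by (simp add: E.emb_add Q_completion)
  qed
  obtain f where "f \<in> carrier Fq" "cnorm Q (x \<ominus>\<^bsub>Q\<^esub> ?emb f) < \<epsilon>"
    using E.emb_dense[of x \<epsilon>] x e unfolding Q_completion by blast
  then show ?thesis using all[of f] E.emb_closed[of f] unfolding Q_completion by blast
qed

end
end


section \<open>Inverse monoids and the tight spectrum\<close>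

text \<open>Regularity with commuting idempotents is the standard description of an inverse
  semigroup. The unit \<open>u\<close> is a parameter because the record has no field for it; it
  lies in every filter, and its germs serve as the unit arrows.\<close>

locale inverse_monoid =
  fixes S :: "('a, 'm) inv_semigroup_scheme" (structure) and u :: 'a
  assumes sm_closed: "\<lbrakk>s \<in> carrier S; t \<in> carrier S\<rbrakk> \<Longrightarrow> s \<cdot> t \<in> carrier S"
    and sm_assoc: "\<lbrakk>s \<in> carrier S; t \<in> carrier S; r \<in> carrier S\<rbrakk> \<Longrightarrow> (s \<cdot> t) \<cdot> r = s \<cdot> (t \<cdot> r)"
    and inv_closed: "s \<in> carrier S \<Longrightarrow> sinv S s \<in> carrier S"
    and inv_inv: "s \<in> carrier S \<Longrightarrow> sinv S (sinv S s) = s"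
    and inv_mult: "\<lbrakk>s \<in> carrier S; t \<in> carrier S\<rbrakk> \<Longrightarrow> sinv S (s \<cdot> t) = sinv S t \<cdot> sinv S s"
    and regular: "s \<in> carrier S \<Longrightarrow> s \<cdot> (sinv S s \<cdot> s) = s"
    and idem_commute: "\<lbrakk>e \<in> idempotents S; f \<in> idempotents S\<rbrakk> \<Longrightarrow> e \<cdot> f = f \<cdot> e"
    and zero_closed: "szero S \<in> carrier S"
    and zero_left: "s \<in> carrier S \<Longrightarrow> szero S \<cdot> s = szero S" and zero_right: "s \<in> carrier S \<Longrightarrow> s \<cdot> szero S = szero S"
    and unit_closed: "u \<in> carrier S"
    and unit_left: "s \<in> carrier S \<Longrightarrow> u \<cdot> s = s" and unit_right: "s \<in> carrier S \<Longrightarrow> s \<cdot> u = s"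
    and unit_nonzero: "u \<noteq> szero S"
begin

abbreviation "E \<equiv> idempotents S"
abbreviation sstar ("_\<dagger>" [1000] 999) where "s\<dagger> \<equiv> sinv S s"

lemma E_carrier: "e \<in> E \<Longrightarrow> e \<in> carrier S" and E_idem: "e \<in> E \<Longrightarrow> e \<cdot> e = e"
  by (simp_all add: idempotents_def)

lemma E_I: "e \<in> carrier S \<Longrightarrow> e \<cdot> e = e \<Longrightarrow> e \<in> E"
  by (simp add: idempotents_def)

lemma unit_E: "u \<in> E" and zero_E: "szero S \<in> E"
  by (simp_all add: E_I unit_closed zero_closed unit_left zero_left)

lemma E_mult: assumes "e \<in> E" "f \<in> E" shows "e \<cdot> f \<in> E"
proof (rule E_I)
  note c = E_carrier[OF assms(1)] E_carrier[OF assms(2)]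
  have "(e \<cdot> f) \<cdot> (e \<cdot> f) = e \<cdot> ((f \<cdot> e) \<cdot> f)" using c by (simp add: sm_assoc sm_closed)
  also have "\<dots> = e \<cdot> ((e \<cdot> f) \<cdot> f)" by (simp only: idem_commute[OF assms])
  also have "\<dots> = (e \<cdot> e) \<cdot> (f \<cdot> f)" using c by (simp add: sm_assoc sm_closed)
  finally show "(e \<cdot> f) \<cdot> (e \<cdot> f) = e \<cdot> f" using assms by (simp add: E_idem)
qed (simp add: sm_closed E_carrier assms)

lemma E_left_commute: assumes "e \<in> E" "f \<in> E" "s \<in> carrier S" shows "e \<cdot> (f \<cdot> s) = f \<cdot> (e \<cdot> s)"
  using assms idem_commute[OF assms(1,2)] by (simp add: E_carrier flip: sm_assoc)

lemma inv_E: assumes e: "e \<in> E" shows "e\<dagger> = e"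
proof -
  have c: "e \<in> carrier S" "e\<dagger> \<in> carrier S" using e by (simp_all add: E_carrier inv_closed)
  have i: "e\<dagger> \<in> E" using inv_mult[OF c(1) c(1)] c e by (intro E_I) (simp_all add: E_idem)
  have "e = e \<cdot> (e\<dagger> \<cdot> e)" using c by (simp add: regular)
  also have "\<dots> = e\<dagger> \<cdot> e" using E_left_commute[OF e i c(1)] e by (simp add: E_idem)
  finally have 1: "e = e\<dagger> \<cdot> e" .
  have "e\<dagger> = e\<dagger> \<cdot> (e \<cdot> e\<dagger>)" using c regular[OF c(2)] by (simp add: inv_inv)
  also have "\<dots> = e \<cdot> e\<dagger>" using E_left_commute[OF i e c(2)] i by (simp add: E_idem)
  also have "\<dots> = e\<dagger> \<cdot> e" by (rule idem_commute[OF e i])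
  finally show ?thesis using 1 by simp
qed

lemma dom_E: assumes s: "s \<in> carrier S" shows "s\<dagger> \<cdot> s \<in> E"
proof (rule E_I)
  have "(s\<dagger> \<cdot> s) \<cdot> (s\<dagger> \<cdot> s) = s\<dagger> \<cdot> (s \<cdot> (s\<dagger> \<cdot> s))" using s by (simp add: sm_assoc sm_closed inv_closed)
  then show "(s\<dagger> \<cdot> s) \<cdot> (s\<dagger> \<cdot> s) = s\<dagger> \<cdot> s" using s by (simp add: regular)
qed (simp add: sm_closed inv_closed s)

lemma ran_E: "s \<in> carrier S \<Longrightarrow> s \<cdot> s\<dagger> \<in> E"
  using dom_E[of "s\<dagger>"] by (simp add: inv_closed inv_inv)

lemma regular_star: "s \<in> carrier S \<Longrightarrow> s\<dagger> \<cdot> (s \<cdot> s\<dagger>) = s\<dagger>"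
  using regular[of "s\<dagger>"] by (simp add: inv_closed inv_inv)

lemma conj_E: assumes s: "s \<in> carrier S" and e: "e \<in> E" shows "s \<cdot> (e \<cdot> s\<dagger>) \<in> E"
proof (rule E_I)
  have c: "e \<in> carrier S" "s\<dagger> \<in> carrier S" using s e by (simp_all add: E_carrier inv_closed)
  have "(s \<cdot> (e \<cdot> s\<dagger>)) \<cdot> (s \<cdot> (e \<cdot> s\<dagger>)) = s \<cdot> (e \<cdot> ((s\<dagger> \<cdot> s) \<cdot> (e \<cdot> s\<dagger>)))"
    using s c by (simp add: sm_assoc sm_closed)
  also have "e \<cdot> ((s\<dagger> \<cdot> s) \<cdot> (e \<cdot> s\<dagger>)) = (s\<dagger> \<cdot> s) \<cdot> (e \<cdot> (e \<cdot> s\<dagger>))"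
    using s c by (intro E_left_commute e dom_E s) (simp add: sm_closed)
  also have "e \<cdot> (e \<cdot> s\<dagger>) = e \<cdot> s\<dagger>" using c e by (simp add: E_idem flip: sm_assoc)
  also have "s \<cdot> ((s\<dagger> \<cdot> s) \<cdot> (e \<cdot> s\<dagger>)) = (s \<cdot> (s\<dagger> \<cdot> s)) \<cdot> (e \<cdot> s\<dagger>)" using s c by (simp add: sm_assoc sm_closed)
  finally show "(s \<cdot> (e \<cdot> s\<dagger>)) \<cdot> (s \<cdot> (e \<cdot> s\<dagger>)) = s \<cdot> (e \<cdot> s\<dagger>)" using s by (simp add: regular)
qed (simp add: sm_closed inv_closed s E_carrier e)

lemma conj_E': "s \<in> carrier S \<Longrightarrow> e \<in> E \<Longrightarrow> s\<dagger> \<cdot> (e \<cdot> s) \<in> E"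
  using conj_E[of "s\<dagger>" e] by (simp add: inv_closed inv_inv)

text \<open>An idempotent passes through \<open>s\<close> at the price of a conjugation. This moves
  all idempotents to the right, where equality of germs is tested.\<close>

lemma idem_swap: assumes s: "s \<in> carrier S" and e: "e \<in> E" shows "e \<cdot> s = s \<cdot> (s\<dagger> \<cdot> (e \<cdot> s))"
proof -
  have "s \<cdot> (s\<dagger> \<cdot> (e \<cdot> s)) = (s \<cdot> s\<dagger>) \<cdot> (e \<cdot> s)" using s e by (simp add: sm_assoc sm_closed inv_closed E_carrier)
  also have "\<dots> = e \<cdot> ((s \<cdot> s\<dagger>) \<cdot> s)" by (rule E_left_commute[OF ran_E[OF s] e s])
  also have "(s \<cdot> s\<dagger>) \<cdot> s = s" using s by (simp add: sm_assoc inv_closed regular)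
  finally show ?thesis by simp
qed

text \<open>Multiplying e = t g by its own adjoint gives e = t* t g, so the unknown idempotent g can
  be traded for e and the order becomes an equation.\<close>

lemma sle_E_iff: assumes e: "e \<in> E" and t: "t \<in> carrier S" shows "sle S e t \<longleftrightarrow> t \<cdot> e = e"
proof
  assume "sle S e t"
  then obtain g where g: "g \<in> E" "e = t \<cdot> g" by (auto simp: sle_def)
  have c: "t\<dagger> \<in> carrier S" "g \<in> carrier S" using g t by (simp_all add: inv_closed E_carrier)
  have "e = e\<dagger> \<cdot> e" using e by (simp add: inv_E E_idem)
  also have "\<dots> = g \<cdot> ((t\<dagger> \<cdot> t) \<cdot> g)" using c t g by (simp add: inv_mult inv_E sm_assoc sm_closed)
  also have "\<dots> = (t\<dagger> \<cdot> t) \<cdot> g" using c g by (simp add: E_left_commute[OF g(1) dom_E[OF t] c(2)] E_idem)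
  finally have "t \<cdot> e = (t \<cdot> (t\<dagger> \<cdot> t)) \<cdot> g" using c t by (simp add: sm_assoc sm_closed)
  then show "t \<cdot> e = e" using t g by (simp add: regular)
next
  assume "t \<cdot> e = e" then show "sle S e t" using e unfolding sle_def by metis
qed

lemma sle_E: "\<lbrakk>e \<in> E; f \<in> E\<rbrakk> \<Longrightarrow> sle S e f \<longleftrightarrow> f \<cdot> e = e"
  by (simp add: sle_E_iff E_carrier)

text \<open>Zero lies below every idempotent, so properness amounts to omitting zero; the unit lies
  above all, so being nonempty amounts to containing it.\<close>

lemma filter_iff: "\<xi> \<in> sfilters S \<longleftrightarrow> \<xi> \<subseteq> E \<and> u \<in> \<xi> \<and> szero S \<notin> \<xi> \<and>
   (\<forall>e\<in>\<xi>. \<forall>f\<in>E. f \<cdot> e = e \<longrightarrow> f \<in> \<xi>) \<and> (\<forall>e\<in>\<xi>. \<forall>f\<in>\<xi>. e \<cdot> f \<in> \<xi>)"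
proof
  assume "\<xi> \<in> sfilters S"
  then have ne: "\<xi> \<noteq> {}" and sub: "\<xi> \<subseteq> E" "\<xi> \<noteq> E" and up: "\<forall>e\<in>\<xi>. \<forall>f\<in>E. sle S e f \<longrightarrow> f \<in> \<xi>"
    and m: "\<forall>e\<in>\<xi>. \<forall>f\<in>\<xi>. e \<cdot> f \<in> \<xi>" unfolding sfilters_def by auto
  have up': "f \<in> \<xi>" if "e \<in> \<xi>" "f \<in> E" "f \<cdot> e = e" for e f using up that sub(1) sle_E by blast
  obtain e where e: "e \<in> \<xi>" using ne by blast
  have "u \<in> \<xi>" by (rule up'[OF e unit_E]) (use e sub(1) in \<open>auto simp: unit_left E_carrier\<close>)
  moreover have "szero S \<notin> \<xi>"
  proof
    assume "szero S \<in> \<xi>"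
    then have "E \<subseteq> \<xi>" using up' by (auto simp: zero_right E_carrier)
    then show False using sub by blast
  qed
  ultimately show "\<xi> \<subseteq> E \<and> u \<in> \<xi> \<and> szero S \<notin> \<xi> \<and>
   (\<forall>e\<in>\<xi>. \<forall>f\<in>E. f \<cdot> e = e \<longrightarrow> f \<in> \<xi>) \<and> (\<forall>e\<in>\<xi>. \<forall>f\<in>\<xi>. e \<cdot> f \<in> \<xi>)"
    using sub(1) up' m by simp
next
  assume a: "\<xi> \<subseteq> E \<and> u \<in> \<xi> \<and> szero S \<notin> \<xi> \<and>
   (\<forall>e\<in>\<xi>. \<forall>f\<in>E. f \<cdot> e = e \<longrightarrow> f \<in> \<xi>) \<and> (\<forall>e\<in>\<xi>. \<forall>f\<in>\<xi>. e \<cdot> f \<in> \<xi>)"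
  have "\<forall>e\<in>\<xi>. \<forall>f\<in>E. sle S e f \<longrightarrow> f \<in> \<xi>" using a sle_E by blast
  then show "\<xi> \<in> sfilters S" using a zero_E unfolding sfilters_def by blast
qed

lemma filter_sub: "\<xi> \<in> sfilters S \<Longrightarrow> e \<in> \<xi> \<Longrightarrow> e \<in> E"
  and filter_unit: "\<xi> \<in> sfilters S \<Longrightarrow> u \<in> \<xi>"
  and filter_zero: "\<xi> \<in> sfilters S \<Longrightarrow> szero S \<notin> \<xi>"
  and filter_up: "\<lbrakk>\<xi> \<in> sfilters S; e \<in> \<xi>; f \<in> E; f \<cdot> e = e\<rbrakk> \<Longrightarrow> f \<in> \<xi>"
  and filter_mult: "\<lbrakk>\<xi> \<in> sfilters S; e \<in> \<xi>; f \<in> \<xi>\<rbrakk> \<Longrightarrow> e \<cdot> f \<in> \<xi>"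
  by (auto simp: filter_iff)

lemma filter_mult_iff: assumes "\<xi> \<in> sfilters S" "e \<in> E" "f \<in> E" shows "e \<cdot> f \<in> \<xi> \<longleftrightarrow> e \<in> \<xi> \<and> f \<in> \<xi>"
proof
  assume a: "e \<cdot> f \<in> \<xi>"
  have c: "e \<in> carrier S" "f \<in> carrier S" using assms by (simp_all add: E_carrier)
  have "e \<cdot> (e \<cdot> f) = e \<cdot> f" using c assms by (simp add: E_idem flip: sm_assoc)
  moreover have "f \<cdot> (e \<cdot> f) = e \<cdot> f" using c assms E_left_commute[of f e f] by (simp add: E_idem)
  ultimately show "e \<in> \<xi> \<and> f \<in> \<xi>" using filter_up[OF assms(1) a] assms by blast
qed (use assms filter_mult in blast)

lemma ultra_filter: "\<zeta> \<in> sultrafilters S \<Longrightarrow> \<zeta> \<in> sfilters S"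
  by (simp add: sultrafilters_def)

text \<open>Were all products f h nonzero, the idempotents above some f h with h in \<zeta> would
  form a filter containing both \<zeta> and \<open>f\<close>, against maximality.\<close>

lemma ultra_disjoint:
  assumes z: "\<zeta> \<in> sultrafilters S" and f: "f \<in> E" "f \<notin> \<zeta>"
  shows "\<exists>h\<in>\<zeta>. f \<cdot> h = szero S"
proof (rule ccontr)
  assume no: "\<not> (\<exists>h\<in>\<zeta>. f \<cdot> h = szero S)"
  have zf: "\<zeta> \<in> sfilters S" by (rule ultra_filter[OF z])
  have fc: "f \<in> carrier S" using f by (simp add: E_carrier)
  define \<eta> where "\<eta> = {g \<in> E. \<exists>h\<in>\<zeta>. g \<cdot> (f \<cdot> h) = f \<cdot> h}"
  have hE: "h \<in> E" "h \<in> carrier S" if "h \<in> \<zeta>" for h using filter_sub[OF zf that] by (simp_all add: E_carrier)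
  have "\<eta> \<in> sfilters S"
    unfolding filter_iff
  proof (intro conjI ballI impI)
    show "\<eta> \<subseteq> E" by (auto simp: \<eta>_def)
    show "u \<in> \<eta>" unfolding \<eta>_def using filter_unit[OF zf] unit_E fc by (auto simp: unit_left unit_right intro!: bexI[of _ u])
    show "szero S \<notin> \<eta>" unfolding \<eta>_def using no hE(2) fc by (auto simp: zero_left sm_closed) 
    fix g assume g: "g \<in> \<eta>"
    then obtain h where h: "g \<in> E" "h \<in> \<zeta>" "g \<cdot> (f \<cdot> h) = f \<cdot> h" by (auto simp: \<eta>_def)
    show "k \<in> \<eta>" if k: "k \<in> E" "k \<cdot> g = g" for k
    proof -
      have "k \<cdot> (f \<cdot> h) = k \<cdot> (g \<cdot> (f \<cdot> h))" by (simp add: h(3))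
      also have "\<dots> = (k \<cdot> g) \<cdot> (f \<cdot> h)"
        using h(1,2) k(1) fc hE(2) by (intro sm_assoc[symmetric]) (simp_all add: sm_closed E_carrier)
      also have "\<dots> = f \<cdot> h" using k h by simp
      finally have "k \<cdot> (f \<cdot> h) = f \<cdot> h" .
      then show ?thesis using k h unfolding \<eta>_def by blast
    qed
    show "g \<cdot> k \<in> \<eta>" if k: "k \<in> \<eta>" for k
    proof -
      obtain j where j: "k \<in> E" "j \<in> \<zeta>" "k \<cdot> (f \<cdot> j) = f \<cdot> j" using k by (auto simp: \<eta>_def)
      have c: "g \<in> carrier S" "k \<in> carrier S" "h \<in> carrier S" "j \<in> carrier S" using h j hE by (simp_all add: E_carrier)
      have "(g \<cdot> k) \<cdot> (f \<cdot> (h \<cdot> j)) = g \<cdot> (h \<cdot> (k \<cdot> (f \<cdot> j)))"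
        using c fc h j hE f by (simp add: sm_assoc sm_closed E_left_commute[of f h] E_left_commute[of k h])
      also have "\<dots> = (g \<cdot> (f \<cdot> h)) \<cdot> j"
        unfolding j(3) using c fc hE(1)[OF h(2)] f(1) by (simp add: sm_assoc sm_closed E_left_commute[of f h])
      also have "\<dots> = f \<cdot> (h \<cdot> j)" unfolding h(3) using c fc by (simp add: sm_assoc sm_closed)
      finally show ?thesis using h j E_mult filter_mult[OF zf h(2) j(2)] unfolding \<eta>_def by blast
    qed
  qed
  moreover have "\<zeta> \<subseteq> \<eta>"
  proof
    fix h assume h: "h \<in> \<zeta>"
    have "h \<cdot> (f \<cdot> h) = f \<cdot> h" using h hE fc E_left_commute[of h f h] f by (simp add: E_idem)
    then show "h \<in> \<eta>" using h hE unfolding \<eta>_def by blast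
  qed
  ultimately have "\<zeta> = \<eta>" using z unfolding sultrafilters_def by blast
  moreover have "f \<in> \<eta>"
    unfolding \<eta>_def using filter_unit[OF zf] f fc by (auto simp: unit_right E_idem intro!: bexI[of _ u])
  ultimately show False using f by blast
qed

text \<open>Zorn's lemma, started at the filter consisting of the unit alone.\<close>

lemma ultrafilter_exists: "\<exists>\<zeta>. \<zeta> \<in> sultrafilters S"
proof -
  have "{u} \<in> sfilters S"
    unfolding filter_iff using unit_E unit_nonzero by (auto simp: E_idem unit_left unit_right E_carrier)
  have "\<exists>M\<in>sfilters S. \<forall>X\<in>sfilters S. M \<subseteq> X \<longrightarrow> X = M"
  proof (rule subset_Zorn_nonempty)
    show "sfilters S \<noteq> {}" using \<open>{u} \<in> sfilters S\<close> by blast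
    fix C assume C: "C \<noteq> {}" "subset.chain (sfilters S) C"
    have CF: "\<xi> \<in> sfilters S" if "\<xi> \<in> C" for \<xi> using that C(2) by (auto simp: subset.chain_def)
    show "\<Union>C \<in> sfilters S"
      unfolding filter_iff
    proof (intro conjI ballI impI)
      show "\<Union>C \<subseteq> E" using CF filter_sub by blast
      show "u \<in> \<Union>C" using C(1) CF filter_unit by blast
      show "szero S \<notin> \<Union>C" using CF filter_zero by blast
      show "f \<in> \<Union>C" if "e \<in> \<Union>C" "f \<in> E" "f \<cdot> e = e" for e f using that CF filter_up by blast
      show "e \<cdot> f \<in> \<Union>C" if ef: "e \<in> \<Union>C" "f \<in> \<Union>C" for e f
      proof -
        obtain \<xi> \<eta> where x: "\<xi> \<in> C" "e \<in> \<xi>" "\<eta> \<in> C" "f \<in> \<eta>" using ef by blast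
        have "\<xi> \<subseteq> \<eta> \<or> \<eta> \<subseteq> \<xi>" using C(2) x unfolding subset.chain_def by blast
        then show ?thesis using x CF filter_mult by blast
      qed
    qed
  qed
  then show ?thesis unfolding sultrafilters_def by blast
qed

text \<open>For filters containing the domain idempotent, \<open>tight_act\<close> becomes a preimage, which makes
  the filter axioms and the composition law formal.\<close>

lemma act_iff:
  assumes s: "s \<in> carrier S" and x: "\<xi> \<in> sfilters S" "s\<dagger> \<cdot> s \<in> \<xi>"
  shows "f \<in> tight_act S s \<xi> \<longleftrightarrow> f \<in> E \<and> s\<dagger> \<cdot> (f \<cdot> s) \<in> \<xi>"
proof
  have sc: "s\<dagger> \<in> carrier S" using s by (rule inv_closed)
  assume "f \<in> tight_act S s \<xi>"
  then obtain e where f: "f \<in> E" and e: "e \<in> \<xi>" and le: "sle S (s \<cdot> e \<cdot> s\<dagger>) f" by (auto simp: tight_act_def)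
  have eE: "e \<in> E" and ec: "e \<in> carrier S" and fc: "f \<in> carrier S" using filter_sub[OF x(1) e] f by (simp_all add: E_carrier)
  have "s \<cdot> e \<cdot> s\<dagger> = s \<cdot> (e \<cdot> s\<dagger>)" using s sc ec by (simp add: sm_assoc)
  then have eq: "f \<cdot> (s \<cdot> (e \<cdot> s\<dagger>)) = s \<cdot> (e \<cdot> s\<dagger>)" using le f conj_E[OF s eE] by (simp add: sle_E)
  have "(s\<dagger> \<cdot> (f \<cdot> s)) \<cdot> (e \<cdot> (s\<dagger> \<cdot> s)) = s\<dagger> \<cdot> ((f \<cdot> (s \<cdot> (e \<cdot> s\<dagger>))) \<cdot> s)"
    using s sc ec fc by (simp add: sm_assoc sm_closed)
  also have "\<dots> = (s\<dagger> \<cdot> s) \<cdot> (e \<cdot> (s\<dagger> \<cdot> s))" unfolding eq using s sc ec by (simp add: sm_assoc sm_closed)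
  also have "\<dots> = e \<cdot> (s\<dagger> \<cdot> s)"
    using E_left_commute[OF dom_E[OF s] eE, of "s\<dagger> \<cdot> s"] E_idem[OF dom_E[OF s]] s sc by (simp add: sm_closed)
  finally have "s\<dagger> \<cdot> (f \<cdot> s) \<in> \<xi>"
    using filter_up[OF x(1) filter_mult[OF x(1) e x(2)] conj_E'[OF s f]] by simp
  then show "f \<in> E \<and> s\<dagger> \<cdot> (f \<cdot> s) \<in> \<xi>" using f by simp
next
  have sc: "s\<dagger> \<in> carrier S" using s by (rule inv_closed)
  assume a: "f \<in> E \<and> s\<dagger> \<cdot> (f \<cdot> s) \<in> \<xi>"
  then have fE: "f \<in> E" and fc: "f \<in> carrier S" by (simp_all add: E_carrier)
  have "s \<cdot> (s\<dagger> \<cdot> (f \<cdot> s)) \<cdot> s\<dagger> = (s \<cdot> s\<dagger>) \<cdot> (f \<cdot> (s \<cdot> s\<dagger>))" using s sc fc by (simp add: sm_assoc sm_closed)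
  also have "\<dots> = f \<cdot> (s \<cdot> s\<dagger>)"
    using E_left_commute[OF ran_E[OF s] fE, of "s \<cdot> s\<dagger>"] E_idem[OF ran_E[OF s]] s sc by (simp add: sm_closed)
  finally have eq: "s \<cdot> (s\<dagger> \<cdot> (f \<cdot> s)) \<cdot> s\<dagger> = f \<cdot> (s \<cdot> s\<dagger>)" .
  have "sle S (f \<cdot> (s \<cdot> s\<dagger>)) f" unfolding sle_def using ran_E[OF s] by blast
  then show "f \<in> tight_act S s \<xi>" unfolding tight_act_def using a eq by (intro CollectI conjI bexI[of _ "s\<dagger> \<cdot> (f \<cdot> s)"]) simp_all
qed

lemma act_filter:
  assumes s: "s \<in> carrier S" and x: "\<xi> \<in> sfilters S" "s\<dagger> \<cdot> s \<in> \<xi>"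
  shows "tight_act S s \<xi> \<in> sfilters S" "s \<cdot> s\<dagger> \<in> tight_act S s \<xi>"
proof -
  note i = act_iff[OF s x]
  have sc: "s\<dagger> \<in> carrier S" using s by (rule inv_closed)
  show "tight_act S s \<xi> \<in> sfilters S"
    unfolding filter_iff
  proof (intro conjI ballI impI)
    show "tight_act S s \<xi> \<subseteq> E" using i by blast
    show "u \<in> tight_act S s \<xi>" using i x s by (simp add: unit_E unit_left)
    show "szero S \<notin> tight_act S s \<xi>" using i x s sc filter_zero by (simp add: zero_left zero_right)
    fix e assume e: "e \<in> tight_act S s \<xi>"
    then have eE: "e \<in> E" and ec: "e \<in> carrier S" and ex: "s\<dagger> \<cdot> (e \<cdot> s) \<in> \<xi>" using i E_carrier by auto
    have prod: "(s\<dagger> \<cdot> (f \<cdot> s)) \<cdot> (s\<dagger> \<cdot> (e \<cdot> s)) = s\<dagger> \<cdot> ((f \<cdot> e) \<cdot> s)" if f: "f \<in> E" for f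
      using idem_swap[OF s eE] s sc ec f by (simp add: sm_assoc sm_closed E_carrier)
    show "f \<in> tight_act S s \<xi>" if f: "f \<in> E" "f \<cdot> e = e" for f
      using filter_up[OF x(1) ex conj_E'[OF s f(1)]] prod[OF f(1)] f i by simp
    show "e \<cdot> f \<in> tight_act S s \<xi>" if f: "f \<in> tight_act S s \<xi>" for f
    proof -
      have fE: "f \<in> E" and fx: "s\<dagger> \<cdot> (f \<cdot> s) \<in> \<xi>" using f i by auto
      show ?thesis using filter_mult[OF x(1) fx ex] prod[OF fE] idem_commute[OF eE fE] E_mult[OF eE fE] i by simp
    qed
  qed
  show "s \<cdot> s\<dagger> \<in> tight_act S s \<xi>" using i s sc x ran_E[OF s] by (simp add: sm_assoc regular)
qed

text \<open>Conjugating \<open>f\<close> forth and back gives s* s f s* s, which belongs to \<xi>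
  exactly when \<open>f\<close> does, because s* s is in \<xi>.\<close>

lemma act_inv:
  assumes s: "s \<in> carrier S" and x: "\<xi> \<in> sfilters S" "s\<dagger> \<cdot> s \<in> \<xi>"
  shows "tight_act S (s\<dagger>) (tight_act S s \<xi>) = \<xi>"
proof (rule Set.set_eqI)
  fix f
  have sc: "s\<dagger> \<in> carrier S" using s by (rule inv_closed)
  have a: "f \<in> tight_act S (s\<dagger>) (tight_act S s \<xi>) \<longleftrightarrow> f \<in> E \<and> s \<cdot> (f \<cdot> s\<dagger>) \<in> tight_act S s \<xi>"
    using act_iff[OF sc act_filter(1)[OF s x]] act_filter(2)[OF s x] s by (simp add: inv_inv)
  have "s\<dagger> \<cdot> (s \<cdot> (f \<cdot> s\<dagger>) \<cdot> s) = (s\<dagger> \<cdot> s) \<cdot> (f \<cdot> (s\<dagger> \<cdot> s))" if "f \<in> E"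
    using s sc that by (simp add: sm_assoc sm_closed E_carrier)
  then show "f \<in> tight_act S (s\<dagger>) (tight_act S s \<xi>) \<longleftrightarrow> f \<in> \<xi>"
    using a act_iff[OF s x, of "s \<cdot> (f \<cdot> s\<dagger>)"] conj_E[OF s, of f] filter_mult_iff[OF x(1)] E_mult dom_E[OF s] x(2)
      filter_sub[OF x(1), of f] by auto
qed

lemma act_comp:
  assumes s: "s \<in> carrier S" and t: "t \<in> carrier S" and x: "\<xi> \<in> sfilters S" "t\<dagger> \<cdot> t \<in> \<xi>" "s\<dagger> \<cdot> s \<in> tight_act S t \<xi>"
  shows "(s \<cdot> t)\<dagger> \<cdot> (s \<cdot> t) \<in> \<xi>" "tight_act S s (tight_act S t \<xi>) = tight_act S (s \<cdot> t) \<xi>"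
proof -
  have c: "s\<dagger> \<in> carrier S" "t\<dagger> \<in> carrier S" using s t by (simp_all add: inv_closed)
  have e: "(s \<cdot> t)\<dagger> \<cdot> (f \<cdot> (s \<cdot> t)) = t\<dagger> \<cdot> ((s\<dagger> \<cdot> (f \<cdot> s)) \<cdot> t)" if "f \<in> carrier S" for f
    using s t c that by (simp add: inv_mult sm_assoc sm_closed)
  have "(s \<cdot> t)\<dagger> \<cdot> (s \<cdot> t) = t\<dagger> \<cdot> ((s\<dagger> \<cdot> s) \<cdot> t)" using s t c by (simp add: inv_mult sm_assoc sm_closed)
  then show 1: "(s \<cdot> t)\<dagger> \<cdot> (s \<cdot> t) \<in> \<xi>" using x(3) act_iff[OF t x(1,2)] by simp
  show "tight_act S s (tight_act S t \<xi>) = tight_act S (s \<cdot> t) \<xi>"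
    using act_iff[OF s act_filter(1)[OF t x(1,2)] x(3)] act_iff[OF t x(1,2)] act_iff[OF sm_closed[OF s t] x(1) 1]
      conj_E'[OF s] e E_carrier by (auto simp: set_eq_iff)
qed

text \<open>A filter larger than the translate, moved back by the adjoint of \<open>s\<close>, would
  contain \<zeta> and so equal it; moving forward again gives equality.\<close>

lemma act_ultra:
  assumes s: "s \<in> carrier S" and z: "\<zeta> \<in> sultrafilters S" "s\<dagger> \<cdot> s \<in> \<zeta>"
  shows "tight_act S s \<zeta> \<in> sultrafilters S"
proof -
  have zf: "\<zeta> \<in> sfilters S" by (rule ultra_filter[OF z(1)])
  note a = act_filter[OF s zf z(2)]
  have sc: "s\<dagger> \<in> carrier S" using s by (rule inv_closed)
  have "tight_act S s \<zeta> = \<eta>" if h: "\<eta> \<in> sfilters S" "tight_act S s \<zeta> \<subseteq> \<eta>" for \<eta>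
  proof -
    have d: "(s\<dagger>)\<dagger> \<cdot> s\<dagger> \<in> \<eta>" using a(2) h(2) s by (auto simp: inv_inv)
    have "tight_act S (s\<dagger>) (tight_act S s \<zeta>) \<subseteq> tight_act S (s\<dagger>) \<eta>"
      using h(2) unfolding tight_act_def by blast
    then have "\<zeta> \<subseteq> tight_act S (s\<dagger>) \<eta>" by (simp add: act_inv[OF s zf z(2)])
    then have "\<zeta> = tight_act S (s\<dagger>) \<eta>" using z(1) act_filter(1)[OF sc h(1) d] unfolding sultrafilters_def by blast
    then show ?thesis using act_inv[OF sc h(1) d] s by (simp add: inv_inv)
  qed
  then show ?thesis using a(1) unfolding sultrafilters_def by blast
qed

end


section \<open>Topology and compactness of the tight spectrum\<close>

context inverse_monoid
begin

abbreviation "\<tau> \<equiv> tight_spectrum S"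
abbreviation "FT \<equiv> sfilter_topology S"
abbreviation "TT \<equiv> subtopology FT \<tau>"

definition coords :: "'a set \<Rightarrow> 'a \<Rightarrow> bool" where "coords \<xi> = (\<lambda>e\<in>E. e \<in> \<xi>)"

text \<open>For finite \<open>W\<close> the sets of all \<eta> with
  \<open>agree W \<eta> \<xi>\<close> are the basic neighbourhoods of \<xi>; the topology on filters
  is handled through them throughout.\<close>

definition agree :: "'a set \<Rightarrow> 'a set \<Rightarrow> 'a set \<Rightarrow> bool" where
  "agree W \<xi> \<eta> \<longleftrightarrow> (\<forall>e\<in>W. e \<in> \<xi> \<longleftrightarrow> e \<in> \<eta>)"

lemma agree_refl: "agree W \<xi> \<xi>" and agree_sym: "agree W \<xi> \<eta> \<Longrightarrow> agree W \<eta> \<xi>"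
  and agree_trans: "agree W \<xi> \<eta> \<Longrightarrow> agree W \<eta> \<mu> \<Longrightarrow> agree W \<xi> \<mu>"
  by (auto simp: agree_def)

lemma agree_coords: "W \<subseteq> E \<Longrightarrow> (\<forall>e\<in>W. coords \<eta> e = coords \<xi> e) \<longleftrightarrow> agree W \<eta> \<xi>"
  by (auto simp: agree_def coords_def)

lemma sfilter_topology_alt: "FT = pullback_topology (sfilters S) coords (product_topology (\<lambda>_. discrete_topology UNIV) E)"
  unfolding sfilter_topology_def coords_def by simp

lemma coords_PiE: "coords \<xi> \<in> PiE E (\<lambda>_. UNIV)"
  by (auto simp: coords_def)

lemma openin_prod: "openin (product_topology (\<lambda>_. discrete_topology (UNIV :: bool set)) E) V \<longleftrightarrow>
   (V \<subseteq> PiE E (\<lambda>_. UNIV) \<and> (\<forall>g\<in>V. \<exists>W. finite W \<and> W \<subseteq> E \<and> (\<forall>h\<in>PiE E (\<lambda>_. UNIV). (\<forall>e\<in>W. h e = g e) \<longrightarrow> h \<in> V)))"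
  (is "?L \<longleftrightarrow> ?R")
proof
  assume L: ?L
  show ?R
  proof (intro conjI ballI)
    show "V \<subseteq> PiE E (\<lambda>_. UNIV)" using openin_subset[OF L] by (simp add: topspace_product_topology)
    fix g assume "g \<in> V"
    then obtain W where W: "finite {i \<in> E. W i \<noteq> UNIV}" "g \<in> PiE E W" "PiE E W \<subseteq> V"
      using L unfolding openin_product_topology_alt by auto
    show "\<exists>W. finite W \<and> W \<subseteq> E \<and> (\<forall>h\<in>PiE E (\<lambda>_. UNIV). (\<forall>e\<in>W. h e = g e) \<longrightarrow> h \<in> V)"
    proof (intro exI[of _ "{i \<in> E. W i \<noteq> UNIV}"] conjI ballI impI)
      fix h assume h: "h \<in> PiE E (\<lambda>_. (UNIV :: bool set))" "\<forall>e\<in>{i \<in> E. W i \<noteq> UNIV}. h e = g e"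
      have "h i \<in> W i" if "i \<in> E" for i using h(2) W(2) that by (cases "W i = UNIV") (auto simp: PiE_iff)
      then have "h \<in> PiE E W" using h(1) by (auto simp: PiE_iff)
      then show "h \<in> V" using W(3) by blast
    qed (use W in auto)
  qed
next
  assume R: ?R
  show ?L
    unfolding openin_product_topology_alt
  proof (intro ballI)
    fix g assume g: "g \<in> V"
    then obtain W where W: "finite W" "W \<subseteq> E" "\<forall>h\<in>PiE E (\<lambda>_. UNIV). (\<forall>e\<in>W. h e = g e) \<longrightarrow> h \<in> V" using R by blast
    let ?U = "\<lambda>i. if i \<in> W then {g i} else UNIV"
    have "finite {i \<in> E. ?U i \<noteq> topspace (discrete_topology UNIV)}"
      by (rule finite_subset[OF _ W(1)]) (auto split: if_splits)
    moreover have "g \<in> PiE E ?U" using g R by (auto simp: PiE_iff)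
    moreover have "PiE E ?U \<subseteq> V"
    proof
      fix h assume h: "h \<in> PiE E ?U"
      have "h \<in> PiE E (\<lambda>_. UNIV)" using h by (auto simp: PiE_iff)
      moreover have "\<forall>e\<in>W. h e = g e"
      proof
        fix e assume e: "e \<in> W"
        then show "h e = g e" using PiE_mem[OF h, of e] W(2) by auto
      qed
      ultimately show "h \<in> V" using W(3) by blast
    qed
    ultimately show "\<exists>U. finite {i \<in> E. U i \<noteq> topspace (discrete_topology UNIV)} \<and> (\<forall>i\<in>E. openin (discrete_topology UNIV) (U i)) \<and> g \<in> PiE E U \<and> PiE E U \<subseteq> V"
      by (intro exI[of _ ?U]) simp
  qed
qed

lemma topspace_FT: "topspace FT = sfilters S"
  unfolding sfilter_topology_alt by (auto simp: topspace_pullback_topology topspace_product_topology coords_PiE)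

lemma openin_FT: "openin FT U \<longleftrightarrow> U \<subseteq> sfilters S \<and>
   (\<forall>\<xi>\<in>U. \<exists>W. finite W \<and> W \<subseteq> E \<and> (\<forall>\<eta>\<in>sfilters S. agree W \<eta> \<xi> \<longrightarrow> \<eta> \<in> U))"
  (is "?L \<longleftrightarrow> ?R")
proof
  assume ?L
  then obtain V where V: "openin (product_topology (\<lambda>_. discrete_topology (UNIV :: bool set)) E) V" "U = coords -` V \<inter> sfilters S"
    unfolding sfilter_topology_alt openin_pullback_topology by blast
  show ?R
  proof (intro conjI ballI)
    show "U \<subseteq> sfilters S" using V by blast
    fix \<xi> assume x: "\<xi> \<in> U"
    then have "coords \<xi> \<in> V" using V(2) by blast
    then obtain W where W: "finite W" "W \<subseteq> E" "\<forall>h\<in>PiE E (\<lambda>_. UNIV). (\<forall>e\<in>W. h e = coords \<xi> e) \<longrightarrow> h \<in> V"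
      using V(1) unfolding openin_prod by blast
    have "\<eta> \<in> U" if "\<eta> \<in> sfilters S" "agree W \<eta> \<xi>" for \<eta>
    proof -
      have "\<forall>e\<in>W. coords \<eta> e = coords \<xi> e" using that(2) agree_coords[OF W(2)] by simp
      then show ?thesis using W(3) coords_PiE[of \<eta>] V(2) that(1) by blast
    qed
    then show "\<exists>W. finite W \<and> W \<subseteq> E \<and> (\<forall>\<eta>\<in>sfilters S. agree W \<eta> \<xi> \<longrightarrow> \<eta> \<in> U)" using W by blast
  qed
next
  assume R: ?R
  \<comment> \<open>Openness of \<open>U\<close> speaks about filters only, so the open set of the
    product is assembled from the cylinders that witness it.\<close>
  define V where "V = {g \<in> PiE E (\<lambda>_. UNIV). \<exists>\<xi>\<in>U. \<exists>W. finite W \<and> W \<subseteq> E \<and> (\<forall>\<eta>\<in>sfilters S. agree W \<eta> \<xi> \<longrightarrow> \<eta> \<in> U) \<and> (\<forall>e\<in>W. g e = coords \<xi> e)}"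
  have "openin (product_topology (\<lambda>_. discrete_topology (UNIV :: bool set)) E) V"
    unfolding openin_prod
  proof (intro conjI ballI)
    fix g assume "g \<in> V"
    then obtain \<xi> W where w: "\<xi> \<in> U" "finite W" "W \<subseteq> E" "\<forall>\<eta>\<in>sfilters S. agree W \<eta> \<xi> \<longrightarrow> \<eta> \<in> U" "\<forall>e\<in>W. g e = coords \<xi> e"
      unfolding V_def by blast
    have "h \<in> V" if "h \<in> PiE E (\<lambda>_. UNIV)" "\<forall>e\<in>W. h e = g e" for h
    proof -
      have "\<forall>e\<in>W. h e = coords \<xi> e" using that w(5) by simp
      then show ?thesis unfolding V_def using w that(1) by blast
    qed
    then show "\<exists>W. finite W \<and> W \<subseteq> E \<and> (\<forall>h\<in>PiE E (\<lambda>_. UNIV). (\<forall>e\<in>W. h e = g e) \<longrightarrow> h \<in> V)" using w by blast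
  qed (auto simp: V_def)
  moreover have "U = coords -` V \<inter> sfilters S"
  proof (intro subset_antisym subsetI)
    fix \<xi> assume x: "\<xi> \<in> U"
    then obtain W where "finite W" "W \<subseteq> E" "\<forall>\<eta>\<in>sfilters S. agree W \<eta> \<xi> \<longrightarrow> \<eta> \<in> U" using R by blast
    then have "\<exists>\<mu>\<in>U. \<exists>W. finite W \<and> W \<subseteq> E \<and> (\<forall>\<eta>\<in>sfilters S. agree W \<eta> \<mu> \<longrightarrow> \<eta> \<in> U) \<and> (\<forall>e\<in>W. coords \<xi> e = coords \<mu> e)"
      using x by (intro bexI[of _ \<xi>] exI[of _ W]) simp_all
    then have "coords \<xi> \<in> V" unfolding V_def using coords_PiE[of \<xi>] by simp
    then show "\<xi> \<in> coords -` V \<inter> sfilters S" using x R by blast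
  next
    fix \<eta> assume "\<eta> \<in> coords -` V \<inter> sfilters S"
    then have \<eta>: "coords \<eta> \<in> V" "\<eta> \<in> sfilters S" by auto
    from \<eta>(1) obtain \<xi> W where w: "\<xi> \<in> U" "finite W" "W \<subseteq> E" "\<forall>\<eta>\<in>sfilters S. agree W \<eta> \<xi> \<longrightarrow> \<eta> \<in> U" "\<forall>e\<in>W. coords \<eta> e = coords \<xi> e"
      unfolding V_def by blast
    have "agree W \<eta> \<xi>" using agree_coords[OF w(3)] w(5) by simp
    then show "\<eta> \<in> U" using w(4) \<eta>(2) by blast
  qed
  ultimately show ?L unfolding sfilter_topology_alt openin_pullback_topology by blast
qed

lemma openin_FT_D: assumes "openin FT U" "\<xi> \<in> U"
  shows "\<exists>W. finite W \<and> W \<subseteq> E \<and> (\<forall>\<eta>\<in>sfilters S. agree W \<eta> \<xi> \<longrightarrow> \<eta> \<in> U)"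
  by (rule bspec[OF conjunct2[OF assms(1)[unfolded openin_FT]] assms(2)])

text \<open>The closure unfolded: a tight filter is one that ultrafilters imitate on every finite
  set of idempotents. In this form the density of the ultrafilters is put to use.\<close>

lemma tight_iff: "\<xi> \<in> \<tau> \<longleftrightarrow> \<xi> \<in> sfilters S \<and>
   (\<forall>W. finite W \<and> W \<subseteq> E \<longrightarrow> (\<exists>\<zeta>\<in>sultrafilters S. agree W \<zeta> \<xi>))"
proof (intro iffI conjI allI impI)
  assume x: "\<xi> \<in> \<tau>"
  show xf: "\<xi> \<in> sfilters S" using x unfolding tight_spectrum_def in_closure_of topspace_FT by blast
  fix W assume W: "finite W \<and> W \<subseteq> E"
  have "openin FT {\<eta> \<in> sfilters S. agree W \<eta> \<xi>}" unfolding openin_FT using W agree_trans by blast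
  moreover have c: "\<exists>y\<in>sultrafilters S. y \<in> T" if "\<xi> \<in> T" "openin FT T" for T
    using x that unfolding tight_spectrum_def in_closure_of by auto
  ultimately have "\<exists>y\<in>sultrafilters S. y \<in> {\<eta> \<in> sfilters S. agree W \<eta> \<xi>}"
    by (intro c) (simp_all add: xf agree_refl)
  then show "\<exists>\<zeta>\<in>sultrafilters S. agree W \<zeta> \<xi>" by blast
next
  assume a: "\<xi> \<in> sfilters S \<and> (\<forall>W. finite W \<and> W \<subseteq> E \<longrightarrow> (\<exists>\<zeta>\<in>sultrafilters S. agree W \<zeta> \<xi>))"
  have "\<exists>y\<in>sultrafilters S. y \<in> U" if U: "\<xi> \<in> U" "openin FT U" for U
  proof -
    obtain W where W: "finite W" "W \<subseteq> E" "\<forall>\<eta>\<in>sfilters S. agree W \<eta> \<xi> \<longrightarrow> \<eta> \<in> U"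
      using openin_FT_D[OF U(2,1)] by blast
    then obtain \<zeta> where "\<zeta> \<in> sultrafilters S" "agree W \<zeta> \<xi>" using a by blast
    then show ?thesis using W ultra_filter by blast
  qed
  then have "\<forall>T. \<xi> \<in> T \<and> openin FT T \<longrightarrow> (\<exists>y. y \<in> sultrafilters S \<and> y \<in> T)" by blast
  then show "\<xi> \<in> \<tau>" unfolding tight_spectrum_def in_closure_of topspace_FT using conjunct1[OF a] by simp
qed

lemma tight_filter: "\<xi> \<in> \<tau> \<Longrightarrow> \<xi> \<in> sfilters S"
  by (simp add: tight_iff)

lemma ultra_tight: "\<zeta> \<in> sultrafilters S \<Longrightarrow> \<zeta> \<in> \<tau>"
  using ultra_filter agree_refl unfolding tight_iff by blast

lemma tight_nonempty: "\<exists>\<xi>. \<xi> \<in> \<tau>"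
  using ultrafilter_exists ultra_tight by blast

lemma tight_domD: assumes "\<xi> \<in> tight_dom S e" shows "\<xi> \<in> \<tau>" "e \<in> \<xi>" "\<xi> \<in> sfilters S"
  using assms by (auto simp: tight_dom_def tight_iff)

text \<open>To imitate the translate on \<open>W\<close>, an ultrafilter has to imitate \<xi> on the
  conjugates of \<open>W\<close>; adding s* s to the list places that ultrafilter in the domain of
  the translation.\<close>

lemma act_tight:
  assumes s: "s \<in> carrier S" and x: "\<xi> \<in> tight_dom S (s\<dagger> \<cdot> s)"
  shows "tight_act S s \<xi> \<in> tight_dom S (s \<cdot> s\<dagger>)"
proof -
  note x' = tight_domD[OF x]
  note i = act_iff[OF s x'(3,2)]
  have "\<exists>\<zeta>\<in>sultrafilters S. agree W \<zeta> (tight_act S s \<xi>)" if W: "finite W \<and> W \<subseteq> E" for W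
  proof -
    let ?W = "insert (s\<dagger> \<cdot> s) ((\<lambda>f. s\<dagger> \<cdot> (f \<cdot> s)) ` W)"
    have "finite ?W \<and> ?W \<subseteq> E" using W dom_E[OF s] conj_E'[OF s] by auto
    then obtain \<zeta> where z: "\<zeta> \<in> sultrafilters S" "agree ?W \<zeta> \<xi>" using x'(1) unfolding tight_iff by blast
    have zd: "s\<dagger> \<cdot> s \<in> \<zeta>" using z(2) x'(2) by (simp add: agree_def)
    have "agree W (tight_act S s \<zeta>) (tight_act S s \<xi>)"
      using z(2) i act_iff[OF s ultra_filter[OF z(1)] zd] by (simp add: agree_def)
    then show ?thesis using act_ultra[OF s z(1) zd] by blast
  qed
  then show ?thesis using act_filter[OF s x'(3,2)] unfolding tight_dom_def tight_iff by blast
qed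

lemma topspace_TT: "topspace TT = \<tau>"
  using tight_filter by (auto simp: topspace_FT)

lemma openin_TT: "openin TT U \<longleftrightarrow> U \<subseteq> \<tau> \<and> (\<forall>\<xi>\<in>U. \<exists>W. finite W \<and> W \<subseteq> E \<and> (\<forall>\<eta>\<in>\<tau>. agree W \<eta> \<xi> \<longrightarrow> \<eta> \<in> U))"
  (is "?L \<longleftrightarrow> ?R")
proof
  assume ?L
  then obtain V where V: "openin FT V" "U = V \<inter> \<tau>" by (auto simp: openin_subtopology)
  have "\<exists>W. finite W \<and> W \<subseteq> E \<and> (\<forall>\<eta>\<in>\<tau>. agree W \<eta> \<xi> \<longrightarrow> \<eta> \<in> U)" if xU: "\<xi> \<in> U" for \<xi>
  proof -
    obtain W where W: "finite W" "W \<subseteq> E" "\<forall>\<eta>\<in>sfilters S. agree W \<eta> \<xi> \<longrightarrow> \<eta> \<in> V"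
      using openin_FT_D[OF V(1), of \<xi>] xU unfolding V(2) by blast
    then have "\<forall>\<eta>\<in>\<tau>. agree W \<eta> \<xi> \<longrightarrow> \<eta> \<in> U" using V(2) tight_filter by simp
    then show ?thesis using W by blast
  qed
  then show ?R using V(2) by simp
next
  assume R: ?R
  let ?V = "{\<eta> \<in> sfilters S. \<exists>\<xi>\<in>U. \<exists>W. finite W \<and> W \<subseteq> E \<and> (\<forall>\<eta>\<in>\<tau>. agree W \<eta> \<xi> \<longrightarrow> \<eta> \<in> U) \<and> agree W \<eta> \<xi>}"
  have "openin FT ?V"
    unfolding openin_FT
  proof (intro conjI ballI)
    fix \<mu> assume "\<mu> \<in> ?V"
    then obtain \<xi> W where w: "\<xi> \<in> U" "finite W" "W \<subseteq> E" "\<forall>\<eta>\<in>\<tau>. agree W \<eta> \<xi> \<longrightarrow> \<eta> \<in> U" "agree W \<mu> \<xi>" by blast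
    have "\<eta> \<in> ?V" if "\<eta> \<in> sfilters S" "agree W \<eta> \<mu>" for \<eta>
    proof -
      have "\<exists>\<xi>'\<in>U. \<exists>W. finite W \<and> W \<subseteq> E \<and> (\<forall>\<eta>\<in>\<tau>. agree W \<eta> \<xi>' \<longrightarrow> \<eta> \<in> U) \<and> agree W \<eta> \<xi>'"
        by (intro bexI[OF _ w(1)] exI[of _ W] conjI w agree_trans[OF that(2) w(5)])
      then show ?thesis using that(1) by simp
    qed
    then show "\<exists>W. finite W \<and> W \<subseteq> E \<and> (\<forall>\<eta>\<in>sfilters S. agree W \<eta> \<mu> \<longrightarrow> \<eta> \<in> ?V)"
      by (intro exI[of _ W] conjI ballI impI w(2,3))
  qed blast
  moreover have "U = ?V \<inter> \<tau>"
  proof (intro subset_antisym subsetI)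
    fix \<xi> assume x: "\<xi> \<in> U"
    then obtain W where W: "finite W" "W \<subseteq> E" "\<forall>\<eta>\<in>\<tau>. agree W \<eta> \<xi> \<longrightarrow> \<eta> \<in> U"
      using bspec[OF conjunct2[OF R]] by blast
    have xt: "\<xi> \<in> \<tau>" using x conjunct1[OF R] by blast
    have "\<exists>\<xi>'\<in>U. \<exists>W. finite W \<and> W \<subseteq> E \<and> (\<forall>\<eta>\<in>\<tau>. agree W \<eta> \<xi>' \<longrightarrow> \<eta> \<in> U) \<and> agree W \<xi> \<xi>'"
      by (intro bexI[OF _ x] exI[of _ W] conjI W agree_refl)
    then show "\<xi> \<in> ?V \<inter> \<tau>" using xt tight_filter by simp
  qed blast
  ultimately show ?L unfolding openin_subtopology by blast
qed

lemma openin_dom: "e \<in> E \<Longrightarrow> openin TT (tight_dom S e)"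
  and openin_dom_compl: "e \<in> E \<Longrightarrow> openin TT (\<tau> - tight_dom S e)"
proof -
  assume e: "e \<in> E"
  have "finite {e} \<and> {e} \<subseteq> E" using e by simp
  moreover have "\<forall>\<eta>\<in>\<tau>. agree {e} \<eta> \<xi> \<longrightarrow> \<eta> \<in> tight_dom S e" if "\<xi> \<in> tight_dom S e" for \<xi>
    using that unfolding tight_dom_def agree_def by blast
  moreover have "\<forall>\<eta>\<in>\<tau>. agree {e} \<eta> \<xi> \<longrightarrow> \<eta> \<in> \<tau> - tight_dom S e" if "\<xi> \<in> \<tau> - tight_dom S e" for \<xi>
    using that unfolding tight_dom_def agree_def by blast
  moreover have "tight_dom S e \<subseteq> \<tau>" by (auto dest: tight_domD(1))
  ultimately have "tight_dom S e \<subseteq> \<tau> \<and> (\<forall>\<xi>\<in>tight_dom S e. \<exists>W. finite W \<and> W \<subseteq> E \<and> (\<forall>\<eta>\<in>\<tau>. agree W \<eta> \<xi> \<longrightarrow> \<eta> \<in> tight_dom S e))"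
    "\<forall>\<xi>\<in>\<tau> - tight_dom S e. \<exists>W. finite W \<and> W \<subseteq> E \<and> (\<forall>\<eta>\<in>\<tau>. agree W \<eta> \<xi> \<longrightarrow> \<eta> \<in> \<tau> - tight_dom S e)"
    by metis+
  then show "openin TT (tight_dom S e)" "openin TT (\<tau> - tight_dom S e)"
    unfolding openin_TT by simp_all
qed

text \<open>Filters form a closed subset of a compact product of two-point spaces, since the failure
  of a filter axiom is visible on at most three coordinates. The tight spectrum is closed among the
  filters.\<close>

lemma compactin_tight: "compactin TT \<tau>"
proof -
  let ?\<Pi> = "product_topology (\<lambda>_. discrete_topology (UNIV :: bool set)) E"
  define Z where "Z = coords ` sfilters S"
  have top: "topspace ?\<Pi> = PiE E (\<lambda>_. UNIV)" by (simp add: topspace_product_topology)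
  have "compact_space ?\<Pi>" by (simp add: compact_space_product_topology compact_space_discrete_topology)
  moreover have "closedin ?\<Pi> Z"
    unfolding closedin_def top openin_prod
  proof (intro conjI ballI)
    show "Z \<subseteq> PiE E (\<lambda>_. UNIV)" using coords_PiE by (auto simp: Z_def)
    fix g assume g: "g \<in> PiE E (\<lambda>_. UNIV) - Z"
    define \<xi> where "\<xi> = {e \<in> E. g e}"
    have "coords \<xi> = g" using g by (auto simp: coords_def \<xi>_def PiE_iff extensional_def restrict_def fun_eq_iff)
    then have "\<xi> \<notin> sfilters S" using g by (auto simp: Z_def)
    then consider "u \<notin> \<xi>" | "szero S \<in> \<xi>" | e f where "e \<in> \<xi>" "f \<in> E" "f \<cdot> e = e" "f \<notin> \<xi>"
      | e f where "e \<in> \<xi>" "f \<in> \<xi>" "e \<cdot> f \<notin> \<xi>"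
      unfolding filter_iff \<xi>_def by blast
    then have "\<exists>W. finite W \<and> W \<subseteq> E \<and> (\<forall>\<eta>\<in>sfilters S. \<not> agree W \<eta> \<xi>)"
    proof cases
      case 1 then show ?thesis using filter_unit unit_E by (intro exI[of _ "{u}"]) (unfold agree_def, blast)
    next
      case 2 then show ?thesis using filter_zero zero_E by (intro exI[of _ "{szero S}"]) (unfold agree_def, blast)
    next
      case (3 e f)
      then have "e \<in> E" by (simp add: \<xi>_def)
      then show ?thesis using 3 filter_up[of _ e f] by (intro exI[of _ "{e, f}"]) (unfold agree_def, blast)
    next
      case (4 e f)
      then have "e \<in> E" "f \<in> E" by (simp_all add: \<xi>_def)
      then show ?thesis using 4 filter_mult[of _ e f] E_mult[of e f] by (intro exI[of _ "{e, f, e \<cdot> f}"]) (unfold agree_def, blast)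
    qed
    then obtain W where W: "finite W" "W \<subseteq> E" "\<forall>\<eta>\<in>sfilters S. \<not> agree W \<eta> \<xi>" by blast
    have "h \<in> PiE E (\<lambda>_. UNIV) - Z" if h: "h \<in> PiE E (\<lambda>_. UNIV)" "\<forall>e\<in>W. h e = g e" for h
    proof -
      have "h \<noteq> coords \<eta>" if \<eta>: "\<eta> \<in> sfilters S" for \<eta>
      proof
        assume "h = coords \<eta>"
        then have "e \<in> \<eta> \<longleftrightarrow> e \<in> \<xi>" if "e \<in> W" for e
          using bspec[OF h(2) that] W(2) that by (auto simp: coords_def \<xi>_def)
        then have "agree W \<eta> \<xi>" by (simp add: agree_def)
        then show False using W(3) \<eta> by blast
      qed
      then show ?thesis using h(1) unfolding Z_def by blast
    qed
    then show "\<exists>W. finite W \<and> W \<subseteq> E \<and> (\<forall>h\<in>PiE E (\<lambda>_. UNIV). (\<forall>e\<in>W. h e = g e) \<longrightarrow> h \<in> PiE E (\<lambda>_. UNIV) - Z)"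
      using W by blast
  qed blast
  ultimately have cZ: "compactin ?\<Pi> Z" by (rule closedin_compact_space)
  have "compactin FT (sfilters S)"
    unfolding compactin_def topspace_FT
  proof (intro conjI allI impI)
    fix \<U> assume U: "Ball \<U> (openin FT) \<and> sfilters S \<subseteq> \<Union>\<U>"
    let ?V = "{V. openin ?\<Pi> V \<and> coords -` V \<inter> sfilters S \<in> \<U>}"
    have "Z \<subseteq> \<Union>?V"
    proof
      fix g assume "g \<in> Z"
      then obtain \<xi> where x: "\<xi> \<in> sfilters S" "g = coords \<xi>" by (auto simp: Z_def)
      then obtain U where u: "U \<in> \<U>" "\<xi> \<in> U" "openin FT U" using U by blast
      then obtain V where "openin ?\<Pi> V" "U = coords -` V \<inter> sfilters S"
        unfolding sfilter_topology_alt openin_pullback_topology by blast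
      then show "g \<in> \<Union>?V" using u x by auto
    qed
    then have "\<exists>\<F>. finite \<F> \<and> \<F> \<subseteq> ?V \<and> Z \<subseteq> \<Union>\<F>" using cZ unfolding compactin_def by simp
    then obtain \<F> where F: "finite \<F>" "\<F> \<subseteq> ?V" "Z \<subseteq> \<Union>\<F>" by blast
    show "\<exists>\<F>'. finite \<F>' \<and> \<F>' \<subseteq> \<U> \<and> sfilters S \<subseteq> \<Union>\<F>'"
    proof (intro exI[of _ "(\<lambda>V. coords -` V \<inter> sfilters S) ` \<F>"] conjI)
      show "sfilters S \<subseteq> \<Union>((\<lambda>V. coords -` V \<inter> sfilters S) ` \<F>)" using F(3) unfolding Z_def by blast
    qed (use F in auto)
  qed simp
  then have "compact_space FT" by (simp add: compact_space_def topspace_FT)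
  moreover have "closedin FT \<tau>" by (simp add: tight_spectrum_def)
  ultimately have "compactin FT \<tau>" by (rule closedin_compact_space)
  then show ?thesis unfolding compactin_subtopology by blast
qed

lemma compactin_dom: assumes e: "e \<in> E" shows "compactin TT (tight_dom S e)"
proof -
  have "tight_dom S e = \<tau> - (\<tau> - tight_dom S e)" by (auto simp: tight_dom_def)
  then have "closedin TT (tight_dom S e)"
    unfolding closedin_def topspace_TT using openin_dom_compl[OF e] tight_domD(1) by blast
  moreover have "compact_space TT" unfolding compact_space_def topspace_TT by (rule compactin_tight)
  ultimately show ?thesis by (rule closedin_compact_space[rotated])
qed

end


section \<open>The reduced norm of a groupoid\<close>

text \<open>Units have a type of their own, so \<open>un\<close> supplies the identity arrow at a
  unit. Inverses are axiomatised by cancellation, the form used in the calculus of matrix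
  entries.\<close>

locale groupoid =
  fixes G :: "('g, 'x, 'm) top_groupoid_scheme" and un :: "'x \<Rightarrow> 'g"
  assumes comp_closed: "\<lbrakk>\<gamma> \<in> arrows G; \<delta> \<in> arrows G; gsrc G \<gamma> = grng G \<delta>\<rbrakk> \<Longrightarrow> gcomp G \<gamma> \<delta> \<in> arrows G"
    and comp_src: "\<lbrakk>\<gamma> \<in> arrows G; \<delta> \<in> arrows G; gsrc G \<gamma> = grng G \<delta>\<rbrakk> \<Longrightarrow> gsrc G (gcomp G \<gamma> \<delta>) = gsrc G \<delta>"
    and comp_rng: "\<lbrakk>\<gamma> \<in> arrows G; \<delta> \<in> arrows G; gsrc G \<gamma> = grng G \<delta>\<rbrakk> \<Longrightarrow> grng G (gcomp G \<gamma> \<delta>) = grng G \<gamma>"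
    and comp_assoc: "\<lbrakk>\<gamma> \<in> arrows G; \<delta> \<in> arrows G; \<epsilon> \<in> arrows G; gsrc G \<gamma> = grng G \<delta>; gsrc G \<delta> = grng G \<epsilon>\<rbrakk>
        \<Longrightarrow> gcomp G (gcomp G \<gamma> \<delta>) \<epsilon> = gcomp G \<gamma> (gcomp G \<delta> \<epsilon>)"
    and ginv_closed: "\<gamma> \<in> arrows G \<Longrightarrow> ginv G \<gamma> \<in> arrows G"
    and ginv_src: "\<gamma> \<in> arrows G \<Longrightarrow> gsrc G (ginv G \<gamma>) = grng G \<gamma>"
    and ginv_rng: "\<gamma> \<in> arrows G \<Longrightarrow> grng G (ginv G \<gamma>) = gsrc G \<gamma>"
    and ginv_ginv: "\<gamma> \<in> arrows G \<Longrightarrow> ginv G (ginv G \<gamma>) = \<gamma>"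
    and inv_cancel: "\<lbrakk>\<gamma> \<in> arrows G; \<delta> \<in> arrows G; gsrc G \<gamma> = grng G \<delta>\<rbrakk> \<Longrightarrow> gcomp G (ginv G \<gamma>) (gcomp G \<gamma> \<delta>) = \<delta>"
    and cancel_inv: "\<lbrakk>\<gamma> \<in> arrows G; \<delta> \<in> arrows G; gsrc G \<gamma> = grng G \<delta>\<rbrakk> \<Longrightarrow> gcomp G (gcomp G \<gamma> \<delta>) (ginv G \<delta>) = \<gamma>"
    and unit_src: "\<gamma> \<in> arrows G \<Longrightarrow> gcomp G (ginv G \<gamma>) \<gamma> = un (gsrc G \<gamma>)"
begin

abbreviation "Ar \<equiv> arrows G"
abbreviation "src \<equiv> gsrc G"
abbreviation "rng \<equiv> grng G"
abbreviation gmul (infixl "\<bullet>\<^sub>G" 70) where "\<gamma> \<bullet>\<^sub>G \<delta> \<equiv> gcomp G \<gamma> \<delta>"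
abbreviation gi where "gi \<equiv> ginv G"
abbreviation "fib \<equiv> src_fibre G"

lemmas ginv_simps = ginv_closed ginv_src ginv_rng ginv_ginv
lemmas comp_simps = comp_closed comp_src comp_rng

lemma inv_comp: assumes "\<gamma> \<in> Ar" "\<delta> \<in> Ar" "src \<gamma> = rng \<delta>" shows "gi (\<gamma> \<bullet>\<^sub>G \<delta>) = gi \<delta> \<bullet>\<^sub>G gi \<gamma>"
proof -
  have 1: "gi (\<gamma> \<bullet>\<^sub>G \<delta>) \<bullet>\<^sub>G \<gamma> = gi \<delta>"
    using inv_cancel[of "\<gamma> \<bullet>\<^sub>G \<delta>" "gi \<delta>"] assms by (simp add: comp_simps ginv_simps cancel_inv)
  have "(gi (\<gamma> \<bullet>\<^sub>G \<delta>) \<bullet>\<^sub>G \<gamma>) \<bullet>\<^sub>G gi \<gamma> = gi (\<gamma> \<bullet>\<^sub>G \<delta>)"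
    using assms by (intro cancel_inv) (simp_all add: comp_simps ginv_simps)
  then show ?thesis by (simp add: 1)
qed

text \<open>The arrow \<open>\<gamma>\<delta>\<^sup>-\<^sup>1\<close> indexes the matrix entries of the regular representation.\<close>

abbreviation gdiv (infixl "\<div>" 70) where "\<gamma> \<div> \<delta> \<equiv> \<gamma> \<bullet>\<^sub>G gi \<delta>"

lemma div_simps:
  assumes "\<gamma> \<in> Ar" "\<delta> \<in> Ar" "src \<gamma> = src \<delta>"
  shows "\<gamma> \<div> \<delta> \<in> Ar" "src (\<gamma> \<div> \<delta>) = rng \<delta>" "rng (\<gamma> \<div> \<delta>) = rng \<gamma>" "gi (\<gamma> \<div> \<delta>) = \<delta> \<div> \<gamma>" "(\<gamma> \<div> \<delta>) \<bullet>\<^sub>G \<delta> = \<gamma>"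
  using assms cancel_inv[of \<gamma> "gi \<delta>"] by (simp_all add: comp_simps ginv_simps inv_comp)

text \<open>Translating both arrows on the right by the same inverse does not change their quotient;
  the intermediate index cancels as in a product of matrices.\<close>

lemma div_div:
  assumes "\<gamma> \<in> Ar" "\<delta> \<in> Ar" "\<epsilon> \<in> Ar" "src \<gamma> = src \<delta>" "src \<epsilon> = src \<delta>"
  shows "(\<gamma> \<div> \<delta>) \<div> (\<epsilon> \<div> \<delta>) = \<gamma> \<div> \<epsilon>"
proof -
  have "(\<gamma> \<div> \<delta>) \<div> (\<epsilon> \<div> \<delta>) = (\<gamma> \<div> \<delta>) \<bullet>\<^sub>G (\<delta> \<bullet>\<^sub>G gi \<epsilon>)" using assms by (simp add: div_simps(4))
  also have "\<dots> = ((\<gamma> \<div> \<delta>) \<bullet>\<^sub>G \<delta>) \<bullet>\<^sub>G gi \<epsilon>"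
    using assms by (intro comp_assoc[symmetric]) (simp_all add: div_simps ginv_simps)
  finally show ?thesis using assms by (simp add: div_simps(5))
qed

lemma div_inj: "\<lbrakk>\<gamma> \<in> Ar; \<delta> \<in> Ar; \<epsilon> \<in> Ar; src \<gamma> = src \<delta>; src \<epsilon> = src \<delta>; \<gamma> \<div> \<delta> = \<epsilon> \<div> \<delta>\<rbrakk> \<Longrightarrow> \<gamma> = \<epsilon>"
  by (metis div_simps(5))

lemma div_inj2: assumes "\<gamma> \<in> Ar" "\<delta> \<in> Ar" "\<epsilon> \<in> Ar" "src \<gamma> = src \<delta>" "src \<gamma> = src \<epsilon>" "\<gamma> \<div> \<delta> = \<gamma> \<div> \<epsilon>" shows "\<delta> = \<epsilon>"
  using assms div_simps(4)[of \<gamma> \<delta>] div_simps(4)[of \<gamma> \<epsilon>] div_inj[of \<delta> \<gamma> \<epsilon>] by simp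

lemma un_simps: assumes "\<gamma> \<in> Ar"
  shows "un (src \<gamma>) \<in> Ar" "src (un (src \<gamma>)) = src \<gamma>" "rng (un (src \<gamma>)) = src \<gamma>" "gi (un (src \<gamma>)) = un (src \<gamma>)"
    "\<gamma> \<bullet>\<^sub>G un (src \<gamma>) = \<gamma>"
  using assms inv_cancel[of "gi \<gamma>" \<gamma>] inv_comp[of "gi \<gamma>" \<gamma>]
  by (simp_all add: comp_simps ginv_simps flip: unit_src)

lemma fib_iff: "\<gamma> \<in> fib x \<longleftrightarrow> \<gamma> \<in> Ar \<and> src \<gamma> = x"
  by (simp add: src_fibre_def)

abbreviation "Cc \<equiv> cc_algebra G"

lemma cc_ops: "f \<oplus>\<^bsub>Cc\<^esub> g = (\<lambda>\<gamma>. f \<gamma> + g \<gamma>)" "scale Cc c f = (\<lambda>\<gamma>. c * f \<gamma>)" "\<zero>\<^bsub>Cc\<^esub> = (\<lambda>_. 0)"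
  "star Cc f = (\<lambda>\<gamma>. if \<gamma> \<in> Ar then cnj (f (gi \<gamma>)) else 0)"
  by (simp_all add: cc_algebra_def)

lemma cc_mult: "(f \<otimes>\<^bsub>Cc\<^esub> g) \<gamma> = (if \<gamma> \<in> Ar then \<Sum>\<^sub>\<infinity>\<alpha>\<in>{\<alpha> \<in> Ar. rng \<alpha> = rng \<gamma>}. f \<alpha> * g (gi \<alpha> \<bullet>\<^sub>G \<gamma>) else 0)"
  by (simp add: cc_algebra_def)

text \<open>Finite support on every source fibre and every range fibre: the matrices of the regular
  representation then have finite columns and rows, and the infinite sums of the convolution reduce
  to finite ones.\<close>

definition ffin :: "('g \<Rightarrow> complex) \<Rightarrow> bool" where
  "ffin f \<longleftrightarrow> (\<forall>\<gamma>. \<gamma> \<notin> Ar \<longrightarrow> f \<gamma> = 0) \<and> (\<forall>x. finite {\<gamma> \<in> Ar. src \<gamma> = x \<and> f \<gamma> \<noteq> 0}) \<and>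
     (\<forall>x. finite {\<gamma> \<in> Ar. rng \<gamma> = x \<and> f \<gamma> \<noteq> 0})"

lemma ffinD: assumes "ffin f" shows "\<gamma> \<notin> Ar \<Longrightarrow> f \<gamma> = 0" "finite {\<gamma> \<in> Ar. src \<gamma> = x \<and> f \<gamma> \<noteq> 0}"
   "finite {\<gamma> \<in> Ar. rng \<gamma> = x \<and> f \<gamma> \<noteq> 0}"
  using assms by (auto simp: ffin_def)

lemma conv1:
  assumes g: "\<gamma> \<in> Ar" and Z: "finite Z" "Z \<subseteq> {\<alpha> \<in> Ar. rng \<alpha> = rng \<gamma>}" "{\<alpha> \<in> Ar. rng \<alpha> = rng \<gamma> \<and> f \<alpha> \<noteq> 0} \<subseteq> Z"
  shows "(f \<otimes>\<^bsub>Cc\<^esub> h) \<gamma> = (\<Sum>\<alpha>\<in>Z. f \<alpha> * h (gi \<alpha> \<bullet>\<^sub>G \<gamma>))"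
proof -
  have "(f \<otimes>\<^bsub>Cc\<^esub> h) \<gamma> = (\<Sum>\<^sub>\<infinity>\<alpha>\<in>Z. f \<alpha> * h (gi \<alpha> \<bullet>\<^sub>G \<gamma>))"
    unfolding cc_mult if_P[OF g] by (rule infsum_cong_neutral) (use Z in auto)
  then show ?thesis using Z(1) by simp
qed

text \<open>The substitution \<alpha> = \<gamma>\<delta>^-1 moves the summation from the support of
  the left factor to that of the right factor.\<close>

lemma conv2:
  assumes g: "\<gamma> \<in> Ar" and W: "finite W" "W \<subseteq> {\<delta> \<in> Ar. src \<delta> = src \<gamma>}" "{\<delta> \<in> Ar. src \<delta> = src \<gamma> \<and> h \<delta> \<noteq> 0} \<subseteq> W"
  shows "(f \<otimes>\<^bsub>Cc\<^esub> h) \<gamma> = (\<Sum>\<delta>\<in>W. f (\<gamma> \<div> \<delta>) * h \<delta>)"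
proof -
  let ?R = "{\<alpha> \<in> Ar. rng \<alpha> = rng \<gamma>}"
  have W': "\<delta> \<in> Ar" "src \<delta> = src \<gamma>" if "\<delta> \<in> W" for \<delta> using W(2) that by auto
  have bk: "gi (\<gamma> \<div> \<delta>) \<bullet>\<^sub>G \<gamma> = \<delta>" if "\<delta> \<in> W" for \<delta>
    using W'[OF that] g by (simp add: div_simps)
  have "(f \<otimes>\<^bsub>Cc\<^esub> h) \<gamma> = (\<Sum>\<^sub>\<infinity>\<alpha>\<in>(\<lambda>\<delta>. \<gamma> \<div> \<delta>) ` W. f \<alpha> * h (gi \<alpha> \<bullet>\<^sub>G \<gamma>))"
    unfolding cc_mult if_P[OF g]
  proof (rule infsum_cong_neutral)
    fix \<alpha> assume "\<alpha> \<in> (\<lambda>\<delta>. \<gamma> \<div> \<delta>) ` W - ?R"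
    then show "f \<alpha> * h (gi \<alpha> \<bullet>\<^sub>G \<gamma>) = 0" using W' g by (auto simp: div_simps)
  next
    fix \<alpha> assume a: "\<alpha> \<in> ?R - (\<lambda>\<delta>. \<gamma> \<div> \<delta>) ` W"
    then have al: "\<alpha> \<in> Ar" "rng \<alpha> = rng \<gamma>" by auto
    let ?d = "gi \<alpha> \<bullet>\<^sub>G \<gamma>"
    have d: "?d \<in> Ar" "src ?d = src \<gamma>" using al g by (simp_all add: comp_simps ginv_simps)
    have "\<gamma> \<div> ?d = \<alpha>"
      using al g inv_comp[of "gi \<alpha>" \<gamma>] inv_cancel[of "gi \<gamma>" \<alpha>] by (simp add: comp_simps ginv_simps)
    then have "?d \<notin> W" using a imageI[of ?d W "\<lambda>\<delta>. \<gamma> \<div> \<delta>"] by auto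
    then show "f \<alpha> * h (gi \<alpha> \<bullet>\<^sub>G \<gamma>) = 0" using W(3) d by auto
  qed simp
  also have "\<dots> = (\<Sum>\<alpha>\<in>(\<lambda>\<delta>. \<gamma> \<div> \<delta>) ` W. f \<alpha> * h (gi \<alpha> \<bullet>\<^sub>G \<gamma>))" using W(1) by simp
  also have "\<dots> = (\<Sum>\<delta>\<in>W. f (\<gamma> \<div> \<delta>) * h (gi (\<gamma> \<div> \<delta>) \<bullet>\<^sub>G \<gamma>))"
    by (rule sum.reindex_cong[OF inj_on_inverseI[of W "\<lambda>\<alpha>. gi \<alpha> \<bullet>\<^sub>G \<gamma>"]]) (erule bk, rule refl, rule refl)
  also have "\<dots> = (\<Sum>\<delta>\<in>W. f (\<gamma> \<div> \<delta>) * h \<delta>)" 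
  proof (rule sum.cong[OF refl])
    fix \<delta> assume "\<delta> \<in> W"
    from bk[OF this] show "f (\<gamma> \<div> \<delta>) * h (gi (\<gamma> \<div> \<delta>) \<bullet>\<^sub>G \<gamma>) = f (\<gamma> \<div> \<delta>) * h \<delta>" by (rule arg_cong)
  qed
  finally show ?thesis .
qed

text \<open>Convolution as matrix multiplication: the indices run over one source fibre, and the
  entry at (\<beta>, \<gamma>) is the value at \<beta>\<gamma>^-1.\<close>

lemma conv3:
  assumes b: "\<beta> \<in> fib x" "\<beta>' \<in> fib x" and U: "finite U" "U \<subseteq> fib x" "{\<gamma> \<in> fib x. h (\<gamma> \<div> \<beta>') \<noteq> 0} \<subseteq> U"
  shows "(f \<otimes>\<^bsub>Cc\<^esub> h) (\<beta> \<div> \<beta>') = (\<Sum>\<gamma>\<in>U. f (\<beta> \<div> \<gamma>) * h (\<gamma> \<div> \<beta>'))"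
proof -
  have U': "\<gamma> \<in> Ar" "src \<gamma> = x" if "\<gamma> \<in> U" for \<gamma> using U(2) that by (auto simp: fib_iff)
  have b': "\<beta> \<in> Ar" "\<beta>' \<in> Ar" "src \<beta> = x" "src \<beta>' = x" using b by (auto simp: fib_iff)
  have "(f \<otimes>\<^bsub>Cc\<^esub> h) (\<beta> \<div> \<beta>') = (\<Sum>\<delta>\<in>(\<lambda>\<gamma>. \<gamma> \<div> \<beta>') ` U. f ((\<beta> \<div> \<beta>') \<div> \<delta>) * h \<delta>)"
  proof (rule conv2)
    show "(\<lambda>\<gamma>. \<gamma> \<div> \<beta>') ` U \<subseteq> {\<delta> \<in> Ar. src \<delta> = src (\<beta> \<div> \<beta>')}" using U' b' by (auto simp: div_simps)
    show "{\<delta> \<in> Ar. src \<delta> = src (\<beta> \<div> \<beta>') \<and> h \<delta> \<noteq> 0} \<subseteq> (\<lambda>\<gamma>. \<gamma> \<div> \<beta>') ` U"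
    proof
      fix \<delta> assume "\<delta> \<in> {\<delta> \<in> Ar. src \<delta> = src (\<beta> \<div> \<beta>') \<and> h \<delta> \<noteq> 0}"
      then have d: "\<delta> \<in> Ar" "src \<delta> = rng \<beta>'" "h \<delta> \<noteq> 0" using b' by (simp_all add: div_simps)
      have "(\<delta> \<bullet>\<^sub>G \<beta>') \<div> \<beta>' = \<delta>" using d b' by (intro cancel_inv) simp_all
      moreover have "\<delta> \<bullet>\<^sub>G \<beta>' \<in> fib x" using d b' by (simp add: fib_iff comp_simps)
      ultimately show "\<delta> \<in> (\<lambda>\<gamma>. \<gamma> \<div> \<beta>') ` U" using U(3) d(3) by (intro image_eqI[of _ _ "\<delta> \<bullet>\<^sub>G \<beta>'"]) auto
    qed
  qed (use U b' in \<open>simp_all add: div_simps\<close>)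
  also have "\<dots> = (\<Sum>\<gamma>\<in>U. f ((\<beta> \<div> \<beta>') \<div> (\<gamma> \<div> \<beta>')) * h (\<gamma> \<div> \<beta>'))"
    by (rule sum.reindex_cong[of "\<lambda>\<gamma>. \<gamma> \<div> \<beta>'" U]) (use U' b' div_inj in \<open>simp_all add: inj_on_def\<close>)
  also have "\<dots> = (\<Sum>\<gamma>\<in>U. f (\<beta> \<div> \<gamma>) * h (\<gamma> \<div> \<beta>'))"
    by (rule sum.cong) (simp_all add: div_div U' b')
  finally show ?thesis .
qed

lemma conv_distrib_right:
  assumes "ffin f" "ffin g" "ffin h" shows "(\<lambda>\<gamma>. f \<gamma> + g \<gamma>) \<otimes>\<^bsub>Cc\<^esub> h = (\<lambda>\<gamma>. (f \<otimes>\<^bsub>Cc\<^esub> h) \<gamma> + (g \<otimes>\<^bsub>Cc\<^esub> h) \<gamma>)"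
proof (rule ext)
  fix \<gamma>
  show "((\<lambda>\<gamma>. f \<gamma> + g \<gamma>) \<otimes>\<^bsub>Cc\<^esub> h) \<gamma> = (f \<otimes>\<^bsub>Cc\<^esub> h) \<gamma> + (g \<otimes>\<^bsub>Cc\<^esub> h) \<gamma>"
  proof (cases "\<gamma> \<in> Ar")
    case True
    have W: "finite {\<delta> \<in> Ar. src \<delta> = src \<gamma> \<and> h \<delta> \<noteq> 0}" by (rule ffinD[OF assms(3)])
    show ?thesis
      by (subst (1 2 3) conv2[OF True W]) (auto simp: distrib_right sum.distrib)
  qed (simp add: cc_mult)
qed

lemma conv_distrib_left:
  assumes "ffin f" "ffin g" "ffin h" shows "f \<otimes>\<^bsub>Cc\<^esub> (\<lambda>\<gamma>. g \<gamma> + h \<gamma>) = (\<lambda>\<gamma>. (f \<otimes>\<^bsub>Cc\<^esub> g) \<gamma> + (f \<otimes>\<^bsub>Cc\<^esub> h) \<gamma>)"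
proof (rule ext)
  fix \<gamma>
  show "(f \<otimes>\<^bsub>Cc\<^esub> (\<lambda>\<gamma>. g \<gamma> + h \<gamma>)) \<gamma> = (f \<otimes>\<^bsub>Cc\<^esub> g) \<gamma> + (f \<otimes>\<^bsub>Cc\<^esub> h) \<gamma>"
  proof (cases "\<gamma> \<in> Ar")
    case True
    have Z: "finite {\<alpha> \<in> Ar. rng \<alpha> = rng \<gamma> \<and> f \<alpha> \<noteq> 0}" by (rule ffinD[OF assms(1)])
    show ?thesis
      by (subst (1 2 3) conv1[OF True Z]) (auto simp: distrib_left sum.distrib)
  qed (simp add: cc_mult)
qed

lemma conv_scale:
  assumes "ffin f" "ffin g"
  shows "(\<lambda>\<gamma>. c * f \<gamma>) \<otimes>\<^bsub>Cc\<^esub> g = (\<lambda>\<gamma>. c * (f \<otimes>\<^bsub>Cc\<^esub> g) \<gamma>)" "f \<otimes>\<^bsub>Cc\<^esub> (\<lambda>\<gamma>. c * g \<gamma>) = (\<lambda>\<gamma>. c * (f \<otimes>\<^bsub>Cc\<^esub> g) \<gamma>)"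
proof -
  have Z: "finite {\<alpha> \<in> Ar. rng \<alpha> = rng \<gamma> \<and> f \<alpha> \<noteq> 0}" for \<gamma> by (rule ffinD[OF assms(1)])
  have W: "finite {\<delta> \<in> Ar. src \<delta> = src \<gamma> \<and> g \<delta> \<noteq> 0}" for \<gamma> by (rule ffinD[OF assms(2)])
  have "((\<lambda>\<gamma>. c * f \<gamma>) \<otimes>\<^bsub>Cc\<^esub> g) \<gamma> = c * (f \<otimes>\<^bsub>Cc\<^esub> g) \<gamma>" if "\<gamma> \<in> Ar" for \<gamma>
    by (subst (1 2) conv2[OF that W]) (auto simp: sum_distrib_left mult.assoc)
  moreover have "(f \<otimes>\<^bsub>Cc\<^esub> (\<lambda>\<gamma>. c * g \<gamma>)) \<gamma> = c * (f \<otimes>\<^bsub>Cc\<^esub> g) \<gamma>" if "\<gamma> \<in> Ar" for \<gamma>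
    by (subst (1 2) conv1[OF that Z]) (auto simp: sum_distrib_left mult_ac)
  moreover have "((\<lambda>\<gamma>. c * f \<gamma>) \<otimes>\<^bsub>Cc\<^esub> g) \<gamma> = c * (f \<otimes>\<^bsub>Cc\<^esub> g) \<gamma>" "(f \<otimes>\<^bsub>Cc\<^esub> (\<lambda>\<gamma>. c * g \<gamma>)) \<gamma> = c * (f \<otimes>\<^bsub>Cc\<^esub> g) \<gamma>" if "\<gamma> \<notin> Ar" for \<gamma>
    using that by (simp_all add: cc_mult)
  ultimately show "(\<lambda>\<gamma>. c * f \<gamma>) \<otimes>\<^bsub>Cc\<^esub> g = (\<lambda>\<gamma>. c * (f \<otimes>\<^bsub>Cc\<^esub> g) \<gamma>)" "f \<otimes>\<^bsub>Cc\<^esub> (\<lambda>\<gamma>. c * g \<gamma>) = (\<lambda>\<gamma>. c * (f \<otimes>\<^bsub>Cc\<^esub> g) \<gamma>)"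
    by (auto simp: fun_eq_iff)
qed

text \<open>Summing over the support of \<open>f\<close> on the left and over that of
  \<open>h\<close> on the right leaves a finite double sum, in which the order of summation can be
  exchanged.\<close>

lemma conv_assoc:
  assumes "ffin f" "ffin g" "ffin h" shows "(f \<otimes>\<^bsub>Cc\<^esub> g) \<otimes>\<^bsub>Cc\<^esub> h = f \<otimes>\<^bsub>Cc\<^esub> (g \<otimes>\<^bsub>Cc\<^esub> h)"
proof (rule ext)
  fix \<gamma>
  show "((f \<otimes>\<^bsub>Cc\<^esub> g) \<otimes>\<^bsub>Cc\<^esub> h) \<gamma> = (f \<otimes>\<^bsub>Cc\<^esub> (g \<otimes>\<^bsub>Cc\<^esub> h)) \<gamma>"
  proof (cases "\<gamma> \<in> Ar")
    case g: True
    let ?Z = "{\<alpha> \<in> Ar. rng \<alpha> = rng \<gamma> \<and> f \<alpha> \<noteq> 0}" and ?W = "{\<delta> \<in> Ar. src \<delta> = src \<gamma> \<and> h \<delta> \<noteq> 0}"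
    have Z: "finite ?Z" and W: "finite ?W" using ffinD[OF assms(1)] ffinD[OF assms(3)] by blast+
    have "((f \<otimes>\<^bsub>Cc\<^esub> g) \<otimes>\<^bsub>Cc\<^esub> h) \<gamma> = (\<Sum>\<delta>\<in>?W. (f \<otimes>\<^bsub>Cc\<^esub> g) (\<gamma> \<div> \<delta>) * h \<delta>)" by (rule conv2[OF g W]) auto
    also have "\<dots> = (\<Sum>\<delta>\<in>?W. (\<Sum>\<alpha>\<in>?Z. f \<alpha> * g (gi \<alpha> \<bullet>\<^sub>G (\<gamma> \<div> \<delta>))) * h \<delta>)"
    proof (rule sum.cong[OF refl])
      fix \<delta> assume d: "\<delta> \<in> ?W"
      have "(f \<otimes>\<^bsub>Cc\<^esub> g) (\<gamma> \<div> \<delta>) = (\<Sum>\<alpha>\<in>?Z. f \<alpha> * g (gi \<alpha> \<bullet>\<^sub>G (\<gamma> \<div> \<delta>)))"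
        by (rule conv1[OF _ Z]) (use d g in \<open>auto simp: div_simps\<close>)
      then show "(f \<otimes>\<^bsub>Cc\<^esub> g) (\<gamma> \<div> \<delta>) * h \<delta> = (\<Sum>\<alpha>\<in>?Z. f \<alpha> * g (gi \<alpha> \<bullet>\<^sub>G (\<gamma> \<div> \<delta>))) * h \<delta>" by simp
    qed
    also have "\<dots> = (\<Sum>\<alpha>\<in>?Z. \<Sum>\<delta>\<in>?W. f \<alpha> * g (gi \<alpha> \<bullet>\<^sub>G (\<gamma> \<div> \<delta>)) * h \<delta>)"
      unfolding sum_distrib_right by (rule sum.swap)
    also have "\<dots> = (\<Sum>\<alpha>\<in>?Z. f \<alpha> * (\<Sum>\<delta>\<in>?W. g ((gi \<alpha> \<bullet>\<^sub>G \<gamma>) \<div> \<delta>) * h \<delta>))"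
      unfolding sum_distrib_left
      by (intro sum.cong refl) (use g in \<open>simp add: comp_assoc ginv_simps mult.assoc\<close>)
    also have "\<dots> = (\<Sum>\<alpha>\<in>?Z. f \<alpha> * (g \<otimes>\<^bsub>Cc\<^esub> h) (gi \<alpha> \<bullet>\<^sub>G \<gamma>))"
    proof (rule sum.cong[OF refl])
      fix \<alpha> assume a: "\<alpha> \<in> ?Z"
      have "(g \<otimes>\<^bsub>Cc\<^esub> h) (gi \<alpha> \<bullet>\<^sub>G \<gamma>) = (\<Sum>\<delta>\<in>?W. g ((gi \<alpha> \<bullet>\<^sub>G \<gamma>) \<div> \<delta>) * h \<delta>)"
        by (rule conv2[OF _ W]) (use a g in \<open>auto simp: comp_simps ginv_simps\<close>)
      then show "f \<alpha> * (\<Sum>\<delta>\<in>?W. g ((gi \<alpha> \<bullet>\<^sub>G \<gamma>) \<div> \<delta>) * h \<delta>) = f \<alpha> * (g \<otimes>\<^bsub>Cc\<^esub> h) (gi \<alpha> \<bullet>\<^sub>G \<gamma>)" by simp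
    qed
    also have "\<dots> = (f \<otimes>\<^bsub>Cc\<^esub> (g \<otimes>\<^bsub>Cc\<^esub> h)) \<gamma>" by (rule conv1[OF g Z, symmetric]) auto
    finally show ?thesis .
  qed (simp add: cc_mult)
qed

lemma conv_star:
  assumes "ffin f" shows "star Cc (f \<otimes>\<^bsub>Cc\<^esub> g) = star Cc g \<otimes>\<^bsub>Cc\<^esub> star Cc f"
proof (rule ext)
  fix \<gamma>
  show "star Cc (f \<otimes>\<^bsub>Cc\<^esub> g) \<gamma> = (star Cc g \<otimes>\<^bsub>Cc\<^esub> star Cc f) \<gamma>"
  proof (cases "\<gamma> \<in> Ar")
    case g: True
    let ?Z = "{\<alpha> \<in> Ar. rng \<alpha> = rng (gi \<gamma>) \<and> f \<alpha> \<noteq> 0}"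
    have Z: "finite ?Z" using ffinD[OF assms(1)] by blast
    have inj: "inj_on gi ?Z" by (rule inj_onI) (metis (lifting) ginv_ginv mem_Collect_eq)
    have "(star Cc g \<otimes>\<^bsub>Cc\<^esub> star Cc f) \<gamma> = (\<Sum>\<delta>\<in>gi ` ?Z. star Cc g (\<gamma> \<div> \<delta>) * star Cc f \<delta>)"
    proof (rule conv2[OF g])
      show "{\<delta> \<in> Ar. src \<delta> = src \<gamma> \<and> star Cc f \<delta> \<noteq> 0} \<subseteq> gi ` ?Z"
      proof
        fix \<delta> assume "\<delta> \<in> {\<delta> \<in> Ar. src \<delta> = src \<gamma> \<and> star Cc f \<delta> \<noteq> 0}"
        then have "\<delta> \<in> Ar" "src \<delta> = src \<gamma>" "f (gi \<delta>) \<noteq> 0" by (simp_all add: cc_ops split: if_splits)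
        then show "\<delta> \<in> gi ` ?Z" using g by (intro image_eqI[of _ _ "gi \<delta>"]) (simp_all add: ginv_simps)
      qed
    qed (use Z g in \<open>auto simp: ginv_simps\<close>)
    also have "\<dots> = (\<Sum>\<alpha>\<in>?Z. star Cc g (\<gamma> \<div> gi \<alpha>) * star Cc f (gi \<alpha>))"
      by (rule sum.reindex_cong[OF inj]) simp_all
    also have "\<dots> = (\<Sum>\<alpha>\<in>?Z. cnj (f \<alpha> * g (gi \<alpha> \<bullet>\<^sub>G gi \<gamma>)))"
      by (rule sum.cong) (use g in \<open>simp_all add: cc_ops comp_simps ginv_simps inv_comp\<close>)
    also have "\<dots> = cnj ((f \<otimes>\<^bsub>Cc\<^esub> g) (gi \<gamma>))"
      by (subst conv1[OF ginv_closed[OF g] Z]) auto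
    finally show ?thesis using g by (simp add: cc_ops)
  qed (simp add: cc_mult cc_ops)
qed

lemma star_star_fun: "ffin f \<Longrightarrow> star Cc (star Cc f) = f"
  by (auto simp: cc_ops ginv_simps fun_eq_iff ffin_def)

text \<open>The closure properties depend on the topology and are postponed; the algebraic laws
  follow from finiteness of the supports on fibres.\<close>

lemma cc_star_algebra:
  assumes fin: "\<And>f. f \<in> carrier Cc \<Longrightarrow> ffin f"
    and closed: "\<zero>\<^bsub>Cc\<^esub> \<in> carrier Cc" "\<And>f g. \<lbrakk>f \<in> carrier Cc; g \<in> carrier Cc\<rbrakk> \<Longrightarrow> f \<oplus>\<^bsub>Cc\<^esub> g \<in> carrier Cc"
      "\<And>f g. \<lbrakk>f \<in> carrier Cc; g \<in> carrier Cc\<rbrakk> \<Longrightarrow> f \<otimes>\<^bsub>Cc\<^esub> g \<in> carrier Cc"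
      "\<And>f c. f \<in> carrier Cc \<Longrightarrow> scale Cc c f \<in> carrier Cc" "\<And>f. f \<in> carrier Cc \<Longrightarrow> star Cc f \<in> carrier Cc"
  shows "star_algebra Cc"
proof -
  have ag: "abelian_group Cc"
  proof (rule abelian_groupI)
    fix f assume "f \<in> carrier Cc"
    then show "\<exists>g\<in>carrier Cc. g \<oplus>\<^bsub>Cc\<^esub> f = \<zero>\<^bsub>Cc\<^esub>"
      by (intro bexI[of _ "scale Cc (-1) f"] closed) (simp_all add: cc_ops)
  qed (simp_all add: closed, simp_all add: cc_ops add_ac)
  interpret A: abelian_group Cc by (rule ag)
  show ?thesis
  proof
    fix f g h assume "f \<in> carrier Cc" "g \<in> carrier Cc" "h \<in> carrier Cc"
    then have f: "ffin f" "ffin g" "ffin h" using fin by auto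
    show "(f \<otimes>\<^bsub>Cc\<^esub> g) \<otimes>\<^bsub>Cc\<^esub> h = f \<otimes>\<^bsub>Cc\<^esub> (g \<otimes>\<^bsub>Cc\<^esub> h)" by (rule conv_assoc[OF f])
    show "(f \<oplus>\<^bsub>Cc\<^esub> g) \<otimes>\<^bsub>Cc\<^esub> h = f \<otimes>\<^bsub>Cc\<^esub> h \<oplus>\<^bsub>Cc\<^esub> g \<otimes>\<^bsub>Cc\<^esub> h" unfolding cc_ops by (rule conv_distrib_right[OF f])
    show "f \<otimes>\<^bsub>Cc\<^esub> (g \<oplus>\<^bsub>Cc\<^esub> h) = f \<otimes>\<^bsub>Cc\<^esub> g \<oplus>\<^bsub>Cc\<^esub> f \<otimes>\<^bsub>Cc\<^esub> h" unfolding cc_ops by (rule conv_distrib_left[OF f])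
  next
    fix f g c assume "f \<in> carrier Cc" "g \<in> carrier Cc"
    then have f: "ffin f" "ffin g" using fin by auto
    show "scale Cc c f \<otimes>\<^bsub>Cc\<^esub> g = scale Cc c (f \<otimes>\<^bsub>Cc\<^esub> g)" "f \<otimes>\<^bsub>Cc\<^esub> scale Cc c g = scale Cc c (f \<otimes>\<^bsub>Cc\<^esub> g)"
      unfolding cc_ops by (rule conv_scale[OF f])+
    show "star Cc (f \<otimes>\<^bsub>Cc\<^esub> g) = star Cc g \<otimes>\<^bsub>Cc\<^esub> star Cc f" by (rule conv_star[OF f(1)])
  next
    fix f assume "f \<in> carrier Cc"
    then show "star Cc (star Cc f) = f" by (simp add: star_star_fun fin)
  qed (simp_all add: closed, auto simp: cc_ops algebra_simps fun_eq_iff)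
qed

end


section \<open>Operator bounds for the regular representations\<close>

context groupoid
begin

abbreviation l2 :: "('g \<Rightarrow> complex) \<Rightarrow> 'g set \<Rightarrow> real" where "l2 v V \<equiv> L2_set (\<lambda>\<gamma>. cmod (v \<gamma>)) V"

definition ap :: "('g \<Rightarrow> complex) \<Rightarrow> ('g \<Rightarrow> complex) \<Rightarrow> 'g set \<Rightarrow> 'g \<Rightarrow> complex" where
  "ap f v V \<gamma> = (\<Sum>\<beta>\<in>V. f (\<gamma> \<div> \<beta>) * v \<beta>)"

text \<open>\<open>nbd f M\<close> says that \<open>M\<close> bounds the operator norms of all finite sections of the regular
  representation of \<open>f\<close>; the reduced norm is the least such bound.\<close>

definition nbd :: "('g \<Rightarrow> complex) \<Rightarrow> real \<Rightarrow> bool" where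
  "nbd f M \<longleftrightarrow> 0 \<le> M \<and> (\<forall>x\<in>src ` Ar. \<forall>U V v. finite U \<and> U \<subseteq> fib x \<and> finite V \<and> V \<subseteq> fib x \<longrightarrow>
     l2 (ap f v V) U \<le> M * l2 v V)"

lemma nbdI: "0 \<le> M \<Longrightarrow> (\<And>x U V v. \<lbrakk>x \<in> src ` Ar; finite U; U \<subseteq> fib x; finite V; V \<subseteq> fib x\<rbrakk> \<Longrightarrow> l2 (ap f v V) U \<le> M * l2 v V) \<Longrightarrow> nbd f M"
  by (simp add: nbd_def)

lemma nbdD: "nbd f M \<Longrightarrow> x \<in> src ` Ar \<Longrightarrow> finite U \<Longrightarrow> U \<subseteq> fib x \<Longrightarrow> finite V \<Longrightarrow> V \<subseteq> fib x \<Longrightarrow> l2 (ap f v V) U \<le> M * l2 v V"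
  and nbd_nonneg: "nbd f M \<Longrightarrow> 0 \<le> M"
  unfolding nbd_def by blast+

lemma l2_nonneg: "0 \<le> l2 v V" by (rule L2_set_nonneg)

lemma l2_power2: "(l2 v V)\<^sup>2 = (\<Sum>\<gamma>\<in>V. (cmod (v \<gamma>))\<^sup>2)"
  unfolding L2_set_def by (rule real_sqrt_pow2) (simp add: sum_nonneg)

lemma l2_power2_cnj: "complex_of_real ((l2 v V)\<^sup>2) = (\<Sum>\<gamma>\<in>V. cnj (v \<gamma>) * v \<gamma>)"
  unfolding l2_power2 of_real_sum by (rule sum.cong[OF refl]) (simp only: complex_norm_square mult.commute)

lemma l2_mono: assumes "finite U'" "U \<subseteq> U'" shows "l2 v U \<le> l2 v U'"
  unfolding L2_set_def using assms by (intro real_sqrt_le_mono sum_mono2) auto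

lemma l2_scale: "l2 (\<lambda>\<gamma>. c * v \<gamma>) V = cmod c * l2 v V"
  by (simp add: norm_mult L2_set_right_distrib)

lemma cauchy_schwarz: "cmod (\<Sum>\<gamma>\<in>V. w \<gamma> * v \<gamma>) \<le> l2 w V * l2 v V"
proof -
  have "cmod (\<Sum>\<gamma>\<in>V. w \<gamma> * v \<gamma>) \<le> (\<Sum>\<gamma>\<in>V. \<bar>cmod (w \<gamma>)\<bar> * \<bar>cmod (v \<gamma>)\<bar>)"
    by (rule sum_norm_le) (simp add: norm_mult)
  also have "\<dots> \<le> l2 w V * l2 v V" by (rule L2_set_mult_ineq)
  finally show ?thesis .
qed

lemma l2_cnj: "l2 (\<lambda>\<gamma>. cnj (v \<gamma>)) V = l2 v V" by simp

lemma cancel_l2: assumes "(l2 z U)\<^sup>2 \<le> k * l2 z U" "0 \<le> k" shows "l2 z U \<le> k"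
proof (cases "l2 z U = 0")
  case False
  then have "0 < l2 z U" using l2_nonneg[of z U] by linarith
  then show ?thesis using assms(1) by (simp add: power2_eq_square)
qed (use assms in simp)

lemma col_finite: assumes f: "ffin f" and b: "\<beta> \<in> fib x" shows "finite {\<gamma> \<in> fib x. f (\<gamma> \<div> \<beta>) \<noteq> 0}"
proof (rule finite_imageD)
  have b': "\<beta> \<in> Ar" "src \<beta> = x" using b by (simp_all add: fib_iff)
  have "(\<lambda>\<gamma>. \<gamma> \<div> \<beta>) ` {\<gamma> \<in> fib x. f (\<gamma> \<div> \<beta>) \<noteq> 0} \<subseteq> {\<delta> \<in> Ar. src \<delta> = rng \<beta> \<and> f \<delta> \<noteq> 0}"
    using b' by (auto simp: fib_iff div_simps)
  then show "finite ((\<lambda>\<gamma>. \<gamma> \<div> \<beta>) ` {\<gamma> \<in> fib x. f (\<gamma> \<div> \<beta>) \<noteq> 0})"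
    by (rule finite_subset) (rule ffinD(2)[OF f])
  show "inj_on (\<lambda>\<gamma>. \<gamma> \<div> \<beta>) {\<gamma> \<in> fib x. f (\<gamma> \<div> \<beta>) \<noteq> 0}"
    by (rule inj_onI) (use b' div_inj in \<open>auto simp: fib_iff\<close>)
qed

lemma row_finite: assumes f: "ffin f" and b: "\<gamma> \<in> fib x" shows "finite {\<beta> \<in> fib x. f (\<gamma> \<div> \<beta>) \<noteq> 0}"
proof (rule finite_imageD)
  have b': "\<gamma> \<in> Ar" "src \<gamma> = x" using b by (simp_all add: fib_iff)
  have "(\<lambda>\<beta>. \<gamma> \<div> \<beta>) ` {\<beta> \<in> fib x. f (\<gamma> \<div> \<beta>) \<noteq> 0} \<subseteq> {\<delta> \<in> Ar. rng \<delta> = rng \<gamma> \<and> f \<delta> \<noteq> 0}"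
    using b' by (auto simp: fib_iff div_simps)
  then show "finite ((\<lambda>\<beta>. \<gamma> \<div> \<beta>) ` {\<beta> \<in> fib x. f (\<gamma> \<div> \<beta>) \<noteq> 0})"
    by (rule finite_subset) (rule ffinD(3)[OF f])
  show "inj_on (\<lambda>\<beta>. \<gamma> \<div> \<beta>) {\<beta> \<in> fib x. f (\<gamma> \<div> \<beta>) \<noteq> 0}"
    by (rule inj_onI) (use b' div_inj2 in \<open>auto simp: fib_iff\<close>)
qed

text \<open>Enlarging the set of rows until it contains the whole columns over \<open>V\<close>
  makes truncated matrix products exact.\<close>

lemma cols_finite: assumes f: "ffin f" and V: "finite V" "V \<subseteq> fib x" and U: "finite U" "U \<subseteq> fib x"
  shows "\<exists>U'. finite U' \<and> U \<subseteq> U' \<and> U' \<subseteq> fib x \<and> (\<forall>\<beta>\<in>V. {\<gamma> \<in> fib x. f (\<gamma> \<div> \<beta>) \<noteq> 0} \<subseteq> U')"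
proof (intro exI conjI)
  let ?U = "U \<union> (\<Union>\<beta>\<in>V. {\<gamma> \<in> fib x. f (\<gamma> \<div> \<beta>) \<noteq> 0})"
  show "finite ?U" using V U col_finite[OF f] by auto
qed (use U in auto)

lemma nbd_add: assumes f: "nbd f M" and g: "nbd g K" shows "nbd (\<lambda>\<gamma>. f \<gamma> + g \<gamma>) (M + K)"
proof (rule nbdI)
  fix x U V v assume a: "x \<in> src ` Ar" "finite U" "U \<subseteq> fib x" "finite V" "V \<subseteq> fib x"
  have "l2 (ap (\<lambda>\<gamma>. f \<gamma> + g \<gamma>) v V) U \<le> L2_set (\<lambda>\<gamma>. cmod (ap f v V \<gamma>) + cmod (ap g v V \<gamma>)) U"
    by (rule L2_set_mono) (simp_all add: ap_def distrib_right sum.distrib norm_triangle_ineq)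
  also have "\<dots> \<le> l2 (ap f v V) U + l2 (ap g v V) U" by (rule L2_set_triangle_ineq)
  also have "\<dots> \<le> M * l2 v V + K * l2 v V" by (intro add_mono nbdD[OF f a] nbdD[OF g a])
  finally show "l2 (ap (\<lambda>\<gamma>. f \<gamma> + g \<gamma>) v V) U \<le> (M + K) * l2 v V" by (simp add: distrib_right)
qed (use nbd_nonneg[OF f] nbd_nonneg[OF g] in simp)

lemma nbd_scale: assumes f: "nbd f M" shows "nbd (\<lambda>\<gamma>. c * f \<gamma>) (cmod c * M)"
proof (rule nbdI)
  fix x U V v assume a: "x \<in> src ` Ar" "finite U" "U \<subseteq> fib x" "finite V" "V \<subseteq> fib x"
  have "ap (\<lambda>\<gamma>. c * f \<gamma>) v V = (\<lambda>\<gamma>. c * ap f v V \<gamma>)"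
    by (rule ext) (simp only: ap_def sum_distrib_left mult.assoc)
  then have "l2 (ap (\<lambda>\<gamma>. c * f \<gamma>) v V) U = cmod c * l2 (ap f v V) U" by (simp only: l2_scale)
  also have "\<dots> \<le> cmod c * (M * l2 v V)" by (intro mult_left_mono nbdD[OF f a]) simp
  finally show "l2 (ap (\<lambda>\<gamma>. c * f \<gamma>) v V) U \<le> cmod c * M * l2 v V" by (simp add: mult.assoc)
qed (use nbd_nonneg[OF f] in simp)

lemma ap_mult:
  assumes a: "V \<subseteq> fib x" "\<gamma> \<in> fib x" and U: "finite U" "U \<subseteq> fib x" "\<forall>\<beta>\<in>V. {\<delta> \<in> fib x. g (\<delta> \<div> \<beta>) \<noteq> 0} \<subseteq> U"
  shows "ap (f \<otimes>\<^bsub>Cc\<^esub> g) v V \<gamma> = ap f (ap g v V) U \<gamma>"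
proof -
  have "ap (f \<otimes>\<^bsub>Cc\<^esub> g) v V \<gamma> = (\<Sum>\<beta>\<in>V. (\<Sum>\<delta>\<in>U. f (\<gamma> \<div> \<delta>) * g (\<delta> \<div> \<beta>)) * v \<beta>)"
    unfolding ap_def by (rule sum.cong[OF refl], subst conv3[OF a(2) _ U(1,2)]) (use a U in auto)
  also have "\<dots> = (\<Sum>\<beta>\<in>V. \<Sum>\<delta>\<in>U. f (\<gamma> \<div> \<delta>) * (g (\<delta> \<div> \<beta>) * v \<beta>))" by (simp add: sum_distrib_right mult.assoc)
  also have "\<dots> = (\<Sum>\<delta>\<in>U. \<Sum>\<beta>\<in>V. f (\<gamma> \<div> \<delta>) * (g (\<delta> \<div> \<beta>) * v \<beta>))" by (rule sum.swap)
  finally show ?thesis by (simp add: ap_def sum_distrib_left)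
qed

lemma nbd_mult: assumes f: "nbd f M" and g: "nbd g K" "ffin g" shows "nbd (f \<otimes>\<^bsub>Cc\<^esub> g) (M * K)"
proof (rule nbdI)
  fix x U V v assume a: "x \<in> src ` Ar" "finite U" "U \<subseteq> fib x" "finite V" "V \<subseteq> fib x"
  obtain U' where U': "finite U'" "U \<subseteq> U'" "U' \<subseteq> fib x" "\<forall>\<beta>\<in>V. {\<gamma> \<in> fib x. g (\<gamma> \<div> \<beta>) \<noteq> 0} \<subseteq> U'"
    using cols_finite[OF g(2) a(4,5,2,3)] by blast
  have "l2 (ap (f \<otimes>\<^bsub>Cc\<^esub> g) v V) U = l2 (ap f (ap g v V) U') U"
    by (rule L2_set_cong) (use a ap_mult[OF a(5) _ U'(1,3,4)] in auto)
  also have "\<dots> \<le> M * l2 (ap g v V) U'" by (rule nbdD[OF f a(1-3) U'(1,3)])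
  also have "\<dots> \<le> M * (K * l2 v V)" by (intro mult_left_mono nbdD[OF g(1) a(1) U'(1,3) a(4,5)] nbd_nonneg[OF f])
  finally show "l2 (ap (f \<otimes>\<^bsub>Cc\<^esub> g) v V) U \<le> M * K * l2 v V" by (simp add: mult.assoc)
qed (use nbd_nonneg[OF f] nbd_nonneg[OF g(1)] in simp)

lemma star_div: "\<lbrakk>\<gamma> \<in> fib x; \<beta> \<in> fib x\<rbrakk> \<Longrightarrow> star Cc f (\<gamma> \<div> \<beta>) = cnj (f (\<beta> \<div> \<gamma>))"
  by (simp add: cc_ops fib_iff div_simps)

lemma adjoint:
  assumes "U \<subseteq> fib x" "V \<subseteq> fib x"
  shows "(\<Sum>\<gamma>\<in>U. cnj (z \<gamma>) * ap f v V \<gamma>) = (\<Sum>\<beta>\<in>V. cnj (ap (star Cc f) z U \<beta>) * v \<beta>)"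
proof -
  have "(\<Sum>\<gamma>\<in>U. cnj (z \<gamma>) * ap f v V \<gamma>) = (\<Sum>\<gamma>\<in>U. \<Sum>\<beta>\<in>V. cnj (z \<gamma>) * (f (\<gamma> \<div> \<beta>) * v \<beta>))"
    by (simp add: ap_def sum_distrib_left)
  also have "\<dots> = (\<Sum>\<beta>\<in>V. \<Sum>\<gamma>\<in>U. cnj (z \<gamma>) * (f (\<gamma> \<div> \<beta>) * v \<beta>))" by (rule sum.swap)
  also have "\<dots> = (\<Sum>\<beta>\<in>V. cnj (ap (star Cc f) z U \<beta>) * v \<beta>)"
  proof (rule sum.cong[OF refl])
    fix \<beta> assume b: "\<beta> \<in> V"
    have "ap (star Cc f) z U \<beta> = (\<Sum>\<gamma>\<in>U. cnj (f (\<gamma> \<div> \<beta>)) * z \<gamma>)"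
      unfolding ap_def by (rule sum.cong[OF refl], subst star_div[of _ x]) (use assms b in auto)
    then show "(\<Sum>\<gamma>\<in>U. cnj (z \<gamma>) * (f (\<gamma> \<div> \<beta>) * v \<beta>)) = cnj (ap (star Cc f) z U \<beta>) * v \<beta>"
      by (simp add: sum_distrib_left mult_ac)
  qed
  finally show ?thesis .
qed

text \<open>With \<open>z\<close> the image of \<open>v\<close> under the adjoint, the squared norm
  of \<open>z\<close> is an inner product of f z with \<open>v\<close>; Cauchy-Schwarz bounds it by
  \<open>M\<close> times both norms, and one factor cancels.\<close>

lemma nbd_star: assumes f: "nbd f M" "ffin f" shows "nbd (star Cc f) M"
proof (rule nbdI)
  fix x U V v assume a: "x \<in> src ` Ar" "finite U" "U \<subseteq> fib x" "finite V" "V \<subseteq> fib x"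
  define z where "z = ap (star Cc f) v V"
  have "complex_of_real ((l2 z U)\<^sup>2) = (\<Sum>\<gamma>\<in>U. cnj (z \<gamma>) * ap (star Cc f) v V \<gamma>)"
    unfolding l2_power2_cnj by (simp add: z_def)
  also have "\<dots> = (\<Sum>\<beta>\<in>V. cnj (ap f z U \<beta>) * v \<beta>)"
    using adjoint[OF a(3,5), of z "star Cc f" v] by (simp add: star_star_fun f(2))
  finally have "(l2 z U)\<^sup>2 = cmod (\<Sum>\<beta>\<in>V. cnj (ap f z U \<beta>) * v \<beta>)" by (metis norm_of_real abs_of_nonneg zero_le_power2)
  also have "\<dots> \<le> l2 (\<lambda>\<beta>. cnj (ap f z U \<beta>)) V * l2 v V" by (rule cauchy_schwarz)
  also have "\<dots> \<le> (M * l2 z U) * l2 v V"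
    unfolding l2_cnj by (intro mult_right_mono nbdD[OF f(1) a(1,4,5,2,3)] l2_nonneg)
  finally have "(l2 z U)\<^sup>2 \<le> (M * l2 v V) * l2 z U" by (simp add: mult_ac)
  then show "l2 (ap (star Cc f) v V) U \<le> M * l2 v V"
    unfolding z_def[symmetric] by (rule cancel_l2) (simp add: nbd_nonneg[OF f(1)] l2_nonneg)
qed (rule nbd_nonneg[OF f(1)])

text \<open>Once the rows contain all columns over \<open>V\<close>, the squared norm of f v is the
  inner product of f* f v with \<open>v\<close>, without truncation error.\<close>

lemma nbd_cstar: assumes f: "nbd (star Cc f \<otimes>\<^bsub>Cc\<^esub> f) M" "ffin f" shows "nbd f (sqrt M)"
proof (rule nbdI)
  have M: "0 \<le> M" by (rule nbd_nonneg[OF f(1)])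
  fix x U V v assume a: "x \<in> src ` Ar" "finite U" "U \<subseteq> fib x" "finite V" "V \<subseteq> fib x"
  obtain U' where U': "finite U'" "U \<subseteq> U'" "U' \<subseteq> fib x" "\<forall>\<beta>\<in>V. {\<gamma> \<in> fib x. f (\<gamma> \<div> \<beta>) \<noteq> 0} \<subseteq> U'"
    using cols_finite[OF f(2) a(4,5,2,3)] by blast
  define z where "z = ap f v V"
  have "complex_of_real ((l2 z U')\<^sup>2) = (\<Sum>\<gamma>\<in>U'. cnj (z \<gamma>) * ap f v V \<gamma>)"
    unfolding l2_power2_cnj by (simp add: z_def)
  also have "\<dots> = (\<Sum>\<beta>\<in>V. cnj (ap (star Cc f) z U' \<beta>) * v \<beta>)" by (rule adjoint[OF U'(3) a(5)])
  also have "\<dots> = (\<Sum>\<beta>\<in>V. cnj (ap (star Cc f \<otimes>\<^bsub>Cc\<^esub> f) v V \<beta>) * v \<beta>)"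
    by (rule sum.cong[OF refl], subst ap_mult[OF a(5) _ U'(1,3,4)]) (use a in \<open>auto simp: z_def\<close>)
  finally have "(l2 z U')\<^sup>2 = cmod (\<Sum>\<beta>\<in>V. cnj (ap (star Cc f \<otimes>\<^bsub>Cc\<^esub> f) v V \<beta>) * v \<beta>)" by (metis norm_of_real abs_of_nonneg zero_le_power2)
  also have "\<dots> \<le> l2 (\<lambda>\<beta>. cnj (ap (star Cc f \<otimes>\<^bsub>Cc\<^esub> f) v V \<beta>)) V * l2 v V" by (rule cauchy_schwarz)
  also have "\<dots> \<le> (M * l2 v V) * l2 v V"
    unfolding l2_cnj by (intro mult_right_mono nbdD[OF f(1) a(1,4,5,4,5)] l2_nonneg)
  finally have "l2 z U' \<le> sqrt (M * (l2 v V)\<^sup>2)" by (intro real_le_rsqrt) (simp add: power2_eq_square mult.assoc)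
  then have "l2 z U' \<le> sqrt M * l2 v V" by (simp add: real_sqrt_mult real_sqrt_abs l2_nonneg)
  then show "l2 (ap f v V) U \<le> sqrt M * l2 v V" using l2_mono[OF U'(1,2), of z] by (simp add: z_def)
qed (simp add: nbd_nonneg[OF f(1)])

lemma zero_l2: "(\<lambda>_. 0) \<in> l2_space (X :: 'g set)" "l2_norm (X :: 'g set) (\<lambda>_. 0) = 0"
  by (simp_all add: l2_space_def l2_norm_def)

lemma rep_row:
  assumes "finite V" "V \<subseteq> fib x" "\<And>\<beta>. \<lbrakk>\<beta> \<in> fib x; \<beta> \<notin> V\<rbrakk> \<Longrightarrow> f (\<gamma> \<div> \<beta>) * v \<beta> = 0"
  shows "regular_rep G x f v \<gamma> = ap f v V \<gamma>"
proof -
  have "regular_rep G x f v \<gamma> = (\<Sum>\<^sub>\<infinity>\<beta>\<in>V. f (\<gamma> \<div> \<beta>) * v \<beta>)"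
    unfolding regular_rep_def by (rule infsum_cong_neutral) (use assms in auto)
  then show ?thesis using assms(1) by (simp add: ap_def)
qed

text \<open>Rows of \<open>f\<close> are finite, so finitely many coordinates of the image depend on
  a finite section only; a bound for all finite sections therefore extends to l^2.\<close>

lemma rep_bound:
  assumes f: "nbd f M" "ffin f" and x: "x \<in> src ` Ar" and v: "v \<in> l2_space (fib x)"
  shows "(\<lambda>\<gamma>. (cmod (regular_rep G x f v \<gamma>))\<^sup>2) summable_on fib x"
    "l2_norm (fib x) (regular_rep G x f v) \<le> M * l2_norm (fib x) v"
proof -
  let ?r = "regular_rep G x f v" and ?n = "l2_norm (fib x) v"
  have n0: "0 \<le> ?n" unfolding l2_norm_def by (simp add: infsum_nonneg)
  have b: "(\<Sum>\<gamma>\<in>U. (cmod (?r \<gamma>))\<^sup>2) \<le> (M * ?n)\<^sup>2" if U: "finite U" "U \<subseteq> fib x" for U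
  proof -
    define V where "V = (\<Union>\<gamma>\<in>U. {\<beta> \<in> fib x. f (\<gamma> \<div> \<beta>) \<noteq> 0})"
    have V: "finite V" "V \<subseteq> fib x" using U row_finite[OF f(2)] by (auto simp: V_def)
    have "(\<Sum>\<gamma>\<in>V. (cmod (v \<gamma>))\<^sup>2) \<le> (\<Sum>\<^sub>\<infinity>\<gamma>\<in>fib x. (cmod (v \<gamma>))\<^sup>2)"
      using v V by (intro finite_sum_le_infsum) (simp_all add: l2_space_def)
    then have vV: "l2 v V \<le> ?n" unfolding L2_set_def l2_norm_def by (rule real_sqrt_le_mono)
    have "l2 ?r U = l2 (ap f v V) U"
      by (rule L2_set_cong[OF refl], subst rep_row[OF V]) (auto simp: V_def)
    also have "\<dots> \<le> M * l2 v V" by (rule nbdD[OF f(1) x U V])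
    also have "\<dots> \<le> M * ?n" by (rule mult_left_mono[OF vV nbd_nonneg[OF f(1)]])
    finally show ?thesis unfolding l2_power2[symmetric] by (rule power_mono) (rule l2_nonneg)
  qed
  then show s: "(\<lambda>\<gamma>. (cmod (?r \<gamma>))\<^sup>2) summable_on fib x"
    by (intro nonneg_bdd_above_summable_on) (auto intro!: bdd_aboveI2[of _ _ "(M * ?n)\<^sup>2"])
  have "(\<Sum>\<^sub>\<infinity>\<gamma>\<in>fib x. (cmod (?r \<gamma>))\<^sup>2) \<le> (M * ?n)\<^sup>2" by (rule infsum_le_finite_sums[OF s b])
  then have "l2_norm (fib x) ?r \<le> sqrt ((M * ?n)\<^sup>2)" unfolding l2_norm_def by (rule real_sqrt_le_mono)
  then show "l2_norm (fib x) ?r \<le> M * ?n" using nbd_nonneg[OF f(1)] n0 by (simp add: real_sqrt_abs)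
qed

lemma reduced_norm_le:
  assumes f: "nbd f M" "ffin f" and ne: "Ar \<noteq> {}"
  shows "reduced_norm G f \<le> M"
    "\<And>x v. \<lbrakk>x \<in> src ` Ar; v \<in> l2_space (fib x); l2_norm (fib x) v \<le> 1\<rbrakk> \<Longrightarrow> l2_norm (fib x) (regular_rep G x f v) \<le> reduced_norm G f"
proof -
  let ?A = "{l2_norm (fib x) (regular_rep G x f v) | x v. x \<in> src ` Ar \<and> v \<in> l2_space (fib x) \<and> l2_norm (fib x) v \<le> 1}"
  have le: "y \<le> M" if "y \<in> ?A" for y
  proof -
    obtain x v where xv: "y = l2_norm (fib x) (regular_rep G x f v)" "x \<in> src ` Ar" "v \<in> l2_space (fib x)" "l2_norm (fib x) v \<le> 1"
      using \<open>y \<in> ?A\<close> by blast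
    have "M * l2_norm (fib x) v \<le> M" using xv(4) nbd_nonneg[OF f(1)] by (simp add: mult_left_le)
    then show ?thesis using rep_bound(2)[OF f xv(2,3)] xv(1) by linarith
  qed
  obtain x where x: "x \<in> src ` Ar" using ne by blast
  have "l2_norm (fib x) (regular_rep G x f (\<lambda>_. 0)) \<in> ?A"
    using x zero_l2[of "fib x"] by (intro CollectI exI[of _ x] exI[of _ "\<lambda>_. 0"]) simp
  then have A: "?A \<noteq> {}" by blast
  show "reduced_norm G f \<le> M" unfolding reduced_norm_def by (rule cSup_least[OF A le])
  have bd: "bdd_above ?A" using le by (intro bdd_aboveI[of _ M]) blast
  show "l2_norm (fib x) (regular_rep G x f v) \<le> reduced_norm G f"
    if "x \<in> src ` Ar" "v \<in> l2_space (fib x)" "l2_norm (fib x) v \<le> 1" for x v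
    unfolding reduced_norm_def by (rule cSup_upper[OF _ bd]) (use that in blast)
qed

text \<open>A finitely supported vector, normalised and extended by zero, is an admissible test
  vector in the supremum. Hence the reduced norm is itself a bound for the finite sections, and the
  least one.\<close>

lemma reduced_norm_nbd:
  assumes f: "nbd f M" "ffin f" and ne: "Ar \<noteq> {}"
  shows "nbd f (reduced_norm G f)"
proof (rule nbdI)
  note rl = reduced_norm_le(2)[OF f ne]
  obtain x0 where x0: "x0 \<in> src ` Ar" using ne by blast
  have "0 \<le> l2_norm (fib x0) (regular_rep G x0 f (\<lambda>_. 0))" unfolding l2_norm_def by (simp add: infsum_nonneg)
  also have "\<dots> \<le> reduced_norm G f"
    by (rule rl[OF x0 zero_l2(1)]) (subst zero_l2(2), rule zero_le_one)
  finally show "0 \<le> reduced_norm G f" .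
  fix x U V v assume a: "x \<in> src ` Ar" "finite U" "U \<subseteq> fib x" "finite V" "V \<subseteq> fib x"
  define c where "c = l2 v V"
  show "l2 (ap f v V) U \<le> reduced_norm G f * l2 v V"
  proof (cases "c = 0")
    case True
    then have "\<forall>\<beta>\<in>V. v \<beta> = 0" using a(4) by (simp add: c_def L2_set_eq_0_iff)
    then have "ap f v V = (\<lambda>_. 0)" by (intro ext) (simp add: ap_def)
    then show ?thesis using True by (simp add: c_def L2_set_def)
  next
    case False
    then have c: "0 < c" using l2_nonneg[of v V] unfolding c_def by linarith
    define v' where "v' = (\<lambda>\<beta>. if \<beta> \<in> V then v \<beta> / complex_of_real c else 0)"
    have s: "((\<lambda>\<gamma>. (cmod (v' \<gamma>))\<^sup>2) summable_on fib x) = ((\<lambda>\<gamma>. (cmod (v' \<gamma>))\<^sup>2) summable_on V)"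
      by (rule summable_on_cong_neutral) (use a(5) in \<open>auto simp: v'_def\<close>)
    then have v'1: "v' \<in> l2_space (fib x)" using a(4) by (simp add: l2_space_def)
    have "(\<Sum>\<^sub>\<infinity>\<gamma>\<in>fib x. (cmod (v' \<gamma>))\<^sup>2) = (\<Sum>\<^sub>\<infinity>\<gamma>\<in>V. (cmod (v' \<gamma>))\<^sup>2)"
      by (rule infsum_cong_neutral) (use a(5) in \<open>auto simp: v'_def\<close>)
    also have "\<dots> = (\<Sum>\<gamma>\<in>V. (cmod (v \<gamma>))\<^sup>2 / c\<^sup>2)" using a(4) by (simp add: v'_def norm_divide power_divide)
    also have "\<dots> = 1" using c by (simp add: sum_divide_distrib[symmetric] l2_power2[symmetric] c_def[symmetric])
    finally have v'2: "l2_norm (fib x) v' \<le> 1" by (simp add: l2_norm_def)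
    let ?r = "regular_rep G x f v'"
    have r: "?r \<gamma> = (1 / complex_of_real c) * ap f v V \<gamma>" for \<gamma>
      by (subst rep_row[OF a(4,5)]) (simp_all add: v'_def ap_def sum_divide_distrib)
    have "(\<Sum>\<gamma>\<in>U. (cmod (?r \<gamma>))\<^sup>2) \<le> (\<Sum>\<^sub>\<infinity>\<gamma>\<in>fib x. (cmod (?r \<gamma>))\<^sup>2)"
      by (rule finite_sum_le_infsum[OF rep_bound(1)[OF f a(1) v'1] a(2,3)]) simp
    then have "l2 ?r U \<le> l2_norm (fib x) ?r" unfolding L2_set_def l2_norm_def by (rule real_sqrt_le_mono)
    also have "\<dots> \<le> reduced_norm G f" by (rule rl[OF a(1) v'1 v'2])
    finally have "1 / c * l2 (ap f v V) U \<le> reduced_norm G f"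
      unfolding r l2_scale using c by (simp add: norm_divide)
    then show ?thesis using c by (simp add: c_def[symmetric] field_simps)
  qed
qed

end

text \<open>What must be known about C_c for the reduced norm to be a C*-seminorm, kept apart from
  the topology that provides it.\<close>

locale cc_groupoid = groupoid +
  assumes cc_ffin: "f \<in> carrier Cc \<Longrightarrow> ffin f"
    and cc_bounded: "f \<in> carrier Cc \<Longrightarrow> \<exists>M. nbd f M"
    and cc_zero: "\<zero>\<^bsub>Cc\<^esub> \<in> carrier Cc"
    and cc_add_closed: "\<lbrakk>f \<in> carrier Cc; g \<in> carrier Cc\<rbrakk> \<Longrightarrow> f \<oplus>\<^bsub>Cc\<^esub> g \<in> carrier Cc"
    and cc_mult_closed: "\<lbrakk>f \<in> carrier Cc; g \<in> carrier Cc\<rbrakk> \<Longrightarrow> f \<otimes>\<^bsub>Cc\<^esub> g \<in> carrier Cc"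
    and cc_scale_closed: "f \<in> carrier Cc \<Longrightarrow> scale Cc c f \<in> carrier Cc"
    and cc_star_closed: "f \<in> carrier Cc \<Longrightarrow> star Cc f \<in> carrier Cc"
    and arrows_nonempty: "Ar \<noteq> {}"
begin

lemma Cc_algebra: "star_algebra Cc"
  by (rule cc_star_algebra) (simp_all add: cc_ffin cc_zero cc_add_closed cc_mult_closed cc_scale_closed cc_star_closed)

abbreviation "rn \<equiv> reduced_norm G"

lemma rn_nbd: "f \<in> carrier Cc \<Longrightarrow> nbd f (rn f)"
  using cc_bounded reduced_norm_nbd cc_ffin arrows_nonempty by blast

lemma rn_le: "f \<in> carrier Cc \<Longrightarrow> nbd f M \<Longrightarrow> rn f \<le> M"
  using reduced_norm_le(1) cc_ffin arrows_nonempty by blast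

lemma rn_scale_le: assumes f: "f \<in> carrier Cc" shows "rn (scale Cc c f) \<le> cmod c * rn f"
  using rn_le[OF cc_scale_closed[OF f], of c "cmod c * rn f"] nbd_scale[OF rn_nbd[OF f], of c] by (simp add: cc_ops)

lemma rn_star_le: "f \<in> carrier Cc \<Longrightarrow> rn (star Cc f) \<le> rn f"
  by (rule rn_le[OF cc_star_closed nbd_star[OF rn_nbd cc_ffin]])

lemma rn_mult: "f \<in> carrier Cc \<Longrightarrow> g \<in> carrier Cc \<Longrightarrow> rn (f \<otimes>\<^bsub>Cc\<^esub> g) \<le> rn f * rn g"
  by (rule rn_le[OF cc_mult_closed nbd_mult[OF rn_nbd rn_nbd cc_ffin]])

theorem reduced_seminorm: "cstar_seminorm Cc rn"
  unfolding cstar_seminorm_def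
proof (intro conjI ballI allI)
  fix f assume f: "f \<in> carrier Cc"
  show n0: "0 \<le> rn f" by (rule nbd_nonneg[OF rn_nbd[OF f]])
  show "rn (scale Cc c f) = cmod c * rn f" for c
  proof (cases "c = 0")
    case True
    then show ?thesis using rn_scale_le[OF f, of 0] nbd_nonneg[OF rn_nbd[OF cc_scale_closed[OF f, of 0]]] by simp
  next
    case False
    have "scale Cc (1/c) (scale Cc c f) = f" using False by (simp add: cc_ops)
    then have "rn f \<le> cmod (1/c) * rn (scale Cc c f)" using rn_scale_le[OF cc_scale_closed[OF f, of c], of "1/c"] by simp
    then have "cmod c * rn f \<le> rn (scale Cc c f)" using False by (simp add: norm_divide field_simps)
    then show ?thesis using rn_scale_le[OF f, of c] by simp
  qed
  have ff: "star Cc f \<otimes>\<^bsub>Cc\<^esub> f \<in> carrier Cc" by (intro cc_mult_closed cc_star_closed f)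
  show "rn (star Cc f \<otimes>\<^bsub>Cc\<^esub> f) = (rn f)\<^sup>2"
  proof (rule antisym)
    have "rn (star Cc f \<otimes>\<^bsub>Cc\<^esub> f) \<le> rn (star Cc f) * rn f" by (rule rn_mult[OF cc_star_closed[OF f] f])
    also have "\<dots> \<le> (rn f)\<^sup>2" unfolding power2_eq_square by (rule mult_right_mono[OF rn_star_le[OF f] n0])
    finally show "rn (star Cc f \<otimes>\<^bsub>Cc\<^esub> f) \<le> (rn f)\<^sup>2" .
    have "rn f \<le> sqrt (rn (star Cc f \<otimes>\<^bsub>Cc\<^esub> f))" by (rule rn_le[OF f nbd_cstar[OF rn_nbd[OF ff] cc_ffin[OF f]]])
    then have "(rn f)\<^sup>2 \<le> (sqrt (rn (star Cc f \<otimes>\<^bsub>Cc\<^esub> f)))\<^sup>2" by (rule power_mono[OF _ n0])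
    then show "(rn f)\<^sup>2 \<le> rn (star Cc f \<otimes>\<^bsub>Cc\<^esub> f)" using nbd_nonneg[OF rn_nbd[OF ff]] by simp
  qed
  fix g assume g: "g \<in> carrier Cc"
  show "rn (f \<oplus>\<^bsub>Cc\<^esub> g) \<le> rn f + rn g"
    using rn_le[OF cc_add_closed[OF f g]] nbd_add[OF rn_nbd[OF f] rn_nbd[OF g]] by (simp add: cc_ops)
  show "rn (f \<otimes>\<^bsub>Cc\<^esub> g) \<le> rn f * rn g" by (rule rn_mult[OF f g])
qed

text \<open>The value at \<gamma> is the matrix entry in row \<gamma> and in the column of the unit
  arrow at its source.\<close>

lemma eval_le_rn: assumes f: "f \<in> carrier Cc" and g: "\<gamma> \<in> Ar" shows "cmod (f \<gamma>) \<le> rn f"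
proof -
  let ?x = "src \<gamma>" and ?e = "un (src \<gamma>)"
  have e: "?e \<in> fib ?x" "\<gamma> \<in> fib ?x" "?x \<in> src ` Ar" using g by (simp_all add: fib_iff un_simps)
  have "l2 (ap f (\<lambda>_. 1) {?e}) {\<gamma>} \<le> rn f * l2 (\<lambda>_. 1) {?e}"
    by (rule nbdD[OF rn_nbd[OF f] e(3)]) (simp_all add: e)
  then show ?thesis using g by (simp add: ap_def un_simps)
qed

text \<open>At a unit, f* f is the sum of |f|^2 over the source fibre, which dominates each single
  term. This trades a large value at an arbitrary arrow for a large value at a unit.\<close>

lemma star_mult_unit:
  assumes f: "f \<in> carrier Cc" and x: "x \<in> src ` Ar" and g: "\<gamma> \<in> fib x"
  shows "(cmod (f \<gamma>))\<^sup>2 \<le> cmod ((star Cc f \<otimes>\<^bsub>Cc\<^esub> f) (un x))"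
proof -
  obtain \<gamma>0 where g0: "\<gamma>0 \<in> Ar" "x = src \<gamma>0" using x by blast
  have u: "un x \<in> fib x" "un x \<in> Ar" using g0 by (simp_all add: fib_iff un_simps)
  have d: "\<delta> \<div> un x = \<delta>" if "\<delta> \<in> fib x" for \<delta> using that un_simps[of \<delta>] by (simp add: fib_iff) 
  let ?U = "insert \<gamma> {\<gamma> \<in> fib x. f (\<gamma> \<div> un x) \<noteq> 0}"
  have U: "finite ?U" using col_finite[OF cc_ffin[OF f] u(1)] by simp
  have "(star Cc f \<otimes>\<^bsub>Cc\<^esub> f) (un x \<div> un x) = (\<Sum>\<delta>\<in>?U. star Cc f (un x \<div> \<delta>) * f (\<delta> \<div> un x))"
    by (rule conv3[OF u(1,1) U]) (use g in auto)
  also have "\<dots> = (\<Sum>\<delta>\<in>?U. complex_of_real ((cmod (f \<delta>))\<^sup>2))"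
  proof (rule sum.cong[OF refl])
    fix \<delta> assume "\<delta> \<in> ?U"
    then have \<delta>: "\<delta> \<in> fib x" using g by auto
    then show "star Cc f (un x \<div> \<delta>) * f (\<delta> \<div> un x) = complex_of_real ((cmod (f \<delta>))\<^sup>2)"
      by (simp only: star_div[OF u(1) \<delta>] d complex_norm_square mult.commute)
  qed
  finally have "cmod ((star Cc f \<otimes>\<^bsub>Cc\<^esub> f) (un x)) = (\<Sum>\<delta>\<in>?U. (cmod (f \<delta>))\<^sup>2)"
    unfolding d[OF u(1)] of_real_sum[symmetric] by (simp only: norm_of_real) (simp add: sum_nonneg)
  moreover have "(cmod (f \<gamma>))\<^sup>2 \<le> (\<Sum>\<delta>\<in>?U. (cmod (f \<delta>))\<^sup>2)"
    using U by (intro member_le_sum) auto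
  ultimately show ?thesis by simp
qed

text \<open>This is the faithfulness of the conditional expectation: the matrix entries of a limit in the
  reduced norm are limits of matrix entries, and they determine the operator.\<close>

lemma null_of_pointwise:
  assumes f: "\<And>n. f n \<in> carrier Cc" and c: "\<And>\<epsilon>. \<epsilon> > 0 \<Longrightarrow> \<exists>M. \<forall>m\<ge>M. \<forall>n\<ge>M. rn (f m \<ominus>\<^bsub>Cc\<^esub> f n) < \<epsilon>"
    and p: "\<And>\<gamma>. \<gamma> \<in> Ar \<Longrightarrow> (\<lambda>n. f n \<gamma>) \<longlonglongrightarrow> 0"
  shows "(\<lambda>n. rn (f n)) \<longlonglongrightarrow> 0"
proof (rule LIMSEQ_I)
  interpret A: star_algebra Cc by (rule Cc_algebra)
  fix r :: real assume "0 < r"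
  then have r: "r/2 > 0" by simp
  obtain M where M: "\<And>m n. m \<ge> M \<Longrightarrow> n \<ge> M \<Longrightarrow> rn (f m \<ominus>\<^bsub>Cc\<^esub> f n) < r/2" using c[OF r] by blast
  have "rn (f m) \<le> r/2" if m: "m \<ge> M" for m
  proof (rule rn_le[OF f nbdI])
    fix x U V v assume a: "x \<in> src ` Ar" "finite U" "U \<subseteq> fib x" "finite V" "V \<subseteq> fib x"
    have z: "(\<lambda>n. l2 (ap (f n) v V) U) \<longlonglongrightarrow> 0"
    proof -
      have "(\<lambda>n. sqrt (\<Sum>\<gamma>\<in>U. (cmod (\<Sum>\<beta>\<in>V. f n (\<gamma> \<div> \<beta>) * v \<beta>))\<^sup>2)) \<longlonglongrightarrow> sqrt (\<Sum>\<gamma>\<in>U. (cmod (\<Sum>\<beta>\<in>V. 0 * v \<beta>))\<^sup>2)"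
      proof (intro tendsto_real_sqrt tendsto_sum tendsto_power tendsto_norm tendsto_mult tendsto_const p)
        fix \<gamma> \<beta> assume "\<gamma> \<in> U" "\<beta> \<in> V"
        then have "\<gamma> \<in> fib x" "\<beta> \<in> fib x" using a(3,5) by auto
        then show "\<gamma> \<div> \<beta> \<in> Ar" by (simp add: fib_iff div_simps(1))
      qed
      then show ?thesis by (simp add: L2_set_def ap_def)
    qed
    \<comment> \<open>For fixed finite \<open>U\<close> and \<open>V\<close> only finitely many
      values of f n occur, so letting n grow removes the second summand while m stays fixed.\<close>
    have "l2 (ap (f m) v V) U \<le> r/2 * l2 v V + l2 (ap (f n) v V) U" if n: "n \<ge> M" for n
    proof -
      let ?d = "f m \<ominus>\<^bsub>Cc\<^esub> f n"
      have d: "?d \<in> carrier Cc" using f by simp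
      have eq: "ap (f m) v V \<gamma> = ap ?d v V \<gamma> + ap (f n) v V \<gamma>" for \<gamma>
        using A.minus_scale[OF f f, of m n] by (simp add: ap_def cc_ops flip: sum.distrib) (simp add: algebra_simps)
      have "l2 (ap (f m) v V) U \<le> L2_set (\<lambda>\<gamma>. cmod (ap ?d v V \<gamma>) + cmod (ap (f n) v V \<gamma>)) U"
        by (rule L2_set_mono) (simp_all add: eq norm_triangle_ineq)
      also have "\<dots> \<le> l2 (ap ?d v V) U + l2 (ap (f n) v V) U" by (rule L2_set_triangle_ineq)
      also have "l2 (ap ?d v V) U \<le> rn ?d * l2 v V" by (rule nbdD[OF rn_nbd[OF d] a])
      also have "\<dots> \<le> r/2 * l2 v V" by (rule mult_right_mono[OF _ l2_nonneg]) (use M[OF m n] in simp)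
      finally show ?thesis by simp
    qed
    then have "\<exists>N. \<forall>n\<ge>N. l2 (ap (f m) v V) U \<le> r/2 * l2 v V + l2 (ap (f n) v V) U" by blast
    from LIMSEQ_le_const[OF tendsto_add[OF tendsto_const z] this]
    show "l2 (ap (f m) v V) U \<le> r/2 * l2 v V" by simp
  qed (use \<open>0 < r\<close> in simp)
  then have "norm (rn (f m) - 0) < r" if "m \<ge> M" for m
    using that nbd_nonneg[OF rn_nbd[OF f[of m]]] \<open>0 < r\<close> by fastforce
  then show "\<exists>no. \<forall>n\<ge>no. norm (rn (f n) - 0) < r" by blast
qed

end


section \<open>The tight groupoid\<close>

context inverse_monoid
begin

abbreviation "GG \<equiv> tight_groupoid S"
abbreviation "dm s \<equiv> tight_dom S (s\<dagger> \<cdot> s)"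

lemma dmD: assumes "\<xi> \<in> dm s" shows "\<xi> \<in> \<tau>" "s\<dagger> \<cdot> s \<in> \<xi>" "\<xi> \<in> sfilters S"
  using tight_domD[OF assms] by auto

lemma dmI: "\<xi> \<in> \<tau> \<Longrightarrow> s\<dagger> \<cdot> s \<in> \<xi> \<Longrightarrow> \<xi> \<in> dm s"
  by (simp add: tight_dom_def)

lemma dm_unit: "dm u = \<tau>"
  using filter_unit tight_filter by (auto simp: tight_dom_def inv_E unit_E unit_left unit_closed)

lemma act_dm: assumes "s \<in> carrier S" "\<xi> \<in> dm s" shows "tight_act S s \<xi> \<in> dm (s\<dagger>)"
  using act_tight[OF assms] assms(1) by (simp add: inv_inv)

lemma act_act_inv: "s \<in> carrier S \<Longrightarrow> \<xi> \<in> dm s \<Longrightarrow> tight_act S (s\<dagger>) (tight_act S s \<xi>) = \<xi>"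
  by (rule act_inv) (simp_all add: dmD)

text \<open>The domain idempotent of the product is t* s* s t, which lies below t* t; its membership
  in \<xi> says that s* s belongs to the translate of \<xi> by \<open>t\<close>.\<close>

lemma dm_comp: assumes s: "s \<in> carrier S" and t: "t \<in> carrier S" 
  shows "\<xi> \<in> dm (s \<cdot> t) \<longleftrightarrow> \<xi> \<in> dm t \<and> tight_act S t \<xi> \<in> dm s"
proof
  have c: "s\<dagger> \<in> carrier S" "t\<dagger> \<in> carrier S" using s t by (simp_all add: inv_closed)
  have eq: "(s \<cdot> t)\<dagger> \<cdot> (s \<cdot> t) = t\<dagger> \<cdot> ((s\<dagger> \<cdot> s) \<cdot> t)" using s t c by (simp add: inv_mult sm_assoc sm_closed)
  assume x: "\<xi> \<in> dm (s \<cdot> t)"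
  have m: "t\<dagger> \<cdot> ((s\<dagger> \<cdot> s) \<cdot> t) \<in> \<xi>" using dmD(2)[OF x] by (simp only: eq)
  have "(t\<dagger> \<cdot> t) \<cdot> (t\<dagger> \<cdot> ((s\<dagger> \<cdot> s) \<cdot> t)) = (t\<dagger> \<cdot> (t \<cdot> t\<dagger>)) \<cdot> ((s\<dagger> \<cdot> s) \<cdot> t)"
    using s t c by (simp add: sm_assoc sm_closed)
  also have "\<dots> = t\<dagger> \<cdot> ((s\<dagger> \<cdot> s) \<cdot> t)" using t by (simp add: regular_star)
  finally have d: "t\<dagger> \<cdot> t \<in> \<xi>" using filter_up[OF dmD(3)[OF x] m dom_E[OF t]] by simp
  have xt: "\<xi> \<in> dm t" by (rule dmI[OF dmD(1)[OF x] d])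
  have "s\<dagger> \<cdot> s \<in> tight_act S t \<xi>" using act_iff[OF t dmD(3)[OF x] d] m dom_E[OF s] by simp
  then show "\<xi> \<in> dm t \<and> tight_act S t \<xi> \<in> dm s" using xt dmI dmD(1)[OF act_dm[OF t xt]] by blast
next
  assume a: "\<xi> \<in> dm t \<and> tight_act S t \<xi> \<in> dm s"
  then show "\<xi> \<in> dm (s \<cdot> t)" using act_comp(1)[OF s t] by (blast intro: dmI dest: dmD)
qed

lemma act_act: "s \<in> carrier S \<Longrightarrow> t \<in> carrier S \<Longrightarrow> \<xi> \<in> dm t \<Longrightarrow> tight_act S t \<xi> \<in> dm s \<Longrightarrow>
    tight_act S s (tight_act S t \<xi>) = tight_act S (s \<cdot> t) \<xi>"
  by (rule act_comp(2)) (simp_all add: dmD)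

text \<open>Equality of germs at \<xi>, with the domain conditions kept separate.\<close>

definition eqg :: "'a \<Rightarrow> 'a \<Rightarrow> 'a set \<Rightarrow> bool" where
  "eqg s t \<xi> \<longleftrightarrow> (\<exists>e\<in>\<xi>. s \<cdot> e = t \<cdot> e)"

lemma eqg_refl: "\<xi> \<in> \<tau> \<Longrightarrow> eqg s s \<xi>" and eqg_sym: "eqg s t \<xi> \<Longrightarrow> eqg t s \<xi>"
  using filter_unit tight_filter by (auto simp: eqg_def dest: sym)

lemma eqg_trans:
  assumes "s \<in> carrier S" "t \<in> carrier S" "r \<in> carrier S" "\<xi> \<in> sfilters S" "eqg s t \<xi>" "eqg t r \<xi>"
  shows "eqg s r \<xi>"
proof -
  obtain e f where e: "e \<in> \<xi>" "s \<cdot> e = t \<cdot> e" and f: "f \<in> \<xi>" "t \<cdot> f = r \<cdot> f" using assms(5,6) unfolding eqg_def by blast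
  have E: "e \<in> E" "f \<in> E" "e \<in> carrier S" "f \<in> carrier S" using e f filter_sub[OF assms(4)] E_carrier by auto
  have "s \<cdot> (e \<cdot> f) = (t \<cdot> e) \<cdot> f" using assms E e by (simp flip: sm_assoc)
  also have "\<dots> = (t \<cdot> f) \<cdot> e" using assms E idem_commute[OF E(1,2)] by (simp add: sm_assoc)
  also have "\<dots> = r \<cdot> (e \<cdot> f)" using assms E idem_commute[OF E(1,2)] f by (simp add: sm_assoc)
  finally show ?thesis using filter_mult[OF assms(4) e(1) f(1)] unfolding eqg_def by blast
qed

lemma germ_alt: "germ S s \<xi> = {(t, \<eta>). t \<in> carrier S \<and> \<eta> = \<xi> \<and> \<xi> \<in> dm t \<and> eqg s t \<xi>}"
  unfolding germ_def eqg_def by auto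

lemma germ_eq_iff:
  assumes "s \<in> carrier S" "t \<in> carrier S" "\<xi> \<in> dm s" "\<eta> \<in> dm t"
  shows "germ S s \<xi> = germ S t \<eta> \<longleftrightarrow> \<xi> = \<eta> \<and> eqg s t \<xi>"
proof
  assume a: "germ S s \<xi> = germ S t \<eta>"
  have "(t, \<eta>) \<in> germ S t \<eta>" using assms eqg_refl[OF dmD(1)[OF assms(4)]] by (simp add: germ_alt)
  then have "(t, \<eta>) \<in> germ S s \<xi>" by (simp add: a)
  then show "\<xi> = \<eta> \<and> eqg s t \<xi>" by (simp add: germ_alt)
next
  assume a: "\<xi> = \<eta> \<and> eqg s t \<xi>"
  then have "eqg s r \<xi> \<longleftrightarrow> eqg t r \<xi>" if "r \<in> carrier S" for r
    using eqg_trans[OF assms(1,2) that] eqg_trans[OF assms(2,1) that] eqg_sym dmD(3)[OF assms(3)] by blast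
  then show "germ S s \<xi> = germ S t \<eta>" using a unfolding germ_alt by auto
qed

lemma germ_rep:
  assumes "s \<in> carrier S" "\<xi> \<in> dm s"
  shows "\<exists>t. germ_rep (germ S s \<xi>) = (t, \<xi>) \<and> t \<in> carrier S \<and> \<xi> \<in> dm t \<and> eqg s t \<xi>"
proof -
  have "(s, \<xi>) \<in> germ S s \<xi>" using assms eqg_refl[OF dmD(1)[OF assms(2)]] by (simp add: germ_alt)
  then have "germ_rep (germ S s \<xi>) \<in> germ S s \<xi>" unfolding germ_rep_def by (rule someI[of "\<lambda>a. a \<in> germ S s \<xi>"])
  then show ?thesis unfolding germ_alt by auto
qed

text \<open>Only conjugates cut down by an idempotent \<open>e\<close> of \<xi> matter, and below
  \<open>e\<close> the two elements coincide.\<close>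

lemma act_eqg:
  assumes s: "s \<in> carrier S" and t: "t \<in> carrier S" and x: "\<xi> \<in> dm s" "\<xi> \<in> dm t" and e: "eqg s t \<xi>"
  shows "tight_act S s \<xi> = tight_act S t \<xi>"
proof -
  obtain e where e: "e \<in> \<xi>" "s \<cdot> e = t \<cdot> e" using e unfolding eqg_def by blast
  note xf = dmD(3)[OF x(1)]
  have E: "e \<in> E" "e \<in> carrier S" using filter_sub[OF xf e(1)] E_carrier by auto
  have *: "r\<dagger> \<cdot> (f \<cdot> r) \<in> \<xi> \<longleftrightarrow> (r \<cdot> e)\<dagger> \<cdot> (f \<cdot> (r \<cdot> e)) \<in> \<xi>" if r: "r \<in> carrier S" and f: "f \<in> E" for r f
  proof -
    have "(r \<cdot> e)\<dagger> \<cdot> (f \<cdot> (r \<cdot> e)) = e \<cdot> ((r\<dagger> \<cdot> (f \<cdot> r)) \<cdot> e)"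
      using r f E by (simp add: inv_mult inv_E sm_assoc sm_closed inv_closed E_carrier)
    then show ?thesis
      using filter_mult_iff[OF xf E(1) E_mult[OF conj_E'[OF r f] E(1)]] filter_mult_iff[OF xf conj_E'[OF r f] E(1)] e(1) by simp
  qed
  show ?thesis
    using act_iff[OF s xf dmD(2)[OF x(1)]] act_iff[OF t xf dmD(2)[OF x(2)]] *[OF s] *[OF t] e(2) by (auto simp: set_eq_iff)
qed

lemma src_germ: "s \<in> carrier S \<Longrightarrow> \<xi> \<in> dm s \<Longrightarrow> gsrc GG (germ S s \<xi>) = \<xi>"
  using germ_rep[of s \<xi>] by (auto simp: tight_groupoid_def)

lemma rng_germ: "s \<in> carrier S \<Longrightarrow> \<xi> \<in> dm s \<Longrightarrow> grng GG (germ S s \<xi>) = tight_act S s \<xi>"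
  using germ_rep[of s \<xi>] act_eqg[of s _ \<xi>] by (auto simp: tight_groupoid_def)

text \<open>The composition of \<open>tight_groupoid\<close> picks representatives of both germs;
  this is its independence of the choice.\<close>

lemma comp_germ:
  assumes s: "s \<in> carrier S" and t: "t \<in> carrier S" and x: "\<xi> \<in> dm t" "tight_act S t \<xi> \<in> dm s"
  shows "gcomp GG (germ S s (tight_act S t \<xi>)) (germ S t \<xi>) = germ S (s \<cdot> t) \<xi>"
proof -
  obtain s' where s': "germ_rep (germ S s (tight_act S t \<xi>)) = (s', tight_act S t \<xi>)" "s' \<in> carrier S"
    "tight_act S t \<xi> \<in> dm s'" "eqg s s' (tight_act S t \<xi>)"
    using germ_rep[OF s x(2)] by blast
  obtain t' where t': "germ_rep (germ S t \<xi>) = (t', \<xi>)" "t' \<in> carrier S" "\<xi> \<in> dm t'" "eqg t t' \<xi>"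
    using germ_rep[OF t x(1)] by blast
  note xf = dmD(3)[OF x(1)]
  have at: "tight_act S t \<xi> = tight_act S t' \<xi>" by (rule act_eqg[OF t t'(2) x(1) t'(3,4)])
  obtain e where e: "e \<in> tight_act S t \<xi>" "s \<cdot> e = s' \<cdot> e" using s'(4) unfolding eqg_def by blast
  obtain f where f: "f \<in> \<xi>" "t \<cdot> f = t' \<cdot> f" using t'(4) unfolding eqg_def by blast
  have fE: "f \<in> E" "f \<in> carrier S" using filter_sub[OF xf f(1)] E_carrier by auto
  have eE: "e \<in> E" "e \<in> carrier S" and te: "t\<dagger> \<cdot> (e \<cdot> t) \<in> \<xi>" using e(1) act_iff[OF t xf dmD(2)[OF x(1)]] E_carrier by auto
  \<comment> \<open>\<open>g\<close> lies below an idempotent where \<open>t\<close> and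
    \<open>t'\<close> coincide, and its image under \<open>t\<close> lies where \<open>s\<close> and
    \<open>s'\<close> coincide; so it witnesses equality of the two products.\<close>
  define g where "g = (t\<dagger> \<cdot> (e \<cdot> t)) \<cdot> f"
  have gE: "t\<dagger> \<cdot> (e \<cdot> t) \<in> E" "t\<dagger> \<cdot> (e \<cdot> t) \<in> carrier S" using conj_E'[OF t eE(1)] E_carrier by auto
  have tg: "t \<cdot> g = e \<cdot> (t \<cdot> f)"
    using idem_swap[OF t eE(1)] t gE fE eE by (simp add: g_def flip: sm_assoc)
  have t'g: "t' \<cdot> g = e \<cdot> (t \<cdot> f)"
  proof -
    have "t' \<cdot> g = (t' \<cdot> f) \<cdot> (t\<dagger> \<cdot> (e \<cdot> t))"
      using idem_commute[OF gE(1) fE(1)] t'(2) gE fE by (simp add: g_def sm_assoc sm_closed)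
    also have "\<dots> = t \<cdot> g" using idem_commute[OF gE(1) fE(1)] t gE fE f(2)[symmetric] by (simp add: g_def sm_assoc sm_closed)
    finally show ?thesis by (simp add: tg)
  qed
  have gx: "g \<in> \<xi>" unfolding g_def by (rule filter_mult[OF xf te f(1)])
  have gc: "g \<in> carrier S" using gE fE by (simp add: g_def sm_closed)
  have "(s \<cdot> t) \<cdot> g = (s \<cdot> e) \<cdot> (t \<cdot> f)" using s t gc eE fE tg by (simp add: sm_assoc sm_closed)
  also have "\<dots> = (s' \<cdot> t') \<cdot> g" using s'(2) t'(2) gc eE fE t t'g e(2) by (simp add: sm_assoc sm_closed)
  finally have eq: "eqg (s \<cdot> t) (s' \<cdot> t') \<xi>" using gx unfolding eqg_def by blast
  have "germ S (s \<cdot> t) \<xi> = germ S (s' \<cdot> t') \<xi>"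
    using dm_comp[OF s t] dm_comp[OF s'(2) t'(2)] x t'(3) s'(3) at eq
    by (subst germ_eq_iff) (simp_all add: s t s'(2) t'(2) sm_closed)
  then show ?thesis using s'(1) t'(1) by (simp add: tight_groupoid_def)
qed

lemma eqg_inv:
  assumes s: "s \<in> carrier S" and t: "t \<in> carrier S" and x: "\<xi> \<in> dm s" and e: "eqg s t \<xi>"
  shows "eqg (s\<dagger>) (t\<dagger>) (tight_act S s \<xi>)"
proof -
  obtain e where e: "e \<in> \<xi>" "s \<cdot> e = t \<cdot> e" using e unfolding eqg_def by blast
  note xf = dmD(3)[OF x]
  have E: "e \<in> E" "e \<in> carrier S" using filter_sub[OF xf e(1)] E_carrier by auto
  have c: "s\<dagger> \<in> carrier S" "t\<dagger> \<in> carrier S" using s t by (simp_all add: inv_closed)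
  \<comment> \<open>The witness moves to the range side: \<open>e\<close> transported by
    \<open>s\<close>, which is the same as \<open>e\<close> transported by \<open>t\<close>.\<close>
  let ?f = "s \<cdot> (e \<cdot> s\<dagger>)"
  have adj: "e \<cdot> s\<dagger> = e \<cdot> t\<dagger>" using inv_mult[OF s E(2)] inv_mult[OF t E(2)] e(2) E by (simp add: inv_E)
  have low: "r\<dagger> \<cdot> (r \<cdot> (e \<cdot> r\<dagger>)) = e \<cdot> r\<dagger>" if r: "r \<in> carrier S" for r
  proof -
    have rc: "r\<dagger> \<in> carrier S" using r by (rule inv_closed)
    have "r\<dagger> \<cdot> (r \<cdot> (e \<cdot> r\<dagger>)) = (r\<dagger> \<cdot> r) \<cdot> (e \<cdot> r\<dagger>)" using r rc E by (simp add: sm_assoc sm_closed)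
    also have "\<dots> = e \<cdot> ((r\<dagger> \<cdot> r) \<cdot> r\<dagger>)" by (rule E_left_commute[OF dom_E[OF r] E(1) rc])
    finally show ?thesis using r rc by (simp add: sm_assoc regular_star)
  qed
  have "?f = (s \<cdot> e) \<cdot> s\<dagger>" using s c E by (simp add: sm_assoc)
  also have "\<dots> = t \<cdot> (e \<cdot> t\<dagger>)" unfolding e(2) using t c E adj by (simp add: sm_assoc)
  finally have "t\<dagger> \<cdot> ?f = e \<cdot> t\<dagger>" using low[OF t] by simp
  then have "s\<dagger> \<cdot> ?f = t\<dagger> \<cdot> ?f" using low[OF s] adj by simp
  moreover have "?f \<in> tight_act S s \<xi>"
  proof -
    have "s\<dagger> \<cdot> (?f \<cdot> s) = (s\<dagger> \<cdot> ?f) \<cdot> s" using s c E by (simp add: sm_assoc sm_closed)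
    also have "\<dots> = e \<cdot> (s\<dagger> \<cdot> s)" using low[OF s] s c E by (simp add: sm_assoc)
    also have "\<dots> \<in> \<xi>" by (rule filter_mult[OF xf e(1) dmD(2)[OF x]])
    finally show ?thesis using act_iff[OF s xf dmD(2)[OF x]] conj_E[OF s E(1)] by simp
  qed
  ultimately show ?thesis unfolding eqg_def by blast
qed

lemma inv_germ:
  assumes s: "s \<in> carrier S" and x: "\<xi> \<in> dm s"
  shows "ginv GG (germ S s \<xi>) = germ S (s\<dagger>) (tight_act S s \<xi>)"
proof -
  obtain t where t: "germ_rep (germ S s \<xi>) = (t, \<xi>)" "t \<in> carrier S" "\<xi> \<in> dm t" "eqg s t \<xi>"
    using germ_rep[OF s x] by blast
  have a: "tight_act S s \<xi> = tight_act S t \<xi>" by (rule act_eqg[OF s t(2) x t(3,4)])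
  have "germ S (s\<dagger>) (tight_act S s \<xi>) = germ S (t\<dagger>) (tight_act S t \<xi>)"
    using eqg_inv[OF s t(2) x t(4)] act_dm[OF s x] act_dm[OF t(2,3)] a
    by (subst germ_eq_iff) (simp_all add: inv_closed s t(2))
  then show ?thesis using t(1) by (simp add: tight_groupoid_def)
qed

lemma openin_dm: "s \<in> carrier S \<Longrightarrow> openin TT (dm s)"
  by (rule openin_dom[OF dom_E])

lemma openin_TT_D: assumes "openin TT U" "\<xi> \<in> U"
  shows "\<exists>W. finite W \<and> W \<subseteq> E \<and> (\<forall>\<eta>\<in>\<tau>. agree W \<eta> \<xi> \<longrightarrow> \<eta> \<in> U)"
  by (rule bspec[OF conjunct2[OF assms(1)[unfolded openin_TT]] assms(2)])

abbreviation "bas \<equiv> {bisection S s U | s U. s \<in> carrier S \<and> U \<subseteq> dm s \<and> openin TT U \<and> compactin TT U}"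

lemma gtop_GG: "gtop GG = topology_generated_by bas"
  by (simp add: tight_groupoid_def)

lemma arrows_GG: "\<gamma> \<in> arrows GG \<longleftrightarrow> (\<exists>s\<in>carrier S. \<exists>\<xi>\<in>dm s. \<gamma> = germ S s \<xi>)"
proof -
  have t: "topspace (gtop GG) = \<Union>bas" unfolding gtop_GG by (rule topology_generated_by_topspace)
  have "bisection S s (dm s) \<in> bas" if "s \<in> carrier S" for s
    using that openin_dm[OF that] compactin_dom[OF dom_E[OF that]] by blast
  moreover have "germ S s \<xi> \<in> bisection S s (dm s)" if "\<xi> \<in> dm s" for s \<xi>
    using that unfolding bisection_def by blast
  ultimately have 1: "\<gamma> \<in> \<Union>bas" if "s \<in> carrier S" "\<xi> \<in> dm s" "\<gamma> = germ S s \<xi>" for s \<xi>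
    using UnionI[of "bisection S s (dm s)" bas \<gamma>] that by simp
  have 2: "\<exists>s\<in>carrier S. \<exists>\<xi>\<in>dm s. \<gamma> = germ S s \<xi>" if g: "\<gamma> \<in> \<Union>bas"
  proof -
    obtain s U where "s \<in> carrier S" "U \<subseteq> dm s" "\<gamma> \<in> germ S s ` U" using g unfolding bisection_def by blast
    then show ?thesis by blast
  qed
  show ?thesis
    unfolding t
  proof
    show "\<exists>s\<in>carrier S. \<exists>\<xi>\<in>dm s. \<gamma> = germ S s \<xi>" if "\<gamma> \<in> \<Union>bas" using that by (rule 2)
    show "\<gamma> \<in> \<Union>bas" if g: "\<exists>s\<in>carrier S. \<exists>\<xi>\<in>dm s. \<gamma> = germ S s \<xi>"
    proof -
      obtain s \<xi> where "s \<in> carrier S" "\<xi> \<in> dm s" "\<gamma> = germ S s \<xi>" using g by auto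
      then show ?thesis by (rule 1)
    qed
  qed
qed

lemma germ_arrow: "s \<in> carrier S \<Longrightarrow> \<xi> \<in> dm s \<Longrightarrow> germ S s \<xi> \<in> arrows GG"
  using arrows_GG by blast

lemma germ_compose:
  assumes "\<gamma> \<in> arrows GG" "\<delta> \<in> arrows GG" "gsrc GG \<gamma> = grng GG \<delta>"
  shows "\<exists>s t \<xi>. s \<in> carrier S \<and> t \<in> carrier S \<and> \<xi> \<in> dm t \<and> tight_act S t \<xi> \<in> dm s \<and> \<gamma> = germ S s (tight_act S t \<xi>) \<and> \<delta> = germ S t \<xi>"
proof -
  obtain s \<eta> where s: "s \<in> carrier S" "\<eta> \<in> dm s" "\<gamma> = germ S s \<eta>" using assms(1) arrows_GG by blast
  obtain t \<xi> where t: "t \<in> carrier S" "\<xi> \<in> dm t" "\<delta> = germ S t \<xi>" using assms(2) arrows_GG by blast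
  have "\<eta> = tight_act S t \<xi>" using assms(3) s t by (simp add: src_germ rng_germ)
  then show ?thesis using s t by blast
qed

text \<open>A composite such as s* s t need not equal \<open>t\<close> in the monoid, only below
  some idempotent of the filter. Each cancellation law is therefore proved by exhibiting such an
  idempotent.\<close>

sublocale Gr: groupoid GG "germ S u"
proof
  fix \<gamma> \<delta> assume a: "\<gamma> \<in> arrows GG" "\<delta> \<in> arrows GG" "gsrc GG \<gamma> = grng GG \<delta>"
  obtain s t \<xi> where st: "s \<in> carrier S" "t \<in> carrier S" "\<xi> \<in> dm t" "tight_act S t \<xi> \<in> dm s" 
    "\<gamma> = germ S s (tight_act S t \<xi>)" "\<delta> = germ S t \<xi>" using germ_compose[OF a] by blast
  have c: "gcomp GG \<gamma> \<delta> = germ S (s \<cdot> t) \<xi>" unfolding st(5,6) by (rule comp_germ[OF st(1-4)])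
  have d: "\<xi> \<in> dm (s \<cdot> t)" "s \<cdot> t \<in> carrier S" using dm_comp[OF st(1,2)] st by (simp_all add: sm_closed)
  show "gcomp GG \<gamma> \<delta> \<in> arrows GG" unfolding c by (rule germ_arrow[OF d(2,1)])
  have "gsrc GG (gcomp GG \<gamma> \<delta>) = \<xi>" unfolding c by (rule src_germ[OF d(2,1)])
  then show "gsrc GG (gcomp GG \<gamma> \<delta>) = gsrc GG \<delta>" unfolding st(6) by (simp add: src_germ st(2,3))
  have "grng GG (gcomp GG \<gamma> \<delta>) = tight_act S (s \<cdot> t) \<xi>" unfolding c by (rule rng_germ[OF d(2,1)])
  then show "grng GG (gcomp GG \<gamma> \<delta>) = grng GG \<gamma>" unfolding st(5) by (simp add: rng_germ st(1-4) act_act)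
  have si: "s\<dagger> \<in> carrier S" "t\<dagger> \<in> carrier S" using st by (simp_all add: inv_closed)
  have ed: "\<xi> \<in> dm (s\<dagger> \<cdot> (s \<cdot> t))"
    using act_dm[OF d(2,1)] act_act[OF st(1,2,3,4)] act_dm[OF st(1,4)] dm_comp[OF si(1) d(2)] d(1) by simp
  \<comment> \<open>The idempotent is t* s* s t, the domain of the product, which belongs to
    \<xi>.\<close>
  have "(s\<dagger> \<cdot> (s \<cdot> t)) \<cdot> (t\<dagger> \<cdot> (s\<dagger> \<cdot> (s \<cdot> t))) = t \<cdot> (t\<dagger> \<cdot> (s\<dagger> \<cdot> (s \<cdot> t)))"
  proof -
    have "s\<dagger> \<cdot> (s \<cdot> t) = (s\<dagger> \<cdot> s) \<cdot> t" using st si by (simp add: sm_assoc)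
    also have "\<dots> = t \<cdot> (t\<dagger> \<cdot> ((s\<dagger> \<cdot> s) \<cdot> t))" by (rule idem_swap[OF st(2) dom_E[OF st(1)]])
    finally have 1: "s\<dagger> \<cdot> (s \<cdot> t) = t \<cdot> (t\<dagger> \<cdot> (s\<dagger> \<cdot> (s \<cdot> t)))" using st si by (simp add: sm_assoc)
    let ?e = "t\<dagger> \<cdot> ((s\<dagger> \<cdot> s) \<cdot> t)"
    have e: "?e \<in> E" by (rule conj_E'[OF st(2) dom_E[OF st(1)]])
    have e': "?e = t\<dagger> \<cdot> (s\<dagger> \<cdot> (s \<cdot> t))" using st si by (simp add: sm_assoc)
    have "(t \<cdot> ?e) \<cdot> ?e = t \<cdot> ?e" using st e E_carrier[OF e] by (simp add: sm_assoc E_idem)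
    then show ?thesis using 1 unfolding e' by simp
  qed
  moreover have "t\<dagger> \<cdot> (s\<dagger> \<cdot> (s \<cdot> t)) \<in> \<xi>" using dmD(2)[OF d(1)] st si by (simp add: inv_mult sm_assoc sm_closed)
  ultimately have eq1: "eqg (s\<dagger> \<cdot> (s \<cdot> t)) t \<xi>" unfolding eqg_def by blast
  have "ginv GG \<gamma> = germ S (s\<dagger>) (tight_act S (s \<cdot> t) \<xi>)"
    unfolding st(5) by (simp add: inv_germ st act_act)
  moreover have "tight_act S (s \<cdot> t) \<xi> \<in> dm (s\<dagger>)" using dm_comp[OF si(1) d(2)] ed by blast
  ultimately have "gcomp GG (ginv GG \<gamma>) (gcomp GG \<gamma> \<delta>) = germ S (s\<dagger> \<cdot> (s \<cdot> t)) \<xi>"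
    unfolding c by (simp add: comp_germ si d)
  also have "\<dots> = germ S t \<xi>" using germ_eq_iff[OF sm_closed[OF si(1) d(2)] st(2) ed st(3)] eq1 by simp
  finally show "gcomp GG (ginv GG \<gamma>) (gcomp GG \<gamma> \<delta>) = \<delta>" by (simp add: st)
  let ?\<eta> = "tight_act S t \<xi>"
  have \<eta>: "?\<eta> \<in> dm (t\<dagger>)" "tight_act S (t\<dagger>) ?\<eta> = \<xi>" using act_dm[OF st(2,3)] act_act_inv[OF st(2,3)] by auto
  have inv\<delta>: "ginv GG \<delta> = germ S (t\<dagger>) ?\<eta>" unfolding st(6) by (rule inv_germ[OF st(2,3)])
  have "gcomp GG (gcomp GG \<gamma> \<delta>) (ginv GG \<delta>) = gcomp GG (germ S (s \<cdot> t) (tight_act S (t\<dagger>) ?\<eta>)) (germ S (t\<dagger>) ?\<eta>)"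
    by (simp only: c inv\<delta> \<eta>(2))
  also have "\<dots> = germ S ((s \<cdot> t) \<cdot> t\<dagger>) ?\<eta>" by (rule comp_germ) (simp_all add: d si \<eta>)
  also have "\<dots> = germ S s ?\<eta>"
  proof (subst germ_eq_iff)
    show "?\<eta> \<in> dm ((s \<cdot> t) \<cdot> t\<dagger>)" using dm_comp[OF d(2) si(2)] \<eta> d(1) by simp
    \<comment> \<open>Here the range idempotent of \<open>t\<close> serves; it belongs to the
      translated filter.\<close>
    have "((s \<cdot> t) \<cdot> t\<dagger>) \<cdot> (t \<cdot> t\<dagger>) = s \<cdot> (t \<cdot> t\<dagger>)" using st si by (simp add: sm_assoc sm_closed regular_star)
    moreover have "t \<cdot> t\<dagger> \<in> ?\<eta>" using dmD(2)[OF \<eta>(1)] st by (simp add: inv_inv)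
    ultimately show "?\<eta> = ?\<eta> \<and> eqg ((s \<cdot> t) \<cdot> t\<dagger>) s ?\<eta>" unfolding eqg_def by blast
  qed (simp_all add: sm_closed st si)
  finally show "gcomp GG (gcomp GG \<gamma> \<delta>) (ginv GG \<delta>) = \<gamma>" by (simp add: st)
  fix \<epsilon> assume b: "\<epsilon> \<in> arrows GG" "gsrc GG \<delta> = grng GG \<epsilon>"
  obtain r \<mu> where r: "r \<in> carrier S" "\<mu> \<in> dm r" "\<epsilon> = germ S r \<mu>" using b(1) arrows_GG by blast
  have xr: "\<xi> = tight_act S r \<mu>" using b(2) st r by (simp add: src_germ rng_germ)
  have m: "\<mu> \<in> dm (t \<cdot> r)" using dm_comp[OF st(2) r(1)] r st(3) xr by simp
  have "gcomp GG (gcomp GG \<gamma> \<delta>) \<epsilon> = germ S ((s \<cdot> t) \<cdot> r) \<mu>"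
    unfolding c r(3) xr by (rule comp_germ) (use d r xr in simp_all)
  moreover have "gcomp GG \<delta> \<epsilon> = germ S (t \<cdot> r) \<mu>"
    unfolding st(6) r(3) xr by (rule comp_germ) (use st r xr in simp_all)
  moreover have ta: "tight_act S t \<xi> = tight_act S (t \<cdot> r) \<mu>"
    unfolding xr by (rule act_act) (use st r xr in simp_all)
  moreover have "gcomp GG (germ S s (tight_act S (t \<cdot> r) \<mu>)) (germ S (t \<cdot> r) \<mu>) = germ S (s \<cdot> (t \<cdot> r)) \<mu>"
    by (rule comp_germ) (use st r m ta in \<open>simp_all add: sm_closed\<close>)
  ultimately show "gcomp GG (gcomp GG \<gamma> \<delta>) \<epsilon> = gcomp GG \<gamma> (gcomp GG \<delta> \<epsilon>)"
    using st r by (simp add: sm_assoc)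
next
  fix \<gamma> assume "\<gamma> \<in> arrows GG"
  then obtain s \<xi> where s: "s \<in> carrier S" "\<xi> \<in> dm s" "\<gamma> = germ S s \<xi>" using arrows_GG by blast
  have i: "ginv GG \<gamma> = germ S (s\<dagger>) (tight_act S s \<xi>)" unfolding s(3) by (rule inv_germ[OF s(1,2)])
  have d: "s\<dagger> \<in> carrier S" "tight_act S s \<xi> \<in> dm (s\<dagger>)" using s act_dm by (simp_all add: inv_closed)
  show "ginv GG \<gamma> \<in> arrows GG" unfolding i by (rule germ_arrow[OF d])
  show "gsrc GG (ginv GG \<gamma>) = grng GG \<gamma>" unfolding i using s d by (simp add: src_germ rng_germ)
  show "grng GG (ginv GG \<gamma>) = gsrc GG \<gamma>" unfolding i using s d by (simp add: src_germ rng_germ act_act_inv)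
  show "ginv GG (ginv GG \<gamma>) = \<gamma>" unfolding i using s d by (simp add: inv_germ act_act_inv inv_inv)
  have c: "gcomp GG (ginv GG \<gamma>) \<gamma> = germ S (s\<dagger> \<cdot> s) \<xi>" 
    using comp_germ[OF d(1) s(1,2) d(2)] by (simp only: i s(3)[symmetric])
  have "\<xi> \<in> dm (s\<dagger> \<cdot> s)" using dm_comp[OF d(1) s(1)] s d by simp
  moreover have "eqg (s\<dagger> \<cdot> s) u \<xi>"
    unfolding eqg_def using dmD(2)[OF s(2)] E_idem[OF dom_E[OF s(1)]] unit_left[of "s\<dagger> \<cdot> s"] s d by (intro bexI) (simp_all add: sm_closed)
  ultimately have "germ S (s\<dagger> \<cdot> s) \<xi> = germ S u \<xi>"
    using s d dm_unit dmD(1)[OF s(2)] by (subst germ_eq_iff) (simp_all add: sm_closed unit_closed)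
  then show "gcomp GG (ginv GG \<gamma>) \<gamma> = germ S u (gsrc GG \<gamma>)" using c s by (simp add: src_germ)
qed

end


section \<open>Finite covers and compact open bisections\<close>

locale inverse_monoid_fc = inverse_monoid +
  assumes finite_cover: "s \<in> carrier S \<Longrightarrow> \<exists>C. finite C \<and> is_cover S C {e \<in> idempotents S. sle S e s}"
begin

text \<open>That \<open>k\<close> fixes some idempotent of \<xi> is an open condition; a finite
  cover turns it into membership of finitely many idempotents, hence into a clopen one. If \<xi>
  contained a fixed \<open>e\<close> but no member of the cover, some ultrafilter would behave
  likewise on these idempotents. It contains an \<open>h\<close> orthogonal to the whole cover, and
  then e h is a nonzero idempotent fixed by \<open>k\<close> that the cover misses.\<close>

lemma cover_iff:
  assumes k: "k \<in> carrier S"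
  shows "\<exists>C. finite C \<and> C \<subseteq> E \<and> (\<forall>\<xi>\<in>\<tau>. (\<exists>e\<in>\<xi>. k \<cdot> e = e) \<longleftrightarrow> (\<exists>c\<in>C. c \<in> \<xi>))"
proof -
  let ?D = "{e \<in> E. sle S e k}"
  obtain C where C: "finite C" "is_cover S C ?D" using finite_cover[OF k] by blast
  have CD: "C \<subseteq> E" "\<And>c. c \<in> C \<Longrightarrow> k \<cdot> c = c"
    using C(2) sle_E_iff[OF _ k] unfolding is_cover_def by auto
  have cov: "\<exists>c\<in>C. d \<cdot> c \<noteq> szero S" if "d \<in> E" "k \<cdot> d = d" "d \<noteq> szero S" for d
    using C(2) sle_E_iff[OF that(1) k] that unfolding is_cover_def by simp
  have "\<exists>c\<in>C. c \<in> \<xi>" if x: "\<xi> \<in> \<tau>" and e: "e \<in> \<xi>" "k \<cdot> e = e" for \<xi> e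
  proof (rule ccontr)
    assume no: "\<not> (\<exists>c\<in>C. c \<in> \<xi>)"
    have eE: "e \<in> E" "e \<in> carrier S" using filter_sub[OF tight_filter[OF x] e(1)] E_carrier by auto
    obtain \<zeta> where z: "\<zeta> \<in> sultrafilters S" "agree (insert e C) \<zeta> \<xi>"
      using x C(1) CD(1) eE(1) unfolding tight_iff by (meson finite_insert insert_subset)
    note zf = ultra_filter[OF z(1)]
    have ez: "e \<in> \<zeta>" and cz: "c \<notin> \<zeta>" if "c \<in> C" for c using z(2) e(1) no that by (auto simp: agree_def)
    have "\<exists>h\<in>\<zeta>. \<forall>c\<in>F. h \<cdot> c = szero S" if "finite F" "F \<subseteq> C" for F
      using that
    proof (induction F)
      case empty then show ?case using filter_unit[OF zf] by auto
    next
      case (insert c F)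
      then obtain h where h: "h \<in> \<zeta>" "\<forall>c\<in>F. h \<cdot> c = szero S" by blast
      have cE: "c \<in> E" "c \<in> carrier S" using insert CD(1) E_carrier by auto
      obtain g where g: "g \<in> \<zeta>" "c \<cdot> g = szero S" using ultra_disjoint[OF z(1) cE(1)] cz insert by blast
      have E: "h \<in> E" "g \<in> E" "h \<in> carrier S" "g \<in> carrier S" using h g filter_sub[OF zf] E_carrier by auto
      have "(h \<cdot> g) \<cdot> c = szero S" using idem_commute[OF E(2) cE(1)] E cE g(2) by (simp add: sm_assoc zero_right)
      moreover have "(h \<cdot> g) \<cdot> b = szero S" if b: "b \<in> F" for b
      proof -
        have bE: "b \<in> E" "b \<in> carrier S" using b insert.prems CD(1) E_carrier by auto
        have "(h \<cdot> g) \<cdot> b = g \<cdot> (h \<cdot> b)" using E_left_commute[OF E(1,2) bE(2)] E bE by (simp add: sm_assoc)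
        then show ?thesis using h(2) b E by (simp add: zero_right)
      qed
      ultimately show ?case using filter_mult[OF zf h(1) g(1)] by blast
    qed
    from this[OF C(1) order_refl] obtain h where h: "h \<in> \<zeta>" "\<forall>c\<in>C. h \<cdot> c = szero S" by blast
    have hE: "h \<in> E" "h \<in> carrier S" using filter_sub[OF zf h(1)] E_carrier by auto
    have ez': "e \<in> \<zeta>" using z(2) e(1) by (auto simp: agree_def)
    have d: "e \<cdot> h \<in> \<zeta>" by (rule filter_mult[OF zf ez' h(1)])
    have "k \<cdot> (e \<cdot> h) = e \<cdot> h" using e(2) k eE hE by (simp flip: sm_assoc)
    then obtain c where c: "c \<in> C" "(e \<cdot> h) \<cdot> c \<noteq> szero S"
      using cov[of "e \<cdot> h"] d filter_zero[OF zf] E_mult[OF eE(1) hE(1)] by metis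
    have "c \<in> carrier S" using c(1) CD(1) E_carrier by blast
    then have "(e \<cdot> h) \<cdot> c = szero S" using h(2) c(1) eE hE by (simp add: sm_assoc zero_right)
    then show False using c(2) by simp
  qed
  then have "\<forall>\<xi>\<in>\<tau>. (\<exists>e\<in>\<xi>. k \<cdot> e = e) \<longleftrightarrow> (\<exists>c\<in>C. c \<in> \<xi>)" using CD(2) by blast
  then show ?thesis using C(1) CD(1) by blast
qed

text \<open>Reduces equality of germs to fixed idempotents, to which finite covers apply. For the
  converse, the adjoint of the fixed-point equation gives e = e t* s, so the idempotent
  \<open>f = t e t*\<close> satisfies f s = t e, and this in turn equals s e.\<close>

lemma eqg_iff:
  assumes s: "s \<in> carrier S" and t: "t \<in> carrier S" and x: "\<xi> \<in> dm s" "\<xi> \<in> dm t"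
  shows "eqg s t \<xi> \<longleftrightarrow> (\<exists>e\<in>\<xi>. (s\<dagger> \<cdot> t) \<cdot> e = e)"
proof
  note xf = dmD(3)[OF x(1)]
  have c: "s\<dagger> \<in> carrier S" "t\<dagger> \<in> carrier S" using s t by (simp_all add: inv_closed)
  {
    assume "eqg s t \<xi>"
    then obtain e where e: "e \<in> \<xi>" "s \<cdot> e = t \<cdot> e" unfolding eqg_def by blast
    have E: "e \<in> E" "e \<in> carrier S" using filter_sub[OF xf e(1)] E_carrier by auto
    have "(s\<dagger> \<cdot> t) \<cdot> (e \<cdot> (s\<dagger> \<cdot> s)) = (s\<dagger> \<cdot> (t \<cdot> e)) \<cdot> (s\<dagger> \<cdot> s)" using s t c E by (simp add: sm_assoc sm_closed)
    also have "\<dots> = (s\<dagger> \<cdot> s) \<cdot> (e \<cdot> (s\<dagger> \<cdot> s))" unfolding e(2)[symmetric] using s c E by (simp add: sm_assoc sm_closed)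
    also have "\<dots> = e \<cdot> ((s\<dagger> \<cdot> s) \<cdot> (s\<dagger> \<cdot> s))" by (rule E_left_commute[OF dom_E[OF s] E(1)]) (simp add: s c sm_closed)
    finally have "(s\<dagger> \<cdot> t) \<cdot> (e \<cdot> (s\<dagger> \<cdot> s)) = e \<cdot> (s\<dagger> \<cdot> s)" using E_idem[OF dom_E[OF s]] by simp
    then show "\<exists>e\<in>\<xi>. (s\<dagger> \<cdot> t) \<cdot> e = e" using filter_mult[OF xf e(1) dmD(2)[OF x(1)]] by blast
  }
  assume "\<exists>e\<in>\<xi>. (s\<dagger> \<cdot> t) \<cdot> e = e"
  then obtain e where e: "e \<in> \<xi>" "(s\<dagger> \<cdot> t) \<cdot> e = e" by blast
  have E: "e \<in> E" "e \<in> carrier S" using filter_sub[OF xf e(1)] E_carrier by auto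
  have "e = ((s\<dagger> \<cdot> t) \<cdot> e)\<dagger>" using e(2) inv_E[OF E(1)] by simp
  also have "\<dots> = e \<cdot> (t\<dagger> \<cdot> s)" using s t c E by (simp add: inv_mult inv_E[OF E(1)] inv_inv sm_closed)
  finally have e': "e = e \<cdot> (t\<dagger> \<cdot> s)" .
  let ?f = "t \<cdot> (e \<cdot> t\<dagger>)"
  have fE: "?f \<in> E" by (rule conj_E[OF t E(1)])
  have "?f \<cdot> s = t \<cdot> (e \<cdot> (t\<dagger> \<cdot> s))" using s t c E by (simp add: sm_assoc sm_closed)
  then have fs: "?f \<cdot> s = t \<cdot> e" using e' by simp
  have "s \<cdot> e = s \<cdot> ((s\<dagger> \<cdot> t) \<cdot> e)" by (simp add: e(2))
  also have "\<dots> = (s \<cdot> s\<dagger>) \<cdot> (?f \<cdot> s)" unfolding fs using s t c E by (simp add: sm_assoc sm_closed)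
  also have "\<dots> = ?f \<cdot> ((s \<cdot> s\<dagger>) \<cdot> s)" by (rule E_left_commute[OF ran_E[OF s] fE s])
  also have "\<dots> = t \<cdot> e" unfolding fs[symmetric] using s c by (simp add: sm_assoc regular)
  finally show "eqg s t \<xi>" using e(1) unfolding eqg_def by blast
qed

text \<open>Once \<open>W\<close> contains both domain idempotents and the finite set obtained from
  the cover, filters that agree on \<open>W\<close> answer the question about germs alike. So the
  condition and its negation are both open.\<close>

lemma clopen_eqg:
  assumes s: "s \<in> carrier S" and t: "t \<in> carrier S"
  shows "openin TT {\<xi> \<in> dm s \<inter> dm t. eqg s t \<xi>}" "openin TT {\<xi> \<in> dm t. \<not> (\<xi> \<in> dm s \<and> eqg s t \<xi>)}"
proof -
  obtain C where C: "finite C" "C \<subseteq> E" "\<forall>\<xi>\<in>\<tau>. (\<exists>e\<in>\<xi>. (s\<dagger> \<cdot> t) \<cdot> e = e) \<longleftrightarrow> (\<exists>c\<in>C. c \<in> \<xi>)"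
    using cover_iff[OF sm_closed[OF inv_closed[OF s] t]] by blast
  have iff: "eqg s t \<xi> \<longleftrightarrow> (\<exists>c\<in>C. c \<in> \<xi>)" if "\<xi> \<in> dm s" "\<xi> \<in> dm t" for \<xi>
    using eqg_iff[OF s t that] C(3) dmD(1)[OF that(1)] by blast
  let ?W = "insert (s\<dagger> \<cdot> s) (insert (t\<dagger> \<cdot> t) C)"
  have W: "finite ?W \<and> ?W \<subseteq> E" using C dom_E s t by simp
  have ag: "(\<eta> \<in> dm s \<longleftrightarrow> \<xi> \<in> dm s) \<and> (\<eta> \<in> dm t \<longleftrightarrow> \<xi> \<in> dm t) \<and> (\<exists>c\<in>C. c \<in> \<eta>) = (\<exists>c\<in>C. c \<in> \<xi>)"
    if "\<eta> \<in> \<tau>" "\<xi> \<in> \<tau>" "agree ?W \<eta> \<xi>" for \<eta> \<xi>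
    using that by (auto simp: agree_def tight_dom_def)
  show "openin TT {\<xi> \<in> dm s \<inter> dm t. eqg s t \<xi>}"
    unfolding openin_TT
  proof (intro conjI ballI)
    fix \<xi> assume x: "\<xi> \<in> {\<xi> \<in> dm s \<inter> dm t. eqg s t \<xi>}"
    have "\<eta> \<in> {\<xi> \<in> dm s \<inter> dm t. eqg s t \<xi>}" if "\<eta> \<in> \<tau>" "agree ?W \<eta> \<xi>" for \<eta>
      using ag[OF that(1) _ that(2)] x dmD(1) iff[of \<xi>] iff[of \<eta>] by auto
    then show "\<exists>W. finite W \<and> W \<subseteq> E \<and> (\<forall>\<eta>\<in>\<tau>. agree W \<eta> \<xi> \<longrightarrow> \<eta> \<in> {\<xi> \<in> dm s \<inter> dm t. eqg s t \<xi>})"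
      using W by (intro exI[of _ ?W]) simp
  qed (auto dest: dmD)
  show "openin TT {\<xi> \<in> dm t. \<not> (\<xi> \<in> dm s \<and> eqg s t \<xi>)}"
    unfolding openin_TT
  proof (intro conjI ballI)
    fix \<xi> assume x: "\<xi> \<in> {\<xi> \<in> dm t. \<not> (\<xi> \<in> dm s \<and> eqg s t \<xi>)}"
    have "\<eta> \<in> {\<xi> \<in> dm t. \<not> (\<xi> \<in> dm s \<and> eqg s t \<xi>)}" if "\<eta> \<in> \<tau>" "agree ?W \<eta> \<xi>" for \<eta>
      using ag[OF that(1) _ that(2)] x dmD(1) iff[of \<xi>] iff[of \<eta>] by auto
    then show "\<exists>W. finite W \<and> W \<subseteq> E \<and> (\<forall>\<eta>\<in>\<tau>. agree W \<eta> \<xi> \<longrightarrow> \<eta> \<in> {\<xi> \<in> dm t. \<not> (\<xi> \<in> dm s \<and> eqg s t \<xi>)})"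
      using W by (intro exI[of _ ?W]) simp
  qed (auto dest: dmD)
qed

definition "Th s = bisection S s (dm s)"

lemma Th_iff: "\<gamma> \<in> Th s \<longleftrightarrow> (\<exists>\<xi>\<in>dm s. \<gamma> = germ S s \<xi>)"
  unfolding Th_def bisection_def by blast

lemma Th_arrow: "s \<in> carrier S \<Longrightarrow> \<gamma> \<in> Th s \<Longrightarrow> \<gamma> \<in> arrows GG"
  unfolding Th_iff arrows_GG by blast

text \<open>The basis of the topology admits compact \<open>U\<close> only. Cylinders given by
  finite sets of idempotents are clopen in the compact spectrum, hence compact, and they exhaust any
  open \<open>U\<close>.\<close>

lemma open_bisection:
  assumes s: "s \<in> carrier S" and U: "openin TT U" "U \<subseteq> dm s"
  shows "openin (gtop GG) (bisection S s U)"
proof -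
  have "\<exists>V. V \<subseteq> U \<and> \<xi> \<in> V \<and> openin (gtop GG) (bisection S s V)" if x: "\<xi> \<in> U" for \<xi>
  proof -
    obtain W where W: "finite W" "W \<subseteq> E" "\<forall>\<eta>\<in>\<tau>. agree W \<eta> \<xi> \<longrightarrow> \<eta> \<in> U" using openin_TT_D[OF U(1) x] by blast
    let ?V = "{\<eta> \<in> \<tau>. agree W \<eta> \<xi>}"
    have xt: "\<xi> \<in> \<tau>" using x U(2) dmD(1) by blast
    have "openin TT ?V"
      unfolding openin_TT
    proof (intro conjI ballI)
      fix \<mu> assume m: "\<mu> \<in> ?V"
      have "\<eta> \<in> ?V" if "\<eta> \<in> \<tau>" "agree W \<eta> \<mu>" for \<eta> using agree_trans[OF that(2)] that(1) m by simp
      then show "\<exists>W. finite W \<and> W \<subseteq> E \<and> (\<forall>\<eta>\<in>\<tau>. agree W \<eta> \<mu> \<longrightarrow> \<eta> \<in> ?V)" using W(1,2) by (intro exI[of _ W]) simp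
    qed simp
    moreover have "openin TT (\<tau> - ?V)"
      unfolding openin_TT
    proof (intro conjI ballI)
      fix \<mu> assume m: "\<mu> \<in> \<tau> - ?V"
      have "\<eta> \<in> \<tau> - ?V" if that: "\<eta> \<in> \<tau>" "agree W \<eta> \<mu>" for \<eta> 
      proof (rule DiffI[OF that(1)], rule notI)
        assume "\<eta> \<in> ?V"
        then have "agree W \<mu> \<xi>" using agree_trans[OF agree_sym[OF that(2)]] by simp
        then show False using m by simp
      qed
      then show "\<exists>W. finite W \<and> W \<subseteq> E \<and> (\<forall>\<eta>\<in>\<tau>. agree W \<eta> \<mu> \<longrightarrow> \<eta> \<in> \<tau> - ?V)" using W(1,2) by (intro exI[of _ W]) simp
    qed simp
    moreover have "?V = \<tau> - (\<tau> - ?V)" by blast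
    ultimately have "closedin TT ?V" "openin TT ?V" unfolding closedin_def topspace_TT by auto
    moreover have "compact_space TT" unfolding compact_space_def topspace_TT by (rule compactin_tight)
    ultimately have "compactin TT ?V" "openin TT ?V" using closedin_compact_space by blast+
    moreover have "?V \<subseteq> dm s" using W(3) U(2) by blast
    ultimately have "bisection S s ?V \<in> bas" using s by blast
    then have "openin (gtop GG) (bisection S s ?V)" unfolding gtop_GG by (rule topology_generated_by_Basis)
    moreover have "?V \<subseteq> U" using W(3) by blast
    moreover have "\<xi> \<in> ?V" using xt agree_refl by simp
    ultimately show ?thesis by (intro exI[of _ ?V] conjI)
  qed
  note nb = this
  have "\<exists>T. openin (gtop GG) T \<and> \<gamma> \<in> T \<and> T \<subseteq> bisection S s U" if g: "\<gamma> \<in> bisection S s U" for \<gamma>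
  proof -
    obtain \<xi> where x: "\<xi> \<in> U" "\<gamma> = germ S s \<xi>" using g unfolding bisection_def by auto
    obtain V where V: "V \<subseteq> U" "\<xi> \<in> V" "openin (gtop GG) (bisection S s V)" using nb[OF x(1)] by auto
    have "\<gamma> \<in> bisection S s V" unfolding x(2) bisection_def by (rule imageI[OF V(2)])
    moreover have "bisection S s V \<subseteq> bisection S s U" unfolding bisection_def by (rule image_mono[OF V(1)])
    ultimately show ?thesis using V(3) by auto
  qed
  then show ?thesis by (subst openin_subopen) blast
qed

lemma open_Th: "s \<in> carrier S \<Longrightarrow> openin (gtop GG) (Th s)"
  unfolding Th_def by (rule open_bisection) (simp_all add: openin_dm)

text \<open>The Hausdorff property in the form needed: a germ outside the bisection keeps its
  representative on a neighbourhood, and there it stays outside, because disagreement with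
  \<open>s\<close> is an open condition.\<close>

lemma closed_Th: assumes s: "s \<in> carrier S" shows "closedin (gtop GG) (Th s)"
proof -
  have "openin (gtop GG) (arrows GG - Th s)"
  proof (subst openin_subopen, intro ballI)
    fix \<gamma> assume g: "\<gamma> \<in> arrows GG - Th s"
    then obtain t \<eta> where t: "t \<in> carrier S" "\<eta> \<in> dm t" "\<gamma> = germ S t \<eta>" using arrows_GG by blast
    let ?U = "{\<xi> \<in> dm t. \<not> (\<xi> \<in> dm s \<and> eqg s t \<xi>)}"
    have "openin (gtop GG) (bisection S t ?U)" by (rule open_bisection[OF t(1) clopen_eqg(2)[OF s t(1)]]) blast
    moreover have "germ S t \<xi> \<in> Th s \<longleftrightarrow> \<xi> \<in> dm s \<and> eqg s t \<xi>" if x: "\<xi> \<in> dm t" for \<xi>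
      unfolding Th_iff using germ_eq_iff[OF t(1) s x] eqg_sym by blast
    then have "\<gamma> \<in> bisection S t ?U" "bisection S t ?U \<subseteq> arrows GG - Th s"
      using g t germ_arrow[OF t(1)] unfolding bisection_def by auto
    ultimately show "\<exists>T. openin (gtop GG) T \<and> \<gamma> \<in> T \<and> T \<subseteq> arrows GG - Th s" by blast
  qed
  moreover have "Th s \<subseteq> arrows GG" using Th_arrow[OF s] by blast
  ultimately show ?thesis by (simp add: closedin_def)
qed

lemma continuous_germ: assumes s: "s \<in> carrier S"
  shows "continuous_map (subtopology TT (dm s)) (gtop GG) (germ S s)"
  unfolding gtop_GG
proof (rule continuous_on_generated_topo)
  have "topspace (subtopology TT (dm s)) = topspace TT \<inter> dm s" by (rule topspace_subtopology)
  then have top: "topspace (subtopology TT (dm s)) = dm s" unfolding topspace_TT using dmD(1) by auto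
  fix B assume "B \<in> bas"
  then obtain t U where t: "t \<in> carrier S" "U \<subseteq> dm t" "openin TT U" "B = germ S t ` U" unfolding bisection_def by blast
  have "germ S s -` B \<inter> dm s = {\<xi> \<in> dm s \<inter> dm t. eqg s t \<xi>} \<inter> U"
  proof (intro subset_antisym subsetI)
    fix \<xi> assume "\<xi> \<in> germ S s -` B \<inter> dm s"
    then have x: "germ S s \<xi> \<in> germ S t ` U" "\<xi> \<in> dm s" unfolding t(4) by simp_all
    obtain \<eta> where h: "\<eta> \<in> U" "germ S s \<xi> = germ S t \<eta>" using x(1) by (rule imageE)
    have e: "\<xi> = \<eta>" "eqg s t \<xi>"
      using germ_eq_iff[OF s t(1) x(2) subsetD[OF t(2) h(1)], THEN iffD1, OF h(2)] by blast+
    then show "\<xi> \<in> {\<xi> \<in> dm s \<inter> dm t. eqg s t \<xi>} \<inter> U" using x(2) h(1) subsetD[OF t(2) h(1)] by blast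
  next
    fix \<xi> assume "\<xi> \<in> {\<xi> \<in> dm s \<inter> dm t. eqg s t \<xi>} \<inter> U"
    then have x: "\<xi> \<in> dm s" "\<xi> \<in> dm t" "eqg s t \<xi>" "\<xi> \<in> U" by simp_all
    have "germ S s \<xi> = germ S t \<xi>" using germ_eq_iff[OF s t(1) x(1,2)] x(3) by simp
    then show "\<xi> \<in> germ S s -` B \<inter> dm s" unfolding t(4) using x by simp
  qed
  moreover have "openin TT ({\<xi> \<in> dm s \<inter> dm t. eqg s t \<xi>} \<inter> U)"
    by (rule openin_Int[OF clopen_eqg(1)[OF s t(1)] t(3)])
  ultimately show "openin (subtopology TT (dm s)) (germ S s -` B \<inter> topspace (subtopology TT (dm s)))"
    unfolding top openin_open_subtopology[OF openin_dm[OF s]] using Int_lower2[of "germ S s -` B" "dm s"] by simp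
next
  have top: "topspace (gtop GG) = \<Union>bas" unfolding gtop_GG by (rule topology_generated_by_topspace)
  have "topspace (subtopology TT (dm s)) = topspace TT \<inter> dm s" by (rule topspace_subtopology)
  then have "topspace (subtopology TT (dm s)) \<subseteq> dm s" by (simp only: Int_lower2)
  moreover have "germ S s ` dm s \<subseteq> \<Union>bas" unfolding top[symmetric] using germ_arrow[OF s] by (rule image_subsetI)
  ultimately show "germ S s ` topspace (subtopology TT (dm s)) \<subseteq> \<Union>bas" by (meson image_mono order_trans)
qed

lemma compact_Th: assumes s: "s \<in> carrier S" shows "compactin (gtop GG) (Th s)"
  unfolding Th_def bisection_def
proof (rule image_compactin[OF _ continuous_germ[OF s]])
  show "compactin (subtopology TT (dm s)) (dm s)"
    unfolding compactin_subtopology[of TT] using compactin_dom[OF dom_E[OF s]] by blast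
qed

abbreviation "CG \<equiv> cc_algebra GG"

lemma Cc_iff: "f \<in> carrier CG \<longleftrightarrow> continuous_map (gtop GG) euclidean f \<and>
   compactin (gtop GG) (gtop GG closure_of {\<gamma> \<in> arrows GG. f \<gamma> \<noteq> 0}) \<and> (\<forall>\<gamma>. \<gamma> \<notin> arrows GG \<longrightarrow> f \<gamma> = 0)"
  by (simp add: cc_algebra_def)

text \<open>Functions supported on a single bisection. Finite sums of them make up C_c, and
  convolution and adjoint only change the index \<open>s\<close>, so properties of C_c are checked
  on them.\<close>

definition BB :: "'a \<Rightarrow> (('a \<times> 'a set) set \<Rightarrow> complex) set" where
  "BB s = {f. continuous_map (gtop GG) euclidean f \<and> (\<forall>\<gamma>. \<gamma> \<notin> Th s \<longrightarrow> f \<gamma> = 0)}"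

lemma Cc_supset:
  assumes "continuous_map (gtop GG) euclidean f" "compactin (gtop GG) K" "closedin (gtop GG) K" "\<And>\<gamma>. \<gamma> \<notin> K \<Longrightarrow> f \<gamma> = 0"
  shows "f \<in> carrier CG"
  unfolding Cc_iff
proof (intro conjI allI impI assms(1))
  have "gtop GG closure_of {\<gamma> \<in> arrows GG. f \<gamma> \<noteq> 0} \<subseteq> K"
    by (rule closure_of_minimal[OF _ assms(3)]) (use assms(4) in blast)
  then show "compactin (gtop GG) (gtop GG closure_of {\<gamma> \<in> arrows GG. f \<gamma> \<noteq> 0})"
    by (rule closed_compactin[OF assms(2)]) (rule closedin_closure_of)
  show "f \<gamma> = 0" if "\<gamma> \<notin> arrows GG" for \<gamma> using assms(4) that closedin_subset[OF assms(3)] by blast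
qed

lemma BB_Cc: "s \<in> carrier S \<Longrightarrow> f \<in> BB s \<Longrightarrow> f \<in> carrier CG"
  by (rule Cc_supset[OF _ compact_Th closed_Th]) (auto simp: BB_def)

lemma Cc_add: assumes f: "f \<in> carrier CG" and g: "g \<in> carrier CG" shows "(\<lambda>\<gamma>. f \<gamma> + g \<gamma>) \<in> carrier CG"
proof -
  let ?K = "\<lambda>f. gtop GG closure_of {\<gamma> \<in> arrows GG. f \<gamma> \<noteq> 0}"
  have z: "h \<gamma> = 0" if "h \<in> carrier CG" "\<gamma> \<notin> ?K h" for h \<gamma>
  proof (rule ccontr)
    assume "h \<gamma> \<noteq> 0"
    then have "\<gamma> \<in> {\<gamma> \<in> arrows GG. h \<gamma> \<noteq> 0}" using that(1) unfolding Cc_iff by blast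
    moreover have "{\<gamma> \<in> arrows GG. h \<gamma> \<noteq> 0} \<subseteq> ?K h" by (rule closure_of_subset) blast
    ultimately show False using that(2) by blast
  qed
  show ?thesis
  proof (rule Cc_supset)
    show "continuous_map (gtop GG) euclidean (\<lambda>\<gamma>. f \<gamma> + g \<gamma>)"
      using f g unfolding Cc_iff by (intro continuous_map_add) auto
    show "compactin (gtop GG) (?K f \<union> ?K g)" using f g unfolding Cc_iff by (intro compactin_Un) auto
    show "closedin (gtop GG) (?K f \<union> ?K g)" by (intro closedin_Un closedin_closure_of)
    show "f \<gamma> + g \<gamma> = 0" if "\<gamma> \<notin> ?K f \<union> ?K g" for \<gamma> using z[OF f] z[OF g] that by simp
  qed
qed

lemma Cc_scale: assumes f: "f \<in> carrier CG" shows "(\<lambda>\<gamma>. c * f \<gamma>) \<in> carrier CG"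
proof (rule Cc_supset)
  let ?K = "gtop GG closure_of {\<gamma> \<in> arrows GG. f \<gamma> \<noteq> 0}"
  have "continuous_map euclidean euclidean (\<lambda>z. c * z)" by (simp add: continuous_intros)
  then show "continuous_map (gtop GG) euclidean (\<lambda>\<gamma>. c * f \<gamma>)"
    using f continuous_map_compose[of "gtop GG" euclidean f euclidean "\<lambda>z. c * z"] unfolding Cc_iff by (simp add: o_def)
  show "compactin (gtop GG) ?K" using f unfolding Cc_iff by blast
  show "c * f \<gamma> = 0" if g: "\<gamma> \<notin> ?K" for \<gamma>
  proof -
    have "f \<gamma> = 0"
    proof (rule ccontr)
      assume "f \<gamma> \<noteq> 0"
      then have "\<gamma> \<in> {\<gamma> \<in> arrows GG. f \<gamma> \<noteq> 0}" using f unfolding Cc_iff by blast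
      moreover have "{\<gamma> \<in> arrows GG. f \<gamma> \<noteq> 0} \<subseteq> ?K" by (rule closure_of_subset) blast
      ultimately show False using g by blast
    qed
    then show ?thesis by simp
  qed
qed (rule closedin_closure_of)

lemma continuous_cut:
  assumes f: "continuous_map (gtop GG) euclidean (f :: _ \<Rightarrow> complex)" and D: "openin (gtop GG) D" "closedin (gtop GG) D"
  shows "continuous_map (gtop GG) euclidean (\<lambda>\<gamma>. if \<gamma> \<in> D then f \<gamma> else 0)"
  unfolding continuous_map
proof (intro conjI allI impI)
  fix U :: "complex set" assume "openin euclidean U"
  then have o: "openin (gtop GG) {\<gamma> \<in> arrows GG. f \<gamma> \<in> U}" using f unfolding continuous_map by blast
  have c: "openin (gtop GG) (arrows GG - D)" using D(2) by (simp add: closedin_def)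
  have "{\<gamma> \<in> arrows GG. (if \<gamma> \<in> D then f \<gamma> else 0) \<in> U} =
    ({\<gamma> \<in> arrows GG. f \<gamma> \<in> U} \<inter> D) \<union> (if 0 \<in> U then arrows GG - D else {})"
    using openin_subset[OF D(1)] by auto
  moreover have "openin (gtop GG) \<dots>" by (intro openin_Un openin_Int o D(1)) (simp add: c)
  ultimately show "openin (gtop GG) {\<gamma> \<in> arrows GG. (if \<gamma> \<in> D then f \<gamma> else 0) \<in> U}" by simp
qed simp

text \<open>The compact support is covered by finitely many bisections. These are clopen, so
  multiplication by indicator functions splits \<open>f\<close> into continuous pieces, in place of
  a partition of unity.\<close>

lemma Cc_induct:
  assumes f: "f \<in> carrier CG" and B: "\<And>s f. \<lbrakk>s \<in> carrier S; f \<in> BB s\<rbrakk> \<Longrightarrow> Q f" and z: "Q (\<lambda>_. 0)"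
    and add: "\<And>f g. \<lbrakk>f \<in> carrier CG; g \<in> carrier CG; Q f; Q g\<rbrakk> \<Longrightarrow> Q (\<lambda>\<gamma>. f \<gamma> + g \<gamma>)"
  shows "Q f"
proof -
  let ?K = "gtop GG closure_of {\<gamma> \<in> arrows GG. f \<gamma> \<noteq> 0}"
  have K: "compactin (gtop GG) ?K" using f unfolding Cc_iff by blast
  have "\<forall>U\<in>Th ` carrier S. openin (gtop GG) U" using open_Th by blast
  moreover have "?K \<subseteq> \<Union>(Th ` carrier S)"
  proof
    fix \<gamma> assume "\<gamma> \<in> ?K"
    then have "\<gamma> \<in> arrows GG" using compactin_subset_topspace[OF K] by blast
    then show "\<gamma> \<in> \<Union>(Th ` carrier S)" unfolding arrows_GG Th_iff UN_iff by blast
  qed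
  ultimately have "\<exists>\<F>. finite \<F> \<and> \<F> \<subseteq> Th ` carrier S \<and> ?K \<subseteq> \<Union>\<F>" using K unfolding compactin_def by simp
  then obtain \<F> where F: "finite \<F>" "\<F> \<subseteq> Th ` carrier S" "?K \<subseteq> \<Union>\<F>" by blast
  obtain T where T: "T \<subseteq> carrier S" "finite T" "\<F> = Th ` T" using finite_subset_image[OF F(1,2)] by blast
  have claim: "Q f \<and> f \<in> carrier CG" if "finite T" "T \<subseteq> carrier S" "continuous_map (gtop GG) euclidean f" "\<And>\<gamma>. (\<forall>s\<in>T. \<gamma> \<notin> Th s) \<Longrightarrow> f \<gamma> = 0" for T f
    using that
  proof (induction T arbitrary: f)
    case empty
    then have "f = (\<lambda>_. 0)" by auto
    moreover have "(\<lambda>_. 0) \<in> carrier CG" by (rule Cc_supset[of _ "{}"]) simp_all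
    ultimately show ?case using z by simp
  next
    case (insert s T)
    have s: "s \<in> carrier S" using insert.prems(1) by simp
    let ?f1 = "\<lambda>\<gamma>. if \<gamma> \<in> Th s then f \<gamma> else 0" and ?f2 = "\<lambda>\<gamma>. if \<gamma> \<in> arrows GG - Th s then f \<gamma> else 0"
    have 1: "?f1 \<in> BB s" unfolding BB_def using continuous_cut[OF insert.prems(2) open_Th[OF s] closed_Th[OF s]] by simp
    have c2: "continuous_map (gtop GG) euclidean ?f2"
      by (rule continuous_cut[OF insert.prems(2)]) (use open_Th[OF s] closed_Th[OF s] in \<open>auto simp: closedin_def openin_diff\<close>)
    have 2: "Q ?f2 \<and> ?f2 \<in> carrier CG"
      by (rule insert.IH[OF _ c2]) (use insert.prems in auto)
    have "f \<gamma> = 0" if "\<gamma> \<notin> arrows GG" for \<gamma>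
      by (rule insert.prems(3)) (use that Th_arrow insert.prems(1) in blast)
    then have "f = (\<lambda>\<gamma>. ?f1 \<gamma> + ?f2 \<gamma>)" using Th_arrow[OF s] by (auto simp: fun_eq_iff)
    then show ?case using add[OF BB_Cc[OF s 1] conjunct2[OF 2] B[OF s 1] conjunct1[OF 2]] Cc_add[OF BB_Cc[OF s 1] conjunct2[OF 2]] by simp
  qed
  have "f \<gamma> = 0" if "\<forall>s\<in>T. \<gamma> \<notin> Th s" for \<gamma>
  proof (rule ccontr)
    assume "f \<gamma> \<noteq> 0"
    then have "\<gamma> \<in> {\<gamma> \<in> arrows GG. f \<gamma> \<noteq> 0}" using f unfolding Cc_iff by blast
    moreover have "{\<gamma> \<in> arrows GG. f \<gamma> \<noteq> 0} \<subseteq> ?K" by (rule closure_of_subset) blast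
    ultimately show False using F(3) T(3) that by blast
  qed
  then show ?thesis using claim[OF T(2,1)] f unfolding Cc_iff by blast
qed

end


section \<open>Convolution and adjoint on bisections\<close>

context inverse_monoid_fc
begin

lemma mk_BB:
  assumes s: "s \<in> carrier S" and \<phi>: "continuous_map (subtopology TT (dm s)) euclidean (\<phi> :: _ \<Rightarrow> complex)"
  shows "(\<lambda>\<gamma>. if \<gamma> \<in> Th s then \<phi> (gsrc GG \<gamma>) else 0) \<in> BB s" (is "?f \<in> _")
proof -
  have "continuous_map (gtop GG) euclidean ?f"
    unfolding continuous_map
  proof (intro conjI allI impI)
    fix O' :: "complex set" assume "openin euclidean O'"
    moreover have top: "topspace (subtopology TT (dm s)) = dm s"
      using topspace_subtopology[of TT "dm s"] dmD(1) unfolding topspace_TT by auto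
    ultimately have "openin (subtopology TT (dm s)) {\<xi> \<in> dm s. \<phi> \<xi> \<in> O'}"
      using \<phi> unfolding continuous_map top by blast
    then have "openin TT {\<xi> \<in> dm s. \<phi> \<xi> \<in> O'}" by (simp only: openin_open_subtopology[OF openin_dm[OF s]])
    then have o: "openin (gtop GG) (bisection S s {\<xi> \<in> dm s. \<phi> \<xi> \<in> O'})" by (rule open_bisection[OF s]) blast
    have c: "openin (gtop GG) (arrows GG - Th s)" using closed_Th[OF s] by (simp add: closedin_def)
    have "{\<gamma> \<in> arrows GG. ?f \<gamma> \<in> O'} = bisection S s {\<xi> \<in> dm s. \<phi> \<xi> \<in> O'} \<union> (if 0 \<in> O' then arrows GG - Th s else {})"
      unfolding bisection_def using Th_iff[of _ s] src_germ[OF s] germ_arrow[OF s] by (auto split: if_splits)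
    moreover have "openin (gtop GG) \<dots>" by (intro openin_Un o) (simp add: c)
    ultimately show "openin (gtop GG) {\<gamma> \<in> arrows GG. ?f \<gamma> \<in> O'}" by simp
  qed simp
  then show ?thesis by (simp add: BB_def)
qed

lemma BB_germ: "s \<in> carrier S \<Longrightarrow> f \<in> BB s \<Longrightarrow> continuous_map (subtopology TT (dm s)) euclidean (\<lambda>\<xi>. f (germ S s \<xi>))"
  using continuous_map_compose[OF continuous_germ, of s euclidean f] by (simp add: BB_def o_def)

lemma act_continuous:
  assumes s: "s \<in> carrier S" and V: "openin TT V" "V \<subseteq> dm s"
  shows "continuous_map (subtopology TT V) TT (tight_act S s)"
proof -
  have top: "topspace (subtopology TT V) = V"
    using topspace_subtopology[of TT V] V(2) dmD(1) unfolding topspace_TT by auto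
  have at: "tight_act S s \<xi> \<in> \<tau>" if "\<xi> \<in> V" for \<xi> using act_dm[OF s] that V(2) dmD(1) by blast
  have "openin TT {\<xi> \<in> V. tight_act S s \<xi> \<in> U}" if U: "openin TT U" for U
    unfolding openin_TT
  proof (intro conjI ballI)
    show "{\<xi> \<in> V. tight_act S s \<xi> \<in> U} \<subseteq> \<tau>" using V(2) dmD(1) by blast
    fix \<xi> assume x: "\<xi> \<in> {\<xi> \<in> V. tight_act S s \<xi> \<in> U}"
    then have xV: "\<xi> \<in> V" "tight_act S s \<xi> \<in> U" "\<xi> \<in> dm s" using V(2) by auto
    obtain W where W: "finite W" "W \<subseteq> E" "\<forall>\<eta>\<in>\<tau>. agree W \<eta> (tight_act S s \<xi>) \<longrightarrow> \<eta> \<in> U"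
      using openin_TT_D[OF U xV(2)] by auto
    obtain W1 where W1: "finite W1" "W1 \<subseteq> E" "\<forall>\<eta>\<in>\<tau>. agree W1 \<eta> \<xi> \<longrightarrow> \<eta> \<in> V"
      using openin_TT_D[OF V(1) xV(1)] by auto
    let ?W = "W1 \<union> (\<lambda>f. s\<dagger> \<cdot> (f \<cdot> s)) ` W"
    have "\<eta> \<in> {\<xi> \<in> V. tight_act S s \<xi> \<in> U}" if h: "\<eta> \<in> \<tau>" "agree ?W \<eta> \<xi>" for \<eta>
    proof -
      have e: "\<eta> \<in> V" using W1(3) h by (auto simp: agree_def)
      have ed: "\<eta> \<in> dm s" using e V(2) by blast
      have "agree W (tight_act S s \<eta>) (tight_act S s \<xi>)"
        using h(2) act_iff[OF s dmD(3,2)[OF xV(3)]] act_iff[OF s dmD(3,2)[OF ed]] by (simp add: agree_def)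
      then show ?thesis using W(3) at[OF e] e by blast
    qed
    then show "\<exists>W. finite W \<and> W \<subseteq> E \<and> (\<forall>\<eta>\<in>\<tau>. agree W \<eta> \<xi> \<longrightarrow> \<eta> \<in> {\<xi> \<in> V. tight_act S s \<xi> \<in> U})"
      using W(1,2) W1(1,2) conj_E'[OF s] by (intro exI[of _ ?W] conjI ballI impI) auto
  qed
  then show ?thesis
    unfolding continuous_map top openin_open_subtopology[OF V(1)] topspace_TT using at by blast
qed

lemma star_BB: assumes s: "s \<in> carrier S" and f: "f \<in> BB s" shows "star CG f \<in> BB (s\<dagger>)"
proof -
  have sc: "s\<dagger> \<in> carrier S" using s by (rule inv_closed)
  let ?\<phi> = "\<lambda>\<xi>. cnj (f (germ S s (tight_act S (s\<dagger>) \<xi>)))"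
  have im: "tight_act S (s\<dagger>) \<in> topspace (subtopology TT (dm (s\<dagger>))) \<rightarrow> dm s"
    using act_dm[OF sc] s by (auto simp: inv_inv)
  have "continuous_map (subtopology TT (dm (s\<dagger>))) (subtopology TT (dm s)) (tight_act S (s\<dagger>))"
    using act_continuous[OF sc openin_dm[OF sc] order_refl] im by (rule continuous_map_in_subtopology[THEN iffD2, OF conjI])
  from continuous_map_compose[OF this BB_germ[OF s f]]
  have "continuous_map (subtopology TT (dm (s\<dagger>))) euclidean (\<lambda>\<xi>. f (germ S s (tight_act S (s\<dagger>) \<xi>)))" by (simp add: o_def)
  then have "continuous_map (subtopology TT (dm (s\<dagger>))) euclidean ?\<phi>"
    by (simp add: continuous_map_atin tendsto_cnj)
  from mk_BB[OF sc this] have m: "(\<lambda>\<gamma>. if \<gamma> \<in> Th (s\<dagger>) then ?\<phi> (gsrc GG \<gamma>) else 0) \<in> BB (s\<dagger>)" .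
  have "star CG f = (\<lambda>\<gamma>. if \<gamma> \<in> Th (s\<dagger>) then ?\<phi> (gsrc GG \<gamma>) else 0)"
  proof (rule ext)
    fix \<gamma>
    show "star CG f \<gamma> = (if \<gamma> \<in> Th (s\<dagger>) then ?\<phi> (gsrc GG \<gamma>) else 0)"
    proof (cases "\<gamma> \<in> Th (s\<dagger>)")
      case True
      then obtain \<xi> where x: "\<xi> \<in> dm (s\<dagger>)" "\<gamma> = germ S (s\<dagger>) \<xi>" unfolding Th_iff by blast
      have "\<gamma> \<in> arrows GG" by (rule Th_arrow[OF sc True])
      then show ?thesis using True x inv_germ[OF sc x(1)] s sc by (simp add: Gr.cc_ops src_germ inv_inv)
    next
      case False
      have "f (ginv GG \<gamma>) = 0" if g: "\<gamma> \<in> arrows GG"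
      proof (rule ccontr)
        assume "f (ginv GG \<gamma>) \<noteq> 0"
        then have "ginv GG \<gamma> \<in> Th s" using f unfolding BB_def by blast
        then obtain \<eta> where h: "\<eta> \<in> dm s" "ginv GG \<gamma> = germ S s \<eta>" unfolding Th_iff by blast
        have "\<gamma> = ginv GG (germ S s \<eta>)" using Gr.ginv_ginv[OF g] h(2) by simp
        then have "\<gamma> = germ S (s\<dagger>) (tight_act S s \<eta>)" using inv_germ[OF s h(1)] by simp
        then show False using False act_dm[OF s h(1)] unfolding Th_iff by blast
      qed
      then show ?thesis using False by (simp add: Gr.cc_ops)
    qed
  qed
  then show ?thesis using m by simp
qed

lemma BB_Th: "f \<in> BB s \<Longrightarrow> f \<gamma> \<noteq> 0 \<Longrightarrow> \<gamma> \<in> Th s"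
  unfolding BB_def by blast

lemma Th_src: "s \<in> carrier S \<Longrightarrow> \<gamma> \<in> Th s \<Longrightarrow> gsrc GG \<gamma> \<in> dm s \<and> \<gamma> = germ S s (gsrc GG \<gamma>)"
  unfolding Th_iff by (auto simp: src_germ)

lemma Th_rng: "s \<in> carrier S \<Longrightarrow> \<gamma> \<in> Th s \<Longrightarrow> \<gamma> = germ S s (tight_act S (s\<dagger>) (grng GG \<gamma>))"
  unfolding Th_iff by (auto simp: rng_germ act_act_inv)

lemma BB_ffin: assumes s: "s \<in> carrier S" and f: "f \<in> BB s" shows "Gr.ffin f"
proof -
  have "{\<gamma> \<in> arrows GG. gsrc GG \<gamma> = x \<and> f \<gamma> \<noteq> 0} \<subseteq> {germ S s x}" for x
    using Th_src[OF s] BB_Th[OF f] by blast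
  moreover have "{\<gamma> \<in> arrows GG. grng GG \<gamma> = x \<and> f \<gamma> \<noteq> 0} \<subseteq> {germ S s (tight_act S (s\<dagger>) x)}" for x
    using Th_rng[OF s] BB_Th[OF f] by blast
  moreover have "f \<gamma> = 0" if "\<gamma> \<notin> arrows GG" for \<gamma> using that Th_arrow[OF s] BB_Th[OF f] by blast
  ultimately show ?thesis unfolding Gr.ffin_def by (meson finite.emptyI finite_insert finite_subset)
qed

text \<open>A source fibre meets a bisection in at most one arrow, so the convolution has at most
  one nonzero term and is supported over the product of the two elements.\<close>

lemma mult_BB:
  assumes s: "s \<in> carrier S" and t: "t \<in> carrier S" and f: "f \<in> BB s" and g: "g \<in> BB t"
  shows "f \<otimes>\<^bsub>CG\<^esub> g \<in> BB (s \<cdot> t)"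
    and "\<And>\<xi>. \<xi> \<in> dm (s \<cdot> t) \<Longrightarrow> (f \<otimes>\<^bsub>CG\<^esub> g) (germ S (s \<cdot> t) \<xi>) = f (germ S s (tight_act S t \<xi>)) * g (germ S t \<xi>)"
proof -
  have st: "s \<cdot> t \<in> carrier S" using s t by (rule sm_closed)
  let ?\<phi> = "\<lambda>\<xi>. f (germ S s (tight_act S t \<xi>)) * g (germ S t \<xi>)"
  let ?X = "subtopology TT (dm (s \<cdot> t))"
  have sub: "dm (s \<cdot> t) \<subseteq> dm t" using dm_comp[OF s t] by blast
  have im: "tight_act S t \<in> topspace ?X \<rightarrow> dm s" using dm_comp[OF s t] by auto
  have "continuous_map ?X (subtopology TT (dm s)) (tight_act S t)"
    using act_continuous[OF t openin_dm[OF st] sub] im by (rule continuous_map_in_subtopology[THEN iffD2, OF conjI])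
  from continuous_map_compose[OF this BB_germ[OF s f]]
  have c1: "continuous_map ?X euclidean (\<lambda>\<xi>. f (germ S s (tight_act S t \<xi>)))" by (simp add: o_def)
  have c2: "continuous_map ?X euclidean (\<lambda>\<xi>. g (germ S t \<xi>))"
    by (rule continuous_map_from_subtopology_mono[OF BB_germ[OF t g] sub])
  have "continuous_map ?X euclidean ?\<phi>"
    using c1 c2 by (simp add: continuous_map_atin tendsto_mult)
  from mk_BB[OF st this] have m: "(\<lambda>\<gamma>. if \<gamma> \<in> Th (s \<cdot> t) then ?\<phi> (gsrc GG \<gamma>) else 0) \<in> BB (s \<cdot> t)" .
  have val: "(f \<otimes>\<^bsub>CG\<^esub> g) \<gamma> = (if \<gamma> \<in> Th (s \<cdot> t) then ?\<phi> (gsrc GG \<gamma>) else 0)" for \<gamma>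
  proof (cases "\<gamma> \<in> arrows GG")
    case False
    then show ?thesis using Th_arrow[OF st] by (auto simp: Gr.cc_mult)
  next
    case gA: True
    let ?x = "gsrc GG \<gamma>"
    let ?W = "if ?x \<in> dm t then {germ S t ?x} else {}"
    have conv: "(f \<otimes>\<^bsub>CG\<^esub> g) \<gamma> = (\<Sum>\<delta>\<in>?W. f (gcomp GG \<gamma> (ginv GG \<delta>)) * g \<delta>)"
    proof (rule Gr.conv2[OF gA])
      show "?W \<subseteq> {\<delta> \<in> arrows GG. gsrc GG \<delta> = ?x}" using germ_arrow[OF t] src_germ[OF t] by auto
      show "{\<delta> \<in> arrows GG. gsrc GG \<delta> = ?x \<and> g \<delta> \<noteq> 0} \<subseteq> ?W"
      proof
        fix \<delta> assume "\<delta> \<in> {\<delta> \<in> arrows GG. gsrc GG \<delta> = ?x \<and> g \<delta> \<noteq> 0}"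
        then show "\<delta> \<in> ?W" using Th_src[OF t BB_Th[OF g, of \<delta>]] by auto
      qed
    qed simp
    show ?thesis
    proof (cases "\<gamma> \<in> Th (s \<cdot> t)")
      case True
      then have x: "?x \<in> dm (s \<cdot> t)" "\<gamma> = germ S (s \<cdot> t) ?x" using Th_src[OF st] by auto
      then have xt: "?x \<in> dm t" "tight_act S t ?x \<in> dm s" using dm_comp[OF s t] by auto
      have "\<gamma> = gcomp GG (germ S s (tight_act S t ?x)) (germ S t ?x)" using comp_germ[OF s t xt] x(2) by simp
      then have "gcomp GG \<gamma> (ginv GG (germ S t ?x)) = germ S s (tight_act S t ?x)"
        using Gr.cancel_inv[OF germ_arrow[OF s xt(2)] germ_arrow[OF t xt(1)]] src_germ[OF s xt(2)] rng_germ[OF t xt(1)] by simp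
      then show ?thesis using True xt conv by simp
    next
      case False
      have "f (gcomp GG \<gamma> (ginv GG (germ S t ?x))) = 0" if xt: "?x \<in> dm t"
      proof (rule ccontr)
        let ?d = "germ S t ?x"
        assume "f (gcomp GG \<gamma> (ginv GG ?d)) \<noteq> 0"
        then have T: "gcomp GG \<gamma> (ginv GG ?d) \<in> Th s" by (rule BB_Th[OF f])
        have d: "?d \<in> arrows GG" "gsrc GG \<gamma> = gsrc GG ?d" using germ_arrow[OF t xt] src_germ[OF t xt] by auto
        have "gsrc GG (gcomp GG \<gamma> (ginv GG ?d)) = tight_act S t ?x"
          using Gr.div_simps(2)[OF gA d] rng_germ[OF t xt] by simp
        then have q: "tight_act S t ?x \<in> dm s" "gcomp GG \<gamma> (ginv GG ?d) = germ S s (tight_act S t ?x)"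
          using Th_src[OF s T] by auto
        have "\<gamma> = gcomp GG (gcomp GG \<gamma> (ginv GG ?d)) ?d" using Gr.div_simps(5)[OF gA d] by simp
        also have "\<dots> = germ S (s \<cdot> t) ?x" unfolding q(2) by (rule comp_germ[OF s t xt q(1)])
        finally have "\<gamma> \<in> Th (s \<cdot> t)" using dm_comp[OF s t] xt q(1) unfolding Th_iff by blast
        then show False using False by blast
      qed
      then show ?thesis using False conv by simp
    qed
  qed
  show "f \<otimes>\<^bsub>CG\<^esub> g \<in> BB (s \<cdot> t)" 
  proof -
    have "f \<otimes>\<^bsub>CG\<^esub> g = (\<lambda>\<gamma>. if \<gamma> \<in> Th (s \<cdot> t) then ?\<phi> (gsrc GG \<gamma>) else 0)" by (rule ext) (rule val)
    then show ?thesis using m by (simp only:)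
  qed
  show "(f \<otimes>\<^bsub>CG\<^esub> g) (germ S (s \<cdot> t) \<xi>) = ?\<phi> \<xi>" if x: "\<xi> \<in> dm (s \<cdot> t)" for \<xi>
  proof -
    have "germ S (s \<cdot> t) \<xi> \<in> Th (s \<cdot> t)" unfolding Th_iff using x by blast
    then show ?thesis using val[of "germ S (s \<cdot> t) \<xi>"] src_germ[OF st x] by simp
  qed
qed

lemma ffin_add: assumes f: "Gr.ffin f" and g: "Gr.ffin g" shows "Gr.ffin (\<lambda>\<gamma>. f \<gamma> + g \<gamma>)"
proof -
  have "{\<gamma> \<in> arrows GG. p \<gamma> = x \<and> f \<gamma> + g \<gamma> \<noteq> 0} \<subseteq> {\<gamma> \<in> arrows GG. p \<gamma> = x \<and> f \<gamma> \<noteq> 0} \<union> {\<gamma> \<in> arrows GG. p \<gamma> = x \<and> g \<gamma> \<noteq> 0}"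
    for p :: "('a \<times> 'a set) set \<Rightarrow> 'a set" and x by auto
  then show ?thesis unfolding Gr.ffin_def using Gr.ffinD[OF f] Gr.ffinD[OF g]
    by (intro conjI allI impI) (simp, (rule finite_subset, assumption, simp)+)
qed

lemma ffin_zero: "Gr.ffin (\<lambda>_. 0)" by (simp add: Gr.ffin_def)

lemma Cc_ffin: "f \<in> carrier CG \<Longrightarrow> Gr.ffin f"
  by (rule Cc_induct[of f Gr.ffin]) (simp_all add: BB_ffin ffin_zero ffin_add)

lemma Cc_zero: "(\<lambda>_. 0) \<in> carrier CG"
  by (rule Cc_supset[of _ "{}"]) simp_all

lemma Cc_star: assumes "f \<in> carrier CG" shows "star CG f \<in> carrier CG"
  using assms
proof (rule Cc_induct)
  have "star CG (\<lambda>_. 0) = (\<lambda>_. 0)" by (rule ext) (simp add: Gr.cc_ops)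
  then show "star CG (\<lambda>_. 0) \<in> carrier CG" using Cc_zero by simp
  fix f g assume "star CG f \<in> carrier CG" "star CG g \<in> carrier CG"
  moreover have "star CG (\<lambda>\<gamma>. f \<gamma> + g \<gamma>) = (\<lambda>\<gamma>. star CG f \<gamma> + star CG g \<gamma>)" by (auto simp: Gr.cc_ops)
  ultimately show "star CG (\<lambda>\<gamma>. f \<gamma> + g \<gamma>) \<in> carrier CG" using Cc_add by simp
qed (blast intro: BB_Cc star_BB inv_closed)

lemma Cc_mult: assumes f: "f \<in> carrier CG" and g: "g \<in> carrier CG" shows "f \<otimes>\<^bsub>CG\<^esub> g \<in> carrier CG"
  using f
proof (rule Cc_induct)
  fix s f assume s: "s \<in> carrier S" "f \<in> BB s"
  show "f \<otimes>\<^bsub>CG\<^esub> g \<in> carrier CG"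
    using g
  proof (rule Cc_induct)
    show "f \<otimes>\<^bsub>CG\<^esub> g \<in> carrier CG" if "t \<in> carrier S" "g \<in> BB t" for t g
      by (rule BB_Cc[OF sm_closed[OF s(1) that(1)] mult_BB(1)[OF s(1) that(1) s(2) that(2)]])
    show "f \<otimes>\<^bsub>CG\<^esub> (\<lambda>_. 0) \<in> carrier CG" using Cc_zero by (simp add: Gr.cc_mult[abs_def] fun_eq_iff cong: if_cong)
    fix g h assume "g \<in> carrier CG" "h \<in> carrier CG" "f \<otimes>\<^bsub>CG\<^esub> g \<in> carrier CG" "f \<otimes>\<^bsub>CG\<^esub> h \<in> carrier CG"
    then show "f \<otimes>\<^bsub>CG\<^esub> (\<lambda>\<gamma>. g \<gamma> + h \<gamma>) \<in> carrier CG"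
      using Gr.conv_distrib_left[OF BB_ffin[OF s] Cc_ffin Cc_ffin] Cc_add by simp
  qed
next
  have "(\<lambda>_. 0) \<otimes>\<^bsub>CG\<^esub> g = (\<lambda>_. 0)" by (rule ext) (simp add: Gr.cc_mult)
  then show "(\<lambda>_. 0) \<otimes>\<^bsub>CG\<^esub> g \<in> carrier CG" using Cc_zero by simp
next
  fix f h assume "f \<in> carrier CG" "h \<in> carrier CG" "f \<otimes>\<^bsub>CG\<^esub> g \<in> carrier CG" "h \<otimes>\<^bsub>CG\<^esub> g \<in> carrier CG"
  then show "(\<lambda>\<gamma>. f \<gamma> + h \<gamma>) \<otimes>\<^bsub>CG\<^esub> g \<in> carrier CG"
    using Gr.conv_distrib_right[OF Cc_ffin Cc_ffin Cc_ffin[OF g]] Cc_add by simp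
qed

lemma BB_bound: assumes s: "s \<in> carrier S" and f: "f \<in> BB s" shows "\<exists>K\<ge>0. \<forall>\<gamma>. cmod (f \<gamma>) \<le> K"
proof -
  have "compactin euclidean (f ` Th s)"
    by (rule image_compactin[OF compact_Th[OF s]]) (use f in \<open>simp add: BB_def\<close>)
  then have "bounded (f ` Th s)" by (simp add: compact_imp_bounded)
  then obtain K where K: "\<forall>z\<in>f ` Th s. norm z \<le> K" unfolding bounded_iff by blast
  have "cmod (f \<gamma>) \<le> max K 0" for \<gamma>
    using K BB_Th[OF f, of \<gamma>] by (cases "f \<gamma> = 0") (auto simp: le_max_iff_disj)
  then show ?thesis by (intro exI[of _ "max K 0"]) simp
qed

text \<open>Source and range are injective on a bisection, so the matrix of \<open>f\<close> has at
  most one nonzero entry in every row and every column. Its operator norm is therefore at most a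
  bound for the values of \<open>f\<close>.\<close>

lemma BB_nbd: assumes s: "s \<in> carrier S" and f: "f \<in> BB s" shows "\<exists>M. Gr.nbd f M"
proof -
  obtain K where K: "K \<ge> 0" "\<forall>\<gamma>. cmod (f \<gamma>) \<le> K" using BB_bound[OF s f] by blast
  have "Gr.nbd f K"
  proof (rule Gr.nbdI[OF K(1)])
    fix x U V v
    assume a: "x \<in> gsrc GG ` arrows GG" "finite U" "U \<subseteq> src_fibre GG x" "finite V" "V \<subseteq> src_fibre GG x"
    have A: "\<gamma> \<in> arrows GG \<and> gsrc GG \<gamma> = x" if "\<gamma> \<in> U \<union> V" for \<gamma> using that a(3,5) by (auto simp: Gr.fib_iff)
    let ?q = "\<lambda>\<gamma> \<beta>. gcomp GG \<gamma> (ginv GG \<beta>)"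
    have col: "\<gamma> = \<gamma>'" if "\<gamma> \<in> U" "\<gamma>' \<in> U" "\<beta> \<in> V" "f (?q \<gamma> \<beta>) \<noteq> 0" "f (?q \<gamma>' \<beta>) \<noteq> 0" for \<gamma> \<gamma>' \<beta>
    proof -
      have "gsrc GG (?q \<gamma> \<beta>) = grng GG \<beta>" "gsrc GG (?q \<gamma>' \<beta>) = grng GG \<beta>"
        using A that by (simp_all add: Gr.div_simps)
      then have "?q \<gamma> \<beta> = ?q \<gamma>' \<beta>"
        using Th_src[OF s BB_Th[OF f that(4)]] Th_src[OF s BB_Th[OF f that(5)]] by metis
      then show ?thesis using A that by (intro Gr.div_inj[of \<gamma> \<beta> \<gamma>']) simp_all
    qed
    have row: "\<beta> = \<beta>'" if "\<gamma> \<in> U" "\<beta> \<in> V" "\<beta>' \<in> V" "f (?q \<gamma> \<beta>) \<noteq> 0" "f (?q \<gamma> \<beta>') \<noteq> 0" for \<gamma> \<beta> \<beta>'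
    proof -
      have "grng GG (?q \<gamma> \<beta>) = grng GG \<gamma>" "grng GG (?q \<gamma> \<beta>') = grng GG \<gamma>"
        using A that by (simp_all add: Gr.div_simps)
      then have "?q \<gamma> \<beta> = ?q \<gamma> \<beta>'"
        using Th_rng[OF s BB_Th[OF f that(4)]] Th_rng[OF s BB_Th[OF f that(5)]] by metis
      then show ?thesis using A that by (intro Gr.div_inj2[of \<gamma> \<beta> \<beta>']) simp_all
    qed
    have sq: "(cmod (Gr.ap f v V \<gamma>))\<^sup>2 = (\<Sum>\<beta>\<in>V. (cmod (f (?q \<gamma> \<beta>) * v \<beta>))\<^sup>2)" if g: "\<gamma> \<in> U" for \<gamma>
    proof (cases "\<exists>\<beta>\<in>V. f (?q \<gamma> \<beta>) \<noteq> 0")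
      case True
      then obtain \<beta> where b: "\<beta> \<in> V" "f (?q \<gamma> \<beta>) \<noteq> 0" by blast
      have z: "f (?q \<gamma> \<beta>') = 0" if "\<beta>' \<in> V - {\<beta>}" for \<beta>' using row[OF g b(1), of \<beta>'] b(2) that by blast
      have "Gr.ap f v V \<gamma> = f (?q \<gamma> \<beta>) * v \<beta>"
        unfolding Gr.ap_def using sum.remove[OF a(4) b(1), of "\<lambda>\<beta>. f (?q \<gamma> \<beta>) * v \<beta>"] z by simp
      moreover have "(\<Sum>\<beta>\<in>V. (cmod (f (?q \<gamma> \<beta>) * v \<beta>))\<^sup>2) = (cmod (f (?q \<gamma> \<beta>) * v \<beta>))\<^sup>2"
        using sum.remove[OF a(4) b(1), of "\<lambda>\<beta>. (cmod (f (?q \<gamma> \<beta>) * v \<beta>))\<^sup>2"] z by simp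
      ultimately show ?thesis by simp
    next
      case False then show ?thesis by (simp add: Gr.ap_def)
    qed
    have "(Gr.l2 (Gr.ap f v V) U)\<^sup>2 = (\<Sum>\<gamma>\<in>U. \<Sum>\<beta>\<in>V. (cmod (f (?q \<gamma> \<beta>) * v \<beta>))\<^sup>2)"
      unfolding Gr.l2_power2 by (rule sum.cong[OF refl sq])
    also have "\<dots> = (\<Sum>\<beta>\<in>V. \<Sum>\<gamma>\<in>U. (cmod (f (?q \<gamma> \<beta>) * v \<beta>))\<^sup>2)" by (rule sum.swap)
    also have "\<dots> \<le> (\<Sum>\<beta>\<in>V. K\<^sup>2 * (cmod (v \<beta>))\<^sup>2)"
    proof (rule sum_mono)
      fix \<beta> assume b: "\<beta> \<in> V"
      show "(\<Sum>\<gamma>\<in>U. (cmod (f (?q \<gamma> \<beta>) * v \<beta>))\<^sup>2) \<le> K\<^sup>2 * (cmod (v \<beta>))\<^sup>2"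
      proof (cases "\<exists>\<gamma>\<in>U. f (?q \<gamma> \<beta>) \<noteq> 0")
        case True
        then obtain \<gamma> where g: "\<gamma> \<in> U" "f (?q \<gamma> \<beta>) \<noteq> 0" by blast
        have z: "f (?q \<gamma>' \<beta>) = 0" if "\<gamma>' \<in> U - {\<gamma>}" for \<gamma>' using col[OF g(1) _ b, of \<gamma>'] g(2) that by blast
        have "(\<Sum>\<gamma>\<in>U. (cmod (f (?q \<gamma> \<beta>) * v \<beta>))\<^sup>2) = (cmod (f (?q \<gamma> \<beta>)))\<^sup>2 * (cmod (v \<beta>))\<^sup>2"
          using sum.remove[OF a(2) g(1), of "\<lambda>\<gamma>. (cmod (f (?q \<gamma> \<beta>) * v \<beta>))\<^sup>2"] z by (simp add: norm_mult power_mult_distrib)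
        also have "\<dots> \<le> K\<^sup>2 * (cmod (v \<beta>))\<^sup>2" using K by (intro mult_right_mono power_mono) simp_all
        finally show ?thesis .
      next
        case False then show ?thesis using K by simp
      qed
    qed
    also have "\<dots> = (K * Gr.l2 v V)\<^sup>2" by (simp add: power_mult_distrib Gr.l2_power2 sum_distrib_left)
    finally show "Gr.l2 (Gr.ap f v V) U \<le> K * Gr.l2 v V"
      by (rule power2_le_imp_le) (simp add: K Gr.l2_nonneg)
  qed
  then show ?thesis by blast
qed

lemma Cc_nbd: "f \<in> carrier CG \<Longrightarrow> \<exists>M. Gr.nbd f M"
proof (erule Cc_induct)
  show "\<exists>M. Gr.nbd (\<lambda>_. 0) M" by (intro exI[of _ 0]) (simp add: Gr.nbd_def Gr.ap_def[abs_def] L2_set_def)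
qed (use BB_nbd Gr.nbd_add in blast)+

sublocale CGr: cc_groupoid GG "germ S u"
proof
  show "arrows GG \<noteq> {}" using tight_nonempty dm_unit germ_arrow[OF unit_closed] by blast
qed (use Cc_ffin Cc_nbd Cc_mult Cc_star Cc_add Cc_scale Cc_zero in \<open>simp_all only: Gr.cc_ops\<close>)

end


section \<open>Fixed idempotents and values at units\<close>

context inverse_monoid
begin

text \<open>For tight \<xi> this says that the unit arrow at \<xi> lies in the bisection of
  \<open>s\<close>; it decides the value of \<open>tight_T S s\<close> there.\<close>

definition stab :: "'a \<Rightarrow> 'a set \<Rightarrow> bool" where
  "stab s \<xi> \<longleftrightarrow> (\<exists>e\<in>\<xi>. s \<cdot> e = e)"

text \<open>If s e = e, then comparing \<open>e\<close> with the domain idempotent of s e shows that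
  e lies below s* s.\<close>

lemma stab_dom: assumes s: "s \<in> carrier S" and x: "\<xi> \<in> \<tau>" and st: "stab s \<xi>" shows "\<xi> \<in> dm s"
proof -
  obtain e where e: "e \<in> \<xi>" "s \<cdot> e = e" using st unfolding stab_def by blast
  have eE: "e \<in> E" by (rule filter_sub[OF tight_filter[OF x] e(1)])
  note c = s inv_closed[OF s] E_carrier[OF eE]
  have "e = (s \<cdot> e)\<dagger> \<cdot> (s \<cdot> e)" unfolding e(2) using eE by (simp add: inv_E E_idem)
  also have "\<dots> = e \<cdot> ((s\<dagger> \<cdot> s) \<cdot> e)" using c eE by (simp add: inv_mult inv_E sm_assoc sm_closed)
  also have "\<dots> = (s\<dagger> \<cdot> s) \<cdot> (e \<cdot> e)" by (rule E_left_commute[OF eE dom_E[OF s] c(3)])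
  also have "\<dots> = (s\<dagger> \<cdot> s) \<cdot> e" using eE by (simp add: E_idem)
  finally have "(s\<dagger> \<cdot> s) \<cdot> e = e" by simp
  then have "s\<dagger> \<cdot> s \<in> \<xi>" by (rule filter_up[OF tight_filter[OF x] e(1) dom_E[OF s]])
  then show ?thesis by (rule dmI[OF x])
qed

text \<open>Compressing by an isometry \<open>v\<close> moves the question from \<xi> to its
  translate. The forward direction is the harder one: with a = s v e, the hypothesis v* a = e
  controls only the part of \<open>a\<close> in the range of \<open>v\<close>. The domain
  \<open>f\<close> of that part turns out to satisfy f e = e, so nothing of \<open>a\<close> is lost
  and a = v e.\<close>

lemma stab_conj:
  assumes v: "v \<in> carrier S" "v\<dagger> \<cdot> v = u" and s: "s \<in> carrier S" and x: "\<xi> \<in> \<tau>"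
  shows "stab (v\<dagger> \<cdot> (s \<cdot> v)) \<xi> \<longleftrightarrow> stab s (tight_act S v \<xi>)"
proof
  have xf: "\<xi> \<in> sfilters S" by (rule tight_filter[OF x])
  have dx: "v\<dagger> \<cdot> v \<in> \<xi>" unfolding v(2) by (rule filter_unit[OF xf])
  note ai = act_iff[OF v(1) xf dx]
  note vc = v(1) inv_closed[OF v(1)] s
  have cancel: "v\<dagger> \<cdot> (v \<cdot> y) = y" if "y \<in> carrier S" for y
    using sm_assoc[OF vc(2,1) that] v(2) unit_left[OF that] by simp
  {
    assume "stab (v\<dagger> \<cdot> (s \<cdot> v)) \<xi>"
    then obtain e where e: "e \<in> \<xi>" "v\<dagger> \<cdot> (s \<cdot> v) \<cdot> e = e" unfolding stab_def by blast
    have eE: "e \<in> E" by (rule filter_sub[OF xf e(1)])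
    have ec: "e \<in> carrier S" by (rule E_carrier[OF eE])
    define a where "a = s \<cdot> (v \<cdot> e)"
    have ac: "a \<in> carrier S" "a\<dagger> \<in> carrier S" unfolding a_def using vc ec by (simp_all add: sm_closed inv_closed)
    have va: "v\<dagger> \<cdot> a = e" unfolding a_def using e(2) vc ec by (simp add: sm_assoc sm_closed)
    have r: "v \<cdot> v\<dagger> \<in> E" by (rule ran_E[OF v(1)])
    define f where "f = a\<dagger> \<cdot> ((v \<cdot> v\<dagger>) \<cdot> a)"
    have fE: "f \<in> E" unfolding f_def by (rule conj_E'[OF ac(1) r])
    have "(v \<cdot> v\<dagger>) \<cdot> a = v \<cdot> (v\<dagger> \<cdot> a)" using vc ac by (simp add: sm_assoc)
    then have af: "a \<cdot> f = v \<cdot> e" using idem_swap[OF ac(1) r] unfolding va f_def by simp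
    have "e = (v \<cdot> e)\<dagger> \<cdot> (v \<cdot> e)" using vc ec eE by (simp add: inv_mult inv_E sm_assoc sm_closed cancel E_idem)
    also have "\<dots> = f \<cdot> (a\<dagger> \<cdot> (a \<cdot> f))"
      unfolding af[symmetric] using ac fE E_carrier[OF fE] by (simp add: inv_mult inv_E sm_assoc sm_closed)
    finally have e1: "e = f \<cdot> (a\<dagger> \<cdot> (a \<cdot> f))" .
    have "f \<cdot> e = f \<cdot> (f \<cdot> (a\<dagger> \<cdot> (a \<cdot> f)))" by (subst e1) (rule refl)
    also have "\<dots> = (f \<cdot> f) \<cdot> (a\<dagger> \<cdot> (a \<cdot> f))"
      by (rule sm_assoc[symmetric]) (use ac E_carrier[OF fE] in \<open>simp_all only: sm_closed\<close>)
    also have "\<dots> = e" unfolding E_idem[OF fE] by (rule e1[symmetric])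
    finally have fe: "f \<cdot> e = e" .
    have "a = a \<cdot> e" unfolding a_def using vc ec eE by (simp add: sm_assoc sm_closed E_idem)
    also have "\<dots> = a \<cdot> (f \<cdot> e)" unfolding fe by (rule refl)
    also have "\<dots> = (a \<cdot> f) \<cdot> e" by (rule sm_assoc[symmetric, OF ac(1) E_carrier[OF fE] ec])
    also have "\<dots> = v \<cdot> e" unfolding af using vc ec eE by (simp add: sm_assoc E_idem)
    finally have a: "s \<cdot> (v \<cdot> e) = v \<cdot> e" unfolding a_def .
    let ?g = "v \<cdot> (e \<cdot> v\<dagger>)"
    have gE: "?g \<in> E" by (rule conj_E[OF v(1) eE])
    have "v\<dagger> \<cdot> (?g \<cdot> v) = e" using vc ec by (simp add: sm_assoc sm_closed cancel v(2) unit_right)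
    then have "?g \<in> tight_act S v \<xi>" using ai gE e(1) by simp
    moreover have "s \<cdot> ?g = ?g"
    proof -
      have "s \<cdot> ?g = (s \<cdot> (v \<cdot> e)) \<cdot> v\<dagger>" using vc ec by (simp add: sm_assoc sm_closed)
      also have "\<dots> = ?g" unfolding a using vc ec by (simp add: sm_assoc)
      finally show ?thesis .
    qed
    ultimately show "stab s (tight_act S v \<xi>)" unfolding stab_def by blast
  next
    assume "stab s (tight_act S v \<xi>)"
    then obtain f where f: "f \<in> tight_act S v \<xi>" "s \<cdot> f = f" unfolding stab_def by blast
    have fE: "f \<in> E" and fx: "v\<dagger> \<cdot> (f \<cdot> v) \<in> \<xi>" using f(1) ai by blast+
    have fc: "f \<in> carrier S" by (rule E_carrier[OF fE])
    have "v\<dagger> \<cdot> (s \<cdot> v) \<cdot> (v\<dagger> \<cdot> (f \<cdot> v)) = v\<dagger> \<cdot> (s \<cdot> ((v \<cdot> v\<dagger>) \<cdot> (f \<cdot> v)))" using vc fc by (simp add: sm_assoc sm_closed)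
    also have "(v \<cdot> v\<dagger>) \<cdot> (f \<cdot> v) = f \<cdot> ((v \<cdot> v\<dagger>) \<cdot> v)" by (rule E_left_commute[OF ran_E[OF v(1)] fE v(1)])
    also have "\<dots> = f \<cdot> v" using vc by (simp add: sm_assoc regular)
    also have "s \<cdot> (f \<cdot> v) = f \<cdot> v" using sm_assoc[OF vc(3) fc vc(1)] f(2) by simp
    finally show "stab (v\<dagger> \<cdot> (s \<cdot> v)) \<xi>" unfolding stab_def using fx by blast
  }
qed

end

context inverse_monoid_fc
begin

lemma Th_unit_iff: assumes s: "s \<in> carrier S" and x: "\<xi> \<in> \<tau>"
  shows "germ S u \<xi> \<in> Th s \<longleftrightarrow> stab s \<xi>"
proof
  have xu: "\<xi> \<in> dm u" using x by (simp add: dm_unit)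
  have e: "eqg u s \<xi> \<longleftrightarrow> stab s \<xi>"
    unfolding eqg_def stab_def using filter_sub[OF tight_filter[OF x]] by (auto simp: unit_left E_carrier dest: sym)
  show "stab s \<xi>" if "germ S u \<xi> \<in> Th s"
  proof -
    have "\<exists>\<eta>\<in>dm s. germ S u \<xi> = germ S s \<eta>" using that by (simp only: Th_iff)
    then obtain \<eta> where \<eta>: "\<eta> \<in> dm s" "germ S u \<xi> = germ S s \<eta>" by (rule bexE)
    have "eqg u s \<xi>" using germ_eq_iff[OF unit_closed s xu \<eta>(1), THEN iffD1, OF \<eta>(2)] by (rule conjunct2)
    then show ?thesis using e by simp
  qed
  show "germ S u \<xi> \<in> Th s" if "stab s \<xi>"
  proof -
    have d: "\<xi> \<in> dm s" by (rule stab_dom[OF s x that])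
    then have "germ S u \<xi> = germ S s \<xi>" using germ_eq_iff[OF unit_closed s xu d] e that by simp
    then show ?thesis unfolding Th_iff using d by blast
  qed
qed

lemma tight_T_unit: "s \<in> carrier S \<Longrightarrow> \<xi> \<in> \<tau> \<Longrightarrow> tight_T S s (germ S u \<xi>) = of_bool (stab s \<xi>)"
  using Th_unit_iff[of s \<xi>] by (simp add: tight_T_def Th_def indicator_def)

lemma tight_T_closed: assumes s: "s \<in> carrier S" shows "tight_T S s \<in> carrier CG"
proof (rule BB_Cc[OF s])
  have "tight_T S s = (\<lambda>\<gamma>. if \<gamma> \<in> Th s then (\<lambda>_. 1) (gsrc GG \<gamma>) else 0)"
    by (rule ext) (simp add: tight_T_def Th_def)
  then show "tight_T S s \<in> BB s" using mk_BB[OF s, of "\<lambda>_. 1"] by simp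
qed

lemma tight_T_zero: "tight_T S (szero S) = (\<lambda>_. 0)"
proof -
  have "dm (szero S) = {}"
    using filter_zero tight_filter zero_left[OF inv_closed[OF zero_closed]] zero_right[OF inv_closed[OF zero_closed]]
    by (auto simp: tight_dom_def)
  then show ?thesis unfolding tight_T_def bisection_def by (intro ext) simp
qed

text \<open>An ultrafilter that agrees with \<xi> on the finite sets obtained from the covers
  contains an idempotent \<open>e\<close> below the members of these sets and orthogonal to the
  non-members, so that \<open>e\<close> settles membership for every filter containing it. The
  passage to an ultrafilter is what guarantees orthogonality.\<close>

lemma stab_locally_constant:
  assumes K: "finite K" "K \<subseteq> carrier S" and x: "\<xi> \<in> \<tau>"
  shows "\<exists>e\<in>E. e \<noteq> szero S \<and> (\<forall>\<eta>\<in>\<tau>. e \<in> \<eta> \<longrightarrow> (\<forall>s\<in>K. stab s \<eta> \<longleftrightarrow> stab s \<xi>))"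
proof -
  have "\<forall>s\<in>K. \<exists>C. finite C \<and> C \<subseteq> E \<and> (\<forall>\<eta>\<in>\<tau>. stab s \<eta> \<longleftrightarrow> (\<exists>c\<in>C. c \<in> \<eta>))"
    unfolding stab_def using cover_iff K(2) by blast
  from bchoice[OF this] obtain C where C:
    "\<forall>s\<in>K. finite (C s) \<and> C s \<subseteq> E \<and> (\<forall>\<eta>\<in>\<tau>. stab s \<eta> \<longleftrightarrow> (\<exists>c\<in>C s. c \<in> \<eta>))" by (elim exE)
  define W where "W = (\<Union>s\<in>K. C s)"
  have W: "finite W" "W \<subseteq> E" unfolding W_def using K(1) C by auto
  obtain \<zeta> where z: "\<zeta> \<in> sultrafilters S" "agree W \<zeta> \<xi>" using x W unfolding tight_iff by blast
  have zf: "\<zeta> \<in> sfilters S" by (rule ultra_filter[OF z(1)])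
  have "\<exists>e\<in>\<zeta>. \<forall>c\<in>W. (c \<in> \<zeta> \<longrightarrow> c \<cdot> e = e) \<and> (c \<notin> \<zeta> \<longrightarrow> c \<cdot> e = szero S)"
    using W
  proof (induction W rule: finite_induct)
    case empty
    show ?case using filter_unit[OF zf] by blast
  next
    case (insert c W)
    then obtain e where e: "e \<in> \<zeta>" "\<forall>d\<in>W. (d \<in> \<zeta> \<longrightarrow> d \<cdot> e = e) \<and> (d \<notin> \<zeta> \<longrightarrow> d \<cdot> e = szero S)" by auto
    have eE: "e \<in> E" by (rule filter_sub[OF zf e(1)])
    have cE: "c \<in> E" and WE: "W \<subseteq> E" using insert.prems by auto
    \<comment> \<open>The new factor is \<open>c\<close> itself if it belongs to the ultrafilter,
      and otherwise an element orthogonal to \<open>c\<close>.\<close>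
    obtain h where h: "h \<in> \<zeta>" "c \<in> \<zeta> \<longrightarrow> c \<cdot> (h \<cdot> e) = h \<cdot> e" "c \<notin> \<zeta> \<longrightarrow> c \<cdot> (h \<cdot> e) = szero S"
    proof (cases "c \<in> \<zeta>")
      case True
      have "c \<cdot> (c \<cdot> e) = c \<cdot> e" using sm_assoc[of c c e] cE eE by (simp add: E_carrier E_idem)
      then show ?thesis using that True by blast
    next
      case False
      obtain h where h: "h \<in> \<zeta>" "c \<cdot> h = szero S" using ultra_disjoint[OF z(1) cE False] by blast
      have "c \<cdot> (h \<cdot> e) = szero S"
        using sm_assoc[of c h e] cE eE filter_sub[OF zf h(1)] h(2) by (simp add: E_carrier zero_left)
      then show ?thesis using that h(1) False by blast
    qed
    have hE: "h \<in> E" by (rule filter_sub[OF zf h(1)])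
    have "d \<cdot> (h \<cdot> e) = h \<cdot> (d \<cdot> e)" if "d \<in> W" for d
      using E_left_commute[of d h e] that WE hE eE by (auto simp: E_carrier)
    then have "(d \<in> \<zeta> \<longrightarrow> d \<cdot> (h \<cdot> e) = h \<cdot> e) \<and> (d \<notin> \<zeta> \<longrightarrow> d \<cdot> (h \<cdot> e) = szero S)" if "d \<in> W" for d
      using e(2) that hE by (simp add: zero_right E_carrier)
    then show ?case using h(2,3) filter_mult[OF zf h(1) e(1)] by (intro bexI[of _ "h \<cdot> e"]) auto
  qed
  then obtain e where e: "e \<in> \<zeta>" and ec: "\<forall>c\<in>W. (c \<in> \<zeta> \<longrightarrow> c \<cdot> e = e) \<and> (c \<notin> \<zeta> \<longrightarrow> c \<cdot> e = szero S)" by blast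
  have eE: "e \<in> E" by (rule filter_sub[OF zf e])
  have "e \<noteq> szero S" using filter_zero[OF zf] e by blast
  moreover have "stab s \<eta> \<longleftrightarrow> stab s \<xi>" if n: "\<eta> \<in> \<tau>" "e \<in> \<eta>" and s: "s \<in> K" for \<eta> s
  proof -
    have nf: "\<eta> \<in> sfilters S" by (rule tight_filter[OF n(1)])
    have "c \<in> \<eta> \<longleftrightarrow> c \<in> \<xi>" if c: "c \<in> C s" for c
    proof -
      have cW: "c \<in> W" and cE: "c \<in> E" using c s C unfolding W_def by blast+
      have "c \<in> \<eta> \<longleftrightarrow> c \<in> \<zeta>"
      proof
        show "c \<in> \<eta>" if "c \<in> \<zeta>" using filter_up[OF nf n(2) cE] ec cW that by blast
        show "c \<in> \<zeta>" if "c \<in> \<eta>" using filter_mult[OF nf that n(2)] filter_zero[OF nf] ec cW by metis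
      qed
      then show ?thesis using z(2) cW unfolding agree_def by blast
    qed
    then have "(\<exists>c\<in>C s. c \<in> \<eta>) \<longleftrightarrow> (\<exists>c\<in>C s. c \<in> \<xi>)" by simp
    moreover have "\<forall>\<eta>\<in>\<tau>. stab s \<eta> \<longleftrightarrow> (\<exists>c\<in>C s. c \<in> \<eta>)" using bspec[OF C s] by simp
    ultimately show ?thesis using n(1) x by simp
  qed
  ultimately show ?thesis using eE by blast
qed

text \<open>A list stands for a formal linear combination. The same list is later evaluated in the
  boundary quotient by \<open>lin\<close>, so that operators, functions and compressions are
  compared term by term.\<close>

primrec linT :: "(complex \<times> 'a) list \<Rightarrow> ('a \<times> 'a set) set \<Rightarrow> complex" where
  "linT [] = (\<lambda>_. 0)"
| "linT (z # cs) = (\<lambda>\<gamma>. fst z * tight_T S (snd z) \<gamma> + linT cs \<gamma>)"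

lemma linT_closed: "snd ` set cs \<subseteq> carrier S \<Longrightarrow> linT cs \<in> carrier CG"
  by (induction cs) (auto intro!: Cc_zero Cc_add Cc_scale tight_T_closed)

lemma linT_append: "linT (a @ b) \<gamma> = linT a \<gamma> + linT b \<gamma>"
  by (induction a) simp_all

lemma linT_scale: "linT (map (\<lambda>z. (c * fst z, snd z)) a) \<gamma> = c * linT a \<gamma>"
  by (induction a) (simp_all add: algebra_simps)

lemma linT_unit_cong:
  assumes "snd ` set cs \<subseteq> carrier S" "\<xi> \<in> \<tau>" "\<eta> \<in> \<tau>" "\<forall>s\<in>snd ` set cs. h s \<in> carrier S \<and> (stab (h s) \<eta> \<longleftrightarrow> stab s \<xi>)"
  shows "linT (map (\<lambda>z. (fst z, h (snd z))) cs) (germ S u \<eta>) = linT cs (germ S u \<xi>)"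
  using assms by (induction cs) (auto simp: tight_T_unit)

end


section \<open>The inverse semigroup of a right LCM monoid\<close>

context right_lcm_monoid
begin

abbreviation "SP \<equiv> lcm_semigroup P"
abbreviation "cls \<equiv> lcm_class P"

text \<open>The class \<open>[p, q]\<close> acts on \<open>P\<close> as the partial bijection \<open>qx \<mapsto> px\<close>. This embeds the semigroup
  into the symmetric inverse monoid, from which it inherits its algebraic laws.\<close>

definition rho :: "'p \<Rightarrow> 'p \<Rightarrow> ('p \<times> 'p) set" where
  "rho p q = {(p \<otimes> x, q \<otimes> x) | x. x \<in> carrier P}"

definition rel :: "('p \<times> 'p) set \<Rightarrow> ('p \<times> 'p) set" where
  "rel X = (\<Union>(p, q)\<in>X. rho p q)"

lemma principal_iff: "y \<in> principal P p \<longleftrightarrow> (\<exists>x\<in>carrier P. y = p \<otimes> x)"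
  by (auto simp: l_coset_def)

lemma class_unit: assumes "p \<in> carrier P" "q \<in> carrier P" "w \<in> Units P"
  shows "cls (p \<otimes> w) (q \<otimes> w) = cls p q"
proof (intro subset_antisym subsetI)
  have w: "w \<in> carrier P" "inv w \<in> carrier P" using assms(3) by (simp_all add: Units_closed)
  fix z assume "z \<in> cls (p \<otimes> w) (q \<otimes> w)"
  then obtain v where v: "v \<in> Units P" "z = (p \<otimes> w \<otimes> v, q \<otimes> w \<otimes> v)" unfolding lcm_class_def by blast
  have "z = (p \<otimes> (w \<otimes> v), q \<otimes> (w \<otimes> v))" using v w assms Units_closed[OF v(1)] by (simp add: m_assoc)
  then show "z \<in> cls p q" using Units_m_closed[OF assms(3) v(1)] unfolding lcm_class_def by blast
next
  have w: "w \<in> carrier P" "inv w \<in> carrier P" using assms(3) by (simp_all add: Units_closed)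
  fix z assume "z \<in> cls p q"
  then obtain v where v: "v \<in> Units P" "z = (p \<otimes> v, q \<otimes> v)" unfolding lcm_class_def by blast
  have vc: "v \<in> carrier P" using v(1) by (simp add: Units_closed)
  have "w \<otimes> (inv w \<otimes> v) = v" using assms(3) w vc by (simp add: m_assoc[symmetric])
  then have "z = (p \<otimes> w \<otimes> (inv w \<otimes> v), q \<otimes> w \<otimes> (inv w \<otimes> v))" using v w vc assms by (simp add: m_assoc)
  moreover have "inv w \<otimes> v \<in> Units P" using assms(3) v(1) by simp
  ultimately show "z \<in> cls (p \<otimes> w) (q \<otimes> w)" unfolding lcm_class_def by blast
qed

lemma in_class: assumes "p \<in> carrier P" "q \<in> carrier P" "(a, b) \<in> cls p q"
  shows "a \<in> carrier P \<and> b \<in> carrier P \<and> cls a b = cls p q"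
proof -
  obtain v where "v \<in> Units P" "a = p \<otimes> v" "b = q \<otimes> v" using assms(3) unfolding lcm_class_def by blast
  then show ?thesis using assms class_unit by (simp add: Units_closed)
qed

lemma self_in_class: "p \<in> carrier P \<Longrightarrow> q \<in> carrier P \<Longrightarrow> (p, q) \<in> cls p q"
  unfolding lcm_class_def by (intro CollectI exI[of _ \<one>]) simp

lemma rho_self: "p \<in> carrier P \<Longrightarrow> q \<in> carrier P \<Longrightarrow> (p, q) \<in> rho p q"
  unfolding rho_def by (intro CollectI exI[of _ \<one>]) simp

text \<open>Each pair is a multiple of the other, and left cancellation makes the two multipliers
  inverse to each other, hence units.\<close>

lemma rho_class_eq:
  assumes "p \<in> carrier P" "q \<in> carrier P" "a \<in> carrier P" "b \<in> carrier P" "rho p q = rho a b"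
  shows "cls p q = cls a b"
proof -
  have "(p, q) \<in> rho a b" "(a, b) \<in> rho p q" using rho_self assms by blast+
  then obtain x y where xy: "x \<in> carrier P" "p = a \<otimes> x" "q = b \<otimes> x" "y \<in> carrier P" "a = p \<otimes> y" "b = q \<otimes> y"
    unfolding rho_def by blast
  have "a \<otimes> (x \<otimes> y) = a \<otimes> \<one>" using xy assms by (metis m_assoc r_one)
  then have 1: "x \<otimes> y = \<one>" by (rule left_cancel[rotated 3]) (simp_all add: xy(1,4) assms)
  have "p \<otimes> (y \<otimes> x) = p \<otimes> \<one>" using xy assms by (metis m_assoc r_one)
  then have 2: "y \<otimes> x = \<one>" by (rule left_cancel[rotated 3]) (simp_all add: xy(1,4) assms)
  have "x \<in> Units P" unfolding Units_def using xy 1 2 by blast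
  then show ?thesis using class_unit[OF assms(3,4), of x] xy(2,3) by simp
qed

lemma rho_unit: assumes "p \<in> carrier P" "q \<in> carrier P" "w \<in> Units P" shows "rho (p \<otimes> w) (q \<otimes> w) \<subseteq> rho p q"
  unfolding rho_def using assms Units_closed[OF assms(3)] by (fastforce simp: m_assoc)

lemma rel_class: assumes "p \<in> carrier P" "q \<in> carrier P" shows "rel (cls p q) = rho p q"
proof
  show "rel (cls p q) \<subseteq> rho p q" unfolding rel_def lcm_class_def using rho_unit[OF assms] by blast
  show "rho p q \<subseteq> rel (cls p q)" unfolding rel_def using self_in_class[OF assms] by blast
qed

lemma rel_empty: "rel {} = {}" by (simp add: rel_def)

lemma SP_cases: assumes "X \<in> carrier SP"
  shows "X = {} \<or> (\<exists>p\<in>carrier P. \<exists>q\<in>carrier P. X = cls p q)"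
  using assms by (auto simp: lcm_semigroup_def)

lemma class_SP: "p \<in> carrier P \<Longrightarrow> q \<in> carrier P \<Longrightarrow> cls p q \<in> carrier SP" and zero_SP: "{} \<in> carrier SP"
  by (auto simp: lcm_semigroup_def)

lemma rel_inj: assumes "X \<in> carrier SP" "Y \<in> carrier SP" "rel X = rel Y" shows "X = Y"
proof -
  have cls_ne: "rel (cls p q) \<noteq> {}" if "p \<in> carrier P" "q \<in> carrier P" for p q
    using rho_self[OF that] unfolding rel_class[OF that] by blast
  have ne: "rel Z = {} \<longleftrightarrow> Z = {}" if "Z \<in> carrier SP" for Z
    using SP_cases[OF that] cls_ne by (auto simp: rel_empty)
  show ?thesis
  proof (cases "X = {} \<or> Y = {}")
    case True
    then show ?thesis using ne[OF assms(1)] ne[OF assms(2)] assms(3) by auto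
  next
    case False
    obtain p q where x: "p \<in> carrier P" "q \<in> carrier P" "X = cls p q" using SP_cases[OF assms(1)] False by blast
    obtain r t where y: "r \<in> carrier P" "t \<in> carrier P" "Y = cls r t" using SP_cases[OF assms(2)] False by blast
    show ?thesis using rho_class_eq[OF x(1,2) y(1,2)] assms(3) rel_class x y by simp
  qed
qed

lemma rho_comp_empty:
  assumes "principal P q \<inter> principal P r = {}" shows "rho p q O rho r t = {}"
  using assms unfolding rho_def set_eq_iff Int_iff principal_iff by blast

text \<open>Composable pairs come from solutions of q x = r y. Such an element lies in the ideal
  generated by q q', and left cancellation exhibits x and y as multiples of q' and r' by a common
  factor.\<close>

lemma rho_comp:
  assumes c: "p \<in> carrier P" "q \<in> carrier P" "r \<in> carrier P" "t \<in> carrier P" "q' \<in> carrier P" "r' \<in> carrier P"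
    and e: "q \<otimes> q' = r \<otimes> r'" "principal P q \<inter> principal P r = principal P (q \<otimes> q')"
  shows "rho p q O rho r t = rho (p \<otimes> q') (t \<otimes> r')"
proof (intro subset_antisym subsetI)
  fix z assume "z \<in> rho p q O rho r t"
  then obtain x y where xy: "x \<in> carrier P" "y \<in> carrier P" "z = (p \<otimes> x, t \<otimes> y)" "q \<otimes> x = r \<otimes> y"
    unfolding rho_def by blast
  have "q \<otimes> x \<in> principal P q" "q \<otimes> x \<in> principal P r" unfolding principal_iff using xy by blast+
  then have "q \<otimes> x \<in> principal P q \<inter> principal P r" by blast
  then obtain w where w: "w \<in> carrier P" "q \<otimes> x = q \<otimes> q' \<otimes> w" unfolding e(2) principal_iff by blast
  have qw: "q' \<otimes> w \<in> carrier P" "r' \<otimes> w \<in> carrier P" using w c by simp_all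
  have "q \<otimes> x = q \<otimes> (q' \<otimes> w)" unfolding w(2) using w c by (simp add: m_assoc)
  then have "x = q' \<otimes> w" by (rule left_cancel[OF c(2) xy(1) qw(1)])
  moreover have "r \<otimes> y = r \<otimes> (r' \<otimes> w)" unfolding xy(4)[symmetric] w(2) e(1) using w c by (simp add: m_assoc)
  then have "y = r' \<otimes> w" by (rule left_cancel[OF c(3) xy(2) qw(2)])
  ultimately show "z \<in> rho (p \<otimes> q') (t \<otimes> r')"
    unfolding rho_def using w(1) xy(3) c by (intro CollectI exI[of _ w]) (simp add: m_assoc)
next
  fix z assume "z \<in> rho (p \<otimes> q') (t \<otimes> r')"
  then obtain w where w: "w \<in> carrier P" "z = (p \<otimes> q' \<otimes> w, t \<otimes> r' \<otimes> w)" unfolding rho_def by blast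
  have "(p \<otimes> (q' \<otimes> w), q \<otimes> (q' \<otimes> w)) \<in> rho p q" unfolding rho_def using w c by blast
  moreover have "(r \<otimes> (r' \<otimes> w), t \<otimes> (r' \<otimes> w)) \<in> rho r t" unfolding rho_def using w c by blast
  moreover have "q \<otimes> (q' \<otimes> w) = r \<otimes> (r' \<otimes> w)" using w c e(1) by (simp add: m_assoc[symmetric])
  ultimately show "z \<in> rho p q O rho r t" using w c by (auto simp: m_assoc)
qed

lemma lcm_exists:
  assumes "q \<in> carrier P" "r \<in> carrier P" "principal P q \<inter> principal P r \<noteq> {}"
  shows "\<exists>q'\<in>carrier P. \<exists>r'\<in>carrier P. q \<otimes> q' = r \<otimes> r' \<and> principal P q \<inter> principal P r = principal P (q \<otimes> q')"
proof -
  obtain l where l: "l \<in> carrier P" "principal P q \<inter> principal P r = principal P l"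
    using right_lcm[OF assms(1,2)] assms(3) by blast
  have "l \<in> principal P l" unfolding principal_iff using l(1) by (intro bexI[of _ \<one>]) simp_all
  then obtain q' r' where "q' \<in> carrier P" "l = q \<otimes> q'" "r' \<in> carrier P" "l = r \<otimes> r'"
    using l(2) principal_iff by (metis Int_iff)
  then show ?thesis using l(2) by metis
qed

text \<open>All members of the union that defines the product represent the same composed partial
  bijection, hence coincide by injectivity of \<open>rel\<close>. So the union is a single class, or
  empty when the composition is.\<close>

lemma sprod_rel:
  assumes X: "X \<in> carrier SP" and Y: "Y \<in> carrier SP"
  shows "X \<cdot>\<^bsub>SP\<^esub> Y \<in> carrier SP \<and> rel (X \<cdot>\<^bsub>SP\<^esub> Y) = rel X O rel Y"
proof -
  define \<M> where "\<M> = {cls (p \<otimes> q') (t \<otimes> r') | p q r t q' r'.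
        (p, q) \<in> X \<and> (r, t) \<in> Y \<and> q' \<in> carrier P \<and> r' \<in> carrier P \<and>
        q \<otimes> q' = r \<otimes> r' \<and> principal P q \<inter> principal P r = principal P (q \<otimes> q')}"
  have prod: "X \<cdot>\<^bsub>SP\<^esub> Y = \<Union>\<M>" by (simp add: lcm_semigroup_def \<M>_def)
  show ?thesis
  proof (cases "X = {} \<or> Y = {}")
    case True
    then have "\<M> = {}" unfolding \<M>_def by blast
    then show ?thesis using True prod zero_SP by (auto simp: rel_empty)
  next
    case False
    obtain p0 q0 where x: "p0 \<in> carrier P" "q0 \<in> carrier P" "X = cls p0 q0" using SP_cases[OF X] False by blast
    obtain r0 t0 where y: "r0 \<in> carrier P" "t0 \<in> carrier P" "Y = cls r0 t0" using SP_cases[OF Y] False by blast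
    have mem: "M \<in> carrier SP \<and> rel M = rel X O rel Y" if "M \<in> \<M>" for M
    proof -
      obtain p q r t q' r' where m: "M = cls (p \<otimes> q') (t \<otimes> r')" "(p, q) \<in> X" "(r, t) \<in> Y" "q' \<in> carrier P" "r' \<in> carrier P"
        "q \<otimes> q' = r \<otimes> r'" "principal P q \<inter> principal P r = principal P (q \<otimes> q')"
        using \<open>M \<in> \<M>\<close> unfolding \<M>_def by blast
      have c: "p \<in> carrier P" "q \<in> carrier P" "cls p q = X" "r \<in> carrier P" "t \<in> carrier P" "cls r t = Y"
        using in_class[OF x(1,2) m(2)[unfolded x(3)]] in_class[OF y(1,2) m(3)[unfolded y(3)]] x(3) y(3) by simp_all
      have "rel M = rho (p \<otimes> q') (t \<otimes> r')" unfolding m(1) by (rule rel_class) (simp_all add: c m)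
      also have "\<dots> = rho p q O rho r t" by (rule rho_comp[symmetric]) (simp_all add: c m)
      also have "\<dots> = rel X O rel Y" using rel_class[OF c(1,2)] rel_class[OF c(4,5)] c(3,6) by simp
      finally show ?thesis unfolding m(1) using class_SP c m by simp
    qed
    show ?thesis
    proof (cases "\<M> = {}")
      case True
      have "principal P q0 \<inter> principal P r0 = {}"
      proof (rule ccontr)
        assume "principal P q0 \<inter> principal P r0 \<noteq> {}"
        then obtain q' r' where "q' \<in> carrier P" "r' \<in> carrier P" "q0 \<otimes> q' = r0 \<otimes> r'" "principal P q0 \<inter> principal P r0 = principal P (q0 \<otimes> q')"
          using lcm_exists[OF x(2) y(1)] by blast
        then have "cls (p0 \<otimes> q') (t0 \<otimes> r') \<in> \<M>"
          unfolding \<M>_def using self_in_class[OF x(1,2)] self_in_class[OF y(1,2)] x(3) y(3) by blast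
        then show False using True by blast
      qed
      then have "rel X O rel Y = {}" using rho_comp_empty x y by (simp add: rel_class)
      then show ?thesis using True prod zero_SP by (simp add: rel_empty)
    next
      case False
      then obtain M where M: "M \<in> \<M>" by blast
      have "M' = M" if "M' \<in> \<M>" for M' using rel_inj mem[OF M] mem[OF that] by simp
      then have "\<M> = {M}" using M by blast
      then show ?thesis using prod mem[OF M] by simp
    qed
  qed
qed

lemma SP_mult_closed: "X \<in> carrier SP \<Longrightarrow> Y \<in> carrier SP \<Longrightarrow> X \<cdot>\<^bsub>SP\<^esub> Y \<in> carrier SP"
  and rel_mult: "X \<in> carrier SP \<Longrightarrow> Y \<in> carrier SP \<Longrightarrow> rel (X \<cdot>\<^bsub>SP\<^esub> Y) = rel X O rel Y"
  using sprod_rel by blast+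

lemma sinv_class: "sinv SP (cls p q) = cls q p"
  unfolding lcm_semigroup_def lcm_class_def by auto

lemma sinv_empty: "sinv SP {} = {}" by (simp add: lcm_semigroup_def)

lemma sinv_rel: assumes "X \<in> carrier SP" shows "sinv SP X \<in> carrier SP \<and> rel (sinv SP X) = (rel X)\<inverse>"
proof -
  have "(rho p q)\<inverse> = rho q p" for p q unfolding rho_def by auto
  then show ?thesis
    using SP_cases[OF assms] by (elim disjE bexE) (simp_all add: sinv_class sinv_empty rel_class rel_empty class_SP zero_SP)
qed

lemma rho_partial_injection:
  assumes pq: "p \<in> carrier P" "q \<in> carrier P" and ab: "(a, b) \<in> rho p q"
  shows "(c, b) \<in> rho p q \<Longrightarrow> a = c" "(a, c) \<in> rho p q \<Longrightarrow> b = c" "a \<in> carrier P \<and> b \<in> carrier P"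
proof -
  obtain x where x: "x \<in> carrier P" "a = p \<otimes> x" "b = q \<otimes> x" using ab unfolding rho_def by blast
  show "a \<in> carrier P \<and> b \<in> carrier P" using x pq by simp
  show "a = c" if "(c, b) \<in> rho p q"
  proof -
    obtain y where y: "y \<in> carrier P" "c = p \<otimes> y" "b = q \<otimes> y" using \<open>(c, b) \<in> rho p q\<close> unfolding rho_def by blast
    have "x = y" by (rule left_cancel[OF pq(2) x(1) y(1)]) (simp add: x(3)[symmetric] y(3)[symmetric])
    then show ?thesis using x y by simp
  qed
  show "b = c" if "(a, c) \<in> rho p q"
  proof -
    obtain y where y: "y \<in> carrier P" "a = p \<otimes> y" "c = q \<otimes> y" using \<open>(a, c) \<in> rho p q\<close> unfolding rho_def by blast
    have "x = y" by (rule left_cancel[OF pq(1) x(1) y(1)]) (simp add: x(2)[symmetric] y(2)[symmetric])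
    then show ?thesis using x y by simp
  qed
qed

lemma rel_partial_injection:
  assumes X: "X \<in> carrier SP" and ab: "(a, b) \<in> rel X"
  shows "(c, b) \<in> rel X \<Longrightarrow> a = c" "(a, c) \<in> rel X \<Longrightarrow> b = c" "a \<in> carrier P \<and> b \<in> carrier P"
proof -
  have "X \<noteq> {}" using ab rel_empty by auto
  then obtain p q where pq: "p \<in> carrier P" "q \<in> carrier P" "X = cls p q" using SP_cases[OF X] by blast
  have r: "rel X = rho p q" unfolding pq(3) by (rule rel_class[OF pq(1,2)])
  show "(c, b) \<in> rel X \<Longrightarrow> a = c" "(a, c) \<in> rel X \<Longrightarrow> b = c" "a \<in> carrier P \<and> b \<in> carrier P"
    using rho_partial_injection[OF pq(1,2) ab[unfolded r]] unfolding r by blast+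
qed

text \<open>If a pair factors through an intermediate point within the same partial injection,
  injectivity on either side identifies that point with both ends.\<close>

lemma SP_idem_rel: assumes X: "X \<in> idempotents SP" shows "rel X \<subseteq> Id"
proof
  have c: "X \<in> carrier SP" and i: "X \<cdot>\<^bsub>SP\<^esub> X = X" using X unfolding idempotents_def by simp_all
  have e: "rel X O rel X = rel X" using rel_mult[OF c c] i by simp
  fix z assume z: "z \<in> rel X"
  obtain a b where ab: "z = (a, b)" by (cases z)
  then have "(a, b) \<in> rel X O rel X" using z e by simp
  then obtain d where d: "(a, d) \<in> rel X" "(d, b) \<in> rel X" by blast
  have "d = a" using rel_partial_injection(1)[OF c d(2), of a] z ab by simp
  moreover have "d = b" using rel_partial_injection(2)[OF c d(1), of b] z ab by simp
  ultimately show "z \<in> Id" by (simp add: ab)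
qed

lemma rel_one: "rel (cls \<one> \<one>) = Id_on (carrier P)"
proof -
  have "rho \<one> \<one> = Id_on (carrier P)" unfolding rho_def by (intro Set.set_eqI) (force simp: Id_on_iff)
  then show ?thesis by (simp add: rel_class)
qed

lemma SP_inverse_monoid: "inverse_monoid SP (cls \<one> \<one>)"
proof
  have z: "szero SP = {}" by (simp add: lcm_semigroup_def)
  fix s t r assume s: "s \<in> carrier SP" and t: "t \<in> carrier SP" and r: "r \<in> carrier SP"
  show "s \<cdot>\<^bsub>SP\<^esub> t \<cdot>\<^bsub>SP\<^esub> r = s \<cdot>\<^bsub>SP\<^esub> (t \<cdot>\<^bsub>SP\<^esub> r)"
    by (rule rel_inj) (simp_all add: SP_mult_closed rel_mult s t r O_assoc)
next
  fix s t assume s: "s \<in> carrier SP" and t: "t \<in> carrier SP"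
  show "s \<cdot>\<^bsub>SP\<^esub> t \<in> carrier SP" by (rule SP_mult_closed[OF s t])
  show "sinv SP (s \<cdot>\<^bsub>SP\<^esub> t) = sinv SP t \<cdot>\<^bsub>SP\<^esub> sinv SP s"
    by (rule rel_inj) (simp_all add: SP_mult_closed rel_mult sinv_rel s t converse_relcomp)
next
  fix s assume s: "s \<in> carrier SP"
  have z: "szero SP = {}" by (simp add: lcm_semigroup_def)
  show "sinv SP s \<in> carrier SP" using sinv_rel[OF s] by simp
  show "sinv SP (sinv SP s) = s" by (simp add: lcm_semigroup_def)
  show "s \<cdot>\<^bsub>SP\<^esub> (sinv SP s \<cdot>\<^bsub>SP\<^esub> s) = s"
  proof (rule rel_inj)
    have "rel s O ((rel s)\<inverse> O rel s) = rel s" using rel_partial_injection(1)[OF s] by (intro Set.set_eqI) (auto 4 3)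
    then show "rel (s \<cdot>\<^bsub>SP\<^esub> (sinv SP s \<cdot>\<^bsub>SP\<^esub> s)) = rel s" by (simp add: SP_mult_closed rel_mult sinv_rel s)
  qed (simp_all add: SP_mult_closed sinv_rel s)
  show "szero SP \<cdot>\<^bsub>SP\<^esub> s = szero SP" "s \<cdot>\<^bsub>SP\<^esub> szero SP = szero SP"
    unfolding z by (rule rel_inj; simp add: SP_mult_closed rel_mult zero_SP s rel_empty)+
  have u: "cls \<one> \<one> \<in> carrier SP" by (simp add: class_SP)
  show "cls \<one> \<one> \<cdot>\<^bsub>SP\<^esub> s = s" "s \<cdot>\<^bsub>SP\<^esub> cls \<one> \<one> = s"
  proof -
    have "Id_on (carrier P) O rel s = rel s" "rel s O Id_on (carrier P) = rel s"
      using rel_partial_injection(3)[OF s] by (auto simp: Id_on_iff)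
    then have "rel (cls \<one> \<one> \<cdot>\<^bsub>SP\<^esub> s) = rel s" "rel (s \<cdot>\<^bsub>SP\<^esub> cls \<one> \<one>) = rel s"
      by (simp_all add: rel_mult u s rel_one)
    then show "cls \<one> \<one> \<cdot>\<^bsub>SP\<^esub> s = s" "s \<cdot>\<^bsub>SP\<^esub> cls \<one> \<one> = s"
      using rel_inj[OF SP_mult_closed[OF u s] s] rel_inj[OF SP_mult_closed[OF s u] s] by simp_all
  qed
next
  fix e f assume e: "e \<in> idempotents SP" and f: "f \<in> idempotents SP"
  then have c: "e \<in> carrier SP" "f \<in> carrier SP" by (simp_all add: idempotents_def)
  have cm: "rel e O rel f = rel f O rel e" using SP_idem_rel[OF e] SP_idem_rel[OF f] by fast
  show "e \<cdot>\<^bsub>SP\<^esub> f = f \<cdot>\<^bsub>SP\<^esub> e" by (rule rel_inj) (use cm in \<open>simp_all add: SP_mult_closed rel_mult c\<close>)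
next
  have z: "szero SP = {}" by (simp add: lcm_semigroup_def)
  show "szero SP \<in> carrier SP" by (simp add: z zero_SP)
  show "cls \<one> \<one> \<in> carrier SP" by (simp add: class_SP)
  show "cls \<one> \<one> \<noteq> szero SP" using self_in_class[of \<one> \<one>] by (auto simp: z)
qed

lemma class_mult:
  assumes "p \<in> carrier P" "q \<in> carrier P" "r \<in> carrier P" "t \<in> carrier P" "q' \<in> carrier P" "r' \<in> carrier P"
    "q \<otimes> q' = r \<otimes> r'" "principal P q \<inter> principal P r = principal P (q \<otimes> q')"
  shows "cls p q \<cdot>\<^bsub>SP\<^esub> cls r t = cls (p \<otimes> q') (t \<otimes> r')"
  by (rule rel_inj) (use assms rho_comp[OF assms] in \<open>simp_all add: SP_mult_closed class_SP rel_mult rel_class\<close>)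

lemma class_mult_empty:
  assumes "p \<in> carrier P" "q \<in> carrier P" "r \<in> carrier P" "t \<in> carrier P" "principal P q \<inter> principal P r = {}"
  shows "cls p q \<cdot>\<^bsub>SP\<^esub> cls r t = {}"
  by (rule rel_inj) (use assms rho_comp_empty[OF assms(5)] in \<open>simp_all add: SP_mult_closed class_SP rel_mult rel_class rel_empty zero_SP\<close>)

lemma principal_one: "principal P \<one> = carrier P"
  by (auto simp: l_coset_def)

text \<open>The elements [p, 1] multiply like \<open>P\<close> and correspond to the isometries
  s_p.\<close>

lemma class_iso_mult: assumes "p \<in> carrier P" "r \<in> carrier P" shows "cls p \<one> \<cdot>\<^bsub>SP\<^esub> cls r \<one> = cls (p \<otimes> r) \<one>"
proof -
  have "principal P r \<subseteq> carrier P" using assms by (auto simp: l_coset_def)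
  then have "principal P \<one> \<inter> principal P r = principal P (\<one> \<otimes> r)" using assms by (auto simp: principal_one)
  then show ?thesis using class_mult[of p \<one> r \<one> r \<one>] assms by simp
qed

lemma class_iso_dom: assumes "p \<in> carrier P" shows "cls \<one> p \<cdot>\<^bsub>SP\<^esub> cls p \<one> = cls \<one> \<one>"
  using class_mult[of \<one> p p \<one> \<one> \<one>] assms by simp

lemma class_iso_ran: assumes "p \<in> carrier P" shows "cls p \<one> \<cdot>\<^bsub>SP\<^esub> cls \<one> p = cls p p"
  using class_mult[of p \<one> \<one> p \<one> \<one>] assms by simp

lemma SP_E_cases: assumes "e \<in> idempotents SP" "e \<noteq> {}" shows "\<exists>p\<in>carrier P. e = cls p p"
proof -
  have "e \<in> carrier SP" using assms(1) by (simp add: idempotents_def)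
  then obtain p q where pq: "p \<in> carrier P" "q \<in> carrier P" "e = cls p q" using SP_cases assms(2) by blast
  have "(p, q) \<in> Id" using SP_idem_rel[OF assms(1)] rho_self[OF pq(1,2)] rel_class[OF pq(1,2)] pq(3) by auto
  then show ?thesis using pq by auto
qed

section \<open>The representation of the semigroup in the boundary quotient\<close>

interpretation Qc: cstar_algebra Q by (rule Q_cstar)

text \<open>\<open>tQ [p, q] = s\<^sub>p s\<^sub>q\<^sup>*\<close> does not depend on the representative, since units give unitaries.\<close>

definition tQ :: "('p \<times> 'p) set \<Rightarrow> (nat \<Rightarrow> ('p bq_gen \<times> bool) list \<Rightarrow> complex) set" where
  "tQ X = (if X = {} then \<zero>\<^bsub>Q\<^esub> else case (SOME z. z \<in> X) of (p, q) \<Rightarrow> sQ p \<otimes>\<^bsub>Q\<^esub> star Q (sQ q))"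

text \<open>A unit generates the full ideal, so the range projection of its isometry is the
  projection of \<open>P\<close>, which is 1.\<close>

lemma sQ_unit: assumes "w \<in> Units P" shows "sQ w \<otimes>\<^bsub>Q\<^esub> star Q (sQ w) = \<one>\<^bsub>Q\<^esub>"
proof -
  have w: "w \<in> carrier P" "inv w \<in> carrier P" using assms by (simp_all add: Units_closed)
  have "x \<in> principal P w" if "x \<in> carrier P" for x
    unfolding principal_iff using assms w that by (intro bexI[of _ "inv w \<otimes> x"]) (simp_all add: m_assoc[symmetric])
  then have "principal P w = carrier P" using w by (auto simp: l_coset_def)
  then show ?thesis using eQ_principal[OF w(1)] eQ_full by simp
qed

lemma tQ_class: assumes p: "p \<in> carrier P" and q: "q \<in> carrier P"
  shows "tQ (cls p q) = sQ p \<otimes>\<^bsub>Q\<^esub> star Q (sQ q)"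
proof -
  have "(SOME z. z \<in> cls p q) \<in> cls p q" using self_in_class[OF p q] by (rule someI[of "\<lambda>z. z \<in> cls p q"])
  then obtain w where w: "w \<in> Units P" "(SOME z. z \<in> cls p q) = (p \<otimes> w, q \<otimes> w)" unfolding lcm_class_def by blast
  have wc: "w \<in> carrier P" using w(1) by (simp add: Units_closed)
  note cl = sQ_closed[OF p] sQ_closed[OF q] sQ_closed[OF wc] Qc.star_closed[OF sQ_closed[OF q]] Qc.star_closed[OF sQ_closed[OF wc]]
  have "tQ (cls p q) = sQ (p \<otimes> w) \<otimes>\<^bsub>Q\<^esub> star Q (sQ (q \<otimes> w))"
    using self_in_class[OF p q] w(2) by (auto simp: tQ_def)
  also have "\<dots> = (sQ p \<otimes>\<^bsub>Q\<^esub> sQ w) \<otimes>\<^bsub>Q\<^esub> (star Q (sQ w) \<otimes>\<^bsub>Q\<^esub> star Q (sQ q))"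
    using sQ_mult[OF p wc] sQ_mult[OF q wc] cl by (simp add: Qc.star_mult[symmetric])
  also have "\<dots> = sQ p \<otimes>\<^bsub>Q\<^esub> ((sQ w \<otimes>\<^bsub>Q\<^esub> star Q (sQ w)) \<otimes>\<^bsub>Q\<^esub> star Q (sQ q))"
    using cl by (simp add: Qc.mult_assoc Qc.mult_closed)
  finally show ?thesis using cl by (simp add: sQ_unit[OF w(1)] oneQ_mult)
qed

lemma tQ_empty: "tQ {} = \<zero>\<^bsub>Q\<^esub>" by (simp add: tQ_def)

lemma tQ_closed: "X \<in> carrier SP \<Longrightarrow> tQ X \<in> carrier Q"
  using SP_cases[of X] by (auto simp: tQ_empty tQ_class Qc.mult_closed Qc.star_closed sQ_closed)

lemma tQ_star: "X \<in> carrier SP \<Longrightarrow> star Q (tQ X) = tQ (sinv SP X)"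
  using SP_cases[of X]
  by (auto simp: tQ_empty tQ_class sinv_class sinv_empty Qc.star_zero Qc.star_mult Qc.star_closed Qc.star_star sQ_closed)

text \<open>An isometry absorbs its range projection, so the projections of qP and rP may be
  inserted between the two factors; their product is the projection of the intersection.\<close>

lemma range_projections:
  assumes q: "q \<in> carrier P" and r: "r \<in> carrier P"
  shows "star Q (sQ q) \<otimes>\<^bsub>Q\<^esub> sQ r = star Q (sQ q) \<otimes>\<^bsub>Q\<^esub> (eQ (principal P q \<inter> principal P r) \<otimes>\<^bsub>Q\<^esub> sQ r)"
proof -
  note cl = sQ_closed[OF q] sQ_closed[OF r] Qc.star_closed[OF sQ_closed[OF q]] Qc.star_closed[OF sQ_closed[OF r]]
  have "eQ (principal P q \<inter> principal P r) = (sQ q \<otimes>\<^bsub>Q\<^esub> star Q (sQ q)) \<otimes>\<^bsub>Q\<^esub> (sQ r \<otimes>\<^bsub>Q\<^esub> star Q (sQ r))"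
    using eQ_mult[OF ideals_closed(3)[OF q] ideals_closed(3)[OF r]] eQ_principal[OF q] eQ_principal[OF r] by simp
  then have "star Q (sQ q) \<otimes>\<^bsub>Q\<^esub> (eQ (principal P q \<inter> principal P r) \<otimes>\<^bsub>Q\<^esub> sQ r) =
     ((star Q (sQ q) \<otimes>\<^bsub>Q\<^esub> sQ q) \<otimes>\<^bsub>Q\<^esub> star Q (sQ q)) \<otimes>\<^bsub>Q\<^esub> (sQ r \<otimes>\<^bsub>Q\<^esub> (star Q (sQ r) \<otimes>\<^bsub>Q\<^esub> sQ r))"
    using cl by (simp add: Qc.mult_assoc Qc.mult_closed)
  also have "\<dots> = star Q (sQ q) \<otimes>\<^bsub>Q\<^esub> sQ r" using cl by (simp add: sQ_isometry q r oneQ_mult)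
  finally show ?thesis by simp
qed

text \<open>The inserted projection vanishes if the two ideals are disjoint. Otherwise it is the
  range projection of the isometry of q q' = r r', and the isometry relations strip off s_q and
  s_r.\<close>

lemma tQ_mult: assumes X: "X \<in> carrier SP" and Y: "Y \<in> carrier SP"
  shows "tQ X \<otimes>\<^bsub>Q\<^esub> tQ Y = tQ (X \<cdot>\<^bsub>SP\<^esub> Y)"
proof (cases "X = {} \<or> Y = {}")
  case True
  have "X \<cdot>\<^bsub>SP\<^esub> Y = {}"
    by (rule rel_inj) (use True X Y in \<open>auto simp: SP_mult_closed rel_mult rel_empty zero_SP\<close>)
  then show ?thesis using True tQ_closed[OF X] tQ_closed[OF Y] by (auto simp: tQ_empty Qc.zero_mult Qc.mult_zero)
next
  case False
  obtain p q where x: "p \<in> carrier P" "q \<in> carrier P" "X = cls p q" using SP_cases[OF X] False by blast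
  obtain r t where y: "r \<in> carrier P" "t \<in> carrier P" "Y = cls r t" using SP_cases[OF Y] False by blast
  note cl = x(1,2)[THEN sQ_closed] y(1,2)[THEN sQ_closed] x(2)[THEN sQ_closed, THEN Qc.star_closed] y(2)[THEN sQ_closed, THEN Qc.star_closed]
  let ?I = "principal P q \<inter> principal P r"
  have I: "?I \<in> ideals P" by (intro inter_ideal ideals_closed x y)
  have "tQ X \<otimes>\<^bsub>Q\<^esub> tQ Y = sQ p \<otimes>\<^bsub>Q\<^esub> ((star Q (sQ q) \<otimes>\<^bsub>Q\<^esub> sQ r) \<otimes>\<^bsub>Q\<^esub> star Q (sQ t))"
    using x y cl by (simp add: tQ_class Qc.mult_assoc Qc.mult_closed)
  also have "\<dots> = sQ p \<otimes>\<^bsub>Q\<^esub> ((star Q (sQ q) \<otimes>\<^bsub>Q\<^esub> (eQ ?I \<otimes>\<^bsub>Q\<^esub> sQ r)) \<otimes>\<^bsub>Q\<^esub> star Q (sQ t))"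
    using range_projections[OF x(2) y(1)] by simp
  finally have 1: "tQ X \<otimes>\<^bsub>Q\<^esub> tQ Y = \<dots>" .
  show ?thesis
  proof (cases "?I = {}")
    case True
    have "tQ X \<otimes>\<^bsub>Q\<^esub> tQ Y = \<zero>\<^bsub>Q\<^esub>"
      unfolding 1 True eQ_empty using cl by (simp add: Qc.zero_mult Qc.mult_zero)
    then show ?thesis using class_mult_empty[OF x(1,2) y(1,2) True] x(3) y(3) by (simp add: tQ_empty)
  next
    case False
    obtain q' r' where l: "q' \<in> carrier P" "r' \<in> carrier P" "q \<otimes> q' = r \<otimes> r'" "?I = principal P (q \<otimes> q')"
      using lcm_exists[OF x(2) y(1) False] by blast
    note cl' = l(1,2)[THEN sQ_closed] l(1,2)[THEN sQ_closed, THEN Qc.star_closed] y(1)[THEN sQ_closed, THEN Qc.star_closed]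
    have e: "eQ ?I = (sQ q \<otimes>\<^bsub>Q\<^esub> sQ q') \<otimes>\<^bsub>Q\<^esub> (star Q (sQ r') \<otimes>\<^bsub>Q\<^esub> star Q (sQ r))"
    proof -
      have "eQ ?I = sQ (q \<otimes> q') \<otimes>\<^bsub>Q\<^esub> star Q (sQ (q \<otimes> q'))" unfolding l(4) by (rule eQ_principal) (simp add: x y l)
      moreover have "sQ (q \<otimes> q') = sQ q \<otimes>\<^bsub>Q\<^esub> sQ q'" using sQ_mult[OF x(2) l(1)] by simp
      moreover have "star Q (sQ (q \<otimes> q')) = star Q (sQ r') \<otimes>\<^bsub>Q\<^esub> star Q (sQ r)"
        unfolding l(3) using sQ_mult[OF y(1) l(2)] cl cl' by (simp add: Qc.star_mult[symmetric])
      ultimately show ?thesis by simp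
    qed
    have "star Q (sQ q) \<otimes>\<^bsub>Q\<^esub> (eQ ?I \<otimes>\<^bsub>Q\<^esub> sQ r) =
      (star Q (sQ q) \<otimes>\<^bsub>Q\<^esub> sQ q) \<otimes>\<^bsub>Q\<^esub> (sQ q' \<otimes>\<^bsub>Q\<^esub> (star Q (sQ r') \<otimes>\<^bsub>Q\<^esub> (star Q (sQ r) \<otimes>\<^bsub>Q\<^esub> sQ r)))"
      unfolding e using cl cl' by (simp add: Qc.mult_assoc Qc.mult_closed)
    also have "\<dots> = sQ q' \<otimes>\<^bsub>Q\<^esub> star Q (sQ r')" using cl cl' x y by (simp add: sQ_isometry oneQ_mult Qc.mult_closed)
    finally have "tQ X \<otimes>\<^bsub>Q\<^esub> tQ Y = sQ p \<otimes>\<^bsub>Q\<^esub> ((sQ q' \<otimes>\<^bsub>Q\<^esub> star Q (sQ r')) \<otimes>\<^bsub>Q\<^esub> star Q (sQ t))" using 1 by simp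
    also have "\<dots> = (sQ p \<otimes>\<^bsub>Q\<^esub> sQ q') \<otimes>\<^bsub>Q\<^esub> (star Q (sQ r') \<otimes>\<^bsub>Q\<^esub> star Q (sQ t))"
      using cl cl' by (simp add: Qc.mult_assoc Qc.mult_closed)
    also have "\<dots> = sQ (p \<otimes> q') \<otimes>\<^bsub>Q\<^esub> star Q (sQ (t \<otimes> r'))"
      using sQ_mult[OF x(1) l(1)] sQ_mult[OF y(2) l(2)] cl cl' by (simp add: Qc.star_mult[symmetric])
    also have "\<dots> = tQ (X \<cdot>\<^bsub>SP\<^esub> Y)" using class_mult[OF x(1,2) y(1,2) l] x y l by (simp add: tQ_class)
    finally show ?thesis .
  qed
qed

end


section \<open>Compression into the core\<close>

lemma star_hom_zero: assumes "star_algebra A" "star_algebra B" "\<phi> \<in> star_hom A B" shows "\<phi> \<zero>\<^bsub>A\<^esub> = \<zero>\<^bsub>B\<^esub>"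
proof -
  interpret A: star_algebra A by fact
  interpret B: star_algebra B by fact
  have "\<phi> (scale A 0 \<zero>\<^bsub>A\<^esub>) = scale B 0 (\<phi> \<zero>\<^bsub>A\<^esub>)" using assms(3) A.zero_closed unfolding star_hom_def by blast
  moreover have "\<phi> \<zero>\<^bsub>A\<^esub> \<in> carrier B" using assms(3) A.zero_closed unfolding star_hom_def by blast
  ultimately show ?thesis by (simp add: A.scale_of_zero B.scale_zero)
qed

lemma star_homD:
  assumes "\<phi> \<in> star_hom A B"
  shows "x \<in> carrier A \<Longrightarrow> \<phi> x \<in> carrier B"
    "x \<in> carrier A \<Longrightarrow> y \<in> carrier A \<Longrightarrow> \<phi> (x \<oplus>\<^bsub>A\<^esub> y) = \<phi> x \<oplus>\<^bsub>B\<^esub> \<phi> y"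
    "x \<in> carrier A \<Longrightarrow> y \<in> carrier A \<Longrightarrow> \<phi> (x \<otimes>\<^bsub>A\<^esub> y) = \<phi> x \<otimes>\<^bsub>B\<^esub> \<phi> y"
    "x \<in> carrier A \<Longrightarrow> \<phi> (scale A c x) = scale B c (\<phi> x)"
    "x \<in> carrier A \<Longrightarrow> \<phi> (star A x) = star B (\<phi> x)"
  using assms unfolding star_hom_def by auto

lemma star_hom_minus:
  assumes "star_algebra A" "star_algebra B" "\<phi> \<in> star_hom A B" "x \<in> carrier A" "y \<in> carrier A"
  shows "\<phi> (x \<ominus>\<^bsub>A\<^esub> y) = \<phi> x \<ominus>\<^bsub>B\<^esub> \<phi> y"
proof -
  interpret A: star_algebra A by fact
  interpret B: star_algebra B by fact
  show ?thesis using assms(4,5) by (simp add: A.minus_scale B.minus_scale star_homD[OF assms(3)] A.scale_closed)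
qed

lemma star_hom_seminorm:
  assumes "star_algebra A" "cstar_algebra B" "\<phi> \<in> star_hom A B" "D \<subseteq> carrier A"
  shows "cstar_seminorm (A\<lparr>carrier := D\<rparr>) (\<lambda>x. cnorm B (\<phi> x))"
proof -
  interpret A: star_algebra A by fact
  interpret B: cstar_algebra B by fact
  have c: "x \<in> carrier A" if "x \<in> D" for x using that assms(4) by blast
  show ?thesis
    unfolding cstar_seminorm_def
    by (auto simp: c star_homD[OF assms(3)] A.star_closed B.N_nonneg B.N_scale B.N_add B.N_mult B.N_cstar)
qed

context cstar_algebra
begin

lemma metric: "Metric_space (carrier A) (cdist A)"
  by (rule Metric_space_seminorm) (auto simp: cdist_def cnorm_eq_zero)

lemma carrier_subalgebra: "cstar_subalgebra (carrier A) A"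
proof -
  have "closedin (Metric_space.mtopology (carrier A) (cdist A)) (carrier A)"
    using closedin_topspace[of "Metric_space.mtopology (carrier A) (cdist A)"]
    by (simp add: Metric_space.topspace_mtopology[OF metric])
  then show ?thesis unfolding cstar_subalgebra_def by (simp add: mult_closed scale_closed star_closed)
qed

lemma generated_subalgebra:
  assumes "X \<subseteq> carrier A"
  shows "cstar_subalgebra (cstar_generated A X) A" "X \<subseteq> cstar_generated A X" "cstar_generated A X \<subseteq> carrier A"
proof -
  let ?F = "{C. cstar_subalgebra C A \<and> X \<subseteq> C}"
  have ne: "carrier A \<in> ?F" using carrier_subalgebra assms by simp
  show "X \<subseteq> cstar_generated A X" unfolding cstar_generated_def by blast
  show "cstar_generated A X \<subseteq> carrier A" unfolding cstar_generated_def using ne by (rule Inter_lower)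
  have "closedin (Metric_space.mtopology (carrier A) (cdist A)) (\<Inter>?F)"
  proof (rule closedin_Inter)
    show "?F \<noteq> {}" using ne by blast
  qed (simp add: cstar_subalgebra_def)
  then show "cstar_subalgebra (cstar_generated A X) A"
    unfolding cstar_generated_def cstar_subalgebra_def[of "\<Inter>?F"]
    by (intro conjI ballI allI InterI) (auto simp: cstar_subalgebra_def)
qed

end

section \<open>The boundary quotient as a reduced groupoid C*-algebra\<close>

locale reduced_boundary = right_lcm_monoid P for P :: "('p, 'm) monoid_scheme" (structure) +
  fixes \<Phi>
  assumes covers: "\<And>s. s \<in> carrier (lcm_semigroup P) \<Longrightarrow> \<exists>C. finite C \<and> is_cover (lcm_semigroup P) C
        {e \<in> idempotents (lcm_semigroup P). sle (lcm_semigroup P) e s}"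
    and \<Phi>_iso: "\<Phi> \<in> star_iso (boundary_quotient P) (reduced_cstar (tight_groupoid (lcm_semigroup P)))"
    and \<Phi>_gen: "\<And>p q. p \<in> carrier P \<Longrightarrow> q \<in> carrier P \<Longrightarrow>
      \<Phi> (bq_isom P p \<otimes>\<^bsub>boundary_quotient P\<^esub> star (boundary_quotient P) (bq_isom P q)) =
        reduced_emb (tight_groupoid (lcm_semigroup P)) (tight_T (lcm_semigroup P) (lcm_class P p q))"
begin

lemma SP_fc: "inverse_monoid_fc SP (cls \<one> \<one>)"
  by (intro inverse_monoid_fc.intro SP_inverse_monoid inverse_monoid_fc_axioms.intro covers)

sublocale S: inverse_monoid_fc SP "cls \<one> \<one>" by (rule SP_fc)

sublocale Qc: cstar_algebra Q by (rule Q_cstar)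

abbreviation "CS \<equiv> cc_algebra (tight_groupoid SP)"
abbreviation "rn \<equiv> reduced_norm (tight_groupoid SP)"
abbreviation "RS \<equiv> reduced_cstar (tight_groupoid SP)"
abbreviation "un \<equiv> germ SP (cls \<one> \<one>)"
abbreviation "spec \<equiv> tight_spectrum SP"

lemma CS_seminormed: "cstar_seminormed CS rn"
  by (intro cstar_seminormed.intro cstar_seminormed_axioms.intro S.CGr.Cc_algebra S.CGr.reduced_seminorm)

sublocale N: cstar_seminormed CS rn by (rule CS_seminormed)

lemma RS_completion: "RS = completion CS rn" and emb_RS: "reduced_emb (tight_groupoid SP) = completion_emb CS rn"
  by (simp_all add: reduced_cstar_def reduced_emb_def)

lemma RS_cstar: "cstar_algebra RS"
  unfolding RS_completion by (rule N.completion_cstar_algebra)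

lemma \<Phi>_hom: "\<Phi> \<in> star_hom Q RS" and \<Phi>_inj: "inj_on \<Phi> (carrier Q)"
  using \<Phi>_iso by (auto simp: star_iso_def bij_betw_def)

lemma \<Phi>_zero: "\<Phi> \<zero>\<^bsub>Q\<^esub> = \<zero>\<^bsub>RS\<^esub>"
  by (rule star_hom_zero[OF Qc.star_algebra_axioms cstar_algebra.axioms(1)[OF RS_cstar] \<Phi>_hom])

lemma Q_unital: "unital_cstar Q (carrier Q)"
  by (intro unital_cstar.intro Q_cstar unital_cstar_axioms.intro Qc.carrier_subalgebra oneQ_closed oneQ_mult)

text \<open>The norm pulled back along \<Phi> is a C*-seminorm on the quotient, definite because
  \<Phi> is injective, so uniqueness of the C*-norm applies.\<close>

lemma \<Phi>_norm: assumes x: "x \<in> carrier Q" shows "cnorm RS (\<Phi> x) = cnorm Q x"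
proof (rule unital_cstar.norm_unique[OF Q_unital _ _ x])
  show "cstar_seminorm (Q\<lparr>carrier := carrier Q\<rparr>) (\<lambda>x. cnorm RS (\<Phi> x))"
    by (rule star_hom_seminorm[OF Qc.star_algebra_axioms RS_cstar \<Phi>_hom order_refl])
  fix y assume y: "y \<in> carrier Q" "cnorm RS (\<Phi> y) = 0"
  have "\<Phi> y = \<Phi> \<zero>\<^bsub>Q\<^esub>"
    unfolding \<Phi>_zero using cstar_algebra.cnorm_eq_zero[OF RS_cstar star_homD(1)[OF \<Phi>_hom y(1)] y(2)] .
  then show "y = \<zero>\<^bsub>Q\<^esub>" using inj_onD[OF \<Phi>_inj] y(1) Qc.zero_closed by blast
qed

primrec lin :: "(complex \<times> ('p \<times> 'p) set) list \<Rightarrow> (nat \<Rightarrow> ('p bq_gen \<times> bool) list \<Rightarrow> complex) set" where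
  "lin [] = \<zero>\<^bsub>Q\<^esub>"
| "lin (z # cs) = scale Q (fst z) (tQ (snd z)) \<oplus>\<^bsub>Q\<^esub> lin cs"

definition okc :: "(complex \<times> ('p \<times> 'p) set) list \<Rightarrow> bool" where
  "okc cs \<longleftrightarrow> snd ` set cs \<subseteq> carrier SP"

lemma okc_simps: "okc []" "okc (z # cs) \<longleftrightarrow> snd z \<in> carrier SP \<and> okc cs" "okc (a @ b) \<longleftrightarrow> okc a \<and> okc b"
  by (auto simp: okc_def)

lemma okc_map: "okc a \<Longrightarrow> (\<And>X. X \<in> carrier SP \<Longrightarrow> h X \<in> carrier SP) \<Longrightarrow> okc (map (\<lambda>z. (g z, h (snd z))) a)"
  by (induction a) (simp_all add: okc_simps)

lemma lin_closed: "okc cs \<Longrightarrow> lin cs \<in> carrier Q"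
  by (induction cs) (simp_all add: okc_simps tQ_closed Qc.scale_closed)

lemma lin_append: "okc a \<Longrightarrow> okc b \<Longrightarrow> lin (a @ b) = lin a \<oplus>\<^bsub>Q\<^esub> lin b"
  by (induction a) (simp_all add: okc_simps tQ_closed lin_closed Qc.scale_closed Qc.a_assoc)

lemma lin_scale: "okc a \<Longrightarrow> lin (map (\<lambda>z. (c * fst z, snd z)) a) = scale Q c (lin a)"
  by (induction a) (simp_all add: okc_simps tQ_closed lin_closed Qc.scale_closed Qc.scale_of_zero Qc.scale_add_right Qc.scale_scale)

lemma lin_star: "okc a \<Longrightarrow> lin (map (\<lambda>z. (cnj (fst z), sinv SP (snd z))) a) = star Q (lin a)"
  by (induction a) (simp_all add: okc_simps tQ_closed lin_closed Qc.scale_closed Qc.star_zero Qc.star_add Qc.star_scale tQ_star)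

lemma lin_mult_left: "okc a \<Longrightarrow> X \<in> carrier SP \<Longrightarrow>
    lin (map (\<lambda>z. (fst z, X \<cdot>\<^bsub>SP\<^esub> snd z)) a) = tQ X \<otimes>\<^bsub>Q\<^esub> lin a"
  by (induction a) (simp_all add: okc_simps tQ_closed lin_closed Qc.scale_closed Qc.mult_zero
      Qc.mult_distrib_left Qc.scale_mult_right tQ_mult)

lemma lin_mult_right: "okc a \<Longrightarrow> X \<in> carrier SP \<Longrightarrow>
    lin (map (\<lambda>z. (fst z, snd z \<cdot>\<^bsub>SP\<^esub> X)) a) = lin a \<otimes>\<^bsub>Q\<^esub> tQ X"
  by (induction a) (simp_all add: okc_simps tQ_closed lin_closed Qc.scale_closed Qc.zero_mult
      Qc.mult_distrib_right Qc.scale_mult_left tQ_mult)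

lemma lin_mult: "okc a \<Longrightarrow> okc b \<Longrightarrow> \<exists>d. okc d \<and> lin d = lin a \<otimes>\<^bsub>Q\<^esub> lin b"
proof (induction a)
  case Nil
  then show ?case by (intro exI[of _ "[]"]) (simp add: okc_simps lin_closed Qc.zero_mult)
next
  case (Cons z a)
  then obtain d where d: "okc d" "lin d = lin a \<otimes>\<^bsub>Q\<^esub> lin b" by (auto simp: okc_simps)
  have z: "snd z \<in> carrier SP" and a: "okc a" using Cons.prems by (simp_all add: okc_simps)
  let ?e = "map (\<lambda>w. (fst w, snd z \<cdot>\<^bsub>SP\<^esub> snd w)) b"
  let ?f = "map (\<lambda>w. (fst z * fst w, snd w)) ?e"
  have e: "okc ?e" by (rule okc_map[OF Cons.prems(2)]) (simp add: SP_mult_closed z)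
  have f: "okc ?f" by (rule okc_map[OF e, of "\<lambda>X. X"]) simp
  have "lin (?f @ d) = scale Q (fst z) (tQ (snd z) \<otimes>\<^bsub>Q\<^esub> lin b) \<oplus>\<^bsub>Q\<^esub> lin a \<otimes>\<^bsub>Q\<^esub> lin b"
    using lin_append[OF f d(1)] lin_scale[OF e, of "fst z"] lin_mult_left[OF Cons.prems(2) z] d(2) by simp
  also have "\<dots> = lin (z # a) \<otimes>\<^bsub>Q\<^esub> lin b"
    using z a Cons.prems(2) by (simp add: tQ_closed lin_closed Qc.scale_closed Qc.mult_distrib_right Qc.scale_mult_left)
  finally show ?case using f d(1) okc_simps(3) by blast
qed

text \<open>An isometry that is idempotent equals the unit: cancel the adjoint on the left.\<close>

lemma sQ_one: "sQ \<one> = \<one>\<^bsub>Q\<^esub>" "star Q \<one>\<^bsub>Q\<^esub> = \<one>\<^bsub>Q\<^esub>"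
proof -
  have i: "star Q (sQ \<one>) \<otimes>\<^bsub>Q\<^esub> sQ \<one> = \<one>\<^bsub>Q\<^esub>" by (simp add: sQ_isometry)
  note cl = sQ_closed[OF one_closed] Qc.star_closed[OF sQ_closed[OF one_closed]]
  have "\<one>\<^bsub>Q\<^esub> = star Q (sQ \<one>) \<otimes>\<^bsub>Q\<^esub> (sQ \<one> \<otimes>\<^bsub>Q\<^esub> sQ \<one>)" using i sQ_mult[OF one_closed one_closed] by simp
  also have "\<dots> = (star Q (sQ \<one>) \<otimes>\<^bsub>Q\<^esub> sQ \<one>) \<otimes>\<^bsub>Q\<^esub> sQ \<one>" using cl by (simp add: Qc.mult_assoc)
  also have "\<dots> = sQ \<one>" using i cl by (simp add: oneQ_mult)
  finally show s: "sQ \<one> = \<one>\<^bsub>Q\<^esub>" by simp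
  show "star Q \<one>\<^bsub>Q\<^esub> = \<one>\<^bsub>Q\<^esub>" using i cl unfolding s by (simp add: oneQ_mult)
qed

text \<open>Products of semigroup elements stay in the semigroup, so the linear combinations form a
  *-algebra. It contains the generators, s_p as [p, 1] and the projection of pP as [p, p].\<close>

lemma lin_dense:
  assumes x: "x \<in> carrier Q" and e: "\<epsilon> > 0"
  shows "\<exists>cs. okc cs \<and> cnorm Q (x \<ominus>\<^bsub>Q\<^esub> lin cs) < \<epsilon>"
proof -
  let ?D = "lin ` Collect okc"
  have single: "tQ X \<in> ?D" if X: "X \<in> carrier SP" for X
    by (rule image_eqI[of _ _ "[(1, X)]"]) (simp_all add: okc_simps X tQ_closed Qc.scale_one)
  have "\<exists>y\<in>?D. y \<in> carrier Q \<and> cnorm Q (x \<ominus>\<^bsub>Q\<^esub> y) < \<epsilon>"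
  proof (rule Q_dense[OF _ _ _ _ _ _ _ _ x e])
    show "x \<oplus>\<^bsub>Q\<^esub> y \<in> ?D" if "x \<in> ?D" "y \<in> ?D" for x y
    proof -
      from that(1) obtain a where a: "x = lin a" "a \<in> Collect okc" by (rule imageE)
      from that(2) obtain b where b: "y = lin b" "b \<in> Collect okc" by (rule imageE)
      show ?thesis using a b by (intro image_eqI[of _ _ "a @ b"]) (simp_all add: lin_append okc_simps)
    qed
    show "x \<otimes>\<^bsub>Q\<^esub> y \<in> ?D" if "x \<in> ?D" "y \<in> ?D" for x y
    proof -
      from that(1) obtain a where a: "x = lin a" "a \<in> Collect okc" by (rule imageE)
      from that(2) obtain b where b: "y = lin b" "b \<in> Collect okc" by (rule imageE)
      obtain d where "okc d" "lin d = lin a \<otimes>\<^bsub>Q\<^esub> lin b" using lin_mult[of a b] a(2) b(2) by auto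
      then show ?thesis unfolding a(1) b(1) by (intro image_eqI[of _ _ d]) simp_all
    qed
    show "scale Q c x \<in> ?D" if "x \<in> ?D" for x c
    proof -
      from that obtain a where x: "x = lin a" and "a \<in> Collect okc" by (rule imageE)
      then have a: "okc a" by simp
      show ?thesis unfolding x
        by (rule image_eqI[of _ lin, OF lin_scale[OF a, symmetric]]) (simp add: okc_map[OF a, of "\<lambda>X. X"])
    qed
    show "star Q x \<in> ?D" if "x \<in> ?D" for x
    proof -
      from that obtain a where x: "x = lin a" and "a \<in> Collect okc" by (rule imageE)
      then have a: "okc a" by simp
      have "okc (map (\<lambda>z. (cnj (fst z), sinv SP (snd z))) a)"
        by (rule okc_map[OF a, of "sinv SP" "\<lambda>z. cnj (fst z)"]) (rule conjunct1[OF sinv_rel])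
      then show ?thesis unfolding x by (intro image_eqI[of _ lin, OF lin_star[OF a, symmetric]]) simp
    qed
    show "sQ p \<in> ?D" if p: "p \<in> carrier P" for p
      using single[OF class_SP[OF p one_closed]] p by (simp add: tQ_class sQ_one sQ_closed oneQ_mult)
    show "eQ Y \<in> ?D" if "Y \<in> ideals P" for Y
    proof (cases "Y = {}")
      case True
      then show ?thesis using single[OF zero_SP] by (simp add: eQ_empty tQ_empty)
    next
      case False
      then have "Y \<in> principal P ` carrier P" using that by (simp add: ideals_def)
      then obtain p where p: "Y = principal P p" "p \<in> carrier P" by (rule imageE)
      have "eQ Y = tQ (cls p p)" unfolding p(1) tQ_class[OF p(2,2)] by (rule eQ_principal[OF p(2)])
      then show ?thesis using single[OF class_SP[OF p(2,2)]] by simp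
    qed
    show "\<one>\<^bsub>Q\<^esub> \<in> ?D" using single[OF class_SP[OF one_closed one_closed]] by (simp add: tQ_class sQ_one oneQ_mult oneQ_closed)
    show "\<zero>\<^bsub>Q\<^esub> \<in> ?D" using single[OF zero_SP] by (simp add: tQ_empty)
  qed
  then show ?thesis by blast
qed

abbreviation "linT \<equiv> S.linT"

lemma linT_CS: "okc cs \<Longrightarrow> linT cs \<in> carrier CS"
  unfolding okc_def by (rule S.linT_closed)

lemma CS_add: "f \<oplus>\<^bsub>CS\<^esub> g = (\<lambda>\<gamma>. f \<gamma> + g \<gamma>)" and CS_scale: "scale CS c f = (\<lambda>\<gamma>. c * f \<gamma>)" and CS_zero: "\<zero>\<^bsub>CS\<^esub> = (\<lambda>_. 0)"
  by (simp_all add: cc_algebra_def)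

lemma CS_minus: "f \<in> carrier CS \<Longrightarrow> g \<in> carrier CS \<Longrightarrow> (f \<ominus>\<^bsub>CS\<^esub> g) \<gamma> = f \<gamma> - g \<gamma>"
  by (simp add: N.minus_scale CS_add CS_scale)

lemma \<Phi>_tQ: assumes X: "X \<in> carrier SP" shows "\<Phi> (tQ X) = completion_emb CS rn (tight_T SP X)"
proof (cases "X = {}")
  case True
  have z: "szero SP = {}" by (simp add: lcm_semigroup_def)
  have "tight_T SP {} = \<zero>\<^bsub>CS\<^esub>" using S.tight_T_zero unfolding z CS_zero .
  then show ?thesis using True by (simp add: tQ_empty \<Phi>_zero N.emb_zero RS_completion)
next
  case False
  then obtain p q where pq: "p \<in> carrier P" "q \<in> carrier P" "X = cls p q" using SP_cases[OF X] by blast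
  show ?thesis using \<Phi>_gen[OF pq(1,2)] pq by (simp add: tQ_class emb_RS)
qed

lemma \<Phi>_lin: "okc cs \<Longrightarrow> \<Phi> (lin cs) = completion_emb CS rn (linT cs)"
proof (induction cs)
  case Nil
  have "linT [] = \<zero>\<^bsub>CS\<^esub>" by (simp add: CS_zero)
  then show ?case by (simp add: \<Phi>_zero N.emb_zero RS_completion del: S.linT.simps)
next
  case (Cons z cs)
  then have z: "snd z \<in> carrier SP" and c: "okc cs" by (simp_all add: okc_simps)
  have t: "tight_T SP (snd z) \<in> carrier CS" by (rule S.tight_T_closed[OF z])
  have l: "linT (z # cs) = scale CS (fst z) (tight_T SP (snd z)) \<oplus>\<^bsub>CS\<^esub> linT cs" by (simp add: CS_add CS_scale)
  have "\<Phi> (lin (z # cs)) = scale RS (fst z) (\<Phi> (tQ (snd z))) \<oplus>\<^bsub>RS\<^esub> \<Phi> (lin cs)"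
    using z c by (simp add: star_homD[OF \<Phi>_hom] tQ_closed lin_closed Qc.scale_closed)
  also have "\<dots> = completion_emb CS rn (linT (z # cs))"
    unfolding l using t linT_CS[OF c] Cons.IH[OF c] by (simp add: \<Phi>_tQ[OF z] N.emb_add N.emb_scale N.scale_closed RS_completion)
  finally show ?case .
qed

lemma rn_lin: "okc cs \<Longrightarrow> rn (linT cs) = cnorm Q (lin cs)"
  using \<Phi>_norm[OF lin_closed, of cs] by (simp add: \<Phi>_lin RS_completion N.emb_norm linT_CS)

lemma lin_neg: assumes "okc a" "okc b"
  shows "\<exists>d. okc d \<and> lin d = lin a \<ominus>\<^bsub>Q\<^esub> lin b \<and> linT d = linT a \<ominus>\<^bsub>CS\<^esub> linT b"
proof -
  let ?b = "map (\<lambda>z. (-1 * fst z, snd z)) b"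
  have b: "okc ?b" by (rule okc_map[OF assms(2), of "\<lambda>X. X"]) simp
  have "lin (a @ ?b) = lin a \<ominus>\<^bsub>Q\<^esub> lin b"
    unfolding lin_append[OF assms(1) b] lin_scale[OF assms(2)] using assms by (simp add: Qc.minus_scale lin_closed)
  moreover have "linT (a @ ?b) = linT a \<ominus>\<^bsub>CS\<^esub> linT b"
    unfolding fun_eq_iff S.linT_append S.linT_scale using assms by (simp add: CS_minus linT_CS)
  ultimately show ?thesis using assms(1) b okc_simps(3) by blast
qed

lemma linT_le: "okc cs \<Longrightarrow> \<xi> \<in> spec \<Longrightarrow> cmod (linT cs (un \<xi>)) \<le> cnorm Q (lin cs)"
  using S.CGr.eval_le_rn[OF linT_CS, of cs "un \<xi>"] S.germ_arrow[OF S.unit_closed, of \<xi>]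
  by (simp add: rn_lin S.dm_unit)

lemma rn_diff: assumes "okc a" "okc b" shows "rn (linT a \<ominus>\<^bsub>CS\<^esub> linT b) = cnorm Q (lin a \<ominus>\<^bsub>Q\<^esub> lin b)"
proof -
  obtain d where "okc d" "lin d = lin a \<ominus>\<^bsub>Q\<^esub> lin b" "linT d = linT a \<ominus>\<^bsub>CS\<^esub> linT b" using lin_neg[OF assms] by blast
  then show ?thesis using rn_lin[of d] by simp
qed

text \<open>The two functions are only known to have the same image in the completion. Since values
  are bounded by the reduced norm, they still agree at every unit.\<close>

lemma linT_star_mult:
  assumes a: "okc a" and d: "okc d" "lin d = star Q (lin a) \<otimes>\<^bsub>Q\<^esub> lin a" and x: "\<xi> \<in> spec"
  shows "linT d (un \<xi>) = (star CS (linT a) \<otimes>\<^bsub>CS\<^esub> linT a) (un \<xi>)"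
proof -
  let ?f = "star CS (linT a) \<otimes>\<^bsub>CS\<^esub> linT a"
  have f: "?f \<in> carrier CS" and sa: "star CS (linT a) \<in> carrier CS"
    using linT_CS[OF a] by (simp_all add: N.mult_closed N.star_closed)
  have "\<Phi> (lin d) = star RS (\<Phi> (lin a)) \<otimes>\<^bsub>RS\<^esub> \<Phi> (lin a)"
    unfolding d(2) using lin_closed[OF a] by (simp add: star_homD[OF \<Phi>_hom] Qc.star_closed)
  also have "\<dots> = completion_emb CS rn ?f"
    using linT_CS[OF a] sa by (simp add: \<Phi>_lin[OF a] N.emb_mult N.emb_star RS_completion)
  finally have "rn (linT d \<ominus>\<^bsub>CS\<^esub> ?f) = 0" using \<Phi>_lin[OF d(1)] N.emb_eq_iff[OF linT_CS[OF d(1)] f] by simp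
  moreover have "un \<xi> \<in> topspace (gtop (tight_groupoid SP))"
    by (rule S.germ_arrow[OF S.unit_closed]) (simp add: S.dm_unit x)
  ultimately have "cmod ((linT d \<ominus>\<^bsub>CS\<^esub> ?f) (un \<xi>)) \<le> 0"
    using S.CGr.eval_le_rn[OF N.minus_closed[OF linT_CS[OF d(1)] f]] by metis
  then show ?thesis by (simp add: CS_minus linT_CS d(1) f)
qed

text \<open>Take combinations converging to \<open>a\<close>. If their values tended to 0 at every
  arrow, so would their norms, contrary to a \<noteq> 0. Hence at some arrow the values are at least
  \<open>r\<close> infinitely often, and passing to a* a moves this to the source of the arrow, with
  \<delta> = r^2.\<close>

lemma nonzero_detected:
  assumes a: "a \<in> carrier Q" "a \<noteq> \<zero>\<^bsub>Q\<^esub>"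
  shows "\<exists>\<delta>>0. \<exists>ds \<xi>. okc ds \<and> \<xi> \<in> spec \<and> cnorm Q (lin ds \<ominus>\<^bsub>Q\<^esub> (star Q a \<otimes>\<^bsub>Q\<^esub> a)) < \<delta> \<and> \<delta> \<le> cmod (linT ds (un \<xi>))"
proof -
  have "\<exists>cs. okc cs \<and> cnorm Q (a \<ominus>\<^bsub>Q\<^esub> lin cs) < 1 / real (Suc n)" for n
    by (rule lin_dense[OF a(1)]) simp
  then have "\<forall>n. \<exists>cs. okc cs \<and> cnorm Q (a \<ominus>\<^bsub>Q\<^esub> lin cs) < 1 / real (Suc n)" by blast
  from choice[OF this] obtain cs where cs: "\<And>n. okc (cs n)" "\<And>n. cnorm Q (a \<ominus>\<^bsub>Q\<^esub> lin (cs n)) < 1 / real (Suc n)" by blast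
  note lc = lin_closed[OF cs(1)]
  have d0: "(\<lambda>n. cnorm Q (a \<ominus>\<^bsub>Q\<^esub> lin (cs n))) \<longlonglongrightarrow> 0"
  proof (rule tendsto_sandwich[of "\<lambda>_. 0" _ _ "\<lambda>n. 1 / real (Suc n)"])
    show "(\<lambda>n. 1 / real (Suc n)) \<longlonglongrightarrow> 0" by (rule LIMSEQ_Suc[OF lim_1_over_n])
  qed (use cs(2) Qc.N_nonneg[OF Qc.minus_closed[OF a(1) lc]] in \<open>auto intro!: always_eventually less_imp_le\<close>)
  have "(\<lambda>n. cnorm Q a - cnorm Q (lin (cs n))) \<longlonglongrightarrow> 0"
    by (rule Lim_null_comparison[OF _ d0]) (simp add: Qc.N_abs_diff[OF a(1) lc])
  then have "(\<lambda>n. cnorm Q a - (cnorm Q a - cnorm Q (lin (cs n)))) \<longlonglongrightarrow> cnorm Q a - 0" by (intro tendsto_intros)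
  then have nlim: "(\<lambda>n. cnorm Q (lin (cs n))) \<longlonglongrightarrow> cnorm Q a" by simp
  have na: "cnorm Q a \<noteq> 0" using Qc.cnorm_eq_zero a by blast
  have "\<exists>\<gamma>. \<gamma> \<in> topspace (gtop (tight_groupoid SP)) \<and> \<not> (\<lambda>n. linT (cs n) \<gamma>) \<longlonglongrightarrow> 0"
  proof (rule ccontr)
    assume no: "\<nexists>\<gamma>. \<gamma> \<in> topspace (gtop (tight_groupoid SP)) \<and> \<not> (\<lambda>n. linT (cs n) \<gamma>) \<longlonglongrightarrow> 0"
    have "(\<lambda>n. rn (linT (cs n))) \<longlonglongrightarrow> 0"
    proof (rule S.CGr.null_of_pointwise)
      show "linT (cs n) \<in> carrier CS" for n by (rule linT_CS[OF cs(1)])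
      show "(\<lambda>n. linT (cs n) \<gamma>) \<longlonglongrightarrow> 0" if "\<gamma> \<in> topspace (gtop (tight_groupoid SP))" for \<gamma> using no that by blast
      fix \<epsilon> :: real assume "\<epsilon> > 0"
      then have "\<forall>\<^sub>F n in sequentially. cnorm Q (a \<ominus>\<^bsub>Q\<^esub> lin (cs n)) < \<epsilon> / 2" using order_tendstoD(2)[OF d0, of "\<epsilon>/2"] by simp
      then obtain M where M: "\<And>n. n \<ge> M \<Longrightarrow> cnorm Q (a \<ominus>\<^bsub>Q\<^esub> lin (cs n)) < \<epsilon> / 2" unfolding eventually_sequentially by blast
      have "rn (linT (cs m) \<ominus>\<^bsub>CS\<^esub> linT (cs n)) < \<epsilon>" if "m \<ge> M" "n \<ge> M" for m n
      proof -
        have "rn (linT (cs m) \<ominus>\<^bsub>CS\<^esub> linT (cs n)) \<le> cnorm Q (lin (cs m) \<ominus>\<^bsub>Q\<^esub> a) + cnorm Q (a \<ominus>\<^bsub>Q\<^esub> lin (cs n))"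
          unfolding rn_diff[OF cs(1) cs(1)] by (rule Qc.N_triangle[OF lc a(1) lc])
        also have "cnorm Q (lin (cs m) \<ominus>\<^bsub>Q\<^esub> a) = cnorm Q (a \<ominus>\<^bsub>Q\<^esub> lin (cs m))" by (rule Qc.N_diff_commute[OF lc a(1)])
        finally show ?thesis using M[OF that(1)] M[OF that(2)] by linarith
      qed
      then show "\<exists>M. \<forall>m\<ge>M. \<forall>n\<ge>M. rn (linT (cs m) \<ominus>\<^bsub>CS\<^esub> linT (cs n)) < \<epsilon>" by blast
    qed
    then have "(\<lambda>n. cnorm Q (lin (cs n))) \<longlonglongrightarrow> 0" unfolding rn_lin[OF cs(1)] .
    then show False using LIMSEQ_unique[OF nlim] na by blast
  qed
  then obtain \<gamma> where g: "\<gamma> \<in> topspace (gtop (tight_groupoid SP))" "\<not> (\<lambda>n. linT (cs n) \<gamma>) \<longlonglongrightarrow> 0" by blast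
  obtain s \<eta> where "s \<in> carrier SP" "\<eta> \<in> S.dm s" "\<gamma> = germ SP s \<eta>" using g(1) S.arrows_GG by blast
  then have sg: "gsrc (tight_groupoid SP) \<gamma> \<in> spec" by (simp add: S.src_germ S.dmD(1))
  define \<xi> where "\<xi> = gsrc (tight_groupoid SP) \<gamma>"
  have x: "\<xi> \<in> spec" unfolding \<xi>_def by (rule sg)
  from g(2) obtain r where r: "r > 0" "\<And>M. \<exists>n\<ge>M. \<not> cmod (linT (cs n) \<gamma>) < r"
    unfolding LIMSEQ_iff by auto
  \<comment> \<open>Eventually a bound for the approximants; the error in approximating a* a is then
    at most K + cnorm Q a times the error for \<open>a\<close>, the sum being the factor, and so
    drops below r^2.\<close>
  define K where "K = cnorm Q a + 1"
  have dl: "(\<lambda>n. (K + cnorm Q a) * cnorm Q (a \<ominus>\<^bsub>Q\<^esub> lin (cs n))) \<longlonglongrightarrow> 0"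
    using tendsto_mult_left[OF d0, of "K + cnorm Q a"] by simp
  have "\<forall>\<^sub>F n in sequentially. (K + cnorm Q a) * cnorm Q (a \<ominus>\<^bsub>Q\<^esub> lin (cs n)) < r\<^sup>2"
    using order_tendstoD(2)[OF dl, of "r\<^sup>2"] r(1) by simp
  moreover have "\<forall>\<^sub>F n in sequentially. cnorm Q (lin (cs n)) < K" using order_tendstoD(2)[OF nlim, of K] by (simp add: K_def)
  ultimately have "\<forall>\<^sub>F n in sequentially. (K + cnorm Q a) * cnorm Q (a \<ominus>\<^bsub>Q\<^esub> lin (cs n)) < r\<^sup>2 \<and> cnorm Q (lin (cs n)) < K"
    by (rule eventually_conj)
  then obtain M where M: "\<And>n. n \<ge> M \<Longrightarrow> (K + cnorm Q a) * cnorm Q (a \<ominus>\<^bsub>Q\<^esub> lin (cs n)) < r\<^sup>2 \<and> cnorm Q (lin (cs n)) < K"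
    unfolding eventually_sequentially by blast
  \<comment> \<open>Late enough for both estimates, and one of the infinitely many indices at which
    the value is not small.\<close>
  obtain n where n: "n \<ge> M" "\<not> cmod (linT (cs n) \<gamma>) < r" using r(2) by blast
  let ?x = "lin (cs n)"
  have xc: "?x \<in> carrier Q" by (rule lc)
  have "\<exists>cs'. okc cs' \<and> lin cs' = star Q ?x" 
    using lin_star[OF cs(1)] okc_map[OF cs(1), of "sinv SP" "\<lambda>z. cnj (fst z)"] sinv_rel by blast
  then obtain cs' where cs': "okc cs'" "lin cs' = star Q ?x" by blast
  obtain ds where ds: "okc ds" "lin ds = star Q ?x \<otimes>\<^bsub>Q\<^esub> ?x" using lin_mult[OF cs'(1) cs(1)] cs'(2) by metis
  have "cnorm Q (lin ds \<ominus>\<^bsub>Q\<^esub> (star Q a \<otimes>\<^bsub>Q\<^esub> a)) \<le> K * cnorm Q (star Q ?x \<ominus>\<^bsub>Q\<^esub> star Q a) + cnorm Q a * cnorm Q (?x \<ominus>\<^bsub>Q\<^esub> a)"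
    unfolding ds(2) by (rule Qc.mult_diff_bound)
      (use M[OF n(1)] xc a(1) in \<open>simp_all add: Qc.star_closed Qc.N_star\<close>)
  also have "star Q ?x \<ominus>\<^bsub>Q\<^esub> star Q a = star Q (?x \<ominus>\<^bsub>Q\<^esub> a)" using Qc.diff_star[OF xc a(1)] by simp
  also have "cnorm Q (star Q (?x \<ominus>\<^bsub>Q\<^esub> a)) = cnorm Q (a \<ominus>\<^bsub>Q\<^esub> ?x)"
    using Qc.N_star[OF Qc.minus_closed[OF xc a(1)]] Qc.N_diff_commute[OF xc a(1)] by simp
  also have "cnorm Q (?x \<ominus>\<^bsub>Q\<^esub> a) = cnorm Q (a \<ominus>\<^bsub>Q\<^esub> ?x)" by (rule Qc.N_diff_commute[OF xc a(1)])
  finally have "cnorm Q (lin ds \<ominus>\<^bsub>Q\<^esub> (star Q a \<otimes>\<^bsub>Q\<^esub> a)) < r\<^sup>2" using M[OF n(1)] by (simp add: algebra_simps)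
  moreover have "r\<^sup>2 \<le> cmod (linT ds (un \<xi>))"
  proof -
    have "r\<^sup>2 \<le> (cmod (linT (cs n) \<gamma>))\<^sup>2" using n(2) r(1) by (intro power_mono) simp_all
    also have "\<dots> \<le> cmod ((star CS (linT (cs n)) \<otimes>\<^bsub>CS\<^esub> linT (cs n)) (un \<xi>))"
      by (rule S.CGr.star_mult_unit[OF linT_CS[OF cs(1)]]) (use g(1) in \<open>simp_all add: \<xi>_def src_fibre_def\<close>)
    finally show ?thesis using linT_star_mult[OF cs(1) ds x] by simp
  qed
  ultimately show ?thesis using ds(1) x r(1) by (intro exI[of _ "r\<^sup>2"] conjI exI[of _ ds] exI[of _ \<xi>]) simp_all
qed

section \<open>Compressions that land in the core\<close>

abbreviation "K \<equiv> core_submonoid P"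

lemma core_carrier: "c \<in> K \<Longrightarrow> c \<in> carrier P"
  by (simp add: core_submonoid_def)

text \<open>On the side of operators this is the compression of x to s_q* x s_q.\<close>

abbreviation conj_by :: "'p \<Rightarrow> ('p \<times> 'p) set \<Rightarrow> ('p \<times> 'p) set" where
  "conj_by q X \<equiv> cls \<one> q \<cdot>\<^bsub>SP\<^esub> (X \<cdot>\<^bsub>SP\<^esub> cls q \<one>)"

lemma conj_by_closed: "q \<in> carrier P \<Longrightarrow> X \<in> carrier SP \<Longrightarrow> conj_by q X \<in> carrier SP"
  by (simp add: SP_mult_closed class_SP)

lemma conj_by_mult:
  assumes "p \<in> carrier P" "r \<in> carrier P" "X \<in> carrier SP"
  shows "conj_by r (conj_by p X) = conj_by (p \<otimes> r) X"
proof -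
  have "cls \<one> r \<cdot>\<^bsub>SP\<^esub> cls \<one> p = sinv SP (cls p \<one> \<cdot>\<^bsub>SP\<^esub> cls r \<one>)"
    using assms by (simp add: S.inv_mult class_SP sinv_class)
  then have "cls \<one> r \<cdot>\<^bsub>SP\<^esub> cls \<one> p = cls \<one> (p \<otimes> r)" using class_iso_mult[OF assms(1,2)] by (simp add: sinv_class)
  then show ?thesis
    using assms class_iso_mult[OF assms(1,2)] S.sm_assoc[of "cls \<one> r" "cls \<one> p" "X \<cdot>\<^bsub>SP\<^esub> (cls p \<one> \<cdot>\<^bsub>SP\<^esub> cls r \<one>)"]
    by (simp add: S.sm_assoc SP_mult_closed class_SP)
qed

text \<open>Conjugating by a further isometry either kills \<open>[c, d]\<close> or does not; if no isometry kills it,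
  then \<open>c\<close> and \<open>d\<close> lie in the core. So it suffices to kill as many elements as possible.\<close>

lemma conjugate_into_core:
  assumes F: "finite F" "F \<subseteq> carrier SP"
  shows "\<exists>r\<in>carrier P. \<forall>X\<in>F. conj_by r X = {} \<or> (\<exists>c\<in>K. \<exists>d\<in>K. conj_by r X = cls c d)"
proof -
  define Z where "Z r = {X \<in> F. conj_by r X = {}}" for r
  have fin: "finite (Z r)" "card (Z r) < Suc (card F)" for r
    using F(1) by (auto simp: Z_def less_Suc_eq_le intro!: card_mono)
  have "\<exists>r. r \<in> carrier P \<and> (\<forall>y. y \<in> carrier P \<longrightarrow> card (Z y) \<le> card (Z r))"
    using ex_has_greatest_nat[of "\<lambda>r. r \<in> carrier P" \<one> "\<lambda>r. card (Z r)" "Suc (card F)"] fin by auto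
  then obtain r where r: "r \<in> carrier P" "\<And>y. y \<in> carrier P \<Longrightarrow> card (Z y) \<le> card (Z r)" by blast
  have z: "szero SP = {}" by (simp add: lcm_semigroup_def)
  have zl: "{} \<cdot>\<^bsub>SP\<^esub> s = {}" "s \<cdot>\<^bsub>SP\<^esub> {} = {}" if "s \<in> carrier SP" for s
    using S.zero_left[OF that] S.zero_right[OF that] unfolding z .
  have "\<exists>c\<in>K. \<exists>d\<in>K. conj_by r X = cls c d" if X: "X \<in> F" and ne: "conj_by r X \<noteq> {}" for X
  proof -
    have Xc: "X \<in> carrier SP" using X F(2) by blast
    have nz: "conj_by y (conj_by r X) \<noteq> {}" if y: "y \<in> carrier P" for y
    proof
      assume e: "conj_by y (conj_by r X) = {}"
      \<comment> \<open>What \<open>r\<close> kills stays killed under further conjugation, so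
        killing \<open>X\<close> as well would exceed the maximal count.\<close>
      have "Z r \<subseteq> Z (r \<otimes> y)"
      proof
        fix Y assume "Y \<in> Z r"
        then have Y: "Y \<in> F" "conj_by r Y = {}" "Y \<in> carrier SP" using F(2) unfolding Z_def by blast+
        have "conj_by (r \<otimes> y) Y = {}"
          using conj_by_mult[OF r(1) y Y(3)] y unfolding Y(2) by (simp add: zl class_SP)
        then show "Y \<in> Z (r \<otimes> y)" unfolding Z_def using Y(1) by blast
      qed
      moreover have "X \<in> Z (r \<otimes> y)" unfolding Z_def using conj_by_mult[OF r(1) y Xc] e X by simp
      moreover have "X \<notin> Z r" unfolding Z_def using ne by simp
      ultimately have "card (Z r) < card (Z (r \<otimes> y))" by (intro psubset_card_mono fin(1)) blast
      then show False using r(2)[of "r \<otimes> y"] r(1) y by simp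
    qed
    obtain c d where cd: "c \<in> carrier P" "d \<in> carrier P" "conj_by r X = cls c d"
      using SP_cases[OF conj_by_closed[OF r(1) Xc]] ne by blast
    \<comment> \<open>If yP missed dP, conjugation by \<open>y\<close> would annihilate [c, d] from
      the right, and if it missed cP, from the left. So both ideals meet every other one.\<close>
    have "principal P d \<inter> principal P y \<noteq> {}" if y: "y \<in> carrier P" for y
    proof
      assume "principal P d \<inter> principal P y = {}"
      then have "cls c d \<cdot>\<^bsub>SP\<^esub> cls y \<one> = {}" using class_mult_empty[OF cd(1,2) y one_closed] by simp
      then show False using nz[OF y] y unfolding cd(3) by (simp add: zl class_SP)
    qed
    then have d: "d \<in> K" unfolding core_submonoid_def using cd(2) by blast
    have "principal P c \<inter> principal P y \<noteq> {}" if y: "y \<in> carrier P" for y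
    proof
      assume "principal P c \<inter> principal P y = {}"
      then have "cls \<one> y \<cdot>\<^bsub>SP\<^esub> cls c d = {}" using class_mult_empty[OF one_closed y cd(1,2)] by (simp add: Int_commute)
      then have "conj_by y (cls c d) = {}"
        using S.sm_assoc[of "cls \<one> y" "cls c d" "cls y \<one>"] y cd(1,2) by (simp add: zl class_SP)
      then show False using nz[OF y] unfolding cd(3) by simp
    qed
    then have "c \<in> K" unfolding core_submonoid_def using cd(1) by blast
    then show "\<exists>c\<in>K. \<exists>d\<in>K. conj_by r X = cls c d" using d cd(3) by blast
  qed
  then show ?thesis using r(1) by blast
qed

lemma core_subalgebra: "cstar_subalgebra (bq_core P) Q" and core_closed: "bq_core P \<subseteq> carrier Q"
  and core_gen: "c \<in> K \<Longrightarrow> sQ c \<in> bq_core P"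
proof -
  have "sQ ` K \<subseteq> carrier Q" using sQ_closed core_carrier by blast
  note g = Qc.generated_subalgebra[OF this]
  show "cstar_subalgebra (bq_core P) Q" "bq_core P \<subseteq> carrier Q" "c \<in> K \<Longrightarrow> sQ c \<in> bq_core P"
    unfolding bq_core_def using g by blast+
qed

lemma core_ops: "\<zero>\<^bsub>Q\<^esub> \<in> bq_core P" "x \<in> bq_core P \<Longrightarrow> y \<in> bq_core P \<Longrightarrow> x \<oplus>\<^bsub>Q\<^esub> y \<in> bq_core P"
  "x \<in> bq_core P \<Longrightarrow> y \<in> bq_core P \<Longrightarrow> x \<otimes>\<^bsub>Q\<^esub> y \<in> bq_core P"
  "x \<in> bq_core P \<Longrightarrow> scale Q c x \<in> bq_core P" "x \<in> bq_core P \<Longrightarrow> star Q x \<in> bq_core P"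
  using core_subalgebra unfolding cstar_subalgebra_def by blast+

lemma one_core: "\<one> \<in> K"
  using principal_one principal_iff one_closed unfolding core_submonoid_def by (auto simp: l_coset_def)

lemma oneQ_core: "\<one>\<^bsub>Q\<^esub> \<in> bq_core P"
  using core_ops(3)[OF core_ops(5)[OF core_gen[OF one_core]] core_gen[OF one_core]] by (simp add: sQ_isometry)

lemma lin_core:
  "\<forall>X\<in>snd ` set cs. X = {} \<or> (\<exists>c\<in>K. \<exists>d\<in>K. X = cls c d) \<Longrightarrow> lin cs \<in> bq_core P"
proof (induction cs)
  case (Cons z cs)
  have "tQ (snd z) \<in> bq_core P"
  proof (cases "snd z = {}")
    case False
    then obtain c d where "c \<in> K" "d \<in> K" "snd z = cls c d" using Cons.prems by auto
    then show ?thesis using core_ops(3)[OF core_gen core_ops(5)[OF core_gen]] by (simp add: tQ_class core_carrier)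
  qed (simp add: tQ_empty core_ops)
  then show ?case using Cons by (simp add: core_ops)
qed (simp add: core_ops)

text \<open>The factor \<open>p\<close> fixes the values at units, the factor \<open>r\<close>
  reaches the core. As \<open>r\<close> acts inside the range of \<open>p\<close>, passing to q = p
  r leaves the constancy secured by \<open>p\<close> intact.\<close>

lemma corner_in_core:
  assumes ds: "okc ds" and x: "\<xi> \<in> spec"
  shows "\<exists>q\<in>carrier P. star Q (sQ q) \<otimes>\<^bsub>Q\<^esub> (lin ds \<otimes>\<^bsub>Q\<^esub> sQ q) \<in> bq_core P \<and>
    cmod (linT ds (un \<xi>)) \<le> cnorm Q (star Q (sQ q) \<otimes>\<^bsub>Q\<^esub> (lin ds \<otimes>\<^bsub>Q\<^esub> sQ q))"
proof -
  let ?F = "snd ` set ds"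
  have F: "finite ?F" "?F \<subseteq> carrier SP" using ds by (simp_all add: okc_def)
  have z: "szero SP = {}" by (simp add: lcm_semigroup_def)
  obtain e where e: "e \<in> idempotents SP" "e \<noteq> {}"
    "\<And>\<eta> X. \<eta> \<in> spec \<Longrightarrow> e \<in> \<eta> \<Longrightarrow> X \<in> ?F \<Longrightarrow> S.stab X \<eta> \<longleftrightarrow> S.stab X \<xi>"
    using S.stab_locally_constant[OF F x] unfolding z by metis
  obtain p where p: "p \<in> carrier P" "e = cls p p" using SP_E_cases[OF e(1,2)] by blast
  have "finite (conj_by p ` ?F)" "conj_by p ` ?F \<subseteq> carrier SP" using F conj_by_closed[OF p(1)] by auto
  from conjugate_into_core[OF this] obtain r where r: "r \<in> carrier P"
    "\<forall>X\<in>conj_by p ` ?F. conj_by r X = {} \<or> (\<exists>c\<in>K. \<exists>d\<in>K. conj_by r X = cls c d)" by blast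
  define q where "q = p \<otimes> r"
  have q: "q \<in> carrier P" unfolding q_def using p(1) r(1) by simp
  have core: "\<forall>X\<in>?F. conj_by q X = {} \<or> (\<exists>c\<in>K. \<exists>d\<in>K. conj_by q X = cls c d)"
  proof
    fix X assume X: "X \<in> ?F"
    have "conj_by q X = conj_by r (conj_by p X)" unfolding q_def using conj_by_mult[OF p(1) r(1)] X F(2) by auto
    then show "conj_by q X = {} \<or> (\<exists>c\<in>K. \<exists>d\<in>K. conj_by q X = cls c d)" using bspec[OF r(2) imageI[OF X]] by simp
  qed
  let ?ds = "map (\<lambda>z. (fst z, conj_by q (snd z))) ds"
  have okds: "okc ?ds" by (rule okc_map[OF ds]) (rule conj_by_closed[OF q])
  have v: "cls q \<one> \<in> carrier SP" "cls \<one> q \<in> carrier SP" using q by (simp_all add: class_SP)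
  have t: "tQ (cls q \<one>) = sQ q" "tQ (cls \<one> q) = star Q (sQ q)"
    using q by (simp_all add: tQ_class sQ_one oneQ_mult sQ_closed Qc.star_closed)
  have "lin ?ds = star Q (sQ q) \<otimes>\<^bsub>Q\<^esub> (lin ds \<otimes>\<^bsub>Q\<^esub> sQ q)"
  proof -
    have m: "okc (map (\<lambda>z. (fst z, snd z \<cdot>\<^bsub>SP\<^esub> cls q \<one>)) ds)" by (rule okc_map[OF ds]) (simp add: SP_mult_closed v)
    show ?thesis using lin_mult_left[OF m v(2)] lin_mult_right[OF ds v(1)] t by (simp add: o_def)
  qed
  moreover have "lin ?ds \<in> bq_core P" by (rule lin_core) (use core in auto)
  moreover have "cmod (linT ds (un \<xi>)) \<le> cnorm Q (lin ?ds)"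
  proof -
    \<comment> \<open>Any unit will do: its translate by \<open>q\<close> contains [p, p], so the
      value found there is the value at \<xi>.\<close>
    obtain \<eta> where n: "\<eta> \<in> spec" using S.tight_nonempty by blast
    let ?V = "cls q \<one>"
    have si: "sinv SP ?V = cls \<one> q" by (rule sinv_class)
    have vv: "sinv SP ?V \<cdot>\<^bsub>SP\<^esub> ?V = cls \<one> \<one>" unfolding si by (rule class_iso_dom[OF q])
    have nd: "sinv SP ?V \<cdot>\<^bsub>SP\<^esub> ?V \<in> \<eta>" unfolding vv by (rule S.filter_unit[OF S.tight_filter[OF n]])
    have nt: "tight_act SP ?V \<eta> \<in> spec" by (rule S.dmD(1)[OF S.act_dm[OF v(1) S.dmI[OF n nd]]])
    have "cls p p \<cdot>\<^bsub>SP\<^esub> ?V = ?V"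
    proof -
      have c: "cls p \<one> \<in> carrier SP" "cls \<one> p \<in> carrier SP" "cls r \<one> \<in> carrier SP" using p r by (simp_all add: class_SP)
      have "cls p p \<cdot>\<^bsub>SP\<^esub> ?V = (cls p \<one> \<cdot>\<^bsub>SP\<^esub> cls \<one> p) \<cdot>\<^bsub>SP\<^esub> (cls p \<one> \<cdot>\<^bsub>SP\<^esub> cls r \<one>)"
        unfolding q_def by (simp add: class_iso_ran class_iso_mult p r)
      also have "\<dots> = cls p \<one> \<cdot>\<^bsub>SP\<^esub> ((cls \<one> p \<cdot>\<^bsub>SP\<^esub> cls p \<one>) \<cdot>\<^bsub>SP\<^esub> cls r \<one>)" using c by (simp add: S.sm_assoc S.sm_closed)
      also have "\<dots> = cls p \<one> \<cdot>\<^bsub>SP\<^esub> cls r \<one>" unfolding class_iso_dom[OF p(1)] S.unit_left[OF c(3)] by (rule refl)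
      finally show ?thesis unfolding q_def by (simp add: class_iso_mult p r)
    qed
    then have "e \<in> tight_act SP ?V \<eta>"
      using S.act_iff[OF v(1) S.tight_filter[OF n] nd] e(1) nd by (simp add: p(2))
    note ep = e(3)[OF nt this]
    have "linT ?ds (un \<eta>) = linT ds (un \<xi>)"
    proof (rule S.linT_unit_cong[OF F(2) x n], intro ballI conjI)
      fix X assume X: "X \<in> ?F"
      have Xc: "X \<in> carrier SP" using X F(2) by blast
      show "conj_by q X \<in> carrier SP" by (rule conj_by_closed[OF q Xc])
      show "S.stab (conj_by q X) \<eta> \<longleftrightarrow> S.stab X \<xi>"
        using S.stab_conj[OF v(1) vv Xc n] ep[OF X] unfolding si by simp
    qed
    then show ?thesis using linT_le[OF okds n] by simp
  qed
  ultimately show ?thesis using q by auto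
qed

lemma sQ_norm: assumes p: "p \<in> carrier P" shows "cnorm Q (sQ p) \<le> 1"
proof -
  have "cnorm Q \<one>\<^bsub>Q\<^esub> \<le> 1"
  proof -
    have "cnorm Q \<one>\<^bsub>Q\<^esub> = (cnorm Q \<one>\<^bsub>Q\<^esub>)\<^sup>2" using Qc.N_cstar[OF oneQ_closed] by (simp add: sQ_one oneQ_mult oneQ_closed)
    then have "cnorm Q \<one>\<^bsub>Q\<^esub> = 0 \<or> cnorm Q \<one>\<^bsub>Q\<^esub> = 1" by (simp add: power2_eq_square)
    then show ?thesis by auto
  qed
  then have "(cnorm Q (sQ p))\<^sup>2 \<le> 1\<^sup>2" using Qc.N_cstar[OF sQ_closed[OF p]] by (simp add: sQ_isometry p)
  then show ?thesis by (rule power2_le_imp_le) simp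
qed

lemma compress_norm:
  assumes q: "q \<in> carrier P" and x: "x \<in> carrier Q"
  shows "cnorm Q (star Q (sQ q) \<otimes>\<^bsub>Q\<^esub> (x \<otimes>\<^bsub>Q\<^esub> sQ q)) \<le> cnorm Q x"
proof -
  note s = sQ_closed[OF q] Qc.star_closed[OF sQ_closed[OF q]] Qc.mult_closed[OF x sQ_closed[OF q]]
  have n: "0 \<le> cnorm Q (sQ q)" "0 \<le> cnorm Q x" "cnorm Q (sQ q) \<le> 1" by (simp_all add: Qc.N_nonneg s x sQ_norm q)
  have "cnorm Q (star Q (sQ q) \<otimes>\<^bsub>Q\<^esub> (x \<otimes>\<^bsub>Q\<^esub> sQ q)) \<le> cnorm Q (sQ q) * cnorm Q (x \<otimes>\<^bsub>Q\<^esub> sQ q)"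
    using Qc.N_mult[OF s(2,3)] by (simp add: Qc.N_star s)
  also have "\<dots> \<le> 1 * (cnorm Q x * cnorm Q (sQ q))"
    by (rule mult_mono) (simp_all add: n Qc.N_nonneg s Qc.N_mult x)
  also have "\<dots> \<le> cnorm Q x" using n by (simp add: mult_left_le)
  finally show ?thesis .
qed

theorem injective_of_core:
  assumes B: "cstar_algebra B" and \<pi>: "\<pi> \<in> star_hom Q B" and inj: "inj_on \<pi> (bq_core P)"
  shows "inj_on \<pi> (carrier Q)"
proof (rule inj_onI)
  interpret B: cstar_algebra B by (rule B)
  note hom = star_homD[OF \<pi>]
  have Qs: "star_algebra Q" and Bs: "star_algebra B" by unfold_locales
  have \<pi>0: "\<pi> \<zero>\<^bsub>Q\<^esub> = \<zero>\<^bsub>B\<^esub>" by (rule star_hom_zero[OF Qs Bs \<pi>])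
  have contr: "cnorm B (\<pi> x) \<le> cnorm Q x" if "x \<in> carrier Q" for x
    by (rule unital_cstar.seminorm_contractive[OF Q_unital star_hom_seminorm[OF Qs B \<pi> order_refl] that])
  have core_unital: "unital_cstar Q (bq_core P)"
    by (intro unital_cstar.intro Q_cstar unital_cstar_axioms.intro core_subalgebra oneQ_core oneQ_mult)
  \<comment> \<open>The core is a closed subalgebra containing the unit, so uniqueness of the
    C*-norm applies to the norm pulled back along \<pi>. On the whole quotient only contractivity is
    available.\<close>
  have isom: "cnorm B (\<pi> g) = cnorm Q g" if g: "g \<in> bq_core P" for g
  proof (rule unital_cstar.norm_unique[OF core_unital star_hom_seminorm[OF Qs B \<pi> core_closed] _ g])
    fix y assume y: "y \<in> bq_core P" "cnorm B (\<pi> y) = 0"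
    have "\<pi> y = \<pi> \<zero>\<^bsub>Q\<^esub>" unfolding \<pi>0 using B.cnorm_eq_zero[OF hom(1) y(2)] y(1) core_closed by blast
    then show "y = \<zero>\<^bsub>Q\<^esub>" using inj_onD[OF inj] y(1) core_ops(1) by blast
  qed
  fix x y assume x: "x \<in> carrier Q" and y: "y \<in> carrier Q" and xy: "\<pi> x = \<pi> y"
  show "x = y"
  proof (rule ccontr)
    assume "x \<noteq> y"
    define a where "a = x \<ominus>\<^bsub>Q\<^esub> y"
    have a: "a \<in> carrier Q" "a \<noteq> \<zero>\<^bsub>Q\<^esub>"
      unfolding a_def using x y \<open>x \<noteq> y\<close> Qc.diff_eq_zero[OF x y] by auto
    have pa: "\<pi> a = \<zero>\<^bsub>B\<^esub>"
      unfolding a_def star_hom_minus[OF Qs Bs \<pi> x y] xy using B.diff_self[OF hom(1)[OF y]] .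
    obtain \<delta> ds \<xi> where d: "okc ds" "\<xi> \<in> spec"
      "cnorm Q (lin ds \<ominus>\<^bsub>Q\<^esub> (star Q a \<otimes>\<^bsub>Q\<^esub> a)) < \<delta>" "\<delta> \<le> cmod (linT ds (un \<xi>))"
      using nonzero_detected[OF a] by blast
    obtain q where q: "q \<in> carrier P" "star Q (sQ q) \<otimes>\<^bsub>Q\<^esub> (lin ds \<otimes>\<^bsub>Q\<^esub> sQ q) \<in> bq_core P"
      "cmod (linT ds (un \<xi>)) \<le> cnorm Q (star Q (sQ q) \<otimes>\<^bsub>Q\<^esub> (lin ds \<otimes>\<^bsub>Q\<^esub> sQ q))"
      using corner_in_core[OF d(1,2)] by blast
    let ?b = "star Q a \<otimes>\<^bsub>Q\<^esub> a"
    let ?z = "lin ds \<ominus>\<^bsub>Q\<^esub> ?b"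
    let ?c = "\<lambda>w. star Q (sQ q) \<otimes>\<^bsub>Q\<^esub> (w \<otimes>\<^bsub>Q\<^esub> sQ q)"
    note s = sQ_closed[OF q(1)] Qc.star_closed[OF sQ_closed[OF q(1)]] lin_closed[OF d(1)]
    have b: "?b \<in> carrier Q" and zc: "?z \<in> carrier Q" using a s by (simp_all add: Qc.mult_closed Qc.star_closed)
    have pc: "\<pi> (?c w) = \<pi> (star Q (sQ q)) \<otimes>\<^bsub>B\<^esub> (\<pi> w \<otimes>\<^bsub>B\<^esub> \<pi> (sQ q))" if "w \<in> carrier Q" for w
      using that s by (simp add: hom Qc.mult_closed)
    have "\<pi> ?b = \<zero>\<^bsub>B\<^esub>" using a by (simp add: hom pa Qc.star_closed B.mult_zero B.star_closed hom(1))
    \<comment> \<open>Since \<pi> kills a* a, the compressions of \<open>lin ds\<close> and of the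
      small error \<open>?z\<close> have the same image; \<pi> is isometric on the former and
      contractive on the latter.\<close>
    then have "\<pi> ?z = \<pi> (lin ds)"
      unfolding star_hom_minus[OF Qs Bs \<pi> s(3) b] using B.diff_zero[OF hom(1)[OF s(3)]] by simp
    then have "\<pi> (?c ?z) = \<pi> (?c (lin ds))" using pc[OF zc] pc[OF s(3)] by simp
    then have "cnorm Q (?c (lin ds)) = cnorm B (\<pi> (?c ?z))" using isom[OF q(2)] by simp
    also have "\<dots> \<le> cnorm Q (?c ?z)" using contr s zc by (simp add: Qc.mult_closed)
    also have "\<dots> \<le> cnorm Q ?z" by (rule compress_norm[OF q(1) zc])
    finally show False using d(3,4) q(3) by linarith
  qed
qed

end

theorem theorem4p1:
  fixes P :: "('p, 'm) monoid_scheme"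
    and B :: "('b, 'n) cstar_alg_scheme"
    and \<pi> :: "(nat \<Rightarrow> ('p bq_gen \<times> bool) list \<Rightarrow> complex) set \<Rightarrow> 'b"
  assumes "right_lcm_monoid P"
    and "\<exists>\<Phi> \<in> star_iso (boundary_quotient P) (reduced_cstar (tight_groupoid (lcm_semigroup P))).
      \<forall>p\<in>carrier P. \<forall>q\<in>carrier P.
        \<Phi> (bq_isom P p \<otimes>\<^bsub>boundary_quotient P\<^esub> star (boundary_quotient P) (bq_isom P q)) =
        reduced_emb (tight_groupoid (lcm_semigroup P)) (tight_T (lcm_semigroup P) (lcm_class P p q))"
    and "\<And>s. s \<in> carrier (lcm_semigroup P) \<Longrightarrow>
      \<exists>C. finite C \<and> is_cover (lcm_semigroup P) C
        {e \<in> idempotents (lcm_semigroup P). sle (lcm_semigroup P) e s}"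
    and "cstar_algebra B"
    and "\<pi> \<in> star_hom (boundary_quotient P) B"
  shows "inj_on \<pi> (carrier (boundary_quotient P)) \<longleftrightarrow> inj_on \<pi> (bq_core P)"
proof -
  obtain \<Phi> where \<Phi>: "\<Phi> \<in> star_iso (boundary_quotient P) (reduced_cstar (tight_groupoid (lcm_semigroup P)))"
    "\<And>p q. p \<in> carrier P \<Longrightarrow> q \<in> carrier P \<Longrightarrow>
      \<Phi> (bq_isom P p \<otimes>\<^bsub>boundary_quotient P\<^esub> star (boundary_quotient P) (bq_isom P q)) =
        reduced_emb (tight_groupoid (lcm_semigroup P)) (tight_T (lcm_semigroup P) (lcm_class P p q))"
    using assms(2) by blast
  interpret reduced_boundary P \<Phi>
    by (intro reduced_boundary.intro reduced_boundary_axioms.intro assms(1,3) \<Phi>)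
  \<comment> \<open>The remaining implication is restriction of an injective map to a
    subset.\<close>
  show ?thesis using injective_of_core[OF assms(4,5)] inj_on_subset[OF _ core_closed] by blast
qed

end
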